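(* Let $d\in\mathbb Z/2$, let $\mathcal O$ be a modular $\mathrm{Det}^d$-operad and let $V$ be a dg vector space with an inner product $\langle\,,\rangle$ of degree $d$. Then the structure of a $\mathsf{BV}_{\mathrm{Det}^d}\mathcal O$-algebra on $V$ is equivalent to the following data: (1) the structure of an $\mathcal O$-algebra on $V$; (2) an odd operator $s:V\to V$ such that $s^2=0$ and $\langle s(a),b\rangle=(-1)^{|a|}\langle a,s(b)\rangle$ for all homogeneous $a,b\in V$; (3) an even operator $t:V\to V$ such that $t^2=t$, $dt=td$, and $\langle t(a),b\rangle=\langle a,t(b)\rangle$ for all $a,b\in V$; (4) such that the following identities hold: $st=ts=0$ and $(ds+sd)(a)=a-t(a)$ for every $a\in V$.
   Context: Conventions. $\mathbf k$ is a field of characteristic $0$; "dg" means differential $\mathbb Z/2$-graded; $\Pi$ is parity reversion. For an $m$-dimensional vector space $W$, $\mathrm{Det}^d(W)=(\Pi^m\Lambda^mW)^{\otimes d}$. An inner product of degree $d$ on a (finite-dimensional) dg vector space $V$ is a nondegenerate symmetric even map of dg vector spaces $V\otimes V\to\Pi^d\mathbf k$. Graphs. Graphs are connected, given by half-edges, a partition of them into vertices ($\mathrm{Flag}(v)$ is the block of $v$, $n(v)=|\mathrm{Flag}(v)|$) and an involution whose 2-cycles are edges and fixed points legs. A pair $(g,n)$ is stable if $2(g-1)+n>0$. A stable graph has a genus $g(v)\ge0$ at each vertex with all $(g(v),n(v))$ stable; an extended stable graph is the same but $(g(v),n(v))=(0,2)$ is also allowed (cycles made only of bivalent genus-$0$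 vertices are excluded). Genus: $g(G)=\dim H_1(G)+\sum_vg(v)$. $\overline\Gamma((g,n))$ is the category of extended stable graphs of genus $g$ with $n$ labelled legs, morphisms generated by isomorphisms and edge contractions. Operads. An extended stable $\mathbb S$-module is a collection of dg vector spaces $\mathcal V((g,n))$ with $\mathbb S_n$-action, zero for $(g,n)=(0,0),(0,1),(1,0)$; it is stable if also $\mathcal V((0,2))=0$. Put $\mathcal V((G))=\bigotimes_v\mathcal V((g(v),\mathrm{Flag}(v)))$ and $\mathrm{Det}^d(G)=\mathrm{Det}^d(H_1(G))$. An extended modular $\mathrm{Det}^d$-operad is an algebra over the triple $\mathcal V\mapsto\{\mathrm{colim}_{G\in\mathrm{Iso}\,\overline\Gamma((g,n))}\mathrm{Det}^d(G)\otimes\mathcal V((G))\}$, i.e. it has compatible composition maps $\mathrm{Det}^d(G)\otimes\mathcal V((G))\to\mathcal V((g,n))$ (Getzler–Kapranov). A modular $\mathrm{Det}^d$-operad is one whose underlying $\mathbb S$-module is stable. BV-resolution. $\mathcal O_+$ denotes $\mathcal O$ with a unit $\mathbf 1$ adjoined in arity $((0,2))$ (even, $\mathbb S_2$-fixed, $d\mathbf 1=0$; composition with $\mathbf 1$ is the identity, self-gluing of $\mathbf 1$ is $0$). $\mathsf{BV}_{\mathrm{Det}^d}\mathcal O$ is the extended modular $\mathrm{Det}^d$-operad freely generated over $\mathcal O_+$ by an odd operation $s$ and an even operation $t$, both in arity $((0,2))$ with trivial $\mathbb S_2$-action, subject to the relations $s^2=0$, $t^2=t$, $st=ts=0$ (products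 are the compositions $\circ_1$ in arity $((0,2))$). Its differential extends that of $\mathcal O$ and satisfies $d(s)=\mathbf 1-t$, $d(t)=0$. Algebras. For $V$ with inner product of degree $d$, the collection $\mathcal E((g,n))=V^{\otimes n}$ with compositions given by contracting tensor factors along edges using the inner product is a modular operad twisted by $\mathfrak K^{d}$, $\mathfrak K(G)=\mathrm{Det}(\mathrm{Edge}(G))$. Twisting by $\mathfrak s^d\otimes\Pi^d$, where $\mathfrak s((g,n))=\Pi^n\epsilon_n$ ($\epsilon_n$ the sign representation) and $\Pi((g,n))=\Pi\mathbf k$, gives $\tilde{\mathcal E}((g,n))=\mathfrak s^d((g,n))\otimes\Pi^d((g,n))\otimes\mathcal E((g,n))\cong\Pi^d(\Pi^dV)^{\otimes n}$, which is a modular $\mathrm{Det}^d$-operad when restricted to stable $(g,n)$, and an extended modular $\mathrm{Det}^d$-operad when $(0,2)$ is also allowed (and the components $(0,0),(0,1),(1,0)$ are set to $0$). Its genus-zero part is the endomorphism cyclic operad $\tilde{\mathcal E}((0,n))\cong\mathrm{Hom}(V^{\otimes(n-1)},V)$; in particular $\tilde{\mathcal E}((0,2))\cong\mathrm{Hom}(V,V)$ with $\mathbb S_2$ acting by passing to the adjoint with respect to $\langle\,,\rangle$. For a modular $\mathrm{Det}^d$-operad (resp. extended one) $\mathcal P$, a $\mathcal P$-algebra structure on $V$ is a homomorphism $\mathcal P\to\tilde{\mathcal E}$ of modular (resp. extended modular) $\mathrm{Det}^d$-operads; if $\mathcal P$ has a unit $\mathbf 1\in\mathcal P((0,2))$,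 it is required to map to $\mathrm{id}_V$. *)

theory Defs
  imports
    "HOL-Library.Z2"
    "HOL-Library.FuncSet"
    "HOL-Library.Function_Algebras"
    "HOL-Combinatorics.Permutations"
    "Jordan_Normal_Form.Determinant"
begin

section \<open>Signs\<close>

text \<open>Parities are elements of \<open>\<int>/2\<close>, i.e. of the type \<^typ>\<open>bit\<close>; \<open>sg p\<close> is \<open>(-1)\<^sup>p\<close>.\<close>

definition sg :: "bit \<Rightarrow> 'k::ring_1" where
  "sg p = (if p = 0 then 1 else - 1)"

text \<open>Koszul sign for moving the \<open>i\<close>-th of \<open>n\<close> factors, of parity \<open>w i\<close>, to position \<open>\<pi> i\<close>.\<close>

definition koszul :: "nat \<Rightarrow> (nat \<Rightarrow> nat) \<Rightarrow> (nat \<Rightarrow> bit) \<Rightarrow> 'k::ring_1" where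
  "koszul n \<pi> w = sg (\<Sum>(a, b) \<in> {(a, b). a < b \<and> b < n \<and> \<pi> b < \<pi> a}. w a * w b)"


section \<open>Graphs\<close>

text \<open>
  The half-edges of the \<open>i\<close>-th vertex, of type \<open>verts ! i = (genus, valence)\<close>, are the pairs
  \<open>(i, j)\<close> with \<open>j < valence\<close>; the \<open>l\<close>-th leg is the half-edge \<open>legs ! l\<close>. Every labelled graph
  is isomorphic to one of this form, and the isomorphisms between graphs of this form
  (including those that permute the vertices and the flags at a vertex) are considered below.
  The numbering of the flags at a vertex identifies \<open>\<V>((g(v), Flag(v)))\<close> with
  \<open>\<V>((g(v), n(v)))\<close>, and the numbering of the vertices orders the tensor product \<open>\<V>((G))\<close>.
\<close>

type_synonym flag = "nat \<times> nat"

record graph =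
  verts :: "(nat \<times> nat) list"
  ginv :: "flag \<Rightarrow> flag"
  legs :: "flag list"

definition flag_list :: "graph \<Rightarrow> flag list" where
  "flag_list G = concat (map (\<lambda>i. map (Pair i) [0..<snd (verts G ! i)]) [0..<length (verts G)])"

definition flags :: "graph \<Rightarrow> flag set" where
  "flags G = {(i, j). i < length (verts G) \<and> j < snd (verts G ! i)}"

definition wf_graph :: "graph \<Rightarrow> bool" where
  "wf_graph G \<longleftrightarrow>
     ginv G permutes flags G \<and> ginv G \<circ> ginv G = id \<and>
     distinct (legs G) \<and> set (legs G) = {f \<in> flags G. ginv G f = f}"

definition connected_graph :: "graph \<Rightarrow> bool" where
  "connected_graph G \<longleftrightarrow> verts G \<noteq> [] \<and>
     (\<forall>i < length (verts G). \<forall>i' < length (verts G).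
        (i, i') \<in> {(fst f, fst (ginv G f)) | f. f \<in> flags G}\<^sup>*)"

text \<open>
  A connected graph whose vertices all have type \<open>(0, 2)\<close> is a cycle exactly when it has no legs;
  these are the cycles that have to be excluded.
\<close>

definition ext_stable :: "graph \<Rightarrow> bool" where
  "ext_stable G \<longleftrightarrow> wf_graph G \<and> connected_graph G \<and>
     (\<forall>(g, n) \<in> set (verts G). 2 * g + n > 2 \<or> (g, n) = (0, 2)) \<and>
     \<not> (legs G = [] \<and> (\<forall>v \<in> set (verts G). v = (0, 2)))"

text \<open>
  A 1-chain assigns coefficients to oriented edges: \<open>c f\<close> is the coefficient of the edge
  \<open>{f, ginv f}\<close> oriented from the vertex of \<open>f\<close> to the vertex of \<open>ginv f\<close>, so that
  \<open>c (ginv f) = - c f\<close>; in particular chains vanish on legs (characteristic 0). The graph is a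
  one-dimensional complex, so \<open>H\<^sub>1\<close> is the kernel of the boundary.
\<close>

definition chains1 :: "graph \<Rightarrow> (flag \<Rightarrow> 'k::field_char_0) set" where
  "chains1 G = {c. (\<forall>f. f \<notin> flags G \<longrightarrow> c f = 0) \<and> (\<forall>f \<in> flags G. c (ginv G f) = - c f)}"

definition bdry :: "graph \<Rightarrow> (flag \<Rightarrow> 'k::field_char_0) \<Rightarrow> nat \<Rightarrow> 'k" where
  "bdry G c i = (\<Sum>j < snd (verts G ! i). c (i, j))"

definition H1 :: "graph \<Rightarrow> (flag \<Rightarrow> 'k::field_char_0) set" where
  "H1 G = {c \<in> chains1 G. \<forall>i < length (verts G). bdry G c i = 0}"

definition betti :: "'k::field_char_0 itself \<Rightarrow> graph \<Rightarrow> nat" where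
  "betti _ G = vector_space.dim (\<lambda>(a::'k) c f. a * c f) (H1 G :: (flag \<Rightarrow> 'k) set)"

definition genus :: "'k::field_char_0 itself \<Rightarrow> graph \<Rightarrow> nat" where
  "genus T G = betti T G + sum_list (map fst (verts G))"

definition corolla :: "nat \<Rightarrow> nat \<Rightarrow> graph" where
  "corolla g n = \<lparr>verts = [(g, n)], ginv = id, legs = map (Pair 0) [0..<n]\<rparr>"

text \<open>
  Isomorphism of labelled graphs: vertex \<open>i\<close> goes to \<open>\<pi> i\<close>, and the flag \<open>(i, j)\<close> goes to
  \<open>(\<pi> i, \<rho> i j)\<close>.
\<close>

definition flag_map :: "(nat \<Rightarrow> nat) \<Rightarrow> (nat \<Rightarrow> nat \<Rightarrow> nat) \<Rightarrow> flag \<Rightarrow> flag" where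
  "flag_map \<pi> \<rho> = (\<lambda>(i, j). (\<pi> i, \<rho> i j))"

definition graph_iso :: "graph \<Rightarrow> graph \<Rightarrow> (nat \<Rightarrow> nat) \<Rightarrow> (nat \<Rightarrow> nat \<Rightarrow> nat) \<Rightarrow> bool" where
  "graph_iso G G' \<pi> \<rho> \<longleftrightarrow>
     length (verts G') = length (verts G) \<and> \<pi> permutes {..<length (verts G)} \<and>
     (\<forall>i < length (verts G). verts G' ! \<pi> i = verts G ! i \<and> \<rho> i permutes {..<snd (verts G ! i)}) \<and>
     (\<forall>f \<in> flags G. ginv G' (flag_map \<pi> \<rho> f) = flag_map \<pi> \<rho> (ginv G f)) \<and>
     legs G' = map (flag_map \<pi> \<rho>) (legs G)"

definition pull_chain :: "graph \<Rightarrow> (flag \<Rightarrow> flag) \<Rightarrow> (flag \<Rightarrow> 'k::field_char_0) \<Rightarrow> flag \<Rightarrow> 'k" where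
  "pull_chain G \<phi> c f = (if f \<in> flags G then c (\<phi> f) else 0)"

definition relabelled :: "graph \<Rightarrow> (nat \<Rightarrow> nat) \<Rightarrow> graph \<Rightarrow> bool" where
  "relabelled G \<tau> G' \<longleftrightarrow> verts G' = verts G \<and> ginv G' = ginv G \<and>
     length (legs G') = length (legs G) \<and> (\<forall>l < length (legs G). legs G' ! \<tau> l = legs G ! l)"

text \<open>
  \<open>grafting H Gs G\<close>: the graph \<open>G\<close> arises from \<open>H\<close> by replacing, for every \<open>i\<close>, the \<open>i\<close>-th vertex by
  the graph \<open>Gs i\<close>, the \<open>l\<close>-th flag of the vertex becoming the \<open>l\<close>-th leg of \<open>Gs i\<close>. Equivalently,
  \<open>G \<rightarrow> H\<close> is an edge contraction with fibres \<open>Gs i\<close>.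
\<close>

definition offset :: "(nat \<Rightarrow> graph) \<Rightarrow> nat \<Rightarrow> nat" where
  "offset Gs i = (\<Sum>i' < i. length (verts (Gs i')))"

definition emb :: "(nat \<Rightarrow> graph) \<Rightarrow> nat \<Rightarrow> flag \<Rightarrow> flag" where
  "emb Gs i = (\<lambda>(v, j). (offset Gs i + v, j))"

definition outer_flag :: "(nat \<Rightarrow> graph) \<Rightarrow> flag \<Rightarrow> flag" where
  "outer_flag Gs = (\<lambda>(i, l). emb Gs i (legs (Gs i) ! l))"

definition grafting :: "graph \<Rightarrow> (nat \<Rightarrow> graph) \<Rightarrow> graph \<Rightarrow> bool" where
  "grafting H Gs G \<longleftrightarrow>
     verts G = concat (map (\<lambda>i. verts (Gs i)) [0..<length (verts H)]) \<and>
     (\<forall>i < length (verts H). \<forall>f \<in> flags (Gs i).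
        f \<notin> set (legs (Gs i)) \<longrightarrow> ginv G (emb Gs i f) = emb Gs i (ginv (Gs i) f)) \<and>
     (\<forall>f \<in> flags H. ginv G (outer_flag Gs f) = outer_flag Gs (ginv H f)) \<and>
     legs G = map (outer_flag Gs) (legs H)"

text \<open>
  The maps of the exact sequence \<open>0 \<rightarrow> \<Oplus>\<^sub>i H\<^sub>1(Gs i) \<rightarrow> H\<^sub>1(G) \<rightarrow> H\<^sub>1(H) \<rightarrow> 0\<close> of a grafting.
\<close>

definition push_chain :: "(nat \<Rightarrow> graph) \<Rightarrow> nat \<Rightarrow> (flag \<Rightarrow> 'k::field_char_0) \<Rightarrow> flag \<Rightarrow> 'k" where
  "push_chain Gs i c = (\<lambda>(w, j).
     if offset Gs i \<le> w \<and> w < offset Gs (Suc i) then c (w - offset Gs i, j) else 0)"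

definition collapse_chain ::
    "graph \<Rightarrow> (nat \<Rightarrow> graph) \<Rightarrow> (flag \<Rightarrow> 'k::field_char_0) \<Rightarrow> flag \<Rightarrow> 'k" where
  "collapse_chain H Gs = pull_chain H (outer_flag Gs)"


section \<open>Modular \<open>Det\<^sup>d\<close>-operads\<close>

text \<open>
  The data of a collection of differential \<open>\<int>/2\<close>-graded vector spaces \<open>\<P>((g,n))\<close> with
  \<open>\<SS>\<^sub>n\<close>-action and of composition maps; \<open>elems P g n p\<close> is the component of parity \<open>p\<close>.
  The action is functorial in the labels: \<open>act P g n p \<sigma>\<close> renames the label \<open>j\<close> to \<open>\<sigma> j\<close>.
  In \<open>mu P G bs ps xs\<close>, the entry \<open>xs ! i\<close>, of parity \<open>ps ! i\<close>, decorates the \<open>i\<close>-th vertex of \<open>G\<close>, and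
  \<open>bs\<close> is the argument from \<open>Det\<^sup>d(H\<^sub>1(G))\<close>: for \<open>d = 1\<close> a linear map on \<open>\<Lambda>\<^sup>m H\<^sub>1(G)\<close>, with
  \<open>m = dim H\<^sub>1(G)\<close>, is an alternating multilinear map of \<open>m\<close> arguments in \<open>H\<^sub>1(G)\<close>; for \<open>d = 0\<close>, where
  \<open>Det\<^sup>d\<close> is the ground field, \<open>bs\<close> is empty.
\<close>

record ('k, 'a) opd =
  elems :: "nat \<Rightarrow> nat \<Rightarrow> bit \<Rightarrow> 'a set"
  zer :: "nat \<Rightarrow> nat \<Rightarrow> bit \<Rightarrow> 'a"
  add :: "nat \<Rightarrow> nat \<Rightarrow> bit \<Rightarrow> 'a \<Rightarrow> 'a \<Rightarrow> 'a"
  smul :: "nat \<Rightarrow> nat \<Rightarrow> bit \<Rightarrow> 'k \<Rightarrow> 'a \<Rightarrow> 'a"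
  dif :: "nat \<Rightarrow> nat \<Rightarrow> bit \<Rightarrow> 'a \<Rightarrow> 'a"
  act :: "nat \<Rightarrow> nat \<Rightarrow> bit \<Rightarrow> (nat \<Rightarrow> nat) \<Rightarrow> 'a \<Rightarrow> 'a"
  mu :: "graph \<Rightarrow> (flag \<Rightarrow> 'k) list \<Rightarrow> bit list \<Rightarrow> 'a list \<Rightarrow> 'a"

definition opsum :: "('k, 'a) opd \<Rightarrow> nat \<Rightarrow> nat \<Rightarrow> bit \<Rightarrow> 'a list \<Rightarrow> 'a" where
  "opsum P g n p xs = foldr (add P g n p) xs (zer P g n p)"

definition det_rank :: "'k::field_char_0 itself \<Rightarrow> bit \<Rightarrow> graph \<Rightarrow> nat" where
  "det_rank T d G = (if d = 0 then 0 else betti T G)"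

definition det_args :: "bit \<Rightarrow> graph \<Rightarrow> (flag \<Rightarrow> 'k::field_char_0) list \<Rightarrow> bool" where
  "det_args d G bs \<longleftrightarrow> set bs \<subseteq> H1 G \<and> length bs = det_rank TYPE('k) d G"

definition inputs :: "('k, 'a) opd \<Rightarrow> graph \<Rightarrow> bit list \<Rightarrow> 'a list \<Rightarrow> bool" where
  "inputs P G ps xs \<longleftrightarrow> length ps = length (verts G) \<and> length xs = length (verts G) \<and>
     (\<forall>i < length (verts G). xs ! i \<in> elems P (fst (verts G ! i)) (snd (verts G ! i)) (ps ! i))"

definition composable ::
    "bit \<Rightarrow> ('k::field_char_0, 'a) opd \<Rightarrow> graph \<Rightarrow> (flag \<Rightarrow> 'k) list \<Rightarrow> bit list \<Rightarrow> 'a list \<Rightarrow> bool" where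
  "composable d P G bs ps xs \<longleftrightarrow> ext_stable G \<and> det_args d G bs \<and> inputs P G ps xs"

text \<open>The parity of \<open>mu P G bs ps xs\<close>; recall that \<open>Det(W)\<close> has the parity of \<open>dim W\<close>.\<close>

definition out_par :: "'b list \<Rightarrow> bit list \<Rightarrow> bit" where
  "out_par bs ps = of_nat (length bs) + sum_list ps"

text \<open>
  The axioms of an extended modular \<open>Det\<^sup>d\<close>-operad, i.e. of an algebra over the triple given by
  \<open>\<V> \<mapsto> colim\<^sub>G Det\<^sup>d(G) \<otimes> \<V>((G))\<close>, with equality replaced by a relation \<open>R\<close> compatible with the
  operations. Taking equality for \<open>R\<close> gives operads; a general \<open>R\<close> is used to impose relations.
  In \<open>mu_assoc\<close>, the structure map \<open>Det(H) \<otimes> \<Otimes>\<^sub>i Det(Gs i) \<rightarrow> Det(G)\<close> is the one coming from the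
  exact sequence above, and the sign is the Koszul sign for moving the determinants past the
  decorations.
\<close>

locale modular_operad_upto =
  fixes d :: bit
    and P :: "('k::field_char_0, 'a) opd"
    and R :: "nat \<Rightarrow> nat \<Rightarrow> bit \<Rightarrow> 'a \<Rightarrow> 'a \<Rightarrow> bool"
  assumes zer_closed: "zer P g n p \<in> elems P g n p"
    and add_closed: "x \<in> elems P g n p \<Longrightarrow> y \<in> elems P g n p \<Longrightarrow> add P g n p x y \<in> elems P g n p"
    and smul_closed: "x \<in> elems P g n p \<Longrightarrow> smul P g n p a x \<in> elems P g n p"
    and dif_closed: "x \<in> elems P g n p \<Longrightarrow> dif P g n p x \<in> elems P g n (p + 1)"
    and act_closed: "x \<in> elems P g n p \<Longrightarrow> \<sigma> permutes {..<n} \<Longrightarrow> act P g n p \<sigma> x \<in> elems P g n p"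
    and mu_closed: "composable d P G bs ps xs \<Longrightarrow>
      mu P G bs ps xs \<in> elems P (genus TYPE('k) G) (length (legs G)) (out_par bs ps)"
    \<comment> \<open>\<open>R\<close> is a congruence\<close>
    and R_refl: "x \<in> elems P g n p \<Longrightarrow> R g n p x x"
    and R_sym: "x \<in> elems P g n p \<Longrightarrow> y \<in> elems P g n p \<Longrightarrow> R g n p x y \<Longrightarrow> R g n p y x"
    and R_trans: "x \<in> elems P g n p \<Longrightarrow> y \<in> elems P g n p \<Longrightarrow> z \<in> elems P g n p \<Longrightarrow>
      R g n p x y \<Longrightarrow> R g n p y z \<Longrightarrow> R g n p x z"
    and add_cong: "x \<in> elems P g n p \<Longrightarrow> x' \<in> elems P g n p \<Longrightarrow> y \<in> elems P g n p \<Longrightarrow>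
      y' \<in> elems P g n p \<Longrightarrow> R g n p x x' \<Longrightarrow> R g n p y y' \<Longrightarrow>
      R g n p (add P g n p x y) (add P g n p x' y')"
    and smul_cong: "x \<in> elems P g n p \<Longrightarrow> x' \<in> elems P g n p \<Longrightarrow> R g n p x x' \<Longrightarrow>
      R g n p (smul P g n p a x) (smul P g n p a x')"
    and dif_cong: "x \<in> elems P g n p \<Longrightarrow> x' \<in> elems P g n p \<Longrightarrow> R g n p x x' \<Longrightarrow>
      R g n (p + 1) (dif P g n p x) (dif P g n p x')"
    and act_cong: "x \<in> elems P g n p \<Longrightarrow> x' \<in> elems P g n p \<Longrightarrow> \<sigma> permutes {..<n} \<Longrightarrow>
      R g n p x x' \<Longrightarrow> R g n p (act P g n p \<sigma> x) (act P g n p \<sigma> x')"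
    and mu_cong: "composable d P G bs ps xs \<Longrightarrow> composable d P G bs ps xs' \<Longrightarrow>
      (\<And>i. i < length (verts G) \<Longrightarrow>
        R (fst (verts G ! i)) (snd (verts G ! i)) (ps ! i) (xs ! i) (xs' ! i)) \<Longrightarrow>
      R (genus TYPE('k) G) (length (legs G)) (out_par bs ps) (mu P G bs ps xs) (mu P G bs ps xs')"
    \<comment> \<open>vector spaces\<close>
    and add_assoc: "x \<in> elems P g n p \<Longrightarrow> y \<in> elems P g n p \<Longrightarrow> z \<in> elems P g n p \<Longrightarrow>
      R g n p (add P g n p (add P g n p x y) z) (add P g n p x (add P g n p y z))"
    and add_comm: "x \<in> elems P g n p \<Longrightarrow> y \<in> elems P g n p \<Longrightarrow>
      R g n p (add P g n p x y) (add P g n p y x)"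
    and add_zer: "x \<in> elems P g n p \<Longrightarrow> R g n p (add P g n p x (zer P g n p)) x"
    and add_neg: "x \<in> elems P g n p \<Longrightarrow>
      R g n p (add P g n p x (smul P g n p (- 1) x)) (zer P g n p)"
    and smul_one: "x \<in> elems P g n p \<Longrightarrow> R g n p (smul P g n p 1 x) x"
    and smul_smul: "x \<in> elems P g n p \<Longrightarrow>
      R g n p (smul P g n p a (smul P g n p b x)) (smul P g n p (a * b) x)"
    and smul_add_left: "x \<in> elems P g n p \<Longrightarrow>
      R g n p (smul P g n p (a + b) x) (add P g n p (smul P g n p a x) (smul P g n p b x))"
    and smul_add_right: "x \<in> elems P g n p \<Longrightarrow> y \<in> elems P g n p \<Longrightarrow>
      R g n p (smul P g n p a (add P g n p x y)) (add P g n p (smul P g n p a x) (smul P g n p a y))"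
    and unstable_zero: "(g, n) \<in> {(0, 0), (0, 1), (1, 0)} \<Longrightarrow> x \<in> elems P g n p \<Longrightarrow>
      R g n p x (zer P g n p)"
    \<comment> \<open>differential\<close>
    and dif_add: "x \<in> elems P g n p \<Longrightarrow> y \<in> elems P g n p \<Longrightarrow>
      R g n (p + 1) (dif P g n p (add P g n p x y)) (add P g n (p + 1) (dif P g n p x) (dif P g n p y))"
    and dif_smul: "x \<in> elems P g n p \<Longrightarrow>
      R g n (p + 1) (dif P g n p (smul P g n p a x)) (smul P g n (p + 1) a (dif P g n p x))"
    and dif_dif: "x \<in> elems P g n p \<Longrightarrow> R g n p (dif P g n (p + 1) (dif P g n p x)) (zer P g n p)"
    \<comment> \<open>action of the symmetric groups\<close>
    and act_add: "x \<in> elems P g n p \<Longrightarrow> y \<in> elems P g n p \<Longrightarrow> \<sigma> permutes {..<n} \<Longrightarrow>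
      R g n p (act P g n p \<sigma> (add P g n p x y)) (add P g n p (act P g n p \<sigma> x) (act P g n p \<sigma> y))"
    and act_smul: "x \<in> elems P g n p \<Longrightarrow> \<sigma> permutes {..<n} \<Longrightarrow>
      R g n p (act P g n p \<sigma> (smul P g n p a x)) (smul P g n p a (act P g n p \<sigma> x))"
    and act_dif: "x \<in> elems P g n p \<Longrightarrow> \<sigma> permutes {..<n} \<Longrightarrow>
      R g n (p + 1) (act P g n (p + 1) \<sigma> (dif P g n p x)) (dif P g n p (act P g n p \<sigma> x))"
    and act_id: "x \<in> elems P g n p \<Longrightarrow> R g n p (act P g n p id x) x"
    and act_act: "x \<in> elems P g n p \<Longrightarrow> \<sigma> permutes {..<n} \<Longrightarrow> \<tau> permutes {..<n} \<Longrightarrow>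
      R g n p (act P g n p \<tau> (act P g n p \<sigma> x)) (act P g n p (\<tau> \<circ> \<sigma>) x)"
    \<comment> \<open>the compositions are maps of dg vector spaces out of \<open>Det\<^sup>d(G) \<otimes> \<V>((G))\<close>\<close>
    and mu_add: "composable d P G bs ps xs \<Longrightarrow> i < length (verts G) \<Longrightarrow>
      y \<in> elems P (fst (verts G ! i)) (snd (verts G ! i)) (ps ! i) \<Longrightarrow>
      R (genus TYPE('k) G) (length (legs G)) (out_par bs ps)
        (mu P G bs ps (xs[i := add P (fst (verts G ! i)) (snd (verts G ! i)) (ps ! i) (xs ! i) y]))
        (add P (genus TYPE('k) G) (length (legs G)) (out_par bs ps)
          (mu P G bs ps xs) (mu P G bs ps (xs[i := y])))"
    and mu_smul: "composable d P G bs ps xs \<Longrightarrow> i < length (verts G) \<Longrightarrow>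
      R (genus TYPE('k) G) (length (legs G)) (out_par bs ps)
        (mu P G bs ps (xs[i := smul P (fst (verts G ! i)) (snd (verts G ! i)) (ps ! i) a (xs ! i)]))
        (smul P (genus TYPE('k) G) (length (legs G)) (out_par bs ps) a (mu P G bs ps xs))"
    and mu_det_linear: "composable d P G bs ps xs \<Longrightarrow> i < length bs \<Longrightarrow> u \<in> H1 G \<Longrightarrow>
      R (genus TYPE('k) G) (length (legs G)) (out_par bs ps)
        (mu P G (bs[i := (\<lambda>f. a * u f + (bs ! i) f)]) ps xs)
        (add P (genus TYPE('k) G) (length (legs G)) (out_par bs ps)
          (smul P (genus TYPE('k) G) (length (legs G)) (out_par bs ps) a (mu P G (bs[i := u]) ps xs))
          (mu P G bs ps xs))"
    and mu_det_alternating: "composable d P G bs ps xs \<Longrightarrow> i < j \<Longrightarrow> j < length bs \<Longrightarrow>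
      bs ! i = bs ! j \<Longrightarrow>
      R (genus TYPE('k) G) (length (legs G)) (out_par bs ps)
        (mu P G bs ps xs) (zer P (genus TYPE('k) G) (length (legs G)) (out_par bs ps))"
    and mu_dif: "composable d P G bs ps xs \<Longrightarrow>
      R (genus TYPE('k) G) (length (legs G)) (out_par bs ps + 1)
        (dif P (genus TYPE('k) G) (length (legs G)) (out_par bs ps) (mu P G bs ps xs))
        (opsum P (genus TYPE('k) G) (length (legs G)) (out_par bs ps + 1)
          (map (\<lambda>i. smul P (genus TYPE('k) G) (length (legs G)) (out_par bs ps + 1)
                 (sg (of_nat (length bs) + sum_list (take i ps)))
                 (mu P G bs (ps[i := ps ! i + 1])
                   (xs[i := dif P (fst (verts G ! i)) (snd (verts G ! i)) (ps ! i) (xs ! i)])))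
             [0..<length (verts G)]))"
    \<comment> \<open>the compositions are defined on the colimit over isomorphisms and are equivariant\<close>
    and mu_iso: "ext_stable G \<Longrightarrow> ext_stable G' \<Longrightarrow> graph_iso G G' \<pi> \<rho> \<Longrightarrow> det_args d G' bs \<Longrightarrow>
      inputs P G ps xs \<Longrightarrow> length ps' = length ps \<Longrightarrow> length xs' = length xs \<Longrightarrow>
      (\<And>i. i < length (verts G) \<Longrightarrow> ps' ! \<pi> i = ps ! i \<and>
        xs' ! \<pi> i = act P (fst (verts G ! i)) (snd (verts G ! i)) (ps ! i) (\<rho> i) (xs ! i)) \<Longrightarrow>
      R (genus TYPE('k) G) (length (legs G)) (out_par bs ps)
        (mu P G' bs ps' xs')
        (smul P (genus TYPE('k) G) (length (legs G)) (out_par bs ps)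
          (koszul (length (verts G)) \<pi> (\<lambda>i. ps ! i))
          (mu P G (map (pull_chain G (flag_map \<pi> \<rho>)) bs) ps xs))"
    and mu_relabel: "composable d P G bs ps xs \<Longrightarrow> \<tau> permutes {..<length (legs G)} \<Longrightarrow>
      relabelled G \<tau> G' \<Longrightarrow>
      R (genus TYPE('k) G) (length (legs G)) (out_par bs ps)
        (mu P G' bs ps xs)
        (act P (genus TYPE('k) G) (length (legs G)) (out_par bs ps) \<tau> (mu P G bs ps xs))"
    \<comment> \<open>unit and associativity of an algebra over the triple\<close>
    and mu_corolla: "ext_stable (corolla g n) \<Longrightarrow> x \<in> elems P g n p \<Longrightarrow>
      R g n p (mu P (corolla g n) [] [p] [x]) x"
    and mu_assoc: "ext_stable H \<Longrightarrow> ext_stable G \<Longrightarrow> grafting H Gs G \<Longrightarrow>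
      (\<And>i. i < length (verts H) \<Longrightarrow>
        verts H ! i = (genus TYPE('k) (Gs i), length (legs (Gs i))) \<and>
        composable d P (Gs i) (bss i) (pss i) (xss i)) \<Longrightarrow>
      set bs \<subseteq> H1 G \<Longrightarrow> length bs = det_rank TYPE('k) d H \<Longrightarrow>
      R (genus TYPE('k) G) (length (legs G))
        (out_par bs (map (\<lambda>i. out_par (bss i) (pss i)) [0..<length (verts H)]))
        (mu P H (map (collapse_chain H Gs) bs)
          (map (\<lambda>i. out_par (bss i) (pss i)) [0..<length (verts H)])
          (map (\<lambda>i. mu P (Gs i) (bss i) (pss i) (xss i)) [0..<length (verts H)]))
        (smul P (genus TYPE('k) G) (length (legs G))
          (out_par bs (map (\<lambda>i. out_par (bss i) (pss i)) [0..<length (verts H)]))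
          (sg (\<Sum>i < length (verts H). \<Sum>j < i. of_nat (length (bss i)) * sum_list (pss j)))
          (mu P G
            (bs @ concat (map (\<lambda>i. map (push_chain Gs i) (bss i)) [0..<length (verts H)]))
            (concat (map pss [0..<length (verts H)]))
            (concat (map xss [0..<length (verts H)]))))"

definition extended_modular_operad :: "bit \<Rightarrow> ('k::field_char_0, 'a) opd \<Rightarrow> bool" where
  "extended_modular_operad d P \<longleftrightarrow> modular_operad_upto d P (\<lambda>_ _ _. (=))"

definition modular_operad :: "bit \<Rightarrow> ('k::field_char_0, 'a) opd \<Rightarrow> bool" where
  "modular_operad d P \<longleftrightarrow> extended_modular_operad d P \<and> (\<forall>p. elems P 0 2 p = {zer P 0 2 p})"

definition stable_part :: "('k, 'a) opd \<Rightarrow> ('k, 'a) opd" where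
  "stable_part P = P\<lparr>elems := (\<lambda>g n p. if (g, n) = (0, 2) then {zer P 0 2 p} else elems P g n p)\<rparr>"

text \<open>
  Homomorphisms; the last conjunct fixes the values outside the domain, so that homomorphisms
  are equal if and only if they agree on all \<open>elems P g n p\<close>.
\<close>

definition operad_hom ::
    "bit \<Rightarrow> ('k::field_char_0, 'a) opd \<Rightarrow> ('k, 'b) opd \<Rightarrow> (nat \<Rightarrow> nat \<Rightarrow> bit \<Rightarrow> 'a \<Rightarrow> 'b) \<Rightarrow> bool" where
  "operad_hom d P Q f \<longleftrightarrow>
     (\<forall>g n p. \<forall>x \<in> elems P g n p.
        f g n p x \<in> elems Q g n p \<and>
        (\<forall>y \<in> elems P g n p. f g n p (add P g n p x y) = add Q g n p (f g n p x) (f g n p y)) \<and>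
        (\<forall>a. f g n p (smul P g n p a x) = smul Q g n p a (f g n p x)) \<and>
        f g n (p + 1) (dif P g n p x) = dif Q g n p (f g n p x) \<and>
        (\<forall>\<sigma>. \<sigma> permutes {..<n} \<longrightarrow> f g n p (act P g n p \<sigma> x) = act Q g n p \<sigma> (f g n p x))) \<and>
     (\<forall>G bs ps xs. composable d P G bs ps xs \<longrightarrow>
        f (genus TYPE('k) G) (length (legs G)) (out_par bs ps) (mu P G bs ps xs) =
        mu Q G bs ps (map (\<lambda>i. f (fst (verts G ! i)) (snd (verts G ! i)) (ps ! i) (xs ! i))
                          [0..<length (verts G)])) \<and>
     (\<forall>g n p x. x \<notin> elems P g n p \<longrightarrow> f g n p x = undefined)"


section \<open>The BV-resolution\<close>

text \<open>
  \<open>BV\<close> is presented by generators and relations: formal expressions built from elements of \<open>\<O>\<close>, the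
  unit and the operations \<open>s\<close> and \<open>t\<close> by means of the operations of an operad, modulo the smallest
  congruence that enforces the axioms of an extended modular operad and the relations of \<open>BV\<close>.
\<close>

datatype ('k, 'a) expr =
    Gen nat nat bit 'a
  | One
  | S
  | T
  | Zero nat nat bit
  | Add "('k, 'a) expr" "('k, 'a) expr"
  | Smul 'k "('k, 'a) expr"
  | Act "nat \<Rightarrow> nat" "('k, 'a) expr"
  | Mu graph "(flag \<Rightarrow> 'k) list" "('k, 'a) expr list"

inductive wt :: "bit \<Rightarrow> ('k::field_char_0, 'a) opd \<Rightarrow> ('k, 'a) expr \<Rightarrow> nat \<Rightarrow> nat \<Rightarrow> bit \<Rightarrow> bool"
  for d \<O> where
  wt_Gen: "x \<in> elems \<O> g n p \<Longrightarrow> wt d \<O> (Gen g n p x) g n p"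
| wt_One: "wt d \<O> One 0 2 0"
| wt_S: "wt d \<O> S 0 2 1"
| wt_T: "wt d \<O> T 0 2 0"
| wt_Zero: "wt d \<O> (Zero g n p) g n p"
| wt_Add: "wt d \<O> e g n p \<Longrightarrow> wt d \<O> e' g n p \<Longrightarrow> wt d \<O> (Add e e') g n p"
| wt_Smul: "wt d \<O> e g n p \<Longrightarrow> wt d \<O> (Smul a e) g n p"
| wt_Act: "wt d \<O> e g n p \<Longrightarrow> \<sigma> permutes {..<n} \<Longrightarrow> wt d \<O> (Act \<sigma> e) g n p"
| wt_Mu: "ext_stable G \<Longrightarrow> det_args d G bs \<Longrightarrow>
    length ps = length (verts G) \<Longrightarrow> length es = length (verts G) \<Longrightarrow>
    (\<forall>i < length (verts G). wt d \<O> (es ! i) (fst (verts G ! i)) (snd (verts G ! i)) (ps ! i)) \<Longrightarrow>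
    wt d \<O> (Mu G bs es) (genus TYPE('k) G) (length (legs G)) (out_par bs ps)"

primrec par :: "('k, 'a) expr \<Rightarrow> bit" where
  "par (Gen g n p x) = p"
| "par One = 0"
| "par S = 1"
| "par T = 0"
| "par (Zero g n p) = p"
| "par (Add e e') = par e"
| "par (Smul a e) = par e"
| "par (Act \<sigma> e) = par e"
| "par (Mu G bs es) = out_par bs (map par es)"

text \<open>The differential of \<open>BV\<close> extends that of \<open>\<O>\<close>, with \<open>d(s) = 1 - t\<close> and \<open>d(t) = 0\<close>.\<close>

primrec expr_dif :: "('k::field_char_0, 'a) opd \<Rightarrow> ('k, 'a) expr \<Rightarrow> ('k, 'a) expr" where
  "expr_dif \<O> (Gen g n p x) = Gen g n (p + 1) (dif \<O> g n p x)"
| "expr_dif \<O> One = Zero 0 2 1"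
| "expr_dif \<O> S = Add One (Smul (- 1) T)"
| "expr_dif \<O> T = Zero 0 2 1"
| "expr_dif \<O> (Zero g n p) = Zero g n (p + 1)"
| "expr_dif \<O> (Add e e') = Add (expr_dif \<O> e) (expr_dif \<O> e')"
| "expr_dif \<O> (Smul a e) = Smul a (expr_dif \<O> e)"
| "expr_dif \<O> (Act \<sigma> e) = Act \<sigma> (expr_dif \<O> e)"
| "expr_dif \<O> (Mu G bs es) =
     (let des = map (expr_dif \<O>) es in
      foldr Add
        (map (\<lambda>i. Smul (sg (of_nat (length bs) + sum_list (take i (map par es))))
                    (Mu G bs (es[i := des ! i])))
           [0..<length (verts G)])
        (Zero (genus TYPE('k) G) (length (legs G)) (out_par bs (map par es) + 1)))"

definition expr_opd :: "bit \<Rightarrow> ('k::field_char_0, 'a) opd \<Rightarrow> ('k, ('k, 'a) expr) opd" where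
  "expr_opd d \<O> = \<lparr>
     elems = (\<lambda>g n p. {e. wt d \<O> e g n p}),
     zer = Zero,
     add = (\<lambda>g n p. Add),
     smul = (\<lambda>g n p. Smul),
     dif = (\<lambda>g n p. expr_dif \<O>),
     act = (\<lambda>g n p. Act),
     mu = (\<lambda>G bs ps. Mu G bs)\<rparr>"

text \<open>
  The graph with vertices of types \<open>(g, n)\<close> and \<open>(0, 2)\<close> and one edge, which joins the flag \<open>j\<close> of
  the first vertex to the flag \<open>0\<close> of the second; the leg \<open>j\<close> is the remaining flag of the second
  vertex. For \<open>(g, n) = (0, 2)\<close> and \<open>j = 1\<close> it defines the product \<open>\<circ>\<^sub>1\<close> in arity \<open>((0, 2))\<close>.
\<close>

definition attach_graph :: "nat \<Rightarrow> nat \<Rightarrow> nat \<Rightarrow> graph" where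
  "attach_graph g n j = \<lparr>
     verts = [(g, n), (0, 2)],
     ginv = Transposition.transpose (0, j) (1, 0),
     legs = map (\<lambda>l. if l = j then (1, 1) else (0, l)) [0..<n]\<rparr>"

abbreviation circ1 :: "('k, 'a) expr \<Rightarrow> ('k, 'a) expr \<Rightarrow> ('k, 'a) expr" where
  "circ1 e e' \<equiv> Mu (attach_graph 0 2 1) [] [e, e']"

text \<open>The last axiom of the unit says that grafting \<open>1\<close> onto any flag is the identity.\<close>

locale BV_relations =
  fixes d :: bit
    and \<O> :: "('k::field_char_0, 'a) opd"
    and R :: "nat \<Rightarrow> nat \<Rightarrow> bit \<Rightarrow> ('k, 'a) expr \<Rightarrow> ('k, 'a) expr \<Rightarrow> bool"
  assumes Gen_add: "x \<in> elems \<O> g n p \<Longrightarrow> y \<in> elems \<O> g n p \<Longrightarrow>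
      R g n p (Gen g n p (add \<O> g n p x y)) (Add (Gen g n p x) (Gen g n p y))"
    and Gen_smul: "x \<in> elems \<O> g n p \<Longrightarrow>
      R g n p (Gen g n p (smul \<O> g n p a x)) (Smul a (Gen g n p x))"
    and Gen_act: "x \<in> elems \<O> g n p \<Longrightarrow> \<sigma> permutes {..<n} \<Longrightarrow>
      R g n p (Gen g n p (act \<O> g n p \<sigma> x)) (Act \<sigma> (Gen g n p x))"
    and Gen_mu: "composable d \<O> G bs ps xs \<Longrightarrow>
      R (genus TYPE('k) G) (length (legs G)) (out_par bs ps)
        (Gen (genus TYPE('k) G) (length (legs G)) (out_par bs ps) (mu \<O> G bs ps xs))
        (Mu G bs (map (\<lambda>i. Gen (fst (verts G ! i)) (snd (verts G ! i)) (ps ! i) (xs ! i))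
                      [0..<length (verts G)]))"
    and One_sym: "R 0 2 0 (Act (Transposition.transpose 0 1) One) One"
    and S_sym: "R 0 2 1 (Act (Transposition.transpose 0 1) S) S"
    and T_sym: "R 0 2 0 (Act (Transposition.transpose 0 1) T) T"
    and S_S: "R 0 2 0 (circ1 S S) (Zero 0 2 0)"
    and T_T: "R 0 2 0 (circ1 T T) T"
    and S_T: "R 0 2 1 (circ1 S T) (Zero 0 2 1)"
    and T_S: "R 0 2 1 (circ1 T S) (Zero 0 2 1)"
    and graft_One: "wt d \<O> e g n p \<Longrightarrow> j < n \<Longrightarrow> ext_stable (attach_graph g n j) \<Longrightarrow>
      R g n p (Mu (attach_graph g n j) [] [e, One]) e"

definition BV_eq :: "bit \<Rightarrow> ('k::field_char_0, 'a) opd \<Rightarrow>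
    nat \<Rightarrow> nat \<Rightarrow> bit \<Rightarrow> ('k, 'a) expr \<Rightarrow> ('k, 'a) expr \<Rightarrow> bool" where
  "BV_eq d \<O> g n p e e' \<longleftrightarrow>
     (\<forall>R. modular_operad_upto d (expr_opd d \<O>) R \<and> BV_relations d \<O> R \<longrightarrow> R g n p e e')"

definition cls :: "('k, 'a) opd \<Rightarrow> (nat \<Rightarrow> nat \<Rightarrow> bit \<Rightarrow> 'a \<Rightarrow> 'a \<Rightarrow> bool) \<Rightarrow>
    nat \<Rightarrow> nat \<Rightarrow> bit \<Rightarrow> 'a \<Rightarrow> 'a set" where
  "cls P R g n p x = {y \<in> elems P g n p. R g n p x y}"

definition rep :: "'a set \<Rightarrow> 'a" where
  "rep X = (SOME x. x \<in> X)"

definition quotient_opd ::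
    "('k::field_char_0, 'a) opd \<Rightarrow> (nat \<Rightarrow> nat \<Rightarrow> bit \<Rightarrow> 'a \<Rightarrow> 'a \<Rightarrow> bool) \<Rightarrow> ('k, 'a set) opd" where
  "quotient_opd P R = \<lparr>
     elems = (\<lambda>g n p. cls P R g n p ` elems P g n p),
     zer = (\<lambda>g n p. cls P R g n p (zer P g n p)),
     add = (\<lambda>g n p X Y. cls P R g n p (add P g n p (rep X) (rep Y))),
     smul = (\<lambda>g n p a X. cls P R g n p (smul P g n p a (rep X))),
     dif = (\<lambda>g n p X. cls P R g n (p + 1) (dif P g n p (rep X))),
     act = (\<lambda>g n p \<sigma> X. cls P R g n p (act P g n p \<sigma> (rep X))),
     mu = (\<lambda>G bs ps Xs. cls P R (genus TYPE('k) G) (length (legs G)) (out_par bs ps)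
                           (mu P G bs ps (map rep Xs)))\<rparr>"

definition BV :: "bit \<Rightarrow> ('k::field_char_0, 'a) opd \<Rightarrow> ('k, ('k, 'a) expr set) opd" where
  "BV d \<O> = quotient_opd (expr_opd d \<O>) (BV_eq d \<O>)"

definition BV_class :: "bit \<Rightarrow> ('k::field_char_0, 'a) opd \<Rightarrow>
    nat \<Rightarrow> nat \<Rightarrow> bit \<Rightarrow> ('k, 'a) expr \<Rightarrow> ('k, 'a) expr set" where
  "BV_class d \<O> = cls (expr_opd d \<O>) (BV_eq d \<O>)"


section \<open>Inner products and the endomorphism operad\<close>

locale dg_inner_product_space =
  fixes d :: bit
    and sc :: "'k::field_char_0 \<Rightarrow> 'v::ab_group_add \<Rightarrow> 'v"
    and V :: "bit \<Rightarrow> 'v set"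
    and D :: "'v \<Rightarrow> 'v"
    and B :: "'v \<Rightarrow> 'v \<Rightarrow> 'k"
  assumes vs: "vector_space sc"
    and fin_dim: "\<exists>X. finite X \<and> module.span sc X = UNIV"
    and parity_subspace: "module.subspace sc (V p)"
    and parity_disjoint: "V 0 \<inter> V 1 = {0}"
    and parity_span: "\<exists>v0 \<in> V 0. \<exists>v1 \<in> V 1. v = v0 + v1"
    and D_linear: "Vector_Spaces.linear sc sc D"
    and D_odd: "v \<in> V p \<Longrightarrow> D v \<in> V (p + 1)"
    and D_D: "D (D v) = 0"
    and B_linear_left: "Vector_Spaces.linear sc (*) (\<lambda>v. B v w)"
    and B_linear_right: "Vector_Spaces.linear sc (*) (B v)"
    and B_even: "v \<in> V p \<Longrightarrow> w \<in> V q \<Longrightarrow> p + q \<noteq> d \<Longrightarrow> B v w = 0"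
    and B_sym: "v \<in> V p \<Longrightarrow> w \<in> V q \<Longrightarrow> B v w = sg (p * q) * B w v"
    and B_nondegenerate: "(\<And>w. B v w = 0) \<Longrightarrow> v = 0"
    and B_dg: "v \<in> V p \<Longrightarrow> B (D v) w + sg p * B v (D w) = 0"

text \<open>
  Tensor powers are represented by coefficients with respect to a homogeneous basis.
\<close>

definition homogeneous_basis ::
    "('k::field \<Rightarrow> 'v::ab_group_add \<Rightarrow> 'v) \<Rightarrow> (bit \<Rightarrow> 'v set) \<Rightarrow> 'v list \<Rightarrow> bool" where
  "homogeneous_basis sc V es \<longleftrightarrow> distinct es \<and> set es \<subseteq> V 0 \<union> V 1 \<and>
     \<not> module.dependent sc (set es) \<and> module.span sc (set es) = UNIV"

definition hbasis ::
    "('k::field \<Rightarrow> 'v::ab_group_add \<Rightarrow> 'v) \<Rightarrow> (bit \<Rightarrow> 'v set) \<Rightarrow> 'v list" where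
  "hbasis sc V = (SOME es. homogeneous_basis sc V es)"

lemma (in dg_inner_product_space) homogeneous_basis_hbasis: "homogeneous_basis sc V (hbasis sc V)"
proof -
  interpret vector_space sc by (rule vs)
  obtain X where X: "finite X" "span X = UNIV" using fin_dim by blast
  obtain E where E: "E \<subseteq> V 0 \<union> V 1" "independent E" "V 0 \<union> V 1 \<subseteq> span E"
    using maximal_independent_subset by blast
  have "finite E" using independent_span_bound[OF X(1) E(2)] X(2) by simp
  then obtain es where es: "set es = E" "distinct es" using finite_distinct_list by blast
  have "v \<in> span E" for v
    using parity_span[of v] E(3) by (auto intro!: span_add)
  then have "homogeneous_basis sc V es"
    unfolding homogeneous_basis_def using es E by auto
  then show ?thesis unfolding hbasis_def by (rule someI)
qed

text \<open>
  The endomorphism operad is \<open>\<Pi>\<^sup>d(\<Pi>\<^sup>dV)\<^sup>\<otimes>\<^sup>n\<close> in arity \<open>((g, n))\<close>. An element is given by the coefficients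
  \<open>x [i\<^sub>1, ..., i\<^sub>n]\<close> of the basis elements \<open>\<theta> E\<^sub>i\<^sub>1 ... E\<^sub>i\<^sub>n\<close>, where \<open>\<theta>\<close> and \<open>E\<^sub>i = \<Pi>\<^sup>d e\<^sub>i\<close> have the
  parities \<open>d\<close> and \<open>|e\<^sub>i| + d\<close>; the latter is \<open>shifted_par\<close>.
\<close>

definition shifted_par :: "bit \<Rightarrow> (bit \<Rightarrow> 'v set) \<Rightarrow> 'v list \<Rightarrow> nat \<Rightarrow> bit" where
  "shifted_par d V es i = (if es ! i \<in> V 0 then 0 else 1) + d"

definition end_elems ::
    "bit \<Rightarrow> (bit \<Rightarrow> 'v set) \<Rightarrow> 'v list \<Rightarrow> nat \<Rightarrow> nat \<Rightarrow> bit \<Rightarrow> (nat list \<Rightarrow> 'k::field_char_0) set" where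
  "end_elems d V es g n p =
     (if (g, n) \<in> {(0, 0), (0, 1), (1, 0)} then {\<lambda>_. 0}
      else {x. \<forall>is. x is \<noteq> 0 \<longrightarrow> length is = n \<and> set is \<subseteq> {..<length es} \<and>
                  d + sum_list (map (shifted_par d V es) is) = p})"

text \<open>
  Moving the differential past \<open>\<theta>\<close> and the identity \<open>d(\<Pi>v) = - \<Pi>(dv)\<close> contribute two signs
  \<open>(-1)\<^sup>d\<close>, which cancel.
\<close>

definition end_dif :: "bit \<Rightarrow> ('k::field_char_0 \<Rightarrow> 'v::ab_group_add \<Rightarrow> 'v) \<Rightarrow> (bit \<Rightarrow> 'v set) \<Rightarrow>
    ('v \<Rightarrow> 'v) \<Rightarrow> 'v list \<Rightarrow> (nat list \<Rightarrow> 'k) \<Rightarrow> nat list \<Rightarrow> 'k" where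
  "end_dif d sc V D es x is =
     (if set is \<subseteq> {..<length es} then
        (\<Sum>j < length is. \<Sum>k < length es.
           sg (sum_list (map (shifted_par d V es) (take j is))) *
           module.representation sc (set es) (D (es ! k)) (es ! (is ! j)) * x (is[j := k]))
      else 0)"

text \<open>The factor in position \<open>j\<close> is moved to position \<open>\<sigma> j\<close>.\<close>

definition end_act :: "bit \<Rightarrow> (bit \<Rightarrow> 'v set) \<Rightarrow> 'v list \<Rightarrow> (nat \<Rightarrow> nat) \<Rightarrow>
    (nat list \<Rightarrow> 'k::field_char_0) \<Rightarrow> nat list \<Rightarrow> 'k" where
  "end_act d V es \<sigma> x is =
     (let js = map (\<lambda>j. is ! \<sigma> j) [0..<length is]
      in koszul (length is) \<sigma> (\<lambda>j. shifted_par d V es (js ! j)) * x js)"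

text \<open>
  An edge is represented by its first half-edge \<open>f\<close>, and oriented from \<open>f\<close> to \<open>ginv f\<close>.
\<close>

definition flag_pos :: "graph \<Rightarrow> flag \<Rightarrow> nat" where
  "flag_pos G = (\<lambda>(i, j). (\<Sum>i' < i. snd (verts G ! i')) + j)"

definition edge_list :: "graph \<Rightarrow> flag list" where
  "edge_list G = filter (\<lambda>f. flag_pos G f < flag_pos G (ginv G f)) (flag_list G)"

text \<open>
  The isomorphism \<open>Det(H\<^sub>1(G)) \<otimes> Det(C\<^sub>0(G)) \<cong> Det(H\<^sub>0(G)) \<otimes> Det(C\<^sub>1(G))\<close>, \<open>H\<^sub>0(G) = \<k>\<close>, induced by
  \<open>0 \<rightarrow> H\<^sub>1 \<rightarrow> C\<^sub>1 \<rightarrow> C\<^sub>0 \<rightarrow> H\<^sub>0 \<rightarrow> 0\<close>, which identifies \<open>Det\<close> with the cocycle \<open>\<KK>\<close> twisted by \<open>\<ss> \<otimes> \<Pi>\<close>: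
  \<open>orient G bs\<close> is the scalar \<open>\<lambda>\<close> with
  \<open>b\<^sub>1 \<and> ... \<and> b\<^sub>m \<and> u\<^sub>1 \<and> ... \<and> u\<^sub>k\<^sub>-\<^sub>1 = \<lambda> e\<^sub>q \<and> ... \<and> e\<^sub>1\<close> in \<open>\<Lambda>\<^sup>q C\<^sub>1(G)\<close>, where the vertices are
  \<open>v\<^sub>0, ..., v\<^sub>k\<^sub>-\<^sub>1\<close>, the edges are \<open>e\<^sub>1, ..., e\<^sub>q\<close>, and \<open>u\<^sub>j\<close> is any chain with boundary \<open>v\<^sub>j - v\<^sub>0\<close>.
  The edges appear in reverse order since the contractions along them are dual to \<open>C\<^sub>1(G)\<close>.
\<close>

definition lift_vertex :: "graph \<Rightarrow> nat \<Rightarrow> flag \<Rightarrow> 'k::field_char_0" where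
  "lift_vertex G j = (SOME u. u \<in> chains1 G \<and>
     (\<forall>i < length (verts G). bdry G u i = (if i = j then 1 else 0) - (if i = 0 then 1 else 0)))"

definition orient :: "graph \<Rightarrow> (flag \<Rightarrow> 'k::field_char_0) list \<Rightarrow> 'k" where
  "orient G bs =
     (let rows = bs @ map (lift_vertex G) [1..<length (verts G)];
          es = rev (edge_list G)
      in Determinant.det (mat (length es) (length es) (\<lambda>(r, c). (rows ! r) (es ! c))))"

text \<open>
  The pairing on \<open>\<Pi>\<^sup>dV\<close>: for \<open>d = 1\<close> the sign makes it antisymmetric, as is needed for
  the contraction along an edge to change sign with the orientation of the edge.
\<close>

definition edge_pairing :: "bit \<Rightarrow> (bit \<Rightarrow> 'v set) \<Rightarrow> ('v \<Rightarrow> 'v \<Rightarrow> 'k::field_char_0) \<Rightarrow> 'v list \<Rightarrow>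
    nat \<Rightarrow> nat \<Rightarrow> 'k" where
  "edge_pairing d V B es a b = sg (d * (if es ! a \<in> V 0 then 0 else 1)) * B (es ! a) (es ! b)"

text \<open>
  The sum runs over the assignments \<open>c\<close> of basis elements to the flags that extend the given one
  \<open>js\<close> on the legs. The first sign comes from moving the factors \<open>\<theta>\<close> of all vertices to the left, the
  second one from moving the two factors of every edge next to each other, in front of the factors
  of the legs.
\<close>

definition end_mu :: "bit \<Rightarrow> (bit \<Rightarrow> 'v set) \<Rightarrow> ('v \<Rightarrow> 'v \<Rightarrow> 'k::field_char_0) \<Rightarrow> 'v list \<Rightarrow>
    graph \<Rightarrow> (flag \<Rightarrow> 'k) list \<Rightarrow> (nat list \<Rightarrow> 'k) list \<Rightarrow> nat list \<Rightarrow> 'k" where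
  "end_mu d V B es G bs xs js =
     (if length js = length (legs G) \<and> set js \<subseteq> {..<length es} then
        (\<Sum>c \<in> {c \<in> flags G \<rightarrow>\<^sub>E {..<length es}. map c (legs G) = js}.
           let q = shifted_par d V es \<circ> c;
               target = concat (map (\<lambda>f. [f, ginv G f]) (edge_list G)) @ legs G
           in (if d = 0 then 1 else orient G bs) *
              sg (\<Sum>i < length (verts G). \<Sum>i' < i. d * (\<Sum>j < snd (verts G ! i'). q (i', j))) *
              koszul (length target) (\<lambda>r. flag_pos G (target ! r)) (\<lambda>r. q (target ! r)) *
              prod_list (map (\<lambda>f. edge_pairing d V B es (c f) (c (ginv G f))) (edge_list G)) *
              (\<Prod>i < length (verts G). (xs ! i) (map (\<lambda>j. c (i, j)) [0..<snd (verts G ! i)])))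
      else 0)"

definition End_opd :: "bit \<Rightarrow> ('k::field_char_0 \<Rightarrow> 'v::ab_group_add \<Rightarrow> 'v) \<Rightarrow> (bit \<Rightarrow> 'v set) \<Rightarrow>
    ('v \<Rightarrow> 'v) \<Rightarrow> ('v \<Rightarrow> 'v \<Rightarrow> 'k) \<Rightarrow> ('k, nat list \<Rightarrow> 'k) opd" where
  "End_opd d sc V D B = (let es = hbasis sc V in \<lparr>
     elems = end_elems d V es,
     zer = (\<lambda>g n p is. 0),
     add = (\<lambda>g n p x y is. x is + y is),
     smul = (\<lambda>g n p a x is. a * x is),
     dif = (\<lambda>g n p. end_dif d sc V D es),
     act = (\<lambda>g n p. end_act d V es),
     mu = (\<lambda>G bs ps. end_mu d V B es G bs)\<rparr>)"

text \<open>
  The identification of arity \<open>((0, 2))\<close> with \<open>Hom(V, V)\<close>: the basis element with indices \<open>a, b\<close>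
  is the operator \<open>v \<mapsto> \<langle>e\<^sub>b, v\<rangle> e\<^sub>a\<close>. Then \<open>\<circ>\<^sub>1\<close> is the composition of operators,
  the transposition acts by passing to the adjoint, and the differential is the (super)commutator
  with \<open>D\<close>.
\<close>

definition as_operator :: "('k::field_char_0 \<Rightarrow> 'v::ab_group_add \<Rightarrow> 'v) \<Rightarrow> (bit \<Rightarrow> 'v set) \<Rightarrow>
    ('v \<Rightarrow> 'v \<Rightarrow> 'k) \<Rightarrow> (nat list \<Rightarrow> 'k) \<Rightarrow> 'v \<Rightarrow> 'v" where
  "as_operator sc V B x v = (let es = hbasis sc V in
     \<Sum>a < length es. \<Sum>b < length es. sc (x [a, b] * B (es ! b) v) (es ! a))"


section \<open>Algebras\<close>

definition algebra_structures :: "bit \<Rightarrow> ('k::field_char_0, 'a) opd \<Rightarrow>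
    ('k \<Rightarrow> 'v::ab_group_add \<Rightarrow> 'v) \<Rightarrow> (bit \<Rightarrow> 'v set) \<Rightarrow> ('v \<Rightarrow> 'v) \<Rightarrow> ('v \<Rightarrow> 'v \<Rightarrow> 'k) \<Rightarrow>
    (nat \<Rightarrow> nat \<Rightarrow> bit \<Rightarrow> 'a \<Rightarrow> nat list \<Rightarrow> 'k) set" where
  "algebra_structures d \<O> sc V D B = {\<alpha>. operad_hom d \<O> (stable_part (End_opd d sc V D B)) \<alpha>}"

definition BV_algebra_structures :: "bit \<Rightarrow> ('k::field_char_0, 'a) opd \<Rightarrow>
    ('k \<Rightarrow> 'v::ab_group_add \<Rightarrow> 'v) \<Rightarrow> (bit \<Rightarrow> 'v set) \<Rightarrow> ('v \<Rightarrow> 'v) \<Rightarrow> ('v \<Rightarrow> 'v \<Rightarrow> 'k) \<Rightarrow>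
    (nat \<Rightarrow> nat \<Rightarrow> bit \<Rightarrow> ('k, 'a) expr set \<Rightarrow> nat list \<Rightarrow> 'k) set" where
  "BV_algebra_structures d \<O> sc V D B =
     {\<beta>. operad_hom d (BV d \<O>) (End_opd d sc V D B) \<beta> \<and>
         as_operator sc V B (\<beta> 0 2 0 (BV_class d \<O> 0 2 0 One)) = id}"

definition restrict_structure :: "bit \<Rightarrow> ('k::field_char_0, 'a) opd \<Rightarrow>
    (nat \<Rightarrow> nat \<Rightarrow> bit \<Rightarrow> ('k, 'a) expr set \<Rightarrow> 'b) \<Rightarrow> nat \<Rightarrow> nat \<Rightarrow> bit \<Rightarrow> 'a \<Rightarrow> 'b" where
  "restrict_structure d \<O> \<beta> g n p x =
     (if x \<in> elems \<O> g n p then \<beta> g n p (BV_class d \<O> g n p (Gen g n p x)) else undefined)"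

end

theory Submission
  imports Defs
begin

text \<open>
  Homomorphisms out of \<open>BV\<close> amount to homomorphisms out of \<open>\<O>\<close> together with values of \<open>1\<close>, \<open>s\<close> and \<open>t\<close> that
  satisfy the relations and are compatible with the differential, because evaluation of expressions
  in an operad identifies any two expressions that are equal in \<open>BV\<close>. In arity \<open>((0, 2))\<close> the elements
  of the endomorphism operad are the operators on \<open>V\<close>; the products \<open>\<circ>\<^sub>1\<close>, the transposition and
  the differential become the composition, the adjoint and the commutator with \<open>D\<close>, so the relations
  of \<open>BV\<close> turn into the identities for \<open>s\<close> and \<open>t\<close>.

  That evaluation has this property rests on the fact that the endomorphism operad satisfies
  the axioms. There the determinant of \<open>H\<^sub>1\<close> of a graph is computed as a wedge product with lifts of the
  differences of vertices, expressed in the edges; the Koszul signs of the contractions and of the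
  shifts compensate, in every axiom, the sign by which this wedge product changes.
\<close>

section \<open>Signs of words\<close>

text \<open>The fixed data in the definition of a contraction (\<open>edge_list\<close>, the lifts
  chosen by \<open>SOME\<close>, the order of the vertices) is not respected by isomorphisms and
  graftings. It is therefore replaced by arbitrary choices. Orientation, Koszul sign and pairings
  are bundled into one quantity \<open>amp\<close>, which depends neither on the order nor on the
  directions of the edges, although its factors separately do. Lifts may be altered by cycles,
  because the determinant arguments already fill the top exterior power of H1. Of the pairing only
  parity and symmetry enter, so all this is done for an abstract matrix \<open>w\<close>. Koszul
  signs are taken of words of flags: the sign between two arrangements of the same letters can be
  computed with any ranking of the letters, and words can be cut and joined along with the graphs.
  Since equality in \<open>BV\<close> is the intersection of all admissible congruences, it suffices
  that the kernel of the evaluation is one of them. Relations between operators lift to arity (0, 2)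
  because nondegeneracy makes an element there determined by its operator.\<close>

declare add_bit_eq_xor [simp del] mult_bit_eq_and [simp del]

lemma bit_add_self [simp]: "a + a = (0::bit)"
  by (cases a) simp_all

lemma bit_add_self_left [simp]: "a + (a + b) = (b::bit)"
  by (simp flip: add.assoc)

lemma bit_mult_self [simp]: "a * a = (a::bit)"
  by (cases a) simp_all

lemma bit_add_eq_move: "a + b = c \<longleftrightarrow> a = b + (c::bit)"
  by (cases a; cases b; cases c) simp_all

lemma sg_0 [simp]: "sg 0 = 1"
  by (simp add: sg_def)

lemma sg_add: "sg (a + b) = sg a * sg b"
  by (cases a; cases b) (simp_all add: sg_def)

lemma sg_square [simp]: "sg a * sg a = 1"
  by (simp add: sg_def)

lemma sg_square_left [simp]: "sg a * (sg a * x) = x"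
  by (simp flip: mult.assoc)

lemma sg_neq_0 [simp]: "sg a \<noteq> (0::'k::field)"
  by (simp add: sg_def)

text \<open>The exponent of the Koszul sign for sorting the word \<open>xs\<close> by the rank
  \<open>r\<close>, the letter \<open>x\<close> having parity \<open>p x\<close>. Words of letters,
  in place of permutations of positions, can be cut, joined and renamed; \<open>koszul_winv\<close>
  is the link to \<open>koszul\<close>.\<close>

primrec winv :: "('a \<Rightarrow> nat) \<Rightarrow> ('a \<Rightarrow> bit) \<Rightarrow> 'a list \<Rightarrow> bit" where
  "winv r p [] = 0"
| "winv r p (x # xs) = (\<Sum>y\<leftarrow>xs. if r y < r x then p x * p y else 0) + winv r p xs"

text \<open>The inversions of \<open>xs @ ys\<close> with one letter in each factor. They are blind
  to the order inside the factors (\<open>wcross_mset\<close>), hence cancel whenever only one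
  factor is rearranged.\<close>

definition wcross :: "('a \<Rightarrow> nat) \<Rightarrow> ('a \<Rightarrow> bit) \<Rightarrow> 'a list \<Rightarrow> 'a list \<Rightarrow> bit" where
  "wcross r p xs ys = (\<Sum>x\<leftarrow>xs. \<Sum>y\<leftarrow>ys. if r y < r x then p x * p y else 0)"

lemma wcross_Nil [simp]: "wcross r p [] ys = 0" "wcross r p xs [] = 0"
  by (simp_all add: wcross_def)

lemma wcross_append_left: "wcross r p (xs @ xs') ys = wcross r p xs ys + wcross r p xs' ys"
  by (simp add: wcross_def)

lemma wcross_append_right: "wcross r p xs (ys @ ys') = wcross r p xs ys + wcross r p xs ys'"
  by (simp add: wcross_def sum_list_addf)

lemma wcross_Cons_left: "wcross r p (x # xs) ys = wcross r p [x] ys + wcross r p xs ys"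
  using wcross_append_left[of r p "[x]" xs ys] by simp

lemma wcross_Cons_right: "wcross r p xs (y # ys) = wcross r p xs [y] + wcross r p xs ys"
  using wcross_append_right[of r p xs "[y]" ys] by simp

lemma winv_Cons: "winv r p (x # xs) = wcross r p [x] xs + winv r p xs"
  by (simp add: wcross_def)

lemma winv_append: "winv r p (xs @ ys) = winv r p xs + winv r p ys + wcross r p xs ys"
proof (induction xs)
  case (Cons x xs)
  then show ?case
    using wcross_append_right[of r p "[x]" xs ys] wcross_Cons_left[of r p x xs ys]
    by (simp only: winv_Cons append_Cons) (simp add: ac_simps)
qed simp

lemma wcross_all:
  assumes "\<And>x y. x \<in> set xs \<Longrightarrow> y \<in> set ys \<Longrightarrow> r y < r x"
  shows "wcross r p xs ys = sum_list (map p xs) * sum_list (map p ys)"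
  using assms
proof (induction xs)
  case (Cons x xs)
  have "(\<Sum>y\<leftarrow>ys. if r y < r x then p x * p y else 0) = (\<Sum>y\<leftarrow>ys. p x * p y)"
    by (rule arg_cong[where f = sum_list]) (use Cons.prems in auto)
  then show ?case
    using Cons wcross_Cons_left[of r p x xs ys]
    by (simp add: distrib_right sum_list_const_mult) (simp add: wcross_def sum_list_const_mult)
qed simp

lemma wcross_none:
  assumes "\<And>x y. x \<in> set xs \<Longrightarrow> y \<in> set ys \<Longrightarrow> r x \<le> r y"
  shows "wcross r p xs ys = 0"
  using assms
proof (induction xs)
  case (Cons x xs)
  have "(\<Sum>y\<leftarrow>ys. if r y < r x then p x * p y else 0) = (\<Sum>y\<leftarrow>ys. 0)"
    by (rule arg_cong[where f = sum_list], rule map_cong[OF refl]) (use Cons.prems in \<open>force simp: not_less\<close>)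
  then show ?case
    using Cons wcross_Cons_left[of r p x xs ys] by (simp add: wcross_def)
qed simp

lemma sum_list_map_mset:
  assumes "mset xs = mset ys"
  shows "sum_list (map f xs) = (sum_list (map f ys) :: 'b::comm_monoid_add)"
  using arg_cong[OF assms, of "\<lambda>M. sum_mset (image_mset f M)"] by (simp add: sum_mset_sum_list[symmetric] del: sum_mset_sum_list)

lemma wcross_mset: "mset xs = mset xs' \<Longrightarrow> mset ys = mset ys' \<Longrightarrow> wcross r p xs ys = wcross r p xs' ys'"
  unfolding wcross_def
  by (subst sum_list_map_mset[of ys ys'], assumption) (rule sum_list_map_mset)

text \<open>With different ranks, a pair of letters is inverted in exactly one of the two orders, so
  together every product of parities is counted once.\<close>

lemma wcross_commute:
  assumes "\<And>x y. x \<in> set xs \<Longrightarrow> y \<in> set ys \<Longrightarrow> r x \<noteq> r y"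
  shows "wcross r p xs ys + wcross r p ys xs = sum_list (map p xs) * sum_list (map p ys)"
proof -
  have 1: "wcross r p [x] ys' + wcross r p ys' [x] = p x * sum_list (map p ys')"
    if "x \<in> set xs" "set ys' \<subseteq> set ys" for x ys'
    using that(2)
  proof (induction ys')
    case (Cons y ys')
    have "r x \<noteq> r y" using Cons.prems assms that(1) by simp
    then have 2: "wcross r p [x] [y] + wcross r p [y] [x] = p x * p y"
      by (cases "r x < r y") (simp_all add: wcross_def mult.commute)
    have "wcross r p [x] (y # ys') + wcross r p (y # ys') [x]
        = (wcross r p [x] [y] + wcross r p [y] [x]) + (wcross r p [x] ys' + wcross r p ys' [x])"
      unfolding wcross_Cons_left[of r p y ys'] wcross_Cons_right[of r p "[x]" y ys'] by (simp only: ac_simps)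
    then show ?case using Cons 2 by (simp add: distrib_left)
  qed simp
  have "wcross r p xs' ys + wcross r p ys xs' = sum_list (map p xs') * sum_list (map p ys)"
    if "set xs' \<subseteq> set xs" for xs'
    using that
  proof (induction xs')
    case (Cons x xs')
    have "wcross r p (x # xs') ys + wcross r p ys (x # xs')
        = (wcross r p [x] ys + wcross r p ys [x]) + (wcross r p xs' ys + wcross r p ys xs')"
      unfolding wcross_Cons_left[of r p x xs'] wcross_Cons_right[of r p ys x xs'] by (simp only: ac_simps)
    then show ?case using Cons 1[of x ys] by (simp add: distrib_right)
  qed simp
  then show ?thesis by simp
qed

lemma winv_sorted: "sorted (map r xs) \<Longrightarrow> winv r p xs = 0"
proof (induction xs)
  case (Cons x xs)
  then have "wcross r p [x] xs = 0" by (intro wcross_none) auto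
  then show ?case using Cons by (simp add: winv_Cons del: winv.simps)
qed simp

lemma winv_map: "winv r p (map f xs) = winv (r \<circ> f) (p \<circ> f) xs"
  by (induction xs) (simp_all add: comp_def)

lemma winv_cong:
  assumes "\<And>x. x \<in> set xs \<Longrightarrow> p x = p' x"
    and "\<And>x y. x \<in> set xs \<Longrightarrow> y \<in> set xs \<Longrightarrow> r x < r y \<longleftrightarrow> r' x < r' y"
  shows "winv r p xs = winv r' p' xs"
  using assms
proof (induction xs)
  case (Cons x xs)
  have "(\<Sum>y\<leftarrow>xs. if r y < r x then p x * p y else 0) = (\<Sum>y\<leftarrow>xs. if r' y < r' x then p' x * p' y else 0)"
    by (rule arg_cong[where f = sum_list]) (use Cons.prems in auto)
  then show ?case using Cons by simp
qed simp

text \<open>Passing \<open>x\<close> over a letter of different rank creates or removes exactly one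
  inversion, so the correction involves parities only and not the rank.\<close>

lemma winv_move:
  assumes "distinct (xs @ x # ys)" "inj_on r (set (xs @ x # ys))"
  shows "winv r p (xs @ x # ys) = winv r p (x # xs @ ys) + p x * sum_list (map p xs)"
proof -
  have "wcross r p [x] xs + wcross r p xs [x] = p x * sum_list (map p xs)"
    using wcross_commute[of "[x]" xs r p] assms by (auto simp: inj_on_def)
  then have "wcross r p xs [x] = wcross r p [x] xs + p x * sum_list (map p xs)"
    by (metis bit_add_self_left)
  then show ?thesis
    using wcross_append_right[of r p "[x]" xs ys] wcross_Cons_right[of r p xs x ys]
    by (simp only: winv_append winv_Cons) (simp add: ac_simps)
qed

text \<open>Either side is the exponent of the Koszul sign that rearranges \<open>xs\<close> into
  \<open>ys\<close>, factored through the order given by \<open>r\<close> or by \<open>r'\<close>;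
  that sign cannot depend on the intermediate order. The applications choose the ranks so that one
  of the words is sorted for one of them.\<close>

lemma winv_change_rank:
  assumes "distinct xs" "mset xs = mset ys" "inj_on r (set xs)" "inj_on r' (set xs)"
  shows "winv r p xs + winv r p ys = winv r' p xs + winv r' p ys"
  using assms
proof (induction xs arbitrary: ys)
  case (Cons x xs)
  then have "x \<in> set ys" by (metis list.set_intros(1) set_mset_mset)
  then obtain as bs where ys: "ys = as @ x # bs" by (meson split_list)
  have m: "mset xs = mset (as @ bs)" using Cons.prems(2) ys by simp
  have d: "distinct (as @ x # bs)" using Cons.prems(1,2) ys mset_eq_imp_distinct_iff by blast
  have s: "set (as @ x # bs) = set (x # xs)" using Cons.prems(2) ys mset_eq_setD by blast
  \<comment> \<open>The inversions of \<open>x\<close> with the other letters occur in both words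
    and cancel. The remaining correction does not mention the rank \<open>s\<close>.\<close>
  have *: "winv s p (x # xs) + winv s p ys = winv s p xs + winv s p (as @ bs) + p x * sum_list (map p as)"
    if "inj_on s (set (x # xs))" for s
    using winv_move[OF d, of s p] that unfolding s ys winv_Cons wcross_mset[OF refl m, of s p "[x]"]
    by (simp only: that) (simp add: ac_simps)
  show ?case
    using Cons.IH[OF _ m] Cons.prems *[OF Cons.prems(3)] *[OF Cons.prems(4)] by simp
qed simp

lemma winv_append_mset:
  assumes "mset xs = mset ys"
  shows "winv r p (zs @ xs) + winv r p (zs @ ys) = winv r p xs + winv r p ys"
  using wcross_mset[OF refl assms, of r p zs] by (simp add: winv_append ac_simps)

lemma sum_list_nth_sum: "sum_list (map f xs) = (\<Sum>i<length xs. f (xs ! i))"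
  by (metis (no_types, lifting) atLeast0LessThan length_map nth_map sum.cong sum_list_sum_nth lessThan_iff)

lemma koszul_double_sum:
  "koszul n \<pi> w = sg (\<Sum>b<n. \<Sum>a<b. if \<pi> b < \<pi> a then w a * w b else 0)"
proof -
  have "(\<Sum>b<n. \<Sum>a<b. if \<pi> b < \<pi> a then w a * w b else 0)
      = (\<Sum>(b, a)\<in>Sigma {..<n} (\<lambda>b. {..<b}). if \<pi> b < \<pi> a then w a * w b else 0)"
    by (simp add: sum.Sigma)
  also have "\<dots> = (\<Sum>(b, a)\<in>{(b, a). a < b \<and> b < n \<and> \<pi> b < \<pi> a}. w a * w b)"
    by (rule sum.mono_neutral_cong_right) (auto split: if_splits)
  also have "\<dots> = (\<Sum>(a, b)\<in>{(a, b). a < b \<and> b < n \<and> \<pi> b < \<pi> a}. w a * w b)"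
    by (rule sum.reindex_bij_witness[of _ "\<lambda>(a, b). (b, a)" "\<lambda>(a, b). (b, a)"]) auto
  finally show ?thesis unfolding koszul_def by simp
qed

lemma winv_double_sum:
  "winv r p xs = (\<Sum>b<length xs. \<Sum>a<b. if r (xs ! b) < r (xs ! a) then p (xs ! a) * p (xs ! b) else 0)"
proof (induction xs rule: rev_induct)
  case (snoc x xs)
  have "wcross r p xs [x] = (\<Sum>a<length xs. if r x < r (xs ! a) then p (xs ! a) * p x else 0)"
    by (simp add: wcross_def sum_list_nth_sum)
  then show ?case using snoc by (simp add: winv_append nth_append wcross_def cong: sum.cong_simp if_cong)
qed simp

lemma koszul_winv: "koszul (length xs) (\<lambda>i. r (xs ! i)) (\<lambda>i. p (xs ! i)) = sg (winv r p xs)"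
  by (simp add: koszul_double_sum winv_double_sum)

lemma koszul_upt: "koszul n r p = sg (winv r p [0..<n])"
  by (auto simp: koszul_double_sum winv_double_sum intro!: arg_cong[where f = sg] sum.cong)

text \<open>The change is the parity of the letters that are inverted with \<open>x\<close>: those
  before it of larger rank and those behind it of smaller rank. Adding all letters before
  \<open>x\<close> and all letters of smaller rank counts exactly these once, the others not at all
  or twice.\<close>

lemma winv_flip:
  assumes "distinct (xs @ x # ys)" "inj_on r (set (xs @ x # ys))"
    and "p' x = p x + 1" "\<And>y. y \<in> set (xs @ ys) \<Longrightarrow> p' y = p y"
  shows "winv r p' (xs @ x # ys) = winv r p (xs @ x # ys) + sum_list (map p xs)
    + (\<Sum>y\<leftarrow>xs @ x # ys. if r y < r x then p y else 0)"
proof -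
  have same: "winv r p' zs = winv r p zs" if "set zs \<subseteq> set (xs @ ys)" for zs
    by (rule winv_cong) (use assms(4) that in auto)
  have 1: "wcross r p' xs ys = wcross r p xs ys"
    using same[of "xs @ ys"] same[of xs] same[of ys] by (simp add: winv_append)
  have 2: "wcross r p' [x] zs = wcross r p [x] zs + (\<Sum>y\<leftarrow>zs. if r y < r x then p y else 0)"
    if "set zs \<subseteq> set (xs @ ys)" for zs
    using that
  proof (induction zs)
    case (Cons z zs)
    then have "p' z = p z" using assms(4) by simp
    then show ?case using Cons by (simp add: wcross_def assms(3) distrib_left distrib_right ac_simps)
  qed simp
  have mv: "winv r q (xs @ x # ys) = winv r q (x # xs @ ys) + q x * sum_list (map q xs)" for q
    by (rule winv_move) (use assms in auto)
  have 3: "sum_list (map p' xs) = sum_list (map p xs)"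
    by (rule arg_cong[where f = sum_list]) (use assms(4) in auto)
  have "winv r p' (xs @ x # ys) = wcross r p [x] (xs @ ys) + (\<Sum>y\<leftarrow>xs @ ys. if r y < r x then p y else 0)
     + winv r p (xs @ ys) + (p x + 1) * sum_list (map p xs)"
    using mv[of p'] 2[of "xs @ ys"] same[of "xs @ ys"]
    by (simp only: winv_Cons 3 assms(3))
  also have "\<dots> = winv r p (xs @ x # ys) + sum_list (map p xs)
    + (\<Sum>y\<leftarrow>xs @ x # ys. if r y < r x then p y else 0)"
    using mv[of p] by (simp add: winv_Cons distrib_right ac_simps del: winv.simps)
  finally show ?thesis .
qed

text \<open>If every exchange of neighbours multiplies \<open>F\<close> by its Koszul sign, the
  value of \<open>F\<close> corrected by the sorting sign depends only on the multiset of letters.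
  With \<open>p = 0\<close> this turns invariance under exchanges into invariance under
  permutations, with \<open>p = 1\<close> it treats antisymmetric functions.\<close>

lemma winv_swap_invariant:
  fixes F :: "'a list \<Rightarrow> 'k::field"
  assumes swap: "\<And>as x y bs. mset (as @ x # y # bs) = M \<Longrightarrow> x \<noteq> y \<Longrightarrow>
      F (as @ y # x # bs) = sg (p x * p y) * F (as @ x # y # bs)"
    and L: "mset xs = M" "mset ys = M" "distinct xs" "inj_on r (set xs)"
  shows "sg (winv r p xs) * F xs = sg (winv r p ys) * F ys"
proof -
  have dM: "distinct zs" if "mset zs = M" for zs
    using that L mset_eq_imp_distinct_iff by blast
  have move: "F (cs @ as @ x # bs) = sg (p x * sum_list (map p as)) * F (cs @ x # as @ bs)"
    if "mset (cs @ as @ x # bs) = M" for cs as x bs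
    using that
  proof (induction as arbitrary: cs)
    case (Cons a as)
    have "F (cs @ (a # as) @ x # bs) = F ((cs @ [a]) @ as @ x # bs)" by simp
    also have "\<dots> = sg (p x * sum_list (map p as)) * F ((cs @ [a]) @ x # as @ bs)"
      by (rule Cons.IH) (use Cons.prems in simp)
    also have "F ((cs @ [a]) @ x # as @ bs) = sg (p x * p a) * F (cs @ x # a # as @ bs)"
      using swap[of cs x a "as @ bs"] dM[OF Cons.prems] Cons.prems by auto
    finally show ?case by (simp add: distrib_left sg_add ac_simps)
  qed simp
  \<comment> \<open>The prefix \<open>cs\<close> holds the letters that are already in place, so
    that the induction can strip the first letter of \<open>xs\<close> without shortening the
    argument of \<open>F\<close>.\<close>
  have "sg (winv r p xs) * F (cs @ xs) = sg (winv r p ys) * F (cs @ ys)"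
    if "mset (cs @ xs) = M" "mset ys = mset xs" "inj_on r (set xs)" for cs
    using that
  proof (induction xs arbitrary: ys cs)
    case (Cons x xs)
    then have "x \<in> set ys" by (metis list.set_intros(1) set_mset_mset)
    then obtain as bs where ys: "ys = as @ x # bs" by (meson split_list)
    have m: "mset (as @ bs) = mset xs" using Cons.prems(2) ys by simp
    have d: "distinct (cs @ as @ x # bs)" using Cons.prems(1,2) ys by (intro dM) simp
    have s: "set (as @ x # bs) = set (x # xs)" using Cons.prems(2) ys mset_eq_setD by blast
    have w: "winv r p ys = wcross r p [x] xs + winv r p (as @ bs) + p x * sum_list (map p as)"
      using winv_move[of as x bs r p] d Cons.prems(3)
      unfolding s ys winv_Cons wcross_mset[OF refl m, of r p "[x]"]
      by (simp only: distinct_append)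
    have "F (cs @ ys) = sg (p x * sum_list (map p as)) * F (cs @ x # as @ bs)"
      unfolding ys by (rule move) (use Cons.prems ys in simp)
    moreover have "sg (winv r p xs) * F ((cs @ [x]) @ xs) = sg (winv r p (as @ bs)) * F ((cs @ [x]) @ as @ bs)"
      by (rule Cons.IH) (use Cons.prems m in auto)
    ultimately show ?case
      by (simp add: w sg_add winv_Cons ac_simps del: winv.simps)
  qed simp
  from this[of "[]"] show ?thesis using L by simp
qed

section \<open>Determinants of lists of functions\<close>

text \<open>The coefficient of a wedge product of chains with respect to the edges
  \<open>cs\<close>: rows are chains, columns are the flags at which they are evaluated. The size is
  that of \<open>cs\<close>, which is why the lemmas that rearrange rows carry a hypothesis on
  lengths.\<close>

definition ldet :: "('c \<Rightarrow> 'k::field) list \<Rightarrow> 'c list \<Rightarrow> 'k" where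
  "ldet rs cs = Determinant.det (mat (length cs) (length cs) (\<lambda>(i, j). (rs ! i) (cs ! j)))"

text \<open>The scalar multiplication is literally the one in \<open>betti\<close>, so that
  \<open>fs.dim\<close> is the dimension used there.\<close>

interpretation fs: vector_space "\<lambda>(a::'k::field) c (f::'c). a * c f"
  by unfold_locales (auto simp: algebra_simps)

lemma ldet_Nil [simp]: "ldet rs [] = 1"
  by (simp add: ldet_def)

lemma ldet_cong:
  assumes "\<And>i c. i < length cs \<Longrightarrow> c \<in> set cs \<Longrightarrow> (rs ! i) c = (rs' ! i) c"
  shows "ldet rs cs = ldet rs' cs"
  unfolding ldet_def by (intro arg_cong[where f = Determinant.det] eq_matI) (use assms in auto)

lemma ldet_map_cols:
  assumes "length rs = length cs"
  shows "ldet rs (map g cs) = ldet (map (\<lambda>r. r \<circ> g) rs) cs"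
  unfolding ldet_def by (intro arg_cong[where f = Determinant.det] eq_matI) (use assms in auto)

lemma ldet_swap_rows:
  assumes "length (as @ x # y # bs) = length cs"
  shows "ldet (as @ y # x # bs) cs = - ldet (as @ x # y # bs) cs"
proof -
  let ?n = "length cs" and ?k = "length as"
  let ?A = "mat ?n ?n (\<lambda>(i, j). ((as @ x # y # bs) ! i) (cs ! j))"
  have k: "?k < ?n" "Suc ?k < ?n" using assms by auto
  have "mat ?n ?n (\<lambda>(i, j). ((as @ y # x # bs) ! i) (cs ! j)) = swaprows ?k (Suc ?k) ?A"
    by (rule eq_matI) (use k in \<open>auto simp: nth_append nth_Cons' le_Suc_eq\<close>)
  then show ?thesis
    unfolding ldet_def using det_swaprows[OF k, of ?A] by simp
qed

lemma ldet_transpose: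
  assumes "length rs = length cs"
  shows "ldet rs cs = ldet (map (\<lambda>c r. r c) cs) rs"
proof -
  let ?n = "length cs"
  let ?A = "mat ?n ?n (\<lambda>(i, j). (rs ! i) (cs ! j))"
  have "mat ?n ?n (\<lambda>(i, j). (map (\<lambda>c r. r c) cs ! i) (rs ! j)) = transpose_mat ?A"
    by (rule eq_matI) (use assms in auto)
  then show ?thesis
    unfolding ldet_def using det_transpose[of ?A ?n] assms by simp
qed

lemma ldet_swap_cols:
  assumes "length rs = length (as @ x # y # bs)"
  shows "ldet rs (as @ y # x # bs) = - ldet rs (as @ x # y # bs)"
  using ldet_swap_rows[of "map (\<lambda>c r. r c) as" "\<lambda>r. r x" "\<lambda>r. r y" "map (\<lambda>c r. r c) bs" rs]
    ldet_transpose[of rs "as @ y # x # bs"] ldet_transpose[of rs "as @ x # y # bs"] assms by simp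

lemma ldet_row_linear:
  assumes "length (as @ u # bs) = length cs"
  shows "ldet (as @ (\<lambda>f. a * u f + v f) # bs) cs = a * ldet (as @ u # bs) cs + ldet (as @ v # bs) cs"
proof -
  let ?n = "length cs" and ?k = "length as"
  define M where "M r = mat ?n ?n (\<lambda>(i, j). ((as @ r # bs) ! i) (cs ! j))" for r
  have k: "?k \<in> {0..<?n}" using assms by auto
  \<comment> \<open>The Leibniz expansion with the factor of row \<open>?k\<close> split off. The
    other factors do not involve \<open>r\<close>, so linearity in \<open>r\<close> can be read
    off.\<close>
  have d: "Determinant.det (M r) = (\<Sum>p | p permutes {0..<?n}.
      signof p * (r (cs ! p ?k) * (\<Prod>i\<in>{0..<?n} - {?k}. ((as @ u # bs) ! i) (cs ! p i))))" for r
  proof -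
    have "(\<Prod>i = 0..<?n. M r $$ (i, p i)) = r (cs ! p ?k) * (\<Prod>i\<in>{0..<?n} - {?k}. ((as @ u # bs) ! i) (cs ! p i))"
      if p: "p permutes {0..<?n}" for p
    proof -
      have pi: "p i < ?n" if "i < ?n" for i using permutes_in_image[OF p, of i] that by simp
      have "(\<Prod>i = 0..<?n. M r $$ (i, p i)) = (\<Prod>i = 0..<?n. ((as @ r # bs) ! i) (cs ! p i))"
        by (rule prod.cong) (auto simp: M_def pi)
      also have "\<dots> = ((as @ r # bs) ! ?k) (cs ! p ?k) * (\<Prod>i\<in>{0..<?n} - {?k}. ((as @ r # bs) ! i) (cs ! p i))"
        by (rule prod.remove) (use k in auto)
      also have "(\<Prod>i\<in>{0..<?n} - {?k}. ((as @ r # bs) ! i) (cs ! p i)) = (\<Prod>i\<in>{0..<?n} - {?k}. ((as @ u # bs) ! i) (cs ! p i))"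
        by (rule prod.cong) (auto simp: nth_append nth_Cons')
      finally show ?thesis by simp
    qed
    moreover have "Determinant.det (M r) = (\<Sum>p | p permutes {0..<?n}. signof p * (\<Prod>i = 0..<?n. M r $$ (i, p i)))"
      by (rule det_def') (simp add: M_def)
    ultimately show ?thesis by simp
  qed
  show ?thesis
    unfolding ldet_def M_def[symmetric] d
    by (simp add: sum_distrib_left sum.distrib[symmetric] algebra_simps)
qed

lemma ldet_zero_row:
  assumes "length (as @ u # bs) = length cs"
  shows "ldet (as @ (\<lambda>f. 0) # bs) cs = 0"
proof -
  have "ldet (as @ (\<lambda>f. 0) # bs) cs = ldet (as @ (\<lambda>f. 0) # bs) cs + ldet (as @ (\<lambda>f. 0) # bs) cs"
    using ldet_row_linear[of as "\<lambda>f. 0" bs cs "1" "\<lambda>f. 0"] assms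
    by (simp only: mult_zero_right add_0_right mult_1_left length_append list.size)
  then show ?thesis by (metis add_cancel_right_right)
qed

lemma ldet_row_scale:
  assumes "length (as @ u # bs) = length cs"
  shows "ldet (as @ (\<lambda>f. a * u f) # bs) cs = a * ldet (as @ u # bs) cs"
  using ldet_row_linear[OF assms, of a "\<lambda>f. 0"] ldet_zero_row[OF assms] by simp

lemma ldet_equal_rows:
  assumes "i < j" "j < length cs" "rs ! i = rs ! j"
  shows "ldet rs cs = 0"
  unfolding ldet_def
  by (rule det_identical_rows[of _ "length cs" i j]) (use assms in \<open>auto intro!: eq_vecI\<close>)

text \<open>The rows \<open>x\<close> for which the determinant vanishes form a subspace, and it
  contains every other row, since two equal rows make the determinant vanish.\<close>

lemma ldet_row_in_span:
  assumes "length (as @ x # bs) = length cs" "x \<in> fs.span (set as \<union> set bs)"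
  shows "ldet (as @ x # bs) cs = 0"
proof (rule fs.span_induct[OF assms(2)])
  show "fs.subspace {x. ldet (as @ x # bs) cs = 0}"
  proof (rule fs.subspaceI)
    fix u v assume "u \<in> {x. ldet (as @ x # bs) cs = 0}" "v \<in> {x. ldet (as @ x # bs) cs = 0}"
    then show "u + v \<in> {x. ldet (as @ x # bs) cs = 0}"
      using ldet_row_linear[of as u bs cs 1 v] assms(1) by (simp add: plus_fun_def)
  qed (use ldet_zero_row[OF assms(1)] ldet_row_scale[of as _ bs cs] assms(1) in \<open>auto simp: zero_fun_def\<close>)
next
  fix y assume "y \<in> set as \<union> set bs"
  then consider i where "i < length as" "as ! i = y" | i where "i < length bs" "bs ! i = y"
    by (auto simp: in_set_conv_nth)
  then show "ldet (as @ y # bs) cs = 0"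
  proof cases
    case 1
    then show ?thesis
      using ldet_equal_rows[of i "length as" cs "as @ y # bs"] assms(1) by (simp add: nth_append)
  next
    case 2
    then show ?thesis
      using ldet_equal_rows[of "length as" "length as + Suc i" cs "as @ y # bs"] assms(1)
      by (simp add: nth_append)
  qed
qed

lemma ldet_row_add_span:
  assumes "length (as @ y # bs) = length cs" "z \<in> fs.span (set as \<union> set bs)"
  shows "ldet (as @ (\<lambda>f. z f + y f) # bs) cs = ldet (as @ y # bs) cs"
  using ldet_row_linear[of as z bs cs 1 y] ldet_row_in_span[of as z bs cs] assms by simp

text \<open>Applied with \<open>c'\<close> the opposite half-edge of \<open>c\<close>, where chains
  take the opposite value: reversing an edge negates its column.\<close>

lemma ldet_neg_col:
  assumes "length rs = length (as @ c # bs)" "\<And>r. r \<in> set rs \<Longrightarrow> r c' = - r c"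
  shows "ldet rs (as @ c' # bs) = - ldet rs (as @ c # bs)"
proof -
  let ?m = "map (\<lambda>c r. r c)"
  have "ldet rs (as @ c' # bs) = ldet (?m as @ (\<lambda>r. r c') # ?m bs) rs"
    using ldet_transpose[of rs "as @ c' # bs"] assms by simp
  also have "\<dots> = ldet (?m as @ (\<lambda>r. (-1) * r c) # ?m bs) rs"
    by (rule ldet_cong) (use assms in \<open>auto simp: nth_append nth_Cons'\<close>)
  also have "\<dots> = - ldet (?m as @ (\<lambda>r. r c) # ?m bs) rs"
    by (subst ldet_row_scale) (use assms in auto)
  also have "\<dots> = - ldet rs (as @ c # bs)"
    using ldet_transpose[of rs "as @ c # bs"] assms by simp
  finally show ?thesis .
qed

lemma ldet_move_row:
  assumes "length (as @ x # ys @ bs) = length cs"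
  shows "ldet (as @ ys @ x # bs) cs = sg (of_nat (length ys)) * ldet (as @ x # ys @ bs) cs"
  using assms
proof (induction ys arbitrary: as)
  case (Cons y ys)
  have "ldet (as @ (y # ys) @ x # bs) cs = sg (of_nat (length ys)) * ldet ((as @ [y]) @ x # ys @ bs) cs"
    using Cons.IH[of "as @ [y]"] Cons.prems by simp
  also have "ldet ((as @ [y]) @ x # ys @ bs) cs = - ldet (as @ x # y # ys @ bs) cs"
    using ldet_swap_rows[of as x y "ys @ bs" cs] Cons.prems by simp
  finally show ?case by (simp add: sg_add) (simp add: sg_def)
qed simp

lemma ldet_swap_row_blocks:
  assumes "length (as @ xs @ ys @ bs) = length cs"
  shows "ldet (as @ ys @ xs @ bs) cs = sg (of_nat (length xs) * of_nat (length ys)) * ldet (as @ xs @ ys @ bs) cs"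
  using assms
proof (induction xs arbitrary: as)
  case (Cons x xs)
  have "ldet (as @ ys @ (x # xs) @ bs) cs = sg (of_nat (length ys)) * ldet ((as @ [x]) @ ys @ xs @ bs) cs"
    using ldet_move_row[of as x ys "xs @ bs" cs] Cons.prems by simp
  also have "ldet ((as @ [x]) @ ys @ xs @ bs) cs = sg (of_nat (length xs) * of_nat (length ys)) * ldet ((as @ [x]) @ xs @ ys @ bs) cs"
    by (rule Cons.IH) (use Cons.prems in simp)
  finally show ?case by (simp add: sg_add distrib_right)
qed simp

lemma ldet_block:
  assumes "length rs1 = length cs1" "length rs2 = length cs2"
    and zero: "\<And>r c. r \<in> set rs2 \<Longrightarrow> c \<in> set cs1 \<Longrightarrow> r c = 0"
  shows "ldet (rs1 @ rs2) (cs1 @ cs2) = ldet rs1 cs1 * ldet rs2 cs2"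
proof -
  let ?n = "length cs1" and ?m = "length cs2"
  let ?A = "mat ?n ?n (\<lambda>(i, j). (rs1 ! i) (cs1 ! j))"
  let ?B = "mat ?n ?m (\<lambda>(i, j). (rs1 ! i) (cs2 ! j))"
  let ?D = "mat ?m ?m (\<lambda>(i, j). (rs2 ! i) (cs2 ! j))"
  have "mat (?n + ?m) (?n + ?m) (\<lambda>(i, j). ((rs1 @ rs2) ! i) ((cs1 @ cs2) ! j))
      = four_block_mat ?A ?B (0\<^sub>m ?m ?n) ?D"
    by (rule eq_matI) (use assms in \<open>auto simp: nth_append\<close>)
  then show ?thesis
    unfolding ldet_def using det_four_block_mat_lower_left_zero[of ?A ?n ?B ?m "0\<^sub>m ?m ?n" ?D] by simp
qed

section \<open>Chains, boundaries and the Euler characteristic\<close>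

lemma fun_sum_apply: "(\<Sum>v\<in>A. F v) f = (\<Sum>v\<in>A. F v f)" for F :: "'a \<Rightarrow> 'b \<Rightarrow> 'c::comm_monoid_add"
  by (induction A rule: infinite_finite_induct) (simp_all add: zero_fun_def plus_fun_def)

lemma sum_flags: "(\<Sum>f\<in>flags G. h f) = (\<Sum>i<length (verts G). \<Sum>j<snd (verts G ! i). h (i, j))"
  for h :: "flag \<Rightarrow> 'b::comm_monoid_add"
proof -
  have "flags G = Sigma {..<length (verts G)} (\<lambda>i. {..<snd (verts G ! i)})"
    by (auto simp: flags_def)
  then show ?thesis by (simp add: sum.Sigma)
qed

lemma finite_flags [simp]: "finite (flags G)"
proof -
  have "flags G = Sigma {..<length (verts G)} (\<lambda>i. {..<snd (verts G ! i)})"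
    by (auto simp: flags_def)
  then show ?thesis by simp
qed

lemma set_flag_list [simp]: "set (flag_list G) = flags G"
  by (auto simp: flag_list_def flags_def)

text \<open>This yields at once that \<open>flag_list\<close> has no repetitions, that
  \<open>flag_pos\<close> is injective on flags, and that \<open>flag_list\<close> is the sorted
  word of all flags.\<close>

lemma map_flag_pos_flag_list:
  "map (flag_pos G) (flag_list G) = [0..<(\<Sum>i<length (verts G). snd (verts G ! i))]"
proof -
  have "map (flag_pos G) (concat (map (\<lambda>i. map (Pair i) [0..<snd (verts G ! i)]) [0..<k]))
      = [0..<(\<Sum>i<k. snd (verts G ! i))]" for k
  proof (induction k)
    case (Suc k)
    have "map (\<lambda>j. m + j) [0..<n] = [m..<m + n]" for m n :: nat
      by (induction n) simp_all
    then have "map (flag_pos G) (map (Pair k) [0..<snd (verts G ! k)])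
        = [\<Sum>i<k. snd (verts G ! i)..<(\<Sum>i<k. snd (verts G ! i)) + snd (verts G ! k)]"
      by (simp add: flag_pos_def comp_def)
    then show ?case using Suc upt_add_eq_append[of 0 "\<Sum>i<k. snd (verts G ! i)"] by simp
  qed simp
  then show ?thesis by (simp add: flag_list_def)
qed

lemma distinct_flag_list [simp]: "distinct (flag_list G)"
  using map_flag_pos_flag_list distinct_upt by (metis distinct_map)

lemma inj_flag_pos: "inj_on (flag_pos G) (flags G)"
  using map_flag_pos_flag_list distinct_upt by (metis distinct_map set_flag_list)

lemma sorted_flag_list: "sorted (map (flag_pos G) (flag_list G))"
  by (simp add: map_flag_pos_flag_list)

lemma sum_flag_list: "(\<Sum>f\<leftarrow>flag_list G. h f) = (\<Sum>f\<in>flags G. h f)" for h :: "flag \<Rightarrow> 'b::comm_monoid_add"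
  by (simp flip: set_flag_list add: sum_list_distinct_conv_sum_set)

text \<open>One half-edge of every edge, in any order and with any directions. The particular choice
  \<open>edge_list\<close> depends on the numbering of the flags and is not preserved by
  isomorphisms or graftings, while this notion is.\<close>

definition edge_reps :: "graph \<Rightarrow> flag list \<Rightarrow> bool" where
  "edge_reps G es \<longleftrightarrow> distinct es \<and> set es \<subseteq> {f \<in> flags G. ginv G f \<noteq> f} \<and>
     (\<forall>f \<in> flags G. ginv G f \<noteq> f \<longrightarrow> (f \<in> set es) \<noteq> (ginv G f \<in> set es))"

definition edge_word :: "graph \<Rightarrow> flag list \<Rightarrow> flag list" where
  "edge_word G es = concat (map (\<lambda>f. [f, ginv G f]) es)"

lemma edge_word_simps [simp]:
  "edge_word G [] = []" "edge_word G (f # es) = f # ginv G f # edge_word G es"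
  "edge_word G (es @ es') = edge_word G es @ edge_word G es'"
  by (simp_all add: edge_word_def)

lemma set_edge_word: "set (edge_word G es) = set es \<union> ginv G ` set es"
  by (induction es) auto

section \<open>Half-edges, legs and chains of a single graph\<close>

locale graph_wf =
  fixes G :: graph
  assumes wf: "wf_graph G"
begin

lemma ginv_in [simp]: "ginv G f \<in> flags G \<longleftrightarrow> f \<in> flags G"
  using wf permutes_in_image unfolding wf_graph_def by metis

lemma ginv_ginv [simp]: "ginv G (ginv G f) = f"
  using wf unfolding wf_graph_def by (metis comp_apply id_apply)

lemma ginv_inj [simp]: "ginv G f = ginv G f' \<longleftrightarrow> f = f'"
  by (metis ginv_ginv)

lemma set_legs: "set (legs G) = {f \<in> flags G. ginv G f = f}"
  and distinct_legs [simp]: "distinct (legs G)"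
  using wf unfolding wf_graph_def by auto

lemma bij_ginv: "bij_betw (ginv G) (flags G) (flags G)"
  by (rule bij_betwI[of _ _ _ "ginv G"]) auto

lemma edge_reps_edge_list: "edge_reps G (edge_list G)"
proof -
  have "flag_pos G f \<noteq> flag_pos G (ginv G f)" if "f \<in> flags G" "ginv G f \<noteq> f" for f
    using inj_onD[OF inj_flag_pos, of G f "ginv G f"] that by auto
  then show ?thesis unfolding edge_reps_def edge_list_def by (auto simp: not_less order_less_le)
qed

lemma distinct_edge_word:
  assumes "edge_reps G es"
  shows "distinct (edge_word G es)"
proof -
  have "distinct (edge_word G es')" if "set es' \<subseteq> set es" "distinct es'" for es'
    using that
  proof (induction es')
    case (Cons f es')
    have f: "f \<in> flags G" "ginv G f \<noteq> f" "ginv G f \<notin> set es"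
      using assms Cons.prems unfolding edge_reps_def by auto
    have "f \<notin> ginv G ` set es'"
      using f Cons.prems by (metis image_iff ginv_ginv list.set_intros(2) subsetD)
    moreover have "ginv G f \<notin> ginv G ` set es'" using Cons.prems by (auto simp: image_iff)
    ultimately show ?case using Cons f by (auto simp: set_edge_word)
  qed simp
  then show ?thesis using assms unfolding edge_reps_def by blast
qed

lemma set_edge_reps:
  assumes "edge_reps G es"
  shows "set (edge_word G es) = {f \<in> flags G. ginv G f \<noteq> f}"
proof (intro equalityI subsetI)
  fix f assume "f \<in> set (edge_word G es)"
  moreover have "set es \<subseteq> {f \<in> flags G. ginv G f \<noteq> f}" using assms unfolding edge_reps_def by blast
  ultimately show "f \<in> {f \<in> flags G. ginv G f \<noteq> f}"
    unfolding set_edge_word by (auto simp: subset_iff simp del: split_paired_All)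
next
  fix f assume "f \<in> {f \<in> flags G. ginv G f \<noteq> f}"
  then have "f \<in> set es \<or> ginv G f \<in> set es" using assms unfolding edge_reps_def by blast
  then show "f \<in> set (edge_word G es)" unfolding set_edge_word by (metis UnI1 UnI2 ginv_ginv imageI)
qed

lemma mset_edge_word:
  assumes "edge_reps G es"
  shows "mset (edge_word G es @ legs G) = mset (flag_list G)" "distinct (edge_word G es @ legs G)"
    "set (edge_word G es @ legs G) = flags G"
proof -
  show d: "distinct (edge_word G es @ legs G)"
    using distinct_edge_word[OF assms] set_edge_reps[OF assms] set_legs by auto
  show s: "set (edge_word G es @ legs G) = flags G"
    using set_edge_reps[OF assms] set_legs by auto
  show "mset (edge_word G es @ legs G) = mset (flag_list G)"
    using d s by (simp only: set_eq_iff_mset_eq_distinct[symmetric] distinct_flag_list set_flag_list)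
qed

lemma length_flags: "edge_reps G es \<Longrightarrow> (\<Sum>i<length (verts G). snd (verts G ! i)) = 2 * length es + length (legs G)"
proof -
  assume a: "edge_reps G es"
  have "length (edge_word G es) = 2 * length es" by (induction es) simp_all
  moreover have "length (edge_word G es @ legs G) = length (flag_list G)"
    using mset_edge_word(1)[OF a] by (metis size_mset)
  moreover have "length (flag_list G) = (\<Sum>i<length (verts G). snd (verts G ! i))"
    using arg_cong[OF map_flag_pos_flag_list[of G], of length] by simp
  ultimately show ?thesis by simp
qed

lemma chain_ginv: "c \<in> chains1 G \<Longrightarrow> c (ginv G f) = - c f"
  using ginv_in[of f] unfolding chains1_def mem_Collect_eq by (metis minus_zero)

lemma chains1_subspace: "fs.subspace (chains1 G :: (flag \<Rightarrow> 'k::field_char_0) set)"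
  by (rule fs.subspaceI) (auto simp: chains1_def)

lemma bdry_linear:
  "bdry G (\<lambda>f. c f + c' f) i = bdry G c i + bdry G c' i"
  "bdry G (\<lambda>f. c f - c' f) i = bdry G c i - bdry G c' i"
  "bdry G (\<lambda>f. a * c f) i = a * bdry G c i"
  "bdry G (\<lambda>f. 0) i = 0"
  by (simp_all add: bdry_def sum.distrib sum_subtractf sum_distrib_left)

lemma bdry_sum: "bdry G (\<Sum>j\<in>A. (\<lambda>f. a j * w j f)) i = (\<Sum>j\<in>A. a j * bdry G (w j) i)"
  unfolding bdry_def by (simp add: fun_sum_apply sum_distrib_left) (rule sum.swap)

lemma H1_subspace: "fs.subspace (H1 G :: (flag \<Rightarrow> 'k::field_char_0) set)"
proof (rule fs.subspaceI)
  show "0 \<in> (H1 G :: (flag \<Rightarrow> 'k) set)" by (auto simp: H1_def chains1_def bdry_def)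
next
  fix x y :: "flag \<Rightarrow> 'k" assume "x \<in> H1 G" "y \<in> H1 G"
  then show "x + y \<in> H1 G"
    using fs.subspace_add[OF chains1_subspace] by (auto simp: H1_def plus_fun_def bdry_linear)
next
  fix a :: 'k and x :: "flag \<Rightarrow> 'k" assume "x \<in> H1 G"
  then show "(\<lambda>f. a * x f) \<in> H1 G"
    using fs.subspace_scale[OF chains1_subspace] by (auto simp: H1_def bdry_linear)
qed

text \<open>The sum of a chain over all flags equals its own negative, because \<open>ginv\<close>
  permutes the flags and reverses the sign. In characteristic 0 it vanishes.\<close>

lemma sum_bdry:
  assumes "c \<in> chains1 G"
  shows "(\<Sum>i<length (verts G). bdry G c i) = 0"
proof -
  have "(\<Sum>f\<in>flags G. c f) = (\<Sum>f\<in>flags G. c (ginv G f))"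
    by (rule sum.reindex_bij_betw[OF bij_ginv, symmetric])
  also have "\<dots> = - (\<Sum>f\<in>flags G. c f)" by (simp add: chain_ginv[OF assms] sum_negf)
  finally have "(\<Sum>f\<in>flags G. c f) = 0" by (simp add: eq_neg_iff_add_eq_0 mult_2[symmetric])
  then show ?thesis by (simp add: bdry_def sum_flags)
qed

definition edge_chain :: "flag \<Rightarrow> flag \<Rightarrow> 'k::field_char_0" where
  "edge_chain f = (\<lambda>g. if g = f then 1 else if g = ginv G f then - 1 else 0)"

lemma edge_chain_in: "f \<in> flags G \<Longrightarrow> ginv G f \<noteq> f \<Longrightarrow> edge_chain f \<in> chains1 G"
  unfolding chains1_def edge_chain_def by auto

lemma bdry_edge_chain:
  assumes "f \<in> flags G" "ginv G f \<noteq> f" "i < length (verts G)"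
  shows "bdry G (edge_chain f) i
    = (if i = fst f then 1 else 0) - (if i = fst (ginv G f) then 1 else 0 :: 'k::field_char_0)"
proof -
  have s: "snd g < snd (verts G ! fst g)" if "g \<in> flags G" for g
    using that by (auto simp: flags_def)
  have "edge_chain f (i, j) = (if i = fst f \<and> j = snd f then 1 else 0)
      - (if i = fst (ginv G f) \<and> j = snd (ginv G f) then 1 else 0 :: 'k)" for j
    using assms(2) unfolding edge_chain_def by (auto simp: prod_eq_iff)
  moreover have "(\<Sum>j<snd (verts G ! i). if i = fst g \<and> j = snd g then 1 else 0 :: 'k)
      = (if i = fst g then 1 else 0)" if "g \<in> flags G" for g
    using s[OF that] by (cases "i = fst g") auto
  ultimately show ?thesis
    using assms(1) by (simp only: bdry_def sum_subtractf ginv_in)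
qed

end

section \<open>Connected graphs: lifts of vertices and the Euler relation\<close>

locale graph_conn = graph_wf +
  assumes conn: "connected_graph G"
begin

abbreviation "nv \<equiv> length (verts G)"

lemma nv_pos: "0 < nv"
  using conn unfolding connected_graph_def by auto

text \<open>A path from vertex 0 to vertex \<open>j\<close> provides the chain; it is built up edge
  by edge along the reachability relation.\<close>

lemma lift_exists:
  assumes "j < nv"
  shows "\<exists>u. u \<in> chains1 G \<and>
     (\<forall>i < nv. bdry G u i = (if i = j then 1 else 0) - (if i = 0 then 1 else 0 :: 'k::field_char_0))"
proof -
  have "(0, j) \<in> {(fst f, fst (ginv G f)) | f. f \<in> flags G}\<^sup>*"
    using conn assms nv_pos unfolding connected_graph_def by blast
  then show ?thesis
  proof (induction rule: rtrancl_induct)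
    case base
    show ?case by (rule exI[of _ "\<lambda>_. 0"]) (auto simp: chains1_def bdry_def)
  next
    case (step y z)
    then obtain u f where u: "u \<in> chains1 G"
        "\<And>i. i < nv \<Longrightarrow> bdry G u i = (if i = y then 1 else 0) - (if i = 0 then 1 else 0 :: 'k)"
      and f: "f \<in> flags G" "y = fst f" "z = fst (ginv G f)" by blast
    show ?case
    proof (cases "ginv G f = f")
      \<comment> \<open>The relation in \<open>connected_graph\<close> also contains steps along
        legs. They stay at the same vertex, so the chain is kept.\<close>
      case True
      then show ?thesis using u f by auto
    next
      case False
      \<comment> \<open>\<open>bdry\<close> counts the flags leaving a vertex, so the chain whose
        boundary is \<open>z - y\<close> is the edge read from its end at \<open>z\<close>.\<close>
      let ?e = "edge_chain (ginv G f) :: flag \<Rightarrow> 'k"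
      have e: "?e \<in> chains1 G" using edge_chain_in[of "ginv G f"] f False by auto
      have b: "bdry G ?e i = (if i = z then 1 else 0) - (if i = y then 1 else 0)" if "i < nv" for i
        using bdry_edge_chain[of "ginv G f" i] f False that by auto
      have "(\<lambda>f. u f + ?e f) \<in> chains1 G"
        using fs.subspace_add[OF chains1_subspace u(1) e] by (simp add: plus_fun_def)
      then show ?thesis
        by (intro exI[of _ "\<lambda>f. u f + ?e f"]) (auto simp: bdry_linear u b)
    qed
  qed
qed

lemma lift_vertex:
  assumes "j < nv"
  shows "lift_vertex G j \<in> chains1 G"
    "i < nv \<Longrightarrow> bdry G (lift_vertex G j) i = (if i = j then 1 else 0) - (if i = 0 then 1 else 0 :: 'k::field_char_0)"
  using someI_ex[OF lift_exists[OF assms]] unfolding lift_vertex_def by blast+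

lemma H1_basis:
  obtains bs :: "(flag \<Rightarrow> 'k::field_char_0) set" where "bs \<subseteq> H1 G" "fs.independent bs" "H1 G \<subseteq> fs.span bs"
    "card bs = betti TYPE('k) G"
  using fs.basis_exists[of "H1 G :: (flag \<Rightarrow> 'k) set"] unfolding betti_def by metis

text \<open>A chain is determined by its values on the chosen half-edges, and these are arbitrary;
  \<open>edge_chain f\<close> has the value 1 at \<open>f\<close> and 0 at the other ones.\<close>

lemma chains1_basis:
  assumes "edge_reps G es"
  shows "fs.independent (edge_chain ` set es :: (flag \<Rightarrow> 'k::field_char_0) set)"
    and "fs.span (edge_chain ` set es :: (flag \<Rightarrow> 'k::field_char_0) set) = chains1 G"
    and "card (edge_chain ` set es :: (flag \<Rightarrow> 'k::field_char_0) set) = length es"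
proof -
  have es: "f \<in> flags G" "ginv G f \<noteq> f" "ginv G f \<notin> set es" if "f \<in> set es" for f
    using assms that unfolding edge_reps_def by auto
  have val: "edge_chain f g = (if g = f then 1 else 0 :: 'k)" if "f \<in> set es" "g \<in> set es" for f g
    using es(2,3)[OF that(1)] that unfolding edge_chain_def by auto
  have inj: "inj_on (edge_chain :: flag \<Rightarrow> flag \<Rightarrow> 'k) (set es)"
    by (rule inj_onI) (metis val zero_neq_one)
  show "card (edge_chain ` set es :: (flag \<Rightarrow> 'k) set) = length es"
    using inj assms by (simp add: card_image edge_reps_def distinct_card)
  show "fs.independent (edge_chain ` set es :: (flag \<Rightarrow> 'k) set)"
  proof -
    have "u (edge_chain g) = 0"
      if "(\<Sum>v\<in>edge_chain ` set es. (\<lambda>f. u v * v f)) = (0 :: flag \<Rightarrow> 'k)" "g \<in> set es" for u g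
    proof -
      have "0 = (\<Sum>f\<in>set es. u (edge_chain f) * (edge_chain f g :: 'k))"
        using fun_cong[OF that(1), of g] by (simp add: fun_sum_apply sum.reindex[OF inj])
      also have "\<dots> = (\<Sum>f\<in>set es. if g = f then u (edge_chain f) else 0)"
        by (rule sum.cong) (auto simp: val that(2))
      finally show ?thesis using that(2) by simp
    qed
    then show ?thesis by (subst fs.dependent_finite) auto
  qed
  show "fs.span (edge_chain ` set es :: (flag \<Rightarrow> 'k) set) = chains1 G"
  proof
    show "fs.span (edge_chain ` set es) \<subseteq> (chains1 G :: (flag \<Rightarrow> 'k) set)"
      by (rule fs.span_minimal[OF _ chains1_subspace]) (use edge_chain_in es(1,2) in blast)
    show "(chains1 G :: (flag \<Rightarrow> 'k) set) \<subseteq> fs.span (edge_chain ` set es)"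
    proof
      fix c :: "flag \<Rightarrow> 'k" assume c: "c \<in> chains1 G"
      have "c g = (\<Sum>f\<in>set es. c f * edge_chain f g)" for g
      proof -
        have e: "c f * edge_chain f g = (if g = f then c g else 0) + (if f = ginv G g then c g else 0)"
          if "f \<in> set es" for f
          using es[OF that] chain_ginv[OF c, of f] unfolding edge_chain_def by auto
        have "(\<Sum>f\<in>set es. c f * edge_chain f g)
            = (if g \<in> set es then c g else 0) + (if ginv G g \<in> set es then c g else 0)"
          by (simp add: e sum.distrib)
        also have "\<dots> = c g"
        proof (cases "g \<in> flags G \<and> ginv G g \<noteq> g")
          case True
          then show ?thesis using assms unfolding edge_reps_def by auto
        next
          case False
          then have "c g = 0" using c chain_ginv[OF c, of g] unfolding chains1_def
            by (cases "g \<in> flags G") (simp_all del: split_paired_All)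
          then show ?thesis by simp
        qed
        finally show ?thesis by simp
      qed
      then have "c = (\<Sum>f\<in>set es. (\<lambda>g. c f * edge_chain f g))"
        unfolding fun_eq_iff fun_sum_apply by blast
      also have "\<dots> \<in> fs.span (edge_chain ` set es)"
        by (intro fs.span_sum fs.span_scale fs.span_base) auto
      finally show "c \<in> fs.span (edge_chain ` set es)" .
    qed
  qed
qed

text \<open>A basis of H1 and the lifts of the differences of vertices form a basis of the 1-chains.
  Independence: the boundary at vertex \<open>j\<close> kills H1 and reads off the coefficient of
  the \<open>j\<close>-th lift. Spanning: subtracting suitable lifts turns any chain into a cycle.
  The relation is stated without subtraction of natural numbers.\<close>

lemma betti_euler:
  assumes es: "edge_reps G es"
  shows "betti TYPE('k::field_char_0) G + nv = length es + 1"
proof -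
  obtain bs :: "(flag \<Rightarrow> 'k) set" where bs: "bs \<subseteq> H1 G" "fs.independent bs" "H1 G \<subseteq> fs.span bs"
    "card bs = betti TYPE('k) G" by (rule H1_basis)
  let ?l = "lift_vertex G :: nat \<Rightarrow> flag \<Rightarrow> 'k" and ?I = "{1..<nv}"
  note chains = chains1_basis[OF es, where ?'k = 'k]
  have "bs \<subseteq> fs.span (edge_chain ` set es)" using bs(1) chains(2) unfolding H1_def by auto
  then have fin: "finite bs" using fs.independent_span_bound[OF _ bs(2)] by blast
  have bl: "bdry G (?l j) i = (if i = j then 1 else 0)" if "i \<in> ?I" "j \<in> ?I" for i j
    using lift_vertex(2)[of j i] that by auto
  have bb: "bdry G b i = 0" if "b \<in> bs" "i \<in> ?I" for b i
    using that bs(1) unfolding H1_def by auto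
  have inj: "inj_on ?l ?I" by (rule inj_onI) (metis bl zero_neq_one)
  have disj: "bs \<inter> ?l ` ?I = {}" using bb bl by fastforce
  have card: "card (bs \<union> ?l ` ?I) = betti TYPE('k) G + (nv - 1)"
    using fin disj bs(4) inj by (simp add: card_Un_disjoint card_image)
  have ind: "fs.independent (bs \<union> ?l ` ?I)"
  proof -
    have "a v = 0" if s: "(\<Sum>v\<in>bs \<union> ?l ` ?I. (\<lambda>f. a v * v f)) = 0" and v: "v \<in> bs \<union> ?l ` ?I" for a v
    proof -
      have l0: "a (?l i) = 0" if "i \<in> ?I" for i
      proof -
        have "0 = (\<Sum>v\<in>bs \<union> ?l ` ?I. a v * bdry G v i)"
          using bdry_sum[of a "\<lambda>v. v" "bs \<union> ?l ` ?I" i] s by (simp add: bdry_def)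
        also have "\<dots> = (\<Sum>v\<in>bs. a v * bdry G v i) + (\<Sum>j\<in>?I. a (?l j) * bdry G (?l j) i)"
          using fin disj by (simp only: sum.union_disjoint finite_imageI finite_atLeastLessThan sum.reindex[OF inj] comp_def)
        also have "\<dots> = (\<Sum>j\<in>?I. if i = j then a (?l j) else 0)"
        proof -
          have "(\<Sum>v\<in>bs. a v * bdry G v i) = 0" by (intro sum.neutral) (use bb that in auto)
          moreover have "(\<Sum>j\<in>?I. a (?l j) * bdry G (?l j) i) = (\<Sum>j\<in>?I. if i = j then a (?l j) else 0)"
            by (rule sum.cong) (use that in \<open>auto simp: bl\<close>)
          ultimately show ?thesis by (simp only: add_0_left)
        qed
        finally show ?thesis using that by simp
      qed
      have "(\<Sum>v\<in>bs \<union> ?l ` ?I. (\<lambda>f. a v * v f)) = (\<Sum>v\<in>bs. (\<lambda>f. a v * v f))"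
        by (rule sum.mono_neutral_right) (use fin l0 in \<open>auto simp: zero_fun_def\<close>)
      then have "(\<Sum>v\<in>bs. (\<lambda>f. a v * v f)) = 0" using s by simp
      then have "\<forall>v\<in>bs. a v = 0" using bs(2) fs.dependent_finite[OF fin] by blast
      then show ?thesis using v l0 by auto
    qed
    then show ?thesis by (subst fs.dependent_finite) (use fin in auto)
  qed
  have span: "fs.span (bs \<union> ?l ` ?I) = chains1 G"
  proof
    show "fs.span (bs \<union> ?l ` ?I) \<subseteq> chains1 G"
      by (rule fs.span_minimal[OF _ chains1_subspace]) (use bs(1) lift_vertex(1) in \<open>auto simp: H1_def\<close>)
    show "chains1 G \<subseteq> fs.span (bs \<union> ?l ` ?I)"
    proof
      fix c :: "flag \<Rightarrow> 'k" assume c: "c \<in> chains1 G"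
      \<comment> \<open>The combination of lifts with the same boundary as \<open>c\<close> at all
        vertices other than 0.\<close>
      let ?s = "\<Sum>j\<in>?I. (\<lambda>f. bdry G c j * ?l j f)"
      have s: "?s \<in> chains1 G"
        by (intro fs.subspace_sum[OF chains1_subspace] fs.subspace_scale[OF chains1_subspace] lift_vertex(1)) auto
      then have d: "c - ?s \<in> chains1 G" using fs.subspace_diff[OF chains1_subspace c] by blast
      have "bdry G (c - ?s) i = 0" if "i \<in> ?I" for i
      proof -
        have "bdry G ?s i = (\<Sum>j\<in>?I. bdry G c j * bdry G (?l j) i)"
          by (rule bdry_sum)
        also have "\<dots> = (\<Sum>j\<in>?I. if i = j then bdry G c j else 0)"
          by (rule sum.cong) (use that in \<open>auto simp: bl\<close>)
        finally show ?thesis using that bdry_linear(2)[of c ?s i] by (simp add: fun_diff_def)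
      qed
      note b = this
      \<comment> \<open>At the base vertex nothing was prescribed; the boundary vanishes there
        because it vanishes at the other vertices and sums to 0.\<close>
      have b0: "bdry G (c - ?s) 0 = 0"
        using b sum_bdry[OF d] nv_pos by (simp add: sum.atLeast_Suc_lessThan lessThan_atLeast0)
      have "bdry G (c - ?s) i = 0" if "i < nv" for i
        by (cases "i = 0") (use b b0 that in auto)
      then have "c - ?s \<in> H1 G" using d unfolding H1_def by blast
      then have "c - ?s \<in> fs.span (bs \<union> ?l ` ?I)"
        using bs(3) fs.span_mono[of bs "bs \<union> ?l ` ?I"] by auto
      moreover have "?s \<in> fs.span (bs \<union> ?l ` ?I)"
        by (intro fs.span_sum fs.span_scale fs.span_base) auto
      ultimately have "c - ?s + ?s \<in> fs.span (bs \<union> ?l ` ?I)" by (rule fs.span_add)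
      then show "c \<in> fs.span (bs \<union> ?l ` ?I)" by simp
    qed
  qed
  have "card (bs \<union> ?l ` ?I) = fs.dim (chains1 G :: (flag \<Rightarrow> 'k) set)"
    using fs.dim_eq_card[of "bs \<union> ?l ` ?I" "chains1 G"] ind span
      fs.span_eq_iff[of "chains1 G :: (flag \<Rightarrow> 'k) set"] chains1_subspace by metis
  moreover have "length es = fs.dim (chains1 G :: (flag \<Rightarrow> 'k) set)"
    using fs.dim_eq_card[of "edge_chain ` set es" "chains1 G :: (flag \<Rightarrow> 'k) set"] chains
      fs.span_eq_iff[of "chains1 G :: (flag \<Rightarrow> 'k) set"] chains1_subspace by metis
  ultimately show ?thesis using card nv_pos by simp
qed

text \<open>More than dim H1 rows in H1 cannot be distinct and independent: two of them agree, or
  one lies in the span of the others.\<close>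

lemma ldet_vanish:
  fixes as :: "(flag \<Rightarrow> 'k::field_char_0) list"
  assumes "set as \<subseteq> H1 G" "betti TYPE('k) G < length as" "length (as @ bs) = length cs"
  shows "ldet (as @ bs) cs = 0"
proof (cases "distinct as")
  case False
  then obtain i j where "i < length as" "j < length as" "i \<noteq> j" "as ! i = as ! j"
    by (auto simp: distinct_conv_nth)
  then have "\<exists>i j. i < j \<and> j < length as \<and> as ! i = as ! j"
    by (cases i j rule: linorder_cases) (blast intro: sym)+
  then obtain i j where "i < j" "j < length as" "as ! i = as ! j" by blast
  then show ?thesis
    using ldet_equal_rows[of i j cs "as @ bs"] assms(3) by (simp add: nth_append)
next
  case True
  obtain B :: "(flag \<Rightarrow> 'k) set" where B: "B \<subseteq> H1 G" "fs.independent B" "H1 G \<subseteq> fs.span B"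
    "card B = betti TYPE('k) G" by (rule H1_basis)
  have "B \<subseteq> fs.span (edge_chain ` set (edge_list G))"
    using B(1) chains1_basis(2)[OF edge_reps_edge_list, where ?'k = 'k] unfolding H1_def by auto
  then have fin: "finite B" using fs.independent_span_bound[OF _ B(2)] by blast
  have "fs.dependent (set as)"
  proof (rule ccontr)
    assume "\<not> fs.dependent (set as)"
    then have "card (set as) \<le> card B"
      using fs.independent_span_bound[OF fin] assms(1) B(3) by blast
    then show False using B(4) True assms(2) by (simp add: distinct_card)
  qed
  then obtain x where x: "x \<in> set as" "x \<in> fs.span (set as - {x})"
    unfolding fs.dependent_def by blast
  then obtain a1 a2 where as: "as = a1 @ x # a2" by (meson split_list)
  have "set as - {x} \<subseteq> set a1 \<union> set (a2 @ bs)" using as by auto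
  then have "x \<in> fs.span (set a1 \<union> set (a2 @ bs))" using x(2) fs.span_mono by blast
  then show ?thesis using ldet_row_in_span[of a1 x "a2 @ bs" cs] assms(3) as by simp
qed

text \<open>Changing a later row by a cycle adds a determinant with one more row in H1 than its
  dimension, which vanishes. Hence the choice made by \<open>SOME\<close> in
  \<open>lift_vertex\<close> does not influence the orientation. The list \<open>xs\<close> in the
  proof collects the rows that have been replaced.\<close>

lemma ldet_lifts:
  fixes bs :: "(flag \<Rightarrow> 'k::field_char_0) list"
  assumes "set bs \<subseteq> H1 G" "length bs = betti TYPE('k) G" "length (bs @ us) = length cs"
    and "list_all2 (\<lambda>u v. (\<lambda>f. u f - v f) \<in> H1 G) us vs"
  shows "ldet (bs @ us) cs = ldet (bs @ vs) cs"
proof -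
  have "ldet (bs @ xs @ us) cs = ldet (bs @ xs @ vs) cs" if "length (bs @ xs @ us) = length cs" for xs
    using assms(4) that
  proof (induction arbitrary: xs rule: list_all2_induct)
    case (Cons u us v vs)
    let ?h = "\<lambda>f. u f - v f"
    have "ldet (bs @ xs @ (\<lambda>f. 1 * ?h f + v f) # us) cs
        = 1 * ldet (bs @ xs @ ?h # us) cs + ldet (bs @ xs @ v # us) cs"
      using ldet_row_linear[of "bs @ xs" ?h us cs 1 v] Cons.prems by simp
    moreover have "ldet (bs @ xs @ ?h # us) cs = 0"
      using ldet_move_row[of bs ?h xs us cs] ldet_vanish[of "bs @ [?h]" "xs @ us" cs] Cons assms(1,2)
      by simp
    ultimately have "ldet (bs @ xs @ u # us) cs = ldet (bs @ xs @ v # us) cs" by simp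
    also have "\<dots> = ldet (bs @ (xs @ [v]) @ us) cs" by simp
    also have "\<dots> = ldet (bs @ (xs @ [v]) @ vs) cs" by (rule Cons.IH) (use Cons.prems in simp)
    finally show ?case by simp
  qed simp
  from this[of "[]"] show ?thesis using assms(3) by simp
qed

end

lemma ldet_shift_rows:
  assumes "length (bs @ y # xs @ zs) = length cs"
  shows "ldet (bs @ y # map (\<lambda>x f. x f + y f) xs @ zs) cs = ldet (bs @ y # xs @ zs) cs"
proof -
  have "ldet (bs @ y # us @ map (\<lambda>x f. x f + y f) xs @ zs) cs = ldet (bs @ y # us @ xs @ zs) cs"
    if "length (bs @ y # us @ xs @ zs) = length cs" for us
    using that
  proof (induction xs arbitrary: us)
    case (Cons x xs)
    have "y \<in> fs.span (set (bs @ y # us) \<union> set (map (\<lambda>x f. x f + y f) xs @ zs))"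
      by (rule fs.span_base) simp
    then have "ldet ((bs @ y # us) @ (\<lambda>f. y f + x f) # map (\<lambda>x f. x f + y f) xs @ zs) cs
        = ldet ((bs @ y # us) @ x # map (\<lambda>x f. x f + y f) xs @ zs) cs"
      using Cons.prems by (intro ldet_row_add_span) simp_all
    then show ?case using Cons.IH[of "us @ [x]"] Cons.prems by (simp add: add.commute)
  qed simp
  from this[of "[]"] assms show ?thesis by simp
qed

text \<open>The wedge product of the differences \<open>z\<^sub>j - z\<^sub>i\<close>, where \<open>i\<close> is the first index, is antisymmetric
  in all indices, including the first one.\<close>

lemma ldet_differences_perm:
  fixes z :: "nat \<Rightarrow> 'c \<Rightarrow> 'k::field" and bs :: "('c \<Rightarrow> 'k) list" and cs :: "'c list"
  defines "F \<equiv> \<lambda>js. ldet (bs @ map (\<lambda>j f. z j f - z (hd js) f) (tl js)) cs"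
  assumes "mset xs = mset ys" "distinct xs" "length bs + length xs = length cs + 1"
  shows "sg (winv id (\<lambda>_. 1) xs) * F xs = sg (winv id (\<lambda>_. 1) ys) * F ys"
proof (rule winv_swap_invariant[where M = "mset xs" and F = F])
  fix as x y ds assume M: "mset (as @ x # y # ds) = mset xs" "x \<noteq> y"
  have len: "length (as @ x # y # ds) = length xs" using M(1) by (metis size_mset)
  show "F (as @ y # x # ds) = sg (1 * 1) * F (as @ x # y # ds)"
  proof (cases as)
    case (Cons a as')
    then show ?thesis
      using ldet_swap_rows[of "bs @ map (\<lambda>j f. z j f - z a f) as'" "\<lambda>f. z x f - z a f" "\<lambda>f. z y f - z a f"
          "map (\<lambda>j f. z j f - z a f) ds" cs] len assms(4)
      by (simp add: F_def sg_def)
  next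
    case Nil
    \<comment> \<open>Exchanging the first two indices moves the base point from \<open>x\<close> to
      \<open>y\<close>. The rows \<open>z j - z x\<close> are \<open>(z j - z y) + ?y\<close>, and
      the summand \<open>?y\<close>, itself a row, can be removed; only its sign remains.\<close>
    let ?y = "\<lambda>f. z y f - z x f"
    have l: "length (bs @ ?y # map (\<lambda>j f. z j f - z y f) ds) = length cs"
      using len assms(4) Nil by simp
    have "F (x # y # ds) = ldet (bs @ ?y # map (\<lambda>u f. u f + ?y f) (map (\<lambda>j f. z j f - z y f) ds)) cs"
      by (simp add: F_def comp_def)
    also have "\<dots> = ldet (bs @ ?y # map (\<lambda>j f. z j f - z y f) ds) cs"
      by (rule ldet_shift_rows[where zs = "[]", unfolded append_Nil2, OF l])
    also have "\<dots> = - ldet (bs @ (\<lambda>f. (- 1) * ?y f) # map (\<lambda>j f. z j f - z y f) ds) cs"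
      by (subst ldet_row_scale[OF l]) simp
    also have "\<dots> = - F (y # x # ds)" by (simp add: F_def)
    finally show ?thesis using Nil by (simp add: sg_def)
  qed
qed (simp_all add: assms(2,3))

section \<open>Contraction along the edges of a graph\<close>

lemma winv_swap_blocks:
  assumes "\<And>x y. x \<in> set xs \<Longrightarrow> y \<in> set ys \<Longrightarrow> r x \<noteq> r y"
  shows "winv r p (as @ ys @ xs @ bs) = winv r p (as @ xs @ ys @ bs) + sum_list (map p xs) * sum_list (map p ys)"
proof -
  have "wcross r p ys xs = wcross r p xs ys + sum_list (map p xs) * sum_list (map p ys)"
    using wcross_commute[OF assms, where p = p] by (simp add: bit_add_eq_move add.commute[of "wcross r p xs ys"])
  then show ?thesis
    by (simp add: winv_append wcross_append_left wcross_append_right ac_simps)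
qed

lemma winv_zero [simp]: "winv r (\<lambda>_. 0) xs = 0"
  by (induction xs) (simp_all cong: if_cong)

lemma edge_reps_perm: "edge_reps G es \<Longrightarrow> mset es' = mset es \<Longrightarrow> edge_reps G es'"
  using mset_eq_setD[of es' es] mset_eq_imp_distinct_iff[of es' es] unfolding edge_reps_def by simp

context graph_wf
begin

lemma edge_reps_flip:
  assumes "edge_reps G (as @ f # bs)"
  shows "edge_reps G (as @ ginv G f # bs)"
proof -
  have f: "f \<in> flags G" "ginv G f \<noteq> f" "ginv G f \<notin> set as \<union> set bs" "f \<notin> set as \<union> set bs"
    "distinct (as @ bs)" "set as \<union> set bs \<subseteq> {f \<in> flags G. ginv G f \<noteq> f}"
    using assms unfolding edge_reps_def by (force+)
  have "(g \<in> insert (ginv G f) (set as \<union> set bs)) \<noteq> (ginv G g \<in> insert (ginv G f) (set as \<union> set bs))"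
    if "g \<in> flags G" "ginv G g \<noteq> g" for g
  proof -
    have "(g \<in> insert f (set as \<union> set bs)) \<noteq> (ginv G g \<in> insert f (set as \<union> set bs))"
      using assms that unfolding edge_reps_def by simp
    then show ?thesis using f(2,3,4) by (cases "g = f"; cases "g = ginv G f") auto
  qed
  then show ?thesis unfolding edge_reps_def using f by simp
qed

end

text \<open>The factor \<open>orient\<close> of \<open>end_mu\<close> for an arbitrary choice
  \<open>es\<close> of half-edges, together with the case \<open>d = 0\<close>, where no orientation
  enters.\<close>

definition det_factor :: "bit \<Rightarrow> graph \<Rightarrow> (flag \<Rightarrow> 'k::field_char_0) list \<Rightarrow> flag list \<Rightarrow> 'k" where
  "det_factor d G bs es =
     (if d = 0 then 1 else ldet (bs @ map (lift_vertex G) [1..<length (verts G)]) (rev es))"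

lemma orient_ldet: "(if d = 0 then 1 else orient G bs) = det_factor d G bs (edge_list G)"
  by (simp add: orient_def det_factor_def ldet_def Let_def)

context graph_conn
begin

lemma length_det_rows:
  assumes "det_args d G bs" "d = 1" "edge_reps G es"
  shows "length (bs @ map (lift_vertex G :: nat \<Rightarrow> flag \<Rightarrow> 'k::field_char_0) [1..<nv]) = length es"
  using assms betti_euler[OF assms(3), where ?'k = 'k] nv_pos
  by (simp add: det_args_def det_rank_def del: length_greater_0_conv)

lemma det_rows_chains:
  assumes "det_args d G bs"
  shows "set (bs @ map (lift_vertex G :: nat \<Rightarrow> flag \<Rightarrow> 'k::field_char_0) [1..<nv]) \<subseteq> chains1 G"
  using assms lift_vertex(1) by (auto simp: det_args_def H1_def)

lemma det_factor_flip:
  assumes "det_args d G bs" "edge_reps G (as @ f # cs)"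
  shows "det_factor d G bs (as @ ginv G f # cs) = sg d * det_factor d G bs (as @ f # cs)"
proof (cases "d = 0")
  case False
  then have d: "d = 1" by simp
  let ?rs = "bs @ map (lift_vertex G) [1..<nv]"
  have "r (ginv G f) = - r f" if "r \<in> set ?rs" for r
    by (rule chain_ginv) (use that det_rows_chains[OF assms(1)] in blast)
  then have "ldet ?rs (rev cs @ ginv G f # rev as) = - ldet ?rs (rev cs @ f # rev as)"
    by (intro ldet_neg_col) (use length_det_rows[OF assms(1) d assms(2)] in simp_all)
  then show ?thesis using d by (simp add: det_factor_def sg_def)
qed (simp add: det_factor_def)

lemma det_factor_swap:
  assumes "det_args d G bs" "edge_reps G (as @ f # g # cs)"
  shows "det_factor d G bs (as @ g # f # cs) = sg d * det_factor d G bs (as @ f # g # cs)"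
proof (cases "d = 0")
  case False
  then have d: "d = 1" by simp
  let ?rs = "bs @ map (lift_vertex G) [1..<nv]"
  have "ldet ?rs (rev cs @ f # g # rev as) = - ldet ?rs (rev cs @ g # f # rev as)"
    by (rule ldet_swap_cols) (use length_det_rows[OF assms(1) d assms(2)] in auto)
  then show ?thesis using d by (simp add: det_factor_def sg_def)
qed (simp add: det_factor_def)

lemma same_bdry_diff:
  assumes "u \<in> chains1 G" "v \<in> chains1 G" "\<And>i. i < nv \<Longrightarrow> bdry G u i = bdry G v i"
  shows "(\<lambda>f. u f - v f) \<in> (H1 G :: (flag \<Rightarrow> 'k::field_char_0) set)"
  using fs.subspace_diff[OF chains1_subspace assms(1,2)] assms(3)
  by (auto simp: H1_def bdry_linear fun_diff_def)

text \<open>Lifts with the same boundary differ by a cycle, so \<open>ldet_lifts\<close> applies.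
  The orientation can thus be computed with whatever lifts are at hand: pulled back, collapsed, or
  composed of two paths.\<close>

lemma det_factor_lifts:
  assumes "det_args d G bs" "edge_reps G es"
    and u: "\<And>j. j \<in> {1..<nv} \<Longrightarrow> u j \<in> chains1 G"
      "\<And>i j. j \<in> {1..<nv} \<Longrightarrow> i < nv \<Longrightarrow> bdry G (u j) i = (if i = j then 1 else 0) - (if i = 0 then 1 else 0)"
  shows "det_factor d G bs es = (if d = 0 then 1 else ldet (bs @ map u [1..<nv]) (rev es))"
proof (cases "d = 0")
  case False
  then have d: "d = 1" by simp
  have "ldet (bs @ map (lift_vertex G) [1..<nv]) (rev es) = ldet (bs @ map u [1..<nv]) (rev es)"
  proof (rule ldet_lifts)
    show "list_all2 (\<lambda>u v. (\<lambda>f. u f - v f) \<in> H1 G) (map (lift_vertex G) [1..<nv]) (map u [1..<nv])"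
    proof -
      have "(\<lambda>f. lift_vertex G j f - u j f) \<in> H1 G" if "j \<in> {1..<nv}" for j
        by (rule same_bdry_diff) (use u that in \<open>auto simp: lift_vertex\<close>)
      then show ?thesis by (auto simp: list_all2_conv_all_nth)
    qed
  qed (use assms(1) length_det_rows[OF assms(1) d assms(2)] d in \<open>auto simp: det_args_def det_rank_def\<close>)
  then show ?thesis using d by (simp add: det_factor_def)
qed (simp add: det_factor_def)

end

text \<open>Here \<open>q\<close> is the parity of the shifted basis elements and \<open>w\<close>
  the pairing on the shifted space. The summand \<open>d\<close> in \<open>w_sym\<close> makes the
  pairing change sign with the direction of the edge for \<open>d = 1\<close>, as the determinant
  does.\<close>

locale pairing =
  fixes d :: bit and N :: nat and q :: "nat \<Rightarrow> bit" and w :: "nat \<Rightarrow> nat \<Rightarrow> 'k::field_char_0"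
  assumes w_par: "a < N \<Longrightarrow> b < N \<Longrightarrow> w a b \<noteq> 0 \<Longrightarrow> q a + q b = d"
    and w_sym: "a < N \<Longrightarrow> b < N \<Longrightarrow> w b a = sg (d + q a * q b) * w a b"
begin

definition assigns :: "graph \<Rightarrow> (flag \<Rightarrow> nat) set" where
  "assigns G = flags G \<rightarrow>\<^sub>E {..<N}"

definition wprod :: "graph \<Rightarrow> flag list \<Rightarrow> (flag \<Rightarrow> nat) \<Rightarrow> 'k" where
  "wprod G es c = prod_list (map (\<lambda>f. w (c f) (c (ginv G f))) es)"

text \<open>The part of a summand of \<open>contract\<close> in which the choice of half-edges
  appears. \<open>amp_edge_reps\<close> shows that the choice has no effect.\<close>

definition amp :: "graph \<Rightarrow> (flag \<Rightarrow> 'k) list \<Rightarrow> flag list \<Rightarrow> (flag \<Rightarrow> nat) \<Rightarrow> 'k" where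
  "amp G bs es c = det_factor d G bs es *
     sg (winv (flag_pos G) (q \<circ> c) (edge_word G es @ legs G)) * wprod G es c"

definition vpar :: "graph \<Rightarrow> (flag \<Rightarrow> nat) \<Rightarrow> nat \<Rightarrow> bit" where
  "vpar G c i = (\<Sum>j<snd (verts G ! i). q (c (i, j)))"

definition vsign :: "graph \<Rightarrow> (flag \<Rightarrow> nat) \<Rightarrow> bit" where
  "vsign G c = (\<Sum>i<length (verts G). \<Sum>i'<i. d * vpar G c i')"

definition vcoeff :: "graph \<Rightarrow> (nat list \<Rightarrow> 'k) list \<Rightarrow> (flag \<Rightarrow> nat) \<Rightarrow> 'k" where
  "vcoeff G xs c = (\<Prod>i<length (verts G). (xs ! i) (map (\<lambda>j. c (i, j)) [0..<snd (verts G ! i)]))"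

definition contract :: "graph \<Rightarrow> (flag \<Rightarrow> 'k) list \<Rightarrow> (nat list \<Rightarrow> 'k) list \<Rightarrow> nat list \<Rightarrow> 'k" where
  "contract G bs xs js =
     (if length js = length (legs G) \<and> set js \<subseteq> {..<N} then
        (\<Sum>c \<in> {c \<in> assigns G. map c (legs G) = js}.
           amp G bs (edge_list G) c * sg (vsign G c) * vcoeff G xs c)
      else 0)"

lemma assigns_less: "c \<in> assigns G \<Longrightarrow> f \<in> flags G \<Longrightarrow> c f < N"
  unfolding assigns_def by auto

lemma finite_assigns [simp]: "finite (assigns G)"
  unfolding assigns_def by (simp add: finite_PiE)

lemma wprod_simps [simp]:
  "wprod G [] c = 1" "wprod G (f # es) c = w (c f) (c (ginv G f)) * wprod G es c"
  "wprod G (es @ es') c = wprod G es c * wprod G es' c"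
  by (simp_all add: wprod_def)

lemma edge_word_par:
  assumes "wf_graph G" "c \<in> assigns G" "set es \<subseteq> flags G" "wprod G es c \<noteq> 0"
  shows "sum_list (map (q \<circ> c) (edge_word G es)) = d * of_nat (length es)"
proof -
  interpret graph_wf G by unfold_locales (rule assms)
  show ?thesis
    using assms(3,4)
  proof (induction es)
    case (Cons f es)
    then have "q (c f) + q (c (ginv G f)) = d"
      using assigns_less[OF assms(2)] by (intro w_par) auto
    then show ?case using Cons by (simp add: distrib_left add.assoc[symmetric])
  qed simp
qed

text \<open>Three signs cancel: \<open>d\<close> from the determinant, the product of the two
  parities from the word, and the sum of both from \<open>w_sym\<close>.\<close>

lemma amp_flip:
  assumes "wf_graph G" "connected_graph G" "det_args d G bs" "edge_reps G (as @ f # cs)" "c \<in> assigns G"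
  shows "amp G bs (as @ ginv G f # cs) c = amp G bs (as @ f # cs) c"
proof -
  interpret graph_conn G by unfold_locales (use assms in auto)
  have f: "f \<in> flags G" "ginv G f \<noteq> f" using assms(4) unfolding edge_reps_def by auto
  have pos: "flag_pos G f \<noteq> flag_pos G (ginv G f)"
    using inj_onD[OF inj_flag_pos, of G f "ginv G f"] f by auto
  have "winv (flag_pos G) (q \<circ> c) (edge_word G as @ [ginv G f] @ [f] @ edge_word G cs @ legs G)
     = winv (flag_pos G) (q \<circ> c) (edge_word G as @ [f] @ [ginv G f] @ edge_word G cs @ legs G)
       + q (c f) * q (c (ginv G f))"
    by (subst winv_swap_blocks) (use pos in auto)
  moreover have "w (c (ginv G f)) (c f) = sg (d + q (c f) * q (c (ginv G f))) * w (c f) (c (ginv G f))"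
    by (rule w_sym) (use assigns_less[OF assms(5)] f in auto)
  ultimately show ?thesis
    using det_factor_flip[OF assms(3,4)] by (simp add: amp_def sg_add ac_simps)
qed

text \<open>If the pairings do not vanish, the two ends of an edge have total parity
  \<open>d\<close>. Exchanging two edges then costs \<open>d * d = d\<close> in the word, which is
  the sign of the exchanged columns of the determinant.\<close>

lemma amp_swap:
  assumes "wf_graph G" "connected_graph G" "det_args d G bs" "edge_reps G (as @ f # g # cs)" "c \<in> assigns G"
  shows "amp G bs (as @ g # f # cs) c = amp G bs (as @ f # g # cs) c"
proof (cases "wprod G (as @ f # g # cs) c = 0")
  case True
  then show ?thesis by (auto simp: amp_def)
next
  case False
  interpret graph_conn G by unfold_locales (use assms in auto)
  have fg: "f \<in> flags G" "g \<in> flags G" using assms(4) unfolding edge_reps_def by auto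
  have d: "distinct (edge_word G (as @ f # g # cs))" by (rule distinct_edge_word[OF assms(4)])
  have pos: "flag_pos G x \<noteq> flag_pos G y" if "x \<in> set [f, ginv G f]" "y \<in> set [g, ginv G g]" for x y
  proof -
    have "x \<noteq> y" using that d by auto
    moreover have "x \<in> flags G" "y \<in> flags G" using that fg by auto
    ultimately show ?thesis using inj_onD[OF inj_flag_pos] by metis
  qed
  have par: "sum_list (map (q \<circ> c) [f, ginv G f]) = d" "sum_list (map (q \<circ> c) [g, ginv G g]) = d"
    using False assigns_less[OF assms(5)] fg w_par by auto
  have "winv (flag_pos G) (q \<circ> c) (edge_word G as @ [g, ginv G g] @ [f, ginv G f] @ edge_word G cs @ legs G)
     = winv (flag_pos G) (q \<circ> c) (edge_word G as @ [f, ginv G f] @ [g, ginv G g] @ edge_word G cs @ legs G) + d"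
    by (subst winv_swap_blocks[OF pos]) (simp_all only: par bit_mult_self)
  then show ?thesis
    using det_factor_swap[OF assms(3,4)] by (simp add: amp_def sg_add ac_simps)
qed

text \<open>Two choices differ by reversing some edges and permuting them, so
  \<open>amp_flip\<close> and \<open>amp_swap\<close> suffice.\<close>

lemma amp_edge_reps:
  assumes "wf_graph G" "connected_graph G" "det_args d G bs" "edge_reps G es" "edge_reps G es'" "c \<in> assigns G"
  shows "amp G bs es c = amp G bs es' c"
proof -
  interpret graph_conn G by unfold_locales (use assms in auto)
  \<comment> \<open>Turns each edge into the direction that it has in \<open>es\<close>. Afterwards
    both lists contain the same half-edges.\<close>
  define fl where "fl f = (if f \<in> set es then f else ginv G f)" for f
  have flip: "edge_reps G (as @ map fl cs) \<and> amp G bs (as @ map fl cs) c = amp G bs (as @ cs) c"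
    if "edge_reps G (as @ cs)" for as cs
    using that
  proof (induction cs arbitrary: as)
    case (Cons f cs)
    have "edge_reps G (as @ fl f # cs) \<and> amp G bs (as @ fl f # cs) c = amp G bs (as @ f # cs) c"
      using Cons.prems edge_reps_flip amp_flip assms by (simp add: fl_def)
    then show ?case using Cons.IH[of "as @ [fl f]"] by simp
  qed simp
  have reps: "edge_reps G (map fl es')" and amp': "amp G bs (map fl es') c = amp G bs es' c"
    using flip[of "[]" es'] assms(5) by auto
  have "set (map fl es') \<subseteq> set es"
  proof -
    have "fl f \<in> set es" if "f \<in> set es'" for f
    proof -
      have "f \<in> flags G" "ginv G f \<noteq> f" using assms(5) that unfolding edge_reps_def by auto
      then have "(f \<in> set es) \<noteq> (ginv G f \<in> set es)" using assms(4) unfolding edge_reps_def by blast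
      then show ?thesis by (auto simp: fl_def)
    qed
    then show ?thesis by auto
  qed
  moreover have "card (set (map fl es')) = card (set es)"
    using betti_euler[OF reps, where ?'k = 'k] betti_euler[OF assms(4), where ?'k = 'k] reps assms(4)
    unfolding edge_reps_def by (simp add: distinct_card del: set_map)
  ultimately have "set (map fl es') = set es" by (intro card_subset_eq) auto
  then have m: "mset (map fl es') = mset es"
    using reps assms(4) unfolding edge_reps_def by (metis set_eq_iff_mset_eq_distinct)
  \<comment> \<open>All letters get parity 0, because \<open>amp\<close> is invariant under
    exchanges without any sign.\<close>
  have "sg (winv (flag_pos G) (\<lambda>_. 0) es) * amp G bs es c
      = sg (winv (flag_pos G) (\<lambda>_. 0) (map fl es')) * amp G bs (map fl es') c"
  proof (rule winv_swap_invariant[where M = "mset es" and F = "\<lambda>es. amp G bs es c"])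
    fix as x y ds assume "mset (as @ x # y # ds) = mset es"
    then have "edge_reps G (as @ x # y # ds)" using edge_reps_perm[OF assms(4)] by blast
    then show "amp G bs (as @ y # x # ds) c = sg (0 * 0) * amp G bs (as @ x # y # ds) c"
      using amp_swap assms by simp
  next
    show "inj_on (flag_pos G) (set es)"
      using inj_on_subset[OF inj_flag_pos] assms(4) unfolding edge_reps_def by blast
  qed (use m assms(4) in \<open>simp_all add: edge_reps_def\<close>)
  then show ?thesis using amp' by simp
qed

lemma vpar_sum: "(\<Sum>i<length (verts G). vpar G c i) = sum_list (map (q \<circ> c) (flag_list G))"
  by (simp add: vpar_def sum_flag_list sum_flags comp_def)

lemma total_par:
  assumes "wf_graph G" "c \<in> assigns G" "edge_reps G es" "wprod G es c \<noteq> 0"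
  shows "(\<Sum>i<length (verts G). vpar G c i) = d * of_nat (length es) + sum_list (map (q \<circ> c) (legs G))"
proof -
  interpret graph_wf G by unfold_locales (rule assms)
  have "sum_list (map (q \<circ> c) (flag_list G)) = sum_list (map (q \<circ> c) (edge_word G es @ legs G))"
    by (rule sum_list_map_mset) (use mset_edge_word[OF assms(3)] in simp)
  then show ?thesis
    using edge_word_par[OF assms(1,2) _ assms(4)] assms(3) by (simp add: vpar_sum edge_reps_def subset_iff)
qed

end

section \<open>Genus and stability of the result of a composition\<close>

lemma ext_stable_wf: "ext_stable G \<Longrightarrow> wf_graph G" "ext_stable G \<Longrightarrow> connected_graph G"
  unfolding ext_stable_def by auto

lemma sum_list_map_sum: "sum_list (map h xs) = (\<Sum>i<length xs. h (xs ! i))"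
  by (rule sum_list_nth_sum)

text \<open>The number \<open>2 * (g - 1) + n\<close> of a graph is the sum of those of its
  vertices, written without subtraction.\<close>

lemma genus_euler:
  assumes "ext_stable G" "edge_reps G es"
  shows "2 * genus TYPE('k::field_char_0) G + length (legs G) + 2 * length (verts G)
    = 2 + (\<Sum>i<length (verts G). 2 * fst (verts G ! i) + snd (verts G ! i))"
proof -
  interpret graph_conn G by unfold_locales (use assms ext_stable_wf in auto)
  show ?thesis
    using betti_euler[OF assms(2), where ?'k = 'k] length_flags[OF assms(2)]
    by (simp add: genus_def sum_list_map_sum sum.distrib sum_distrib_left[symmetric])
qed

text \<open>All vertices have \<open>2 * (g - 1) + n >= 0\<close>, hence so does the graph, which
  excludes genus 0 with at most one leg. For genus 1 without legs all vertices reach equality, so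
  they are of type (0, 2), and this is an excluded cycle. Therefore compositions never land in the
  arities where the endomorphism operad is set to 0.\<close>

lemma ext_stable_genus:
  assumes "ext_stable G"
  shows "(genus TYPE('k::field_char_0) G, length (legs G)) \<notin> {(0, 0), (0, 1), (1, 0)}"
proof
  interpret graph_conn G by unfold_locales (use assms ext_stable_wf in auto)
  let ?s = "\<lambda>i. 2 * fst (verts G ! i) + snd (verts G ! i)"
  assume a: "(genus TYPE('k) G, length (legs G)) \<in> {(0, 0), (0, 1), (1, 0)}"
  have v: "?s i > 2 \<or> verts G ! i = (0, 2)" if "i < nv" for i
  proof -
    have "verts G ! i \<in> set (verts G)" using that by simp
    then show ?thesis using assms unfolding ext_stable_def by fastforce
  qed
  have "(\<Sum>i<nv. 2) \<le> (\<Sum>i<nv. ?s i)" by (rule sum_mono) (use v in fastforce)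
  then have ge: "2 * nv \<le> (\<Sum>i<nv. ?s i)" by simp
  note eu = genus_euler[OF assms edge_reps_edge_list, where ?'k = 'k]
  have "genus TYPE('k) G = 1" "legs G = []" using a eu ge by auto
  then have eq: "(\<Sum>i<nv. ?s i) = 2 * nv" using eu by simp
  have "verts G ! i = (0, 2)" if i: "i < nv" for i
  proof (rule ccontr)
    assume "verts G ! i \<noteq> (0, 2)"
    then have "2 < ?s i" using v i by blast
    then have "(\<Sum>i<nv. 2) < (\<Sum>i<nv. ?s i)"
      by (intro sum_strict_mono_ex1) (use i v in \<open>fastforce+\<close>)
    then show False using eq by simp
  qed
  then have "\<forall>v\<in>set (verts G). v = (0, 2)" by (auto simp: in_set_conv_nth)
  then show False using assms \<open>legs G = []\<close> unfolding ext_stable_def by blast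
qed

section \<open>The differential of a contraction\<close>

lemma sum_lessThan_if: "i \<le> n \<Longrightarrow> (\<Sum>x<n. if x < i then g x else 0) = (\<Sum>x<i. g x)"
  for i n :: nat and g :: "nat \<Rightarrow> 'b::comm_monoid_add"
  by (rule sum.mono_neutral_cong_right) auto

lemma edge_repsD:
  assumes "edge_reps G es" "f \<in> set es"
  shows "f \<in> flags G" "ginv G f \<noteq> f"
  using assms unfolding edge_reps_def by blast+

lemma flag_pos_less_iff:
  assumes "f \<in> flags G" "f' \<in> flags G"
  shows "flag_pos G f < flag_pos G f' \<longleftrightarrow> fst f < fst f' \<or> fst f = fst f' \<and> snd f < snd f'"
proof -
  have mono: "(\<Sum>i<a. snd (verts G ! i)) + snd (verts G ! a) \<le> (\<Sum>i<b. snd (verts G ! i))" if "a < b" for a b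
  proof -
    have "(\<Sum>i<Suc a. snd (verts G ! i)) \<le> (\<Sum>i<b. snd (verts G ! i))"
      by (rule sum_mono2) (use that in auto)
    then show ?thesis by simp
  qed
  obtain i j i' j' where f: "f = (i, j)" "f' = (i', j')" by fastforce
  then have l: "j < snd (verts G ! i)" "j' < snd (verts G ! i')" using assms by (auto simp: flags_def)
  show ?thesis
    using mono[of i i'] mono[of i' i] l unfolding f by (cases i i' rule: linorder_cases) (auto simp: flag_pos_def)
qed

context pairing
begin

abbreviation legs_assigns :: "graph \<Rightarrow> nat list \<Rightarrow> (flag \<Rightarrow> nat) set" where
  "legs_assigns G js \<equiv> {c \<in> assigns G. map c (legs G) = js}"

text \<open>The total parity of the flags that precede \<open>f\<close> in the order
  \<open>flag_pos\<close>, see \<open>below_par_sum\<close>. Apart from the symbols \<theta>, it is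
  what the differential passes before acting on \<open>f\<close>.\<close>

definition below_par :: "graph \<Rightarrow> flag \<Rightarrow> (flag \<Rightarrow> nat) \<Rightarrow> bit" where
  "below_par G f c = (\<Sum>i'<fst f. vpar G c i') + (\<Sum>j'<snd f. q (c (fst f, j')))"

lemma below_par_sum:
  assumes "f \<in> flags G"
  shows "(\<Sum>y\<leftarrow>flag_list G. if flag_pos G y < flag_pos G f then q (c y) else 0) = below_par G f c"
proof -
  let ?n = "\<lambda>i. snd (verts G ! i)"
  obtain i j where f: "f = (i, j)" by fastforce
  then have ij: "i < length (verts G)" "j < ?n i" using assms by (auto simp: flags_def)
  have "(\<Sum>y\<leftarrow>flag_list G. if flag_pos G y < flag_pos G f then q (c y) else 0)
     = (\<Sum>y\<in>flags G. if flag_pos G y < flag_pos G f then q (c y) else 0)" by (rule sum_flag_list)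
  also have "\<dots> = (\<Sum>y\<in>flags G. if fst y < i \<or> fst y = i \<and> snd y < j then q (c y) else 0)"
    by (rule sum.cong) (use flag_pos_less_iff[OF _ assms] f in auto)
  also have "\<dots> = (\<Sum>i'<length (verts G). (if i' < i then vpar G c i' else 0)
      + (if i' = i then (\<Sum>j'<j. q (c (i, j'))) else 0))"
  proof (unfold sum_flags, rule sum.cong[OF refl])
    fix i'
    show "(\<Sum>j'<?n i'. if fst (i', j') < i \<or> fst (i', j') = i \<and> snd (i', j') < j then q (c (i', j')) else 0)
      = (if i' < i then vpar G c i' else 0) + (if i' = i then (\<Sum>j'<j. q (c (i, j'))) else 0)"
      using sum_lessThan_if[of j "?n i" "\<lambda>j'. q (c (i, j'))"] ij
      by (cases i' i rule: linorder_cases) (simp_all add: vpar_def cong: if_cong)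
  qed
  also have "\<dots> = below_par G f c"
    using sum_lessThan_if[of i "length (verts G)" "vpar G c"] ij by (simp add: sum.distrib below_par_def f)
  finally show ?thesis .
qed

lemma vpar_flip:
  assumes "(i, j) \<in> flags G" "q a = q (c (i, j)) + 1"
  shows "vpar G (c((i, j) := a)) i' = vpar G c i' + (if i' = i then 1 else 0)"
proof (cases "i' = i")
  case True
  have "q ((c((i, j) := a)) (i, j')) = q (c (i, j')) + (if j' = j then 1 else 0)" for j'
    using assms(2) by simp
  then show ?thesis using True assms(1) by (simp add: vpar_def sum.distrib flags_def del: fun_upd_apply)
qed (simp add: vpar_def)

text \<open>The symbol \<theta> of each vertex behind the \<open>i\<close>-th one is moved past the
  flags of the \<open>i\<close>-th vertex, which explains the number of vertices behind
  \<open>i\<close>.\<close>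

lemma vsign_flip:
  assumes "(i, j) \<in> flags G" "q a = q (c (i, j)) + 1"
  shows "vsign G (c((i, j) := a)) = vsign G c + d * of_nat (length (verts G) - 1 - i)"
proof -
  have i: "i < length (verts G)" using assms(1) by (auto simp: flags_def)
  have "(\<Sum>i'<i2. d * vpar G (c((i, j) := a)) i') = (\<Sum>i'<i2. d * vpar G c i') + (if i < i2 then d else 0)" for i2
  proof -
    have "d * vpar G (c((i, j) := a)) i' = d * vpar G c i' + (if i' = i then d else 0)" for i'
      by (simp only: vpar_flip[where c = c, OF assms]) (simp add: distrib_left)
    then show ?thesis by (simp only: sum.distrib) simp
  qed
  then have "vsign G (c((i, j) := a)) = vsign G c + (\<Sum>i2<length (verts G). if i < i2 then d else 0)"
    by (simp add: vsign_def sum.distrib)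
  also have "(\<Sum>i2<length (verts G). if i < i2 then d else 0) = (\<Sum>i2\<in>{i<..<length (verts G)}. d)"
    by (rule sum.mono_neutral_cong_right) auto
  also have "\<dots> = d * of_nat (length (verts G) - 1 - i)"
    by (simp add: mult.commute)
  finally show ?thesis .
qed

text \<open>Compares the sign of an odd map that reaches the flag through the vertices with the sign
  of one that reaches it through the word of edges and legs. The letters of smaller rank in
  \<open>winv_flip\<close> are just those in \<open>below_par\<close> and cancel; the symbols
  \<theta> before the \<open>i\<close>-th vertex and the change of \<open>vsign\<close> from those
  behind it add up to all vertices but one.\<close>

lemma flip_sign:
  assumes "wf_graph G" "c \<in> assigns G" "edge_reps G es" "(i, j) \<in> flags G" "q a = q (c (i, j)) + 1"
    and L: "edge_word G es @ legs G = xs @ (i, j) # ys"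
  shows "d * of_nat i + below_par G (i, j) (c((i, j) := a))
      + winv (flag_pos G) (q \<circ> c((i, j) := a)) (edge_word G es @ legs G) + vsign G (c((i, j) := a))
    = d * of_nat (length (verts G) - 1) + sum_list (map (q \<circ> c) xs)
      + winv (flag_pos G) (q \<circ> c) (edge_word G es @ legs G) + vsign G c"
proof -
  interpret graph_wf G by unfold_locales (rule assms)
  let ?f = "(i, j)" and ?p = "q \<circ> c" and ?p' = "q \<circ> c((i, j) := a)"
  note L' = mset_edge_word[OF assms(3)]
  have 1: "winv (flag_pos G) ?p' (xs @ ?f # ys) = winv (flag_pos G) ?p (xs @ ?f # ys) + sum_list (map ?p xs)
    + (\<Sum>y\<leftarrow>xs @ ?f # ys. if flag_pos G y < flag_pos G ?f then ?p y else 0)"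
    by (rule winv_flip) (use L'(2,3) inj_flag_pos assms(5) in \<open>auto simp: L\<close>)
  have 2: "(\<Sum>y\<leftarrow>xs @ ?f # ys. if flag_pos G y < flag_pos G ?f then ?p y else 0) = below_par G ?f c"
    unfolding below_par_sum[OF assms(4), symmetric] comp_def
    by (rule sum_list_map_mset) (use L'(1) in \<open>simp add: L\<close>)
  have 3: "below_par G ?f (c(?f := a)) = below_par G ?f c"
    by (simp add: below_par_def vpar_def)
  have "i < length (verts G)" using assms(4) by (auto simp: flags_def)
  then have 4: "of_nat i + of_nat (length (verts G) - 1 - i) = (of_nat (length (verts G) - 1) :: bit)"
    by (simp flip: of_nat_add)
  show ?thesis
    unfolding L 1 2 3 vsign_flip[where c = c, OF assms(4,5)] 4[symmetric]
    by (simp add: distrib_left ac_simps)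
qed

lemma vcoeff_upd:
  assumes "(i, j) \<in> flags G"
  shows "vcoeff G xs (c((i, j) := k)) = (xs ! i) ((map (\<lambda>j. c (i, j)) [0..<snd (verts G ! i)])[j := k]) *
    (\<Prod>i'\<in>{..<length (verts G)} - {i}. (xs ! i') (map (\<lambda>j. c (i', j)) [0..<snd (verts G ! i')]))"
proof -
  have i: "i < length (verts G)" using assms by (auto simp: flags_def)
  have "map (\<lambda>j'. (c((i, j) := k)) (i, j')) [0..<n] = (map (\<lambda>j. c (i, j)) [0..<n])[j := k]" for n
    by (rule nth_equalityI) (auto simp: nth_list_update)
  moreover have "(\<Prod>i'\<in>{..<length (verts G)} - {i}. (xs ! i') (map (\<lambda>j'. (c((i, j) := k)) (i', j')) [0..<snd (verts G ! i')]))
     = (\<Prod>i'\<in>{..<length (verts G)} - {i}. (xs ! i') (map (\<lambda>j. c (i', j)) [0..<snd (verts G ! i')]))"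
    by (rule prod.cong) auto
  ultimately show ?thesis
    unfolding vcoeff_def by (subst prod.remove[of _ i]) (use i in simp_all)
qed

text \<open>The coefficient functions of parity \<open>p\<close>, where the additional symbol \<open>\<theta>\<close> has parity \<open>d\<close>.\<close>

definition supported :: "nat \<Rightarrow> bit \<Rightarrow> (nat list \<Rightarrow> 'k) \<Rightarrow> bool" where
  "supported n p x \<longleftrightarrow> (\<forall>js. x js \<noteq> 0 \<longrightarrow> length js = n \<and> set js \<subseteq> {..<N} \<and> d + sum_list (map q js) = p)"

lemma vcoeff_par:
  assumes "\<And>i. i < length (verts G) \<Longrightarrow> supported (snd (verts G ! i)) (ps ! i) (xs ! i)"
    and "vcoeff G xs c \<noteq> 0" "i < length (verts G)"
  shows "ps ! i = d + vpar G c i"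
proof -
  have "(xs ! i) (map (\<lambda>j. c (i, j)) [0..<snd (verts G ! i)]) \<noteq> 0"
    using assms(2,3) by (auto simp: vcoeff_def)
  then have "d + sum_list (map q (map (\<lambda>j. c (i, j)) [0..<snd (verts G ! i)])) = ps ! i"
    using assms(1)[OF assms(3)] unfolding supported_def by blast
  then show ?thesis by (simp add: vpar_def sum_list_nth_sum)
qed

text \<open>The vertices, the edges and the determinant each contribute multiples of
  \<open>d\<close> to the parity. By the Euler relation these add up to a single \<open>d\<close>,
  the parity of the symbol \<theta> of the result.\<close>

lemma supported_contract:
  assumes "wf_graph G" "connected_graph G" "length bs = det_rank TYPE('k) d G"
    "\<And>i. i < length (verts G) \<Longrightarrow> supported (snd (verts G ! i)) (ps ! i) (xs ! i)"
    "length ps = length (verts G)"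
  shows "supported (length (legs G)) (out_par bs ps) (contract G bs xs)"
  unfolding supported_def
proof (intro allI impI)
  fix js assume nz: "contract G bs xs js \<noteq> 0"
  interpret graph_conn G by unfold_locales (use assms in auto)
  have js: "length js = length (legs G)" "set js \<subseteq> {..<N}"
    using nz unfolding contract_def by (auto split: if_splits)
  then obtain c where c: "c \<in> assigns G" "map c (legs G) = js"
    "amp G bs (edge_list G) c * sg (vsign G c) * vcoeff G xs c \<noteq> 0"
    using nz unfolding contract_def by (auto elim: sum.not_neutral_contains_not_neutral)
  have "sum_list ps = (\<Sum>i<nv. d + vpar G c i)"
    unfolding sum_list_map_sum[of id ps, simplified] assms(5)
    by (rule sum.cong) (use vcoeff_par[OF assms(4)] c(3) in auto)
  also have "\<dots> = d * of_nat nv + (d * of_nat (length (edge_list G)) + sum_list (map q js))"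
    using total_par[OF assms(1) c(1) edge_reps_edge_list] c(2,3)
    by (auto simp: sum.distrib amp_def mult.commute)
  finally have "out_par bs ps = of_nat (length bs) + d * of_nat nv + d * of_nat (length (edge_list G)) + sum_list (map q js)"
    by (simp add: out_par_def add.assoc)
  moreover have "of_nat (length bs) + d * of_nat nv + d * of_nat (length (edge_list G)) = d"
  proof (cases "d = 0")
    case False
    have "of_nat (betti TYPE('k) G) + of_nat nv = (of_nat (length (edge_list G)) + 1 :: bit)"
      using arg_cong[OF betti_euler[OF edge_reps_edge_list, where ?'k = 'k], of "of_nat :: nat \<Rightarrow> bit"] by simp
    then show ?thesis using False assms(3) by (simp add: det_rank_def ac_simps)
  qed (use assms(3) in \<open>simp add: det_rank_def\<close>)
  ultimately show "length js = length (legs G) \<and> set js \<subseteq> {..<N} \<and> d + sum_list (map q js) = out_par bs ps"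
    using js by simp
qed

end

text \<open>\<open>M a k\<close> is the coefficient at index \<open>a\<close> of the differential of
  the \<open>k\<close>-th basis element, and \<open>w_M\<close> says that the pairing is a chain
  map.\<close>

locale dg_pairing = pairing d N q w
  for d N q and w :: "nat \<Rightarrow> nat \<Rightarrow> 'k::field_char_0" +
  fixes M :: "nat \<Rightarrow> nat \<Rightarrow> 'k"
  assumes M_par: "a < N \<Longrightarrow> k < N \<Longrightarrow> M a k \<noteq> 0 \<Longrightarrow> q a = q k + 1"
    and w_M: "x < N \<Longrightarrow> y < N \<Longrightarrow> (\<Sum>a<N. w a y * M a x) + sg (q x) * (\<Sum>a<N. w x a * M a y) = 0"
begin

definition deriv :: "(nat list \<Rightarrow> 'k) \<Rightarrow> nat list \<Rightarrow> 'k" where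
  "deriv x js = (if set js \<subseteq> {..<N} then
     (\<Sum>j<length js. \<Sum>k<N. sg (sum_list (map q (take j js))) * M (js ! j) k * x (js[j := k])) else 0)"

lemma vcoeff_deriv:
  assumes "i < length (verts G)" "c \<in> assigns G" "length xs = length (verts G)"
  shows "vcoeff G (xs[i := deriv (xs ! i)]) c = (\<Sum>j<snd (verts G ! i). \<Sum>k<N.
     sg (\<Sum>j'<j. q (c (i, j'))) * M (c (i, j)) k * vcoeff G xs (c((i, j) := k)))"
proof -
  let ?n = "snd (verts G ! i)" and ?js = "map (\<lambda>j. c (i, j)) [0..<snd (verts G ! i)]"
  let ?P = "\<Prod>i'\<in>{..<length (verts G)} - {i}. (xs ! i') (map (\<lambda>j. c (i', j)) [0..<snd (verts G ! i')])"
  have "set ?js \<subseteq> {..<N}" using assms(1,2) by (auto simp: flags_def intro!: assigns_less)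
  then have "deriv (xs ! i) ?js = (\<Sum>j<?n. \<Sum>k<N. sg (sum_list (map q (take j ?js))) * M (?js ! j) k * (xs ! i) (?js[j := k]))"
    by (simp add: deriv_def)
  also have "\<dots> = (\<Sum>j<?n. \<Sum>k<N. sg (\<Sum>j'<j. q (c (i, j'))) * M (c (i, j)) k * (xs ! i) (?js[j := k]))"
    by (intro sum.cong refl arg_cong2[where f = "(*)"] arg_cong[where f = sg])
      (simp_all add: take_map sum_list_nth_sum)
  finally have der: "deriv (xs ! i) ?js = \<dots>" .
  have "vcoeff G (xs[i := deriv (xs ! i)]) c = deriv (xs ! i) ?js * ?P"
    unfolding vcoeff_def by (subst prod.remove[of _ i]) (use assms in \<open>auto intro!: prod.cong\<close>)
  also have "\<dots> = (\<Sum>j<?n. \<Sum>k<N. sg (\<Sum>j'<j. q (c (i, j'))) * M (c (i, j)) k * ((xs ! i) (?js[j := k]) * ?P))"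
    by (simp add: der sum_distrib_right mult.assoc)
  also have "\<dots> = (\<Sum>j<?n. \<Sum>k<N. sg (\<Sum>j'<j. q (c (i, j'))) * M (c (i, j)) k * vcoeff G xs (c((i, j) := k)))"
    by (intro sum.cong refl arg_cong2[where f = "(*)"], subst vcoeff_upd) (use assms(1) in \<open>auto simp: flags_def\<close>)
  finally show ?thesis .
qed

text \<open>The contribution of the flag \<open>f\<close> to the signed sum over all vertices of
  contractions with one differentiated decoration.\<close>

definition flag_term where
  "flag_term G bs xs js f = (\<Sum>c\<in>legs_assigns G js. \<Sum>k<N.
     sg (of_nat (length bs) + d * of_nat (fst f) + below_par G f c) * amp G bs (edge_list G) c *
     sg (vsign G c) * M (c f) k * vcoeff G xs (c(f := k)))"

text \<open>Where the coefficients do not vanish, the parities \<open>take i ps\<close> can be read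
  off from the assignment. The signs of the Leibniz rule over vertices and inside a decoration then
  combine to \<open>below_par\<close> and the symbols \<theta>.\<close>

lemma sum_contract_deriv:
  assumes "\<And>i. i < length (verts G) \<Longrightarrow> supported (snd (verts G ! i)) (ps ! i) (xs ! i)"
    and "length xs = length (verts G)" "length ps = length (verts G)" "length js = length (legs G)" "set js \<subseteq> {..<N}"
  shows "(\<Sum>i<length (verts G). sg (of_nat (length bs) + sum_list (take i ps)) *
      contract G bs (xs[i := deriv (xs ! i)]) js) = (\<Sum>f\<in>flags G. flag_term G bs xs js f)"
proof -
  have "sg (of_nat (length bs) + sum_list (take i ps)) * contract G bs (xs[i := deriv (xs ! i)]) js
      = (\<Sum>j<snd (verts G ! i). flag_term G bs xs js (i, j))" if i: "i < length (verts G)" for i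
  proof -
    have summand: "sg (of_nat (length bs) + sum_list (take i ps)) * (amp G bs (edge_list G) c * sg (vsign G c) *
        (sg (\<Sum>j'<j. q (c (i, j'))) * M (c (i, j)) k * vcoeff G xs (c((i, j) := k))))
      = sg (of_nat (length bs) + d * of_nat i + below_par G (i, j) c) * amp G bs (edge_list G) c *
        sg (vsign G c) * M (c (i, j)) k * vcoeff G xs (c((i, j) := k))" for c j k
    proof (cases "vcoeff G xs (c((i, j) := k)) = 0")
      case False
      have "ps ! i' = d + vpar G c i'" if "i' < i" for i'
        using vcoeff_par[OF assms(1) False, of i'] that i by (simp add: vpar_def)
      then have "sum_list (take i ps) = d * of_nat i + (\<Sum>i'<i. vpar G c i')"
        using i assms(3) sum_list_map_sum[of id "take i ps"] by (simp add: sum.distrib mult.commute)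
      then show ?thesis by (simp add: below_par_def sg_add ac_simps)
    qed simp
    have "contract G bs (xs[i := deriv (xs ! i)]) js = (\<Sum>c\<in>legs_assigns G js. \<Sum>j<snd (verts G ! i). \<Sum>k<N.
        amp G bs (edge_list G) c * sg (vsign G c) *
        (sg (\<Sum>j'<j. q (c (i, j'))) * M (c (i, j)) k * vcoeff G xs (c((i, j) := k))))"
      using assms(4,5) i by (simp add: contract_def vcoeff_deriv[OF _ _ assms(2)] sum_distrib_left)
    then show ?thesis
      by (simp add: sum_distrib_left summand flag_term_def) (rule sum.swap)
  qed
  then show ?thesis by (simp add: sum_flags)
qed

text \<open>The parity of the determinant argument and the \<open>d\<close>-multiple left over by
  \<open>flip_sign\<close> together equal the parity of all edges in the word.\<close>

lemma length_bs_par: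
  assumes "wf_graph G" "connected_graph G" "length bs = det_rank TYPE('k) d G"
  shows "of_nat (length bs) + d * of_nat (length (verts G) - 1) = d * of_nat (length (edge_list G))"
proof (cases "d = 0")
  case False
  interpret graph_conn G by unfold_locales (use assms in auto)
  have "betti TYPE('k) G + (nv - 1) = length (edge_list G)"
    using betti_euler[OF edge_reps_edge_list, where ?'k = 'k] nv_pos by linarith
  then show ?thesis using False assms(3) by (simp add: det_rank_def flip: of_nat_add)
qed (use assms(3) in \<open>simp add: det_rank_def\<close>)

text \<open>In this form \<open>c\<close> is the assignment seen by the decorations and
  \<open>a\<close> the value at \<open>f\<close> after the differential has acted. All signs are
  expressed by \<open>c\<close>, so that terms for different \<open>a\<close>, and for the two ends
  of an edge, can be added.\<close>

lemma flag_term_eq: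
  assumes "wf_graph G" "connected_graph G" "length bs = det_rank TYPE('k) d G" "c \<in> assigns G" "a < N"
    and "f \<in> flags G" and L: "edge_word G (edge_list G) @ legs G = ys @ f # zs"
  shows "sg (of_nat (length bs) + d * of_nat (fst f) + below_par G f (c(f := a))) *
      amp G bs (edge_list G) (c(f := a)) * sg (vsign G (c(f := a))) * M a (c f) * V
    = sg (d * of_nat (length (edge_list G)) + sum_list (map (q \<circ> c) ys)) * det_factor d G bs (edge_list G) *
      sg (winv (flag_pos G) (q \<circ> c) (edge_word G (edge_list G) @ legs G)) * wprod G (edge_list G) (c(f := a)) *
      sg (vsign G c) * M a (c f) * V"
proof (cases "M a (c f) = 0")
  case False
  then have par: "q a = q (c f) + 1"
    using M_par assigns_less assms by blast
  interpret graph_wf G by unfold_locales (rule assms)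
  obtain i j where f: "f = (i, j)" by fastforce
  have "of_nat (length bs) + (d * of_nat i + below_par G f (c(f := a))
      + winv (flag_pos G) (q \<circ> c(f := a)) (edge_word G (edge_list G) @ legs G) + vsign G (c(f := a)))
    = of_nat (length bs) + d * of_nat (length (verts G) - 1) + sum_list (map (q \<circ> c) ys)
      + winv (flag_pos G) (q \<circ> c) (edge_word G (edge_list G) @ legs G) + vsign G c"
    using flip_sign[OF assms(1,4) edge_reps_edge_list, of i j a ys zs] assms(6) par L
    unfolding f by (simp only: add.assoc)
  then have "sg (of_nat (length bs) + (d * of_nat i + below_par G f (c(f := a))
      + winv (flag_pos G) (q \<circ> c(f := a)) (edge_word G (edge_list G) @ legs G) + vsign G (c(f := a))))
    = (sg (d * of_nat (length (edge_list G)) + sum_list (map (q \<circ> c) ys)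
      + winv (flag_pos G) (q \<circ> c) (edge_word G (edge_list G) @ legs G) + vsign G c) :: 'k)"
    unfolding length_bs_par[OF assms(1-3)] by (rule arg_cong)
  then have s: "sg (of_nat (length bs) + d * of_nat i + below_par G f (c(f := a))) *
      (sg (winv (flag_pos G) (q \<circ> c(f := a)) (edge_word G (edge_list G) @ legs G)) * sg (vsign G (c(f := a))))
    = sg (d * of_nat (length (edge_list G)) + sum_list (map (q \<circ> c) ys)) *
      (sg (winv (flag_pos G) (q \<circ> c) (edge_word G (edge_list G) @ legs G)) * (sg (vsign G c) :: 'k))"
    by (simp only: sg_add mult.assoc)
  show ?thesis
    using arg_cong[OF s, of "\<lambda>z. z * (det_factor d G bs (edge_list G) * wprod G (edge_list G) (c(f := a)) * M a (c f) * V)"]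
    by (simp only: f fst_conv amp_def ac_simps)
qed simp

text \<open>The edges precede the legs in the word and have parity \<open>d\<close> each, which
  cancels the factor \<open>d * of_nat (length (edge_list G))\<close>. What remains is the sign of
  the legs before the \<open>l\<close>-th one, as in \<open>deriv\<close>.\<close>

lemma flag_term_leg:
  assumes "wf_graph G" "connected_graph G" "length bs = det_rank TYPE('k) d G"
    and l: "l < length (legs G)" "length js = length (legs G)" "set js \<subseteq> {..<N}"
  shows "flag_term G bs xs js (legs G ! l)
    = (\<Sum>k<N. sg (sum_list (map q (take l js))) * M (js ! l) k * contract G bs xs (js[l := k]))"
proof -
  interpret graph_wf G by unfold_locales (rule assms)
  let ?f = "legs G ! l" and ?es = "edge_list G"
  have f: "?f \<in> flags G" "ginv G ?f = ?f" using l set_legs nth_mem by blast+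
  have legs: "legs G = take l (legs G) @ ?f # drop (Suc l) (legs G)" using l by (simp add: id_take_nth_drop)
  have upd: "map (c(?f := k)) (legs G) = (map c (legs G))[l := k]" for c k
    by (rule nth_equalityI) (use l distinct_legs in \<open>auto simp: nth_list_update nth_eq_iff_index_eq\<close>)
  have es: "?f \<noteq> f' \<and> ?f \<noteq> ginv G f'" if "f' \<in> set ?es" for f'
    using edge_repsD(2)[OF edge_reps_edge_list that] f(2) by (metis ginv_ginv)
  have wp: "wprod G ?es (c(?f := k)) = wprod G ?es c" for c k
  proof -
    have "map (\<lambda>f. w ((c(?f := k)) f) ((c(?f := k)) (ginv G f))) ?es = map (\<lambda>f. w (c f) (c (ginv G f))) ?es"
    proof (rule map_cong[OF refl])
      fix f' assume "f' \<in> set ?es"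
      then have "f' \<noteq> ?f" "ginv G f' \<noteq> ?f" using es[of f'] by auto
      then show "w ((c(?f := k)) f') ((c(?f := k)) (ginv G f')) = w (c f') (c (ginv G f'))" by simp
    qed
    then show ?thesis unfolding wprod_def by (rule arg_cong)
  qed
  have "flag_term G bs xs js ?f = (\<Sum>k<N. \<Sum>c\<in>legs_assigns G js.
     sg (of_nat (length bs) + d * of_nat (fst ?f) + below_par G ?f c) * amp G bs ?es c *
     sg (vsign G c) * M (c ?f) k * vcoeff G xs (c(?f := k)))"
    unfolding flag_term_def by (rule sum.swap)
  \<comment> \<open>The summation variable becomes the assignment with the value \<open>k\<close> at
    the leg, which is the one the decorations see.\<close>
  also have "\<dots> = (\<Sum>k<N. \<Sum>c\<in>legs_assigns G (js[l := k]).
     sg (of_nat (length bs) + d * of_nat (fst ?f) + below_par G ?f (c(?f := js ! l))) * amp G bs ?es (c(?f := js ! l)) *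
     sg (vsign G (c(?f := js ! l))) * M (js ! l) k * vcoeff G xs c)"
  proof (rule sum.cong[OF refl])
    fix k assume k: "k \<in> {..<N}"
    have val: "c ?f = js ! l" if "map c (legs G) = js" for c
      using that l by (metis nth_map)
    have N: "js ! l < N" using l by (metis lessThan_iff nth_mem subsetD)
    have up: "c(?f := b) \<in> assigns G" if "c \<in> assigns G" "b < N" for c b
      using that f(1) unfolding assigns_def by (auto simp: PiE_def extensional_def)
    show "(\<Sum>c\<in>legs_assigns G js.
         sg (of_nat (length bs) + d * of_nat (fst ?f) + below_par G ?f c) * amp G bs ?es c *
         sg (vsign G c) * M (c ?f) k * vcoeff G xs (c(?f := k)))
      = (\<Sum>c\<in>legs_assigns G (js[l := k]).
         sg (of_nat (length bs) + d * of_nat (fst ?f) + below_par G ?f (c(?f := js ! l))) * amp G bs ?es (c(?f := js ! l)) *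
         sg (vsign G (c(?f := js ! l))) * M (js ! l) k * vcoeff G xs c)"
    proof (rule sum.reindex_bij_witness[of _ "\<lambda>c. c(?f := js ! l)" "\<lambda>c. c(?f := k)"])
      fix c assume c: "c \<in> legs_assigns G js"
      show "(c(?f := k))(?f := js ! l) = c" using val[of c] c by auto
      show "c(?f := k) \<in> legs_assigns G (js[l := k])" using c k up by (simp add: upd)
    next
      fix c assume c: "c \<in> legs_assigns G (js[l := k])"
      have "c ?f = k" using c l by (metis (mono_tags, lifting) mem_Collect_eq nth_list_update_eq nth_map)
      then show "(c(?f := js ! l))(?f := k) = c" by auto
      show "c(?f := js ! l) \<in> legs_assigns G js" using c N up l by (simp add: upd)
    next
      fix c assume c: "c \<in> legs_assigns G js"
      then have "(c(?f := k))(?f := js ! l) = c" using val[of c] by auto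
      then show "sg (of_nat (length bs) + d * of_nat (fst ?f) + below_par G ?f ((c(?f := k))(?f := js ! l))) *
         amp G bs ?es ((c(?f := k))(?f := js ! l)) *
         sg (vsign G ((c(?f := k))(?f := js ! l))) * M (js ! l) k * vcoeff G xs (c(?f := k))
       = sg (of_nat (length bs) + d * of_nat (fst ?f) + below_par G ?f c) * amp G bs ?es c *
         sg (vsign G c) * M (c ?f) k * vcoeff G xs (c(?f := k))"
        using val[of c] c by simp
    qed
  qed
  also have "\<dots> = (\<Sum>k<N. \<Sum>c\<in>legs_assigns G (js[l := k]).
     sg (sum_list (map q (take l js))) * M (js ! l) k * (amp G bs ?es c * sg (vsign G c) * vcoeff G xs c))"
  proof (intro sum.cong refl)
    fix k c assume k: "k \<in> {..<N}" and c: "c \<in> legs_assigns G (js[l := k])"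
    have N: "js ! l < N" using l by (metis lessThan_iff nth_mem subsetD)
    have cf: "c ?f = k" using c l by (metis (mono_tags, lifting) mem_Collect_eq nth_list_update_eq nth_map)
    have L: "edge_word G ?es @ legs G = (edge_word G ?es @ take l (legs G)) @ ?f # drop (Suc l) (legs G)"
      using legs by simp
    have tk: "map c (take l (legs G)) = take l js"
      using c by (metis (mono_tags, lifting) mem_Collect_eq order_refl take_map take_update_cancel)
    note eq = flag_term_eq[OF assms(1-3) _ N f(1) L, of c "vcoeff G xs c"]
    show "sg (of_nat (length bs) + d * of_nat (fst ?f) + below_par G ?f (c(?f := js ! l))) * amp G bs ?es (c(?f := js ! l)) *
         sg (vsign G (c(?f := js ! l))) * M (js ! l) k * vcoeff G xs c
      = sg (sum_list (map q (take l js))) * M (js ! l) k * (amp G bs ?es c * sg (vsign G c) * vcoeff G xs c)"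
    proof (cases "wprod G ?es c = 0")
      case True
      then show ?thesis using eq c by (simp add: wp amp_def cf)
    next
      case False
      then have "sum_list (map (q \<circ> c) (edge_word G ?es)) = d * of_nat (length ?es)"
        using c edge_reps_edge_list by (intro edge_word_par[OF assms(1)]) (auto simp: edge_reps_def)
      moreover have "sum_list (map (q \<circ> c) (take l (legs G))) = sum_list (map q (take l js))"
        by (simp flip: tk)
      ultimately show ?thesis using eq c by (simp add: wp amp_def cf ac_simps)
    qed
  qed
  also have "\<dots> = (\<Sum>k<N. sg (sum_list (map q (take l js))) * M (js ! l) k * contract G bs xs (js[l := k]))"
  proof (rule sum.cong[OF refl])
    fix k assume "k \<in> {..<N}"
    then have "set (js[l := k]) \<subseteq> {..<N}" using l set_update_subset_insert[of js l k] by auto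
    then show "(\<Sum>c\<in>legs_assigns G (js[l := k]).
        sg (sum_list (map q (take l js))) * M (js ! l) k * (amp G bs ?es c * sg (vsign G c) * vcoeff G xs c))
      = sg (sum_list (map q (take l js))) * M (js ! l) k * contract G bs xs (js[l := k])"
      using l by (simp add: contract_def sum_distrib_left)
  qed
  finally show ?thesis .
qed

text \<open>The differentials of the two ends of an edge cancel by \<open>w_M\<close>; the sign
  there is that of moving past the first end.\<close>

lemma flag_term_edge:
  assumes "wf_graph G" "connected_graph G" "length bs = det_rank TYPE('k) d G" "f \<in> set (edge_list G)"
  shows "flag_term G bs xs js f + flag_term G bs xs js (ginv G f) = 0"
proof -
  interpret graph_wf G by unfold_locales (rule assms)
  let ?es = "edge_list G" and ?g = "ginv G f"
  obtain as ds where es: "?es = as @ f # ds" using assms(4) by (meson split_list)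
  have f: "f \<in> flags G" "?g \<noteq> f" "?g \<in> flags G"
    using edge_repsD[OF edge_reps_edge_list assms(4)] by simp_all
  have dist: "distinct (edge_word G (as @ f # ds))" using distinct_edge_word[OF edge_reps_edge_list] es by simp
  have shift: "flag_term G bs xs js h = (\<Sum>c\<in>legs_assigns G js. \<Sum>a<N.
     sg (of_nat (length bs) + d * of_nat (fst h) + below_par G h (c(h := a))) * amp G bs ?es (c(h := a)) *
     sg (vsign G (c(h := a))) * M a (c h) * vcoeff G xs c)" if h: "h \<in> {f, ?g}" for h
  proof -
    have hl: "h \<notin> set (legs G)"
    proof
      assume "h \<in> set (legs G)"
      then have "ginv G h = h" using set_legs by blast
      then show False using h f(2) by (metis ginv_ginv insertE singletonD)
    qed
    have hf: "h \<in> flags G" using h f by blast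
    have up: "c(h := b) \<in> legs_assigns G js" if "c \<in> legs_assigns G js" "b < N" for c b
    proof -
      have "map (c(h := b)) (legs G) = map c (legs G)" using hl by simp
      then show ?thesis using that hf unfolding assigns_def by (auto simp: PiE_def extensional_def simp del: map_eq_conv)
    qed
    let ?H = "\<lambda>c k. sg (of_nat (length bs) + d * of_nat (fst h) + below_par G h c) * amp G bs ?es c *
     sg (vsign G c) * M (c h) k * vcoeff G xs (c(h := k))"
    have "flag_term G bs xs js h = (\<Sum>(c, k)\<in>legs_assigns G js \<times> {..<N}. ?H c k)"
      by (simp add: flag_term_def sum.cartesian_product)
    \<comment> \<open>The involution exchanges the value of the assignment at \<open>h\<close> with
      the inner summation index.\<close>
    also have "\<dots> = (\<Sum>(c, a)\<in>legs_assigns G js \<times> {..<N}. ?H (c(h := a)) (c h))"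
      by (rule sum.reindex_bij_witness[of _ "\<lambda>(c, a). (c(h := a), c h)" "\<lambda>(c, a). (c(h := a), c h)"])
        (use up assigns_less[OF _ hf] in \<open>auto simp del: map_eq_conv\<close>)
    finally show ?thesis by (simp add: sum.cartesian_product)
  qed
  have "(\<Sum>a<N. sg (of_nat (length bs) + d * of_nat (fst f) + below_par G f (c(f := a))) * amp G bs ?es (c(f := a)) *
     sg (vsign G (c(f := a))) * M a (c f) * vcoeff G xs c)
   + (\<Sum>a<N. sg (of_nat (length bs) + d * of_nat (fst ?g) + below_par G ?g (c(?g := a))) * amp G bs ?es (c(?g := a)) *
     sg (vsign G (c(?g := a))) * M a (c ?g) * vcoeff G xs c) = 0" if c: "c \<in> legs_assigns G js" for c
  proof -
    let ?K = "sg (d * of_nat (length ?es) + sum_list (map (q \<circ> c) (edge_word G as))) * det_factor d G bs ?es *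
      sg (winv (flag_pos G) (q \<circ> c) (edge_word G ?es @ legs G)) * sg (vsign G c) * vcoeff G xs c *
      (wprod G as c * wprod G ds c)"
    have other: "wprod G cs (c(h := a)) = wprod G cs c" if "h \<in> {f, ?g}" "cs = as \<or> cs = ds" for h cs a
    proof -
      have "h \<notin> set (edge_word G cs)" using dist that by auto
      then have "map (\<lambda>f. w ((c(h := a)) f) ((c(h := a)) (ginv G f))) cs = map (\<lambda>f. w (c f) (c (ginv G f))) cs"
        by (auto simp: set_edge_word)
      then show ?thesis unfolding wprod_def by (rule arg_cong)
    qed
    have 1: "sg (of_nat (length bs) + d * of_nat (fst f) + below_par G f (c(f := a))) * amp G bs ?es (c(f := a)) *
       sg (vsign G (c(f := a))) * M a (c f) * vcoeff G xs c = ?K * (w a (c ?g) * M a (c f))" if "a < N" for a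
      using flag_term_eq[OF assms(1-3) _ that f(1), of c "edge_word G as" "?g # edge_word G ds @ legs G" "vcoeff G xs c"] c f(2)
      by (simp add: es other ac_simps)
    have 2: "sg (of_nat (length bs) + d * of_nat (fst ?g) + below_par G ?g (c(?g := a))) * amp G bs ?es (c(?g := a)) *
       sg (vsign G (c(?g := a))) * M a (c ?g) * vcoeff G xs c = ?K * (sg (q (c f)) * (w (c f) a * M a (c ?g)))" if "a < N" for a
      using flag_term_eq[OF assms(1-3) _ that f(3), of c "edge_word G as @ [f]" "edge_word G ds @ legs G" "vcoeff G xs c"] c f(2)
      by (simp add: es other sg_add ac_simps)
    have "(\<Sum>a<N. ?K * (w a (c ?g) * M a (c f))) + (\<Sum>a<N. ?K * (sg (q (c f)) * (w (c f) a * M a (c ?g)))) =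
      ?K * ((\<Sum>a<N. w a (c ?g) * M a (c f)) + sg (q (c f)) * (\<Sum>a<N. w (c f) a * M a (c ?g)))"
      by (simp only: sum_distrib_left distrib_left)
    also have "\<dots> = 0"
    proof -
      have "c f < N" "c ?g < N" using c f assigns_less by blast+
      then show ?thesis by (simp only: w_M mult_zero_right)
    qed
    finally have "(\<Sum>a<N. ?K * (w a (c ?g) * M a (c f))) + (\<Sum>a<N. ?K * (sg (q (c f)) * (w (c f) a * M a (c ?g)))) = 0" .
    moreover note sum.cong[OF refl 1, of "{..<N}" "\<lambda>a. a"] sum.cong[OF refl 2, of "{..<N}" "\<lambda>a. a"]
    ultimately show ?thesis by (simp only: lessThan_iff)
  qed
  then show ?thesis
    by (simp add: shift sum.distrib[symmetric])
qed

text \<open>Sorted by flags, the terms of the two ends of every edge cancel, and those of the legs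
  make up the differential of the contraction.\<close>

lemma deriv_contract:
  assumes "wf_graph G" "connected_graph G" "length bs = det_rank TYPE('k) d G"
    and "\<And>i. i < length (verts G) \<Longrightarrow> supported (snd (verts G ! i)) (ps ! i) (xs ! i)"
    and "length xs = length (verts G)" "length ps = length (verts G)"
  shows "deriv (contract G bs xs) js = (\<Sum>i<length (verts G). sg (of_nat (length bs) + sum_list (take i ps)) *
      contract G bs (xs[i := deriv (xs ! i)]) js)"
proof (cases "length js = length (legs G) \<and> set js \<subseteq> {..<N}")
  case False
  then show ?thesis by (auto simp: deriv_def contract_def)
next
  case True
  interpret graph_wf G by unfold_locales (rule assms)
  let ?T = "flag_term G bs xs js"
  have "(\<Sum>f\<in>flags G. ?T f) = (\<Sum>f\<leftarrow>edge_word G (edge_list G) @ legs G. ?T f)"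
    unfolding sum_flag_list[symmetric] using mset_edge_word(1)[OF edge_reps_edge_list]
    by (metis sum_list_map_mset)
  also have "\<dots> = (\<Sum>f\<leftarrow>edge_word G (edge_list G). ?T f) + (\<Sum>f\<leftarrow>legs G. ?T f)" by simp
  also have "(\<Sum>f\<leftarrow>edge_word G (edge_list G). ?T f) = 0"
  proof -
    have "(\<Sum>f\<leftarrow>edge_word G es. ?T f) = 0" if "set es \<subseteq> set (edge_list G)" for es
      using that
    proof (induction es)
      case (Cons f es)
      then show ?case using flag_term_edge[OF assms(1-3), of f xs js] by (simp add: add.assoc[symmetric])
    qed simp
    then show ?thesis by blast
  qed
  also have "(\<Sum>f\<leftarrow>legs G. ?T f) = (\<Sum>l<length (legs G). ?T (legs G ! l))" by (rule sum_list_nth_sum)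
  also have "\<dots> = deriv (contract G bs xs) js"
    using True by (simp add: deriv_def flag_term_leg[OF assms(1-3)])
  finally show ?thesis using sum_contract_deriv[OF assms(4-6)] True by simp
qed

end

section \<open>Relabelling the legs and the action of the symmetric groups\<close>

lemma perm_upt:
  assumes "\<sigma> permutes {..<n}"
  shows "distinct (map \<sigma> [0..<n])" "set (map \<sigma> [0..<n]) = {..<n}" "mset (map \<sigma> [0..<n]) = mset [0..<n]"
proof -
  show d: "distinct (map \<sigma> [0..<n])"
    using permutes_inj_on[OF assms] by (simp add: distinct_map)
  show s: "set (map \<sigma> [0..<n]) = {..<n}"
    using permutes_image[OF assms] by (simp add: lessThan_atLeast0)
  show "mset (map \<sigma> [0..<n]) = mset [0..<n]"
    using set_eq_iff_mset_eq_distinct[OF d distinct_upt[of 0 n]] s by (simp add: lessThan_atLeast0)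
qed

lemma mset_permute_nth:
  assumes "\<sigma> permutes {..<length js}"
  shows "mset (map (\<lambda>j. js ! \<sigma> j) [0..<length js]) = mset js"
proof -
  have "map (\<lambda>j. js ! \<sigma> j) [0..<length js] = map ((!) js) (map \<sigma> [0..<length js])" by simp
  then have "mset (map (\<lambda>j. js ! \<sigma> j) [0..<length js]) = image_mset ((!) js) (mset (map \<sigma> [0..<length js]))"
    by (metis mset_map)
  also have "\<dots> = mset (map ((!) js) [0..<length js])"
    unfolding perm_upt(3)[OF assms] by (rule mset_map[symmetric])
  finally show ?thesis unfolding map_nth .
qed

lemma nth_less: "set js \<subseteq> {..<N} \<Longrightarrow> j < length js \<Longrightarrow> js ! j < N"
  using nth_mem by blast

text \<open>The cocycle property of Koszul signs, from \<open>winv_change_rank\<close> with the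
  ranks \<sigma> and \<open>\<tau> \<circ> \<sigma>\<close>: the word of preimages under \<sigma> is
  sorted for the first rank, and renaming its letters by \<sigma> gives the sign of \<tau>.\<close>

lemma koszul_compose:
  assumes "\<sigma> permutes {..<n}" "\<tau> permutes {..<n}"
  shows "koszul n (\<tau> \<circ> \<sigma>) p = koszul n \<tau> (p \<circ> inv_into UNIV \<sigma>) * (koszul n \<sigma> p :: 'k::ring_1)"
proof -
  let ?ys = "map (inv_into UNIV \<sigma>) [0..<n]"
  note \<sigma>' = permutes_inv[OF assms(1)]
  have st: "\<sigma> \<circ> inv_into UNIV \<sigma> = id" using permutes_inv_o[OF assms(1)] by simp
  have "winv (\<tau> \<circ> \<sigma>) p [0..<n] + winv (\<tau> \<circ> \<sigma>) p ?ys = winv \<sigma> p [0..<n] + winv \<sigma> p ?ys"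
    by (rule winv_change_rank)
      (use perm_upt(3)[OF \<sigma>'] permutes_inj_on[OF assms(1)] permutes_inj_on[OF permutes_compose[OF assms]] in simp_all)
  moreover have "winv \<sigma> p ?ys = 0"
    by (rule winv_sorted) (simp add: comp_assoc[symmetric] st)
  moreover have "winv (\<tau> \<circ> \<sigma>) p ?ys = winv \<tau> (p \<circ> inv_into UNIV \<sigma>) [0..<n]"
    by (simp add: winv_map comp_assoc st)
  ultimately have "winv (\<tau> \<circ> \<sigma>) p [0..<n] = winv \<tau> (p \<circ> inv_into UNIV \<sigma>) [0..<n] + winv \<sigma> p [0..<n]"
    by (simp add: bit_add_eq_move)
  then show ?thesis by (simp add: koszul_upt sg_add)
qed

lemma koszul_cong:
  assumes "\<And>i. i < n \<Longrightarrow> p i = p' i" "\<And>i. i < n \<Longrightarrow> \<pi> i = \<pi>' i"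
  shows "koszul n \<pi> p = koszul n \<pi>' p'"
  unfolding koszul_double_sum by (intro arg_cong[where f = sg] sum.cong) (use assms in auto)

context pairing
begin

lemma supportedD:
  assumes "supported n p x" "x js \<noteq> 0"
  shows "length js = n" "set js \<subseteq> {..<N}" "d + sum_list (map q js) = p"
  using assms unfolding supported_def by blast+

definition perm_act :: "(nat \<Rightarrow> nat) \<Rightarrow> (nat list \<Rightarrow> 'k) \<Rightarrow> nat list \<Rightarrow> 'k" where
  "perm_act \<sigma> x is = (let js = map (\<lambda>j. is ! \<sigma> j) [0..<length is]
     in koszul (length is) \<sigma> (\<lambda>j. q (js ! j)) * x js)"

text \<open>The two graphs have the same edges, lifts and assignments; only the last part of the
  word, the legs, is rearranged, and this is the Koszul sign in \<open>perm_act\<close>.\<close>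

lemma contract_relabel:
  assumes "wf_graph G" "wf_graph G'" "relabelled G \<tau> G'" "\<tau> permutes {..<length (legs G)}"
  shows "contract G' bs xs = perm_act \<tau> (contract G bs xs)"
proof
  fix js
  interpret graph_wf G by unfold_locales (rule assms)
  let ?n = "length (legs G)"
  have G': "G' = G\<lparr>legs := legs G'\<rparr>" and len: "length (legs G') = ?n"
    and lg: "\<And>l. l < ?n \<Longrightarrow> legs G' ! \<tau> l = legs G ! l"
    using assms(3) unfolding relabelled_def by (auto intro: graph.equality)
  have same: "verts G' = verts G" "ginv G' = ginv G" using assms(3) unfolding relabelled_def by auto
  have fl: "flags G' = flags G" "flag_pos G' = flag_pos G" "flag_list G' = flag_list G"
    by (simp_all add: flags_def flag_pos_def flag_list_def same)
  have edges: "edge_list G' = edge_list G" "edge_word G' = edge_word G"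
    by (simp_all add: edge_list_def edge_word_def fl same fun_eq_iff)
  have lift: "lift_vertex G' = (lift_vertex G :: nat \<Rightarrow> flag \<Rightarrow> 'k)"
    by (simp add: lift_vertex_def chains1_def bdry_def fl same fun_eq_iff)
  have fac: "det_factor d G' bs = det_factor d G bs" "assigns G' = assigns G" "wprod G' = wprod G"
    "vsign G' = vsign G" "vcoeff G' xs = vcoeff G xs"
    by (simp_all add: det_factor_def assigns_def wprod_def vsign_def vpar_def vcoeff_def fl same lift fun_eq_iff)
  show "contract G' bs xs js = perm_act \<tau> (contract G bs xs) js"
  proof (cases "length js = ?n \<and> set js \<subseteq> {..<N}")
    case False
    have "length js = ?n \<Longrightarrow> set (map (\<lambda>j. js ! \<tau> j) [0..<?n]) = set js"
      using mset_eq_setD[OF mset_permute_nth[of \<tau> js]] assms(4) by simp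
    then show ?thesis using False by (auto simp: contract_def perm_act_def Let_def len)
  next
    case True
    let ?js = "map (\<lambda>j. js ! \<tau> j) [0..<?n]"
    have in_n: "\<tau> l < ?n \<longleftrightarrow> l < ?n" for l using permutes_in_image[OF assms(4), of l] by simp
    have js': "set ?js \<subseteq> {..<N}" using True in_n nth_less[of js N] by auto
    have leg_eq: "map c (legs G') = js \<longleftrightarrow> map c (legs G) = ?js" for c
    proof
      assume a: "map c (legs G') = js"
      show "map c (legs G) = ?js"
      proof (rule nth_equalityI)
        fix l assume "l < length (map c (legs G))"
        then have "l < ?n" by simp
        then show "map c (legs G) ! l = ?js ! l"
          using a lg[of l] in_n[of l] len by (simp add: a[symmetric])
      qed simp
    next
      assume a: "map c (legs G) = ?js"
      show "map c (legs G') = js"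
      proof (rule nth_equalityI)
        fix m assume "m < length (map c (legs G'))"
        then obtain l where l: "m = \<tau> l" "l < ?n"
          using len in_n permutes_surj[OF assms(4)] by (metis length_map surjD)
        then have "map c (legs G) ! l = ?js ! l" using a by simp
        then show "map c (legs G') ! m = js ! m" using l lg[of l] in_n[of l] len by simp
      qed (use len True in simp)
    qed
    have mset_legs: "mset (legs G) = mset (legs G')"
    proof -
      have "distinct (legs G')" "set (legs G') = set (legs G)"
        using assms(1,2) unfolding wf_graph_def by (auto simp: fl same)
      then show ?thesis by (simp add: set_eq_iff_mset_eq_distinct[symmetric])
    qed
    have sign: "winv (flag_pos G) (q \<circ> c) (edge_word G (edge_list G) @ legs G')
      = winv (flag_pos G) (q \<circ> c) (edge_word G (edge_list G) @ legs G) + winv \<tau> (\<lambda>j. q (?js ! j)) [0..<?n]"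
      if c: "map c (legs G) = ?js" for c
    proof -
      \<comment> \<open>Ranking the legs by their new label sorts \<open>legs G'\<close>, and the
        old list then has the inversions of \<tau>.\<close>
      define r where "r = inv_into {..<?n} ((!) (legs G'))"
      have inj: "inj_on ((!) (legs G')) {..<?n}"
        using assms(2) len unfolding wf_graph_def by (auto intro: inj_on_nth)
      have r: "r (legs G' ! m) = m" if "m < ?n" for m
        unfolding r_def using inv_into_f_f[OF inj] that by simp
      have "inj_on r (set (legs G'))"
        by (rule inj_onI) (metis in_set_conv_nth len r)
      moreover have "set (legs G') = set (legs G)" using mset_legs by (metis mset_eq_setD)
      ultimately have "winv (flag_pos G) (q \<circ> c) (legs G) + winv (flag_pos G) (q \<circ> c) (legs G')
        = winv r (q \<circ> c) (legs G) + winv r (q \<circ> c) (legs G')"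
        using set_legs by (intro winv_change_rank mset_legs distinct_legs) (auto intro: inj_on_subset[OF inj_flag_pos])
      also have "winv r (q \<circ> c) (legs G') = 0"
      proof (rule winv_sorted)
        have "map r (legs G') = [0..<?n]" by (rule nth_equalityI) (use len r in auto)
        then show "sorted (map r (legs G'))" by simp
      qed
      also have "winv r (q \<circ> c) (legs G) = winv \<tau> (\<lambda>j. q (?js ! j)) [0..<?n]"
      proof -
        have "r (legs G ! l) = \<tau> l" "c (legs G ! l) = ?js ! l" if "l < ?n" for l
          using that r[of "\<tau> l"] lg[of l] in_n[of l] nth_map[of l "legs G" c] by (simp_all only: c)
        then show ?thesis unfolding winv_double_sum by (intro sum.cong) auto
      qed
      finally show ?thesis
        using winv_append_mset[OF mset_legs, of "flag_pos G" "q \<circ> c" "edge_word G (edge_list G)"]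
        by (simp add: bit_add_eq_move comp_def ac_simps)
    qed
    have "contract G' bs xs js = (\<Sum>c\<in>{c \<in> assigns G. map c (legs G) = ?js}.
        amp G' bs (edge_list G) c * sg (vsign G c) * vcoeff G xs c)"
      using True len by (simp add: contract_def leg_eq fac edges del: map_eq_conv)
    also have "\<dots> = (\<Sum>c\<in>{c \<in> assigns G. map c (legs G) = ?js}.
        koszul ?n \<tau> (\<lambda>j. q (?js ! j)) * (amp G bs (edge_list G) c * sg (vsign G c) * vcoeff G xs c))"
      by (rule sum.cong) (simp_all add: amp_def fac edges fl sign koszul_upt sg_add ac_simps del: map_eq_conv)
    also have "\<dots> = perm_act \<tau> (contract G bs xs) js"
      using True js' by (simp add: perm_act_def contract_def sum_distrib_left Let_def del: map_eq_conv)
    finally show ?thesis .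
  qed
qed

lemma perm_act_id: "supported n p x \<Longrightarrow> perm_act id x = x"
  by (rule ext) (simp add: perm_act_def map_nth koszul_upt winv_sorted)

lemma perm_act_compose:
  assumes "supported n p x" "\<sigma> permutes {..<n}" "\<tau> permutes {..<n}"
  shows "perm_act \<tau> (perm_act \<sigma> x) = perm_act (\<tau> \<circ> \<sigma>) x"
proof
  fix js :: "nat list"
  show "perm_act \<tau> (perm_act \<sigma> x) js = perm_act (\<tau> \<circ> \<sigma>) x js"
  proof (cases "length js = n")
    case False
    then have "x ys = 0" if "length ys = length js" for ys
      using supportedD(1)[OF assms(1)] that by metis
    then show ?thesis by (simp add: perm_act_def Let_def)
  next
    case True
    have in_n: "\<sigma> l < n \<longleftrightarrow> l < n" for l using permutes_in_image[OF assms(2), of l] by simp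
    have inv: "inv_into UNIV \<sigma> l < n \<longleftrightarrow> l < n" "\<sigma> (inv_into UNIV \<sigma> l) = l" for l
      using permutes_in_image[OF permutes_inv[OF assms(2)], of l] permutes_inverses(1)[OF assms(2)] by simp_all
    let ?js1 = "map (\<lambda>j. js ! \<tau> j) [0..<n]"
    have 2: "map (\<lambda>j. ?js1 ! \<sigma> j) [0..<n] = map (\<lambda>j. js ! \<tau> (\<sigma> j)) [0..<n]"
      by (rule nth_equalityI) (simp_all add: in_n)
    have "koszul n (\<tau> \<circ> \<sigma>) (\<lambda>j. q (map (\<lambda>j. js ! \<tau> (\<sigma> j)) [0..<n] ! j))
      = koszul n \<tau> ((\<lambda>j. q (map (\<lambda>j. js ! \<tau> (\<sigma> j)) [0..<n] ! j)) \<circ> inv_into UNIV \<sigma>) *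
        (koszul n \<sigma> (\<lambda>j. q (map (\<lambda>j. js ! \<tau> (\<sigma> j)) [0..<n] ! j)) :: 'k)"
      by (rule koszul_compose[OF assms(2,3)])
    also have "koszul n \<tau> ((\<lambda>j. q (map (\<lambda>j. js ! \<tau> (\<sigma> j)) [0..<n] ! j)) \<circ> inv_into UNIV \<sigma>) = (koszul n \<tau> (\<lambda>j. q (?js1 ! j)) :: 'k)"
      by (rule koszul_cong) (simp_all add: inv)
    finally show ?thesis
      unfolding perm_act_def Let_def length_map length_upt diff_zero True 2 comp_apply
      by (simp only: mult.assoc)
  qed
qed

lemma supported_perm_act:
  assumes "supported n p x" "\<sigma> permutes {..<n}"
  shows "supported n p (perm_act \<sigma> x)"
  unfolding supported_def
proof (intro allI impI)
  fix js assume nz: "perm_act \<sigma> x js \<noteq> 0"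
  let ?js = "map (\<lambda>j. js ! \<sigma> j) [0..<length js]"
  have "x ?js \<noteq> 0" using nz by (simp add: perm_act_def Let_def)
  note js = supportedD[OF assms(1) this]
  have m: "mset ?js = mset js" by (rule mset_permute_nth) (use js(1) assms(2) in simp)
  show "length js = n \<and> set js \<subseteq> {..<N} \<and> d + sum_list (map q js) = p"
    using js(1) js(2,3)[unfolded mset_eq_setD[OF m] sum_list_map_mset[OF m, of q]] by simp
qed

lemma perm_act_linear:
  "perm_act \<sigma> (\<lambda>is. x is + y is) = (\<lambda>is. perm_act \<sigma> x is + perm_act \<sigma> y is)"
  "perm_act \<sigma> (\<lambda>is. a * x is) = (\<lambda>is. a * perm_act \<sigma> x is)"
  by (simp_all add: fun_eq_iff perm_act_def Let_def distrib_left ac_simps)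

section \<open>Corollas\<close>

lemma corolla_flags: "flags (corolla g n) = {0} \<times> {..<n}" "flag_list (corolla g n) = map (Pair 0) [0..<n]"
  by (auto simp: flags_def corolla_def flag_list_def)

lemma corolla_wf: "wf_graph (corolla g n)" "connected_graph (corolla g n)"
  by (auto simp: wf_graph_def connected_graph_def corolla_flags)
    (auto simp: corolla_def permutes_id distinct_map inj_on_def)

lemma corolla_edges: "edge_list (corolla g n) = []"
  by (simp add: edge_list_def corolla_def)

lemma contract_corolla:
  assumes "supported n p x"
  shows "contract (corolla g n) [] [x] = x"
proof
  fix js
  show "contract (corolla g n) [] [x] js = x js"
  proof (cases "length js = n \<and> set js \<subseteq> {..<N}")
    case False
    then have "x js = 0" using assms unfolding supported_def by blast
    moreover have "contract (corolla g n) [] [x] js = 0" using False by (auto simp: contract_def corolla_def)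
    ultimately show ?thesis by simp
  next
    case True
    let ?G = "corolla g n" and ?c = "\<lambda>f\<in>{0 :: nat} \<times> {..<n}. js ! snd f"
    have legs: "legs ?G = map (Pair 0) [0..<n]" and len: "length (verts ?G) = 1" and snd: "snd (verts ?G ! 0) = n"
      by (simp_all add: corolla_def)
    have "{c \<in> assigns ?G. map c (legs ?G) = js} = {?c}"
    proof (intro equalityI subsetI)
      fix c assume c: "c \<in> {c \<in> assigns ?G. map c (legs ?G) = js}"
      then have "c (0, j) = js ! j" if "j < n" for j using that by (auto simp: legs)
      then show "c \<in> {?c}" using c
        by (auto simp: assigns_def corolla_flags PiE_def extensional_def fun_eq_iff restrict_def)
    next
      fix c assume "c \<in> {?c}"
      moreover have "map ?c (legs ?G) = js" by (rule nth_equalityI) (use True in \<open>auto simp: legs\<close>)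
      ultimately show "c \<in> {c \<in> assigns ?G. map c (legs ?G) = js}"
        using True nth_less[of js N] by (auto simp: assigns_def corolla_flags simp del: map_eq_conv)
    qed
    moreover have "amp ?G [] (edge_list ?G) ?c = 1"
      using sorted_flag_list[of ?G] by (simp add: amp_def corolla_edges det_factor_def legs corolla_flags winv_sorted)
    moreover have "vsign ?G ?c = 0" by (simp add: vsign_def len)
    moreover have "vcoeff ?G [x] ?c = x js"
    proof -
      have "map (\<lambda>j. ?c (0, j)) [0..<n] = js" by (rule nth_equalityI) (use True in auto)
      then show ?thesis by (simp add: vcoeff_def len snd)
    qed
    ultimately show ?thesis using True by (simp add: contract_def legs del: map_eq_conv)
  qed
qed

end

context dg_pairing
begin

lemma supported_deriv:
  assumes "supported n p x"
  shows "supported n (p + 1) (deriv x)"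
  unfolding supported_def
proof (intro allI impI)
  fix js assume nz: "deriv x js \<noteq> 0"
  then have js: "set js \<subseteq> {..<N}" by (auto simp: deriv_def split: if_splits)
  then obtain j k where jk: "j < length js" "k < N" "M (js ! j) k * x (js[j := k]) \<noteq> 0"
    using nz by (auto simp: deriv_def elim!: sum.not_neutral_contains_not_neutral)
  then have x: "length js = n" "d + sum_list (map q (js[j := k])) = p"
    using supportedD[OF assms, of "js[j := k]"] by auto
  have "q (js ! j) = q k + 1" using M_par[of "js ! j" k] jk nth_less[OF js] by auto
  moreover have "sum_list (map q (js[j := k])) = sum_list (map q js) + q (js ! j) + q k"
  proof -
    have "js = take j js @ js ! j # drop (Suc j) js" using jk by (simp add: id_take_nth_drop)
    then have "sum_list (map q js) = sum_list (map q (take j js)) + (q (js ! j) + sum_list (map q (drop (Suc j) js)))"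
      by (metis list.simps(9) map_append sum_list.Cons sum_list.append)
    then show ?thesis using jk by (simp add: upd_conv_take_nth_drop ac_simps)
  qed
  ultimately show "length js = n \<and> set js \<subseteq> {..<N} \<and> d + sum_list (map q js) = p + 1"
    using x js by (simp add: ac_simps) (simp add: bit_add_eq_move ac_simps)
qed

text \<open>The action of a permutation is the contraction along a corolla with permuted legs, so
  the claim is a case of \<open>deriv_contract\<close>.\<close>

lemma deriv_perm_act:
  assumes "supported n p x" "\<sigma> permutes {..<n}"
  shows "deriv (perm_act \<sigma> x) = perm_act \<sigma> (deriv x)"
proof -
  let ?G = "corolla 0 n"
  \<comment> \<open>The inverse appears because the flag \<open>(0, l)\<close> has to carry the
    label \<open>\<sigma> l\<close>.\<close>
  define G' where "G' = ?G\<lparr>legs := map (\<lambda>l. (0, inv_into UNIV \<sigma> l)) [0..<n]\<rparr>"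
  have inv: "inv_into UNIV \<sigma> permutes {..<n}" by (rule permutes_inv[OF assms(2)])
  have v: "verts G' = [(0, n)]" "ginv G' = id" "legs G' = map (\<lambda>l. (0, inv_into UNIV \<sigma> l)) [0..<n]"
    by (simp_all add: G'_def corolla_def)
  have fl: "flags G' = {0} \<times> {..<n}" by (auto simp: flags_def v)
  have wf: "wf_graph G'" "connected_graph G'"
  proof -
    have "distinct (map (\<lambda>l. (0::nat, inv_into UNIV \<sigma> l)) [0..<n])"
      using perm_upt(1)[OF inv] by (auto simp: distinct_map inj_on_def)
    moreover have "set (legs G') = {0} \<times> {..<n}" using perm_upt(2)[OF inv] by (auto simp: v)
    ultimately show "wf_graph G'" by (simp add: wf_graph_def fl v permutes_id)
    show "connected_graph G'" by (simp add: connected_graph_def v)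
  qed
  have rel: "relabelled ?G \<sigma> G'"
    using permutes_in_image[OF assms(2)] permutes_inverses(2)[OF assms(2)]
    by (simp add: relabelled_def v) (simp add: corolla_def)
  have act: "contract G' [] [y] = perm_act \<sigma> y" if "supported n p' y" for y p'
    using contract_relabel[OF corolla_wf(1) wf(1) rel, of "[]" "[y]"] contract_corolla[OF that] assms(2)
    by (simp add: corolla_def)
  note der = supported_deriv[OF assms(1)]
  have b0: "length ([] :: (flag \<Rightarrow> 'k) list) = det_rank TYPE('k) d G'"
  proof (cases "d = 0")
    case False
    interpret graph_conn G' by unfold_locales (use wf in auto)
    have "edge_list G' = []" by (simp add: edge_list_def v)
    then show ?thesis using betti_euler[OF edge_reps_edge_list, where ?'k = 'k] False by (simp add: det_rank_def v)
  qed (simp add: det_rank_def)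
  have "deriv (contract G' [] [x]) js = contract G' [] [deriv x] js" for js
    using deriv_contract[OF wf b0, of "[p]" "[x]" js] assms(1) by (simp add: v)
  then show ?thesis using act[OF assms(1)] act[OF der] by auto
qed

end

section \<open>Invariance under isomorphisms\<close>

lemma winv_concat:
  "winv r p (concat (map F [0..<n])) = (\<Sum>i<n. winv r p (F i)) + (\<Sum>b<n. \<Sum>a<b. wcross r p (F a) (F b))"
proof (induction n)
  case (Suc n)
  have "wcross r p (concat (map F [0..<m])) ys = (\<Sum>a<m. wcross r p (F a) ys)" for m ys
    by (induction m) (simp_all add: wcross_append_left)
  then show ?case using Suc by (simp add: winv_append ac_simps)
qed simp

lemma sum_pairs:
  fixes f :: "nat \<Rightarrow> nat \<Rightarrow> 'b::comm_monoid_add"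
  shows "(\<Sum>b<n. \<Sum>a<n. f a b) = (\<Sum>b<n. \<Sum>a<b. f a b + f b a) + (\<Sum>a<n. f a a)"
  by (induction n) (simp_all add: sum.distrib ac_simps)

lemma image_filter: "f ` {x \<in> A. P (f x)} = {y \<in> f ` A. P y}"
  by auto

lemma edge_reps_subset: "edge_reps G es \<Longrightarrow> set es \<subseteq> flags G"
  unfolding edge_reps_def by blast

locale graph_isomorphism = G: graph_conn G + G': graph_conn G' for G G' +
  fixes \<pi> :: "nat \<Rightarrow> nat" and \<rho> :: "nat \<Rightarrow> nat \<Rightarrow> nat"
  assumes iso: "graph_iso G G' \<pi> \<rho>"
begin

abbreviation "\<phi> \<equiv> flag_map \<pi> \<rho>"
abbreviation "n \<equiv> length (verts G)"
abbreviation "val i \<equiv> snd (verts G ! i)"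
abbreviation "\<sigma> \<equiv> inv_into UNIV \<pi>"

lemma iso_simps:
  shows len: "length (verts G') = n" and perm: "\<pi> permutes {..<n}"
    and vert: "i < n \<Longrightarrow> verts G' ! \<pi> i = verts G ! i" and perm_\<rho>: "i < n \<Longrightarrow> \<rho> i permutes {..<val i}"
    and ginv_\<phi>: "f \<in> flags G \<Longrightarrow> ginv G' (\<phi> f) = \<phi> (ginv G f)"
    and legs: "legs G' = map \<phi> (legs G)"
  using iso unfolding graph_iso_def by auto

lemma \<pi>_less [simp]: "\<pi> i < n \<longleftrightarrow> i < n"
  using permutes_in_image[OF perm, of i] by simp

lemma \<sigma>_less [simp]: "\<sigma> i < n \<longleftrightarrow> i < n"
  using permutes_in_image[OF permutes_inv[OF perm], of i] by simp

lemma \<pi>_\<sigma> [simp]: "\<pi> (\<sigma> i) = i" "\<sigma> (\<pi> i) = i"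
  using permutes_inverses[OF perm] by auto

lemma \<rho>_less [simp]: "i < n \<Longrightarrow> \<rho> i j < val i \<longleftrightarrow> j < val i"
  using permutes_in_image[OF perm_\<rho>, of i j] by simp

lemma \<phi>_Pair [simp]: "\<phi> (i, j) = (\<pi> i, \<rho> i j)"
  by (simp add: flag_map_def)

lemma \<phi>_flags: "f \<in> flags G \<Longrightarrow> \<phi> f \<in> flags G'"
  by (cases f) (simp add: flags_def len vert)

lemma bij_\<phi>: "bij_betw \<phi> (flags G) (flags G')"
  unfolding bij_betw_def
proof
  show "inj_on \<phi> (flags G)"
  proof (rule inj_onI)
    fix f f' assume f: "f \<in> flags G" "f' \<in> flags G" "\<phi> f = \<phi> f'"
    obtain i j i' j' where ff: "f = (i, j)" "f' = (i', j')" by fastforce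
    then have "i = i'" using f(3) \<pi>_\<sigma>(2) by (metis \<phi>_Pair fst_conv)
    moreover from this have "j = j'"
      using f ff permutes_inj_on[OF perm_\<rho>[of i]] by (auto simp: flags_def inj_on_def)
    ultimately show "f = f'" by (simp add: ff)
  qed
  show "\<phi> ` flags G = flags G'"
  proof (intro equalityI subsetI)
    fix f assume "f \<in> flags G'"
    then obtain i j where f: "f = (i, j)" "i < n" "j < snd (verts G' ! i)" by (auto simp: flags_def len)
    let ?i = "\<sigma> i" and ?j = "inv_into UNIV (\<rho> (\<sigma> i)) j"
    have i: "?i < n" using f by simp
    have "verts G' ! i = verts G ! ?i" using vert[OF i] by simp
    then have "?j < val ?i" using f(3) permutes_in_image[OF permutes_inv[OF perm_\<rho>[OF i]], of j] by simp
    moreover have "\<phi> (?i, ?j) = f" using permutes_inverses(1)[OF perm_\<rho>[OF i]] by (simp add: f)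
    ultimately show "f \<in> \<phi> ` flags G" using i by (intro image_eqI[of _ _ "(?i, ?j)"]) (simp_all add: flags_def)
  qed (use \<phi>_flags in auto)
qed

lemma \<phi>_eq: "f \<in> flags G \<Longrightarrow> f' \<in> flags G \<Longrightarrow> \<phi> f = \<phi> f' \<longleftrightarrow> f = f'"
  using bij_\<phi> unfolding bij_betw_def inj_on_def by blast

lemma edge_reps_map:
  assumes "edge_reps G es"
  shows "edge_reps G' (map \<phi> es)"
proof -
  have es: "set es \<subseteq> flags G" "distinct es" using assms unfolding edge_reps_def by blast+
  have mem: "\<phi> f \<in> \<phi> ` set es \<longleftrightarrow> f \<in> set es" if "f \<in> flags G" for f
    by (rule inj_on_image_mem_iff[of \<phi> "flags G"]) (use that es(1) bij_\<phi> in \<open>simp_all add: bij_betw_def\<close>)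
  have "distinct (map \<phi> es)"
    using es(2) inj_on_subset[OF bij_betw_imp_inj_on[OF bij_\<phi>] es(1)] by (simp add: distinct_map)
  moreover have "\<phi> f \<in> flags G' \<and> ginv G' (\<phi> f) \<noteq> \<phi> f" if "f \<in> set es" for f
    using edge_repsD[OF assms that] \<phi>_flags ginv_\<phi> \<phi>_eq by simp
  moreover have "(f' \<in> \<phi> ` set es) \<noteq> (ginv G' f' \<in> \<phi> ` set es)" if f': "f' \<in> flags G'" "ginv G' f' \<noteq> f'" for f'
  proof -
    obtain f where f: "f \<in> flags G" "f' = \<phi> f" using f'(1) bij_\<phi> unfolding bij_betw_def by blast
    then have "ginv G f \<noteq> f" using f'(2) ginv_\<phi> by auto
    then have "(f \<in> set es) \<noteq> (ginv G f \<in> set es)" using assms f(1) unfolding edge_reps_def by blast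
    then show ?thesis using f mem ginv_\<phi> by simp
  qed
  ultimately show ?thesis unfolding edge_reps_def set_map by blast
qed

lemma edge_word_map: "set es \<subseteq> flags G \<Longrightarrow> edge_word G' (map \<phi> es) = map \<phi> (edge_word G es)"
  by (induction es) (simp_all add: ginv_\<phi>)

abbreviation pull :: "(flag \<Rightarrow> 'k::field_char_0) \<Rightarrow> flag \<Rightarrow> 'k" where
  "pull \<equiv> pull_chain G \<phi>"

lemma pull_chains1: "c \<in> chains1 G' \<Longrightarrow> pull c \<in> chains1 G"
  unfolding chains1_def[of G] mem_Collect_eq
proof (intro conjI allI impI ballI)
  fix f assume "c \<in> chains1 G'" "f \<in> flags G"
  then show "pull c (ginv G f) = - pull c f"
    using G'.chain_ginv[of c "\<phi> f"] by (simp add: pull_chain_def ginv_\<phi>)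
qed (simp add: pull_chain_def)

lemma bdry_pull:
  assumes "i < n"
  shows "bdry G (pull c) i = bdry G' c (\<pi> i)"
proof -
  have "bdry G (pull c) i = (\<Sum>j<val i. c (\<pi> i, \<rho> i j))"
    unfolding bdry_def by (rule sum.cong) (use assms in \<open>auto simp: pull_chain_def flags_def\<close>)
  also have "\<dots> = (\<Sum>j<val i. c (\<pi> i, j))"
    by (rule sum.reindex_bij_betw) (rule permutes_imp_bij[OF perm_\<rho>[OF assms]])
  finally show ?thesis using assms by (simp add: bdry_def vert)
qed

lemma pull_H1: "c \<in> H1 G' \<Longrightarrow> pull c \<in> H1 G"
  by (simp add: H1_def len pull_chains1 bdry_pull)

lemma betti_iso: "betti TYPE('k::field_char_0) G' = betti TYPE('k) G"
  using G.betti_euler[OF G.edge_reps_edge_list, where ?'k = 'k]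
    G'.betti_euler[OF edge_reps_map[OF G.edge_reps_edge_list], where ?'k = 'k] len by simp

lemma det_args_pull: "det_args d G' bs \<Longrightarrow> det_args d G (map pull (bs :: (flag \<Rightarrow> 'k::field_char_0) list))"
  unfolding det_args_def det_rank_def using pull_H1 by (auto simp: betti_iso[where ?'k = 'k])

text \<open>A permutation and its inverse have the same Koszul exponent, when the parities are
  carried along.\<close>

lemma winv_\<sigma>: "winv id p (map \<sigma> [0..<n]) = winv \<pi> p [0..<n]"
proof -
  have "winv \<pi> p [0..<n] + winv \<pi> p (map \<sigma> [0..<n]) = winv id p [0..<n] + winv id p (map \<sigma> [0..<n])"
    by (rule winv_change_rank)
      (use perm_upt(3)[OF permutes_inv[OF perm]] permutes_inj_on[OF perm] in simp_all)
  moreover have "winv \<pi> p (map \<sigma> [0..<n]) = 0" by (rule winv_sorted) (simp add: comp_def)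
  moreover have "winv id p [0..<n] = 0" by (rule winv_sorted) simp
  ultimately show ?thesis by simp
qed

lemma det_factor_iso:
  fixes bs :: "(flag \<Rightarrow> 'k::field_char_0) list"
  assumes "det_args d G' bs" "edge_reps G es"
  shows "det_factor d G' bs (map \<phi> es) = koszul n \<pi> (\<lambda>_. d) * det_factor d G (map pull bs) es"
proof (cases "d = 0")
  case True
  then show ?thesis by (simp add: det_factor_def koszul_upt)
next
  case False
  then have d: "d = 1" by simp
  let ?z = "lift_vertex G :: nat \<Rightarrow> flag \<Rightarrow> 'k" and ?bs = "map pull bs"
  let ?F = "\<lambda>js. ldet (?bs @ map (\<lambda>j f. ?z j f - ?z (hd js) f) (tl js)) (rev es)"
  note args = det_args_pull[OF assms(1)]
  have len1: "length (?bs @ map ?z [1..<n]) = length es" by (rule G.length_det_rows[OF args d assms(2)])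
  have len2: "length bs + n = length es + 1"
    using len1 G.nv_pos unfolding length_append length_map length_upt by linarith
  note es = edge_reps_subset[OF assms(2)]
  have n: "[0..<n] = 0 # [1..<n]" using G.nv_pos by (simp add: upt_conv_Cons)
  have bs: "set ?bs \<subseteq> H1 G" "length ?bs = betti TYPE('k) G"
    using args d by (auto simp: det_args_def det_rank_def)
  have lift: "?z i \<in> chains1 G" "k < n \<Longrightarrow> bdry G (?z i) k = (if k = i then 1 else 0) - (if k = 0 then 1 else 0)"
    if "i < n" for i k
    by (simp_all add: G.lift_vertex that)
  have diff: "(\<lambda>f. ?z i f - ?z k f) \<in> chains1 G" if "i < n" "k < n" for i k
    using fs.subspace_diff[OF G.chains1_subspace lift(1)[OF that(1)] lift(1)[OF that(2)]]
    by (simp add: fun_diff_def)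
  have "det_factor d G' bs (map \<phi> es) = ldet (bs @ map (lift_vertex G') [1..<n]) (map \<phi> (rev es))"
    using d by (simp add: det_factor_def len rev_map)
  also have "\<dots> = ldet (map (\<lambda>r. r \<circ> \<phi>) (bs @ map (lift_vertex G') [1..<n])) (rev es)"
    by (rule ldet_map_cols) (use len1 in simp)
  also have "\<dots> = ldet (?bs @ map (\<lambda>j. pull (lift_vertex G' j)) [1..<n]) (rev es)"
    by (rule ldet_cong) (use len1 es in \<open>auto simp: nth_append pull_chain_def subset_iff\<close>)
  \<comment> \<open>Vertex \<open>j\<close> of \<open>G'\<close> is vertex \<open>\<sigma> j\<close>
    of \<open>G\<close>, so the pulled back lift has the boundary of this difference.\<close>
  also have "\<dots> = ldet (?bs @ map (\<lambda>j f. ?z (\<sigma> j) f - ?z (\<sigma> 0) f) [1..<n]) (rev es)"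
  proof (rule G.ldet_lifts[OF bs])
    have "(\<lambda>f. pull (lift_vertex G' j) f - (?z (\<sigma> j) f - ?z (\<sigma> 0) f)) \<in> H1 G" if j: "1 \<le> j" "j < n" for j
    proof (rule G.same_bdry_diff)
      have l': "lift_vertex G' j \<in> chains1 G'" using G'.lift_vertex(1)[of j] j len by simp
      then show "pull (lift_vertex G' j) \<in> chains1 G" by (rule pull_chains1)
      show "(\<lambda>f. ?z (\<sigma> j) f - ?z (\<sigma> 0) f) \<in> chains1 G" by (rule diff) (use j G.nv_pos in auto)
      fix i assume i: "i < n"
      have "bdry G (pull (lift_vertex G' j)) i = (if \<pi> i = j then 1 else 0) - (if \<pi> i = 0 then 1 else 0 :: 'k)"
        unfolding bdry_pull[OF i] using G'.lift_vertex(2)[of j "\<pi> i", where ?'k = 'k] i j len by simp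
      also have "\<dots> = bdry G (?z (\<sigma> j)) i - bdry G (?z (\<sigma> 0)) i"
      proof -
        have "\<sigma> j < n" "\<sigma> 0 < n" using j G.nv_pos by auto
        moreover have "\<pi> i = k \<longleftrightarrow> i = \<sigma> k" for k using \<pi>_\<sigma> by metis
        ultimately show ?thesis using i lift(2)[of "\<sigma> j" i] lift(2)[of "\<sigma> 0" i] by simp
      qed
      finally show "bdry G (pull (lift_vertex G' j)) i = bdry G (\<lambda>f. ?z (\<sigma> j) f - ?z (\<sigma> 0) f) i"
        by (simp add: G.bdry_linear)
    qed
    then show "list_all2 (\<lambda>u v. (\<lambda>f. u f - v f) \<in> H1 G) (map (\<lambda>j. pull (lift_vertex G' j)) [1..<n])
        (map (\<lambda>j f. ?z (\<sigma> j) f - ?z (\<sigma> 0) f) [1..<n])"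
      by (auto simp: list_all2_conv_all_nth)
  qed (use len1 in simp)
  also have "\<dots> = ?F (map \<sigma> [0..<n])" by (simp add: n comp_def)
  also have "\<dots> = sg (winv id (\<lambda>_. 1) (map \<sigma> [0..<n])) * ?F [0..<n]"
  proof -
    have "sg (winv id (\<lambda>_. 1) (map \<sigma> [0..<n])) * ?F (map \<sigma> [0..<n]) = sg (winv id (\<lambda>_. 1) [0..<n]) * ?F [0..<n]"
      by (rule ldet_differences_perm)
        (use perm_upt[OF permutes_inv[OF perm]] len2 in simp_all)
    moreover have "winv id (\<lambda>_. 1) [0..<n] = 0" by (rule winv_sorted) simp
    ultimately have "sg (winv id (\<lambda>_. 1) (map \<sigma> [0..<n])) * ?F (map \<sigma> [0..<n]) = ?F [0..<n]" by simp
    from arg_cong[OF this, of "\<lambda>z. sg (winv id (\<lambda>_. 1) (map \<sigma> [0..<n])) * z"] show ?thesis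
      by (simp only: sg_square_left)
  qed
  also have "sg (winv id (\<lambda>_. 1) (map \<sigma> [0..<n])) = (koszul n \<pi> (\<lambda>_. d) :: 'k)"
    by (simp add: winv_\<sigma> koszul_upt d)
  also have "?F [0..<n] = ldet (?bs @ map (\<lambda>j f. ?z j f - ?z 0 f) [1..<n]) (rev es)"
    by (simp add: n)
  also have "\<dots> = det_factor d G ?bs es"
  proof -
    have "det_factor d G ?bs es = (if d = 0 then 1 else ldet (?bs @ map (\<lambda>j f. ?z j f - ?z 0 f) [1..<n]) (rev es))"
      by (rule G.det_factor_lifts[OF args assms(2)])
        (use diff lift(2) G.nv_pos in \<open>auto simp: G.bdry_linear\<close>)
    then show ?thesis using d by simp
  qed
  finally show ?thesis .
qed

end

section \<open>Contractions along isomorphic graphs\<close>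

locale pairing_iso = pairing d N q w + graph_isomorphism G G' \<pi> \<rho>
  for d N q and w :: "nat \<Rightarrow> nat \<Rightarrow> 'k::field_char_0" and G G' \<pi> \<rho>
begin

definition pull_assign :: "(flag \<Rightarrow> nat) \<Rightarrow> flag \<Rightarrow> nat" where
  "pull_assign c = (\<lambda>f\<in>flags G. c (\<phi> f))"

lemma pull_assign_apply: "f \<in> flags G \<Longrightarrow> pull_assign c f = c (\<phi> f)"
  by (simp add: pull_assign_def)

lemma bij_pull_assign: "bij_betw pull_assign (assigns G') (assigns G)"
proof (rule bij_betwI)
  let ?\<psi> = "inv_into (flags G) \<phi>"
  let ?push = "\<lambda>c. \<lambda>f\<in>flags G'. c (?\<psi> f)"
  have \<psi>: "?\<psi> f \<in> flags G" "\<phi> (?\<psi> f) = f" if "f \<in> flags G'" for f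
    using that bij_\<phi> by (auto simp: bij_betw_def inv_into_into f_inv_into_f)
  have \<psi>\<phi>: "?\<psi> (\<phi> f) = f" if "f \<in> flags G" for f
    using that bij_\<phi> by (simp add: bij_betw_def)
  show "pull_assign \<in> assigns G' \<rightarrow> assigns G"
    using \<phi>_flags by (auto simp: assigns_def pull_assign_def)
  show "?push \<in> assigns G \<rightarrow> assigns G'"
    using \<psi>(1) by (auto simp: assigns_def)
  fix c assume "c \<in> assigns G'"
  then show "?push (pull_assign c) = c"
    using \<psi> by (auto simp: assigns_def pull_assign_def PiE_def extensional_def fun_eq_iff restrict_def)
next
  let ?\<psi> = "inv_into (flags G) \<phi>"
  fix c assume "c \<in> assigns G"
  moreover have "?\<psi> (\<phi> f) = f" if "f \<in> flags G" for f
    using that bij_\<phi> by (simp add: bij_betw_def)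
  ultimately show "pull_assign (\<lambda>f\<in>flags G'. c (?\<psi> f)) = c"
    using \<phi>_flags by (auto simp: assigns_def pull_assign_def PiE_def extensional_def fun_eq_iff restrict_def)
qed

lemma vpar_iso: "i < n \<Longrightarrow> vpar G' c (\<pi> i) = vpar G (pull_assign c) i"
proof -
  assume i: "i < n"
  have "vpar G (pull_assign c) i = (\<Sum>j<val i. q (c (\<pi> i, \<rho> i j)))"
    unfolding vpar_def by (rule sum.cong) (use i in \<open>auto simp: pull_assign_def flags_def\<close>)
  also have "\<dots> = (\<Sum>j<val i. q (c (\<pi> i, j)))"
    by (rule sum.reindex_bij_betw) (rule permutes_imp_bij[OF perm_\<rho>[OF i]])
  finally show ?thesis using i by (simp add: vpar_def vert)
qed

text \<open>For a pair of vertices whose order is reversed, the symbol \<theta> of the other vertex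
  has to pass, so \<open>d\<close> times one parity is replaced by \<open>d\<close> times the
  other.\<close>

lemma vsign_iso:
  "vsign G' c = vsign G (pull_assign c) + (\<Sum>b<n. \<Sum>a<b. if \<pi> b < \<pi> a
     then d * vpar G (pull_assign c) a + d * vpar G (pull_assign c) b else 0)"
proof -
  let ?Q = "vpar G (pull_assign c)"
  have bij: "bij_betw \<pi> {..<n} {..<n}" by (rule permutes_imp_bij[OF perm])
  have "vsign G' c = (\<Sum>b<n. \<Sum>a<n. if a < b then d * vpar G' c a else 0)"
    unfolding vsign_def len by (rule sum.cong[OF refl], rule sum_lessThan_if[symmetric]) simp
  also have "\<dots> = (\<Sum>b<n. \<Sum>a<n. if a < \<pi> b then d * vpar G' c a else 0)"
    by (rule sum.reindex_bij_betw[OF bij, symmetric])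
  also have "\<dots> = (\<Sum>b<n. \<Sum>a<n. if \<pi> a < \<pi> b then d * vpar G' c (\<pi> a) else 0)"
    by (rule sum.cong[OF refl], rule sum.reindex_bij_betw[OF bij, symmetric])
  also have "\<dots> = (\<Sum>b<n. \<Sum>a<n. if \<pi> a < \<pi> b then d * ?Q a else 0)"
    by (intro sum.cong refl) (simp add: vpar_iso)
  also have "\<dots> = (\<Sum>b<n. \<Sum>a<b. (if \<pi> a < \<pi> b then d * ?Q a else 0) + (if \<pi> b < \<pi> a then d * ?Q b else 0))"
    by (subst sum_pairs) simp
  also have "\<dots> = (\<Sum>b<n. \<Sum>a<b. d * ?Q a + (if \<pi> b < \<pi> a then d * ?Q a + d * ?Q b else 0))"
  proof (intro sum.cong refl)
    fix a b assume "b \<in> {..<n}" "a \<in> {..<b}"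
    then have "\<pi> a \<noteq> \<pi> b" using \<pi>_\<sigma>(2) by (metis lessThan_iff less_irrefl)
    then show "(if \<pi> a < \<pi> b then d * ?Q a else 0) + (if \<pi> b < \<pi> a then d * ?Q b else 0)
      = d * ?Q a + (if \<pi> b < \<pi> a then d * ?Q a + d * ?Q b else 0)"
      by (cases "\<pi> a < \<pi> b") auto
  qed
  finally show ?thesis by (simp add: vsign_def sum.distrib)
qed

text \<open>The ranks by \<open>flag_pos G\<close> and by the position of the image are compared on
  \<open>flag_list G\<close>, which is sorted for the first. For the second it has inversions inside
  the vertices, given by \<rho>, and between vertices, where two blocks are inverted entirely or not
  at all.\<close>

lemma winv_iso:
  assumes "edge_reps G es" "c \<in> assigns G'"
  shows "winv (flag_pos G') (q \<circ> c) (edge_word G' (map \<phi> es) @ legs G')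
    = winv (flag_pos G) (q \<circ> pull_assign c) (edge_word G es @ legs G)
      + (\<Sum>i<n. winv (\<rho> i) (\<lambda>j. q (pull_assign c (i, j))) [0..<val i])
      + (\<Sum>b<n. \<Sum>a<b. if \<pi> b < \<pi> a then vpar G (pull_assign c) a * vpar G (pull_assign c) b else 0)"
proof -
  let ?L = "edge_word G es @ legs G" and ?FL = "flag_list G" and ?r = "flag_pos G' \<circ> \<phi>" and ?p = "q \<circ> pull_assign c"
  let ?F = "\<lambda>i. map (Pair i) [0..<val i]"
  note L = G.mset_edge_word[OF assms(1)]
  note es = edge_reps_subset[OF assms(1)]
  have inj: "inj_on ?r (flags G)"
    using comp_inj_on[of \<phi> "flags G" "flag_pos G'"] bij_\<phi> inj_flag_pos[of G'] by (simp add: bij_betw_def)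
  have "winv (flag_pos G') (q \<circ> c) (edge_word G' (map \<phi> es) @ legs G') = winv ?r (q \<circ> c \<circ> \<phi>) ?L"
    by (simp only: edge_word_map[OF es] legs map_append[symmetric] winv_map comp_assoc)
  also have "\<dots> = winv ?r ?p ?L"
    by (rule winv_cong) (simp_all only: L(3) comp_apply pull_assign_apply)
  also have "\<dots> = winv (flag_pos G) ?p ?L + winv ?r ?p ?FL"
  proof -
    have "winv ?r ?p ?L + winv ?r ?p ?FL = winv (flag_pos G) ?p ?L + winv (flag_pos G) ?p ?FL"
      by (rule winv_change_rank) (use L inj inj_flag_pos[of G] in simp_all)
    moreover have "winv (flag_pos G) ?p ?FL = 0" by (rule winv_sorted[OF sorted_flag_list])
    ultimately show ?thesis by (simp add: bit_add_eq_move add.commute)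
  qed
  also have "winv ?r ?p ?FL = (\<Sum>i<n. winv ?r ?p (?F i)) + (\<Sum>b<n. \<Sum>a<b. wcross ?r ?p (?F a) (?F b))"
    unfolding flag_list_def by (rule winv_concat)
  also have "(\<Sum>i<n. winv ?r ?p (?F i)) = (\<Sum>i<n. winv (\<rho> i) (\<lambda>j. q (pull_assign c (i, j))) [0..<val i])"
  proof (rule sum.cong[OF refl])
    fix i assume "i \<in> {..<n}"
    show "winv ?r ?p (?F i) = winv (\<rho> i) (\<lambda>j. q (pull_assign c (i, j))) [0..<val i]"
      unfolding winv_map by (rule winv_cong) (auto simp: flag_pos_def)
  qed
  also have "(\<Sum>b<n. \<Sum>a<b. wcross ?r ?p (?F a) (?F b))
      = (\<Sum>b<n. \<Sum>a<b. if \<pi> b < \<pi> a then vpar G (pull_assign c) a * vpar G (pull_assign c) b else 0)"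
  proof (intro sum.cong refl)
    fix a b assume ab: "b \<in> {..<n}" "a \<in> {..<b}"
    have psum: "sum_list (map ?p (?F i)) = vpar G (pull_assign c) i" for i
      by (simp add: vpar_def sum_list_nth_sum comp_def)
    have less: "?r x < ?r y \<longleftrightarrow> \<pi> i < \<pi> k" if "x \<in> set (?F i)" "y \<in> set (?F k)" "i < n" "k < n" "i \<noteq> k" for x y i k
    proof -
      have "x \<in> flags G" "y \<in> flags G" using that by (auto simp: flags_def)
      then have "?r x < ?r y \<longleftrightarrow> fst (\<phi> x) < fst (\<phi> y) \<or> fst (\<phi> x) = fst (\<phi> y) \<and> snd (\<phi> x) < snd (\<phi> y)"
        by (simp add: flag_pos_less_iff \<phi>_flags)
      moreover have "\<pi> i \<noteq> \<pi> k" using that(5) \<pi>_\<sigma>(2) by metis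
      ultimately show ?thesis using that by auto
    qed
    show "wcross ?r ?p (?F a) (?F b) = (if \<pi> b < \<pi> a then vpar G (pull_assign c) a * vpar G (pull_assign c) b else 0)"
    proof (cases "\<pi> b < \<pi> a")
      case True
      have "wcross ?r ?p (?F a) (?F b) = sum_list (map ?p (?F a)) * sum_list (map ?p (?F b))"
        by (rule wcross_all) (use less ab True in auto)
      then show ?thesis using True by (simp only: psum if_True)
    next
      case False
      have "wcross ?r ?p (?F a) (?F b) = 0"
      proof (rule wcross_none)
        fix x y assume "x \<in> set (?F a)" "y \<in> set (?F b)"
        then show "?r x \<le> ?r y" using less[of y b x a] ab False by auto
      qed
      then show ?thesis using False by simp
    qed
  qed
  finally show ?thesis by (simp only: add.assoc)
qed

lemma wprod_iso: "set es \<subseteq> flags G \<Longrightarrow> wprod G' (map \<phi> es) c = wprod G es (pull_assign c)"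
  by (induction es) (simp_all add: pull_assign_apply ginv_\<phi>)

lemma vcoeff_iso:
  assumes "\<And>i. i < n \<Longrightarrow> xs' ! \<pi> i = perm_act (\<rho> i) (xs ! i)"
  shows "vcoeff G' xs' c = sg (\<Sum>i<n. winv (\<rho> i) (\<lambda>j. q (pull_assign c (i, j))) [0..<val i]) * vcoeff G xs (pull_assign c)"
proof -
  have "vcoeff G' xs' c = (\<Prod>i<n. (xs' ! \<pi> i) (map (\<lambda>j. c (\<pi> i, j)) [0..<snd (verts G' ! \<pi> i)]))"
    unfolding vcoeff_def len by (rule prod.reindex_bij_betw[OF permutes_imp_bij[OF perm], symmetric])
  also have "\<dots> = (\<Prod>i<n. sg (winv (\<rho> i) (\<lambda>j. q (pull_assign c (i, j))) [0..<val i]) *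
      (xs ! i) (map (\<lambda>j. pull_assign c (i, j)) [0..<val i]))"
  proof (rule prod.cong[OF refl])
    fix i assume "i \<in> {..<n}"
    then have i: "i < n" by simp
    have js: "map (\<lambda>j. map (\<lambda>j. c (\<pi> i, j)) [0..<val i] ! \<rho> i j) [0..<val i] = map (\<lambda>j. pull_assign c (i, j)) [0..<val i]"
      by (rule nth_equalityI) (use i in \<open>auto simp: pull_assign_def flags_def\<close>)
    have "(xs' ! \<pi> i) (map (\<lambda>j. c (\<pi> i, j)) [0..<snd (verts G' ! \<pi> i)])
       = koszul (val i) (\<rho> i) (\<lambda>j. q (map (\<lambda>j. pull_assign c (i, j)) [0..<val i] ! j)) *
         (xs ! i) (map (\<lambda>j. pull_assign c (i, j)) [0..<val i])"
      unfolding assms[OF i] vert[OF i] perm_act_def Let_def length_map length_upt diff_zero js ..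
    also have "koszul (val i) (\<rho> i) (\<lambda>j. q (map (\<lambda>j. pull_assign c (i, j)) [0..<val i] ! j))
       = (koszul (val i) (\<rho> i) (\<lambda>j. q (pull_assign c (i, j))) :: 'k)"
      by (rule koszul_cong) auto
    finally show "(xs' ! \<pi> i) (map (\<lambda>j. c (\<pi> i, j)) [0..<snd (verts G' ! \<pi> i)])
       = sg (winv (\<rho> i) (\<lambda>j. q (pull_assign c (i, j))) [0..<val i]) *
         (xs ! i) (map (\<lambda>j. pull_assign c (i, j)) [0..<val i])"
      by (simp add: koszul_upt)
  qed
  also have "\<dots> = sg (\<Sum>i<n. winv (\<rho> i) (\<lambda>j. q (pull_assign c (i, j))) [0..<val i]) * vcoeff G xs (pull_assign c)"
  proof -
    have "(\<Prod>i<m. sg (g i)) = (sg (\<Sum>i<m. g i) :: 'k)" for m :: nat and g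
      by (induction m) (simp_all add: sg_add)
    then show ?thesis by (simp add: prod.distrib vcoeff_def)
  qed
  finally show ?thesis .
qed

text \<open>A decoration has parity \<open>d + ?Q i\<close>, and the Koszul sign of a reversed pair
  expands into three parts: \<open>d * d\<close> comes from the determinant, the mixed terms from
  \<open>vsign\<close>, and the product of the flag parities from the word. The inversions inside
  the vertices cancel against the action on the decorations.\<close>

lemma contract_iso:
  assumes "det_args d G' bs"
    and supp: "\<And>i. i < n \<Longrightarrow> supported (val i) (ps ! i) (xs ! i)"
    and xs': "\<And>i. i < n \<Longrightarrow> xs' ! \<pi> i = perm_act (\<rho> i) (xs ! i)"
  shows "contract G' bs xs' js = koszul n \<pi> (\<lambda>i. ps ! i) * contract G (map pull bs) xs js"
proof (cases "length js = length (legs G) \<and> set js \<subseteq> {..<N}")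
  case False
  then show ?thesis by (auto simp: contract_def legs)
next
  case True
  let ?es = "edge_list G"
  note es = G.edge_reps_edge_list edge_reps_subset[OF G.edge_reps_edge_list]
  have summand: "amp G' bs (edge_list G') c * sg (vsign G' c) * vcoeff G' xs' c
    = koszul n \<pi> (\<lambda>i. ps ! i) * (amp G (map pull bs) ?es (pull_assign c) * sg (vsign G (pull_assign c)) *
        vcoeff G xs (pull_assign c))" if c: "c \<in> assigns G'" for c
  proof (cases "vcoeff G xs (pull_assign c) = 0")
    case True
    then show ?thesis using vcoeff_iso[OF xs'] by simp
  next
    case False
    let ?c = "pull_assign c" and ?Q = "vpar G (pull_assign c)"
    let ?D = "\<Sum>b<n. \<Sum>a<b. if \<pi> b < \<pi> a then d * ?Q a + d * ?Q b else 0"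
    let ?I = "\<Sum>b<n. \<Sum>a<b. if \<pi> b < \<pi> a then ?Q a * ?Q b else 0"
    let ?K = "\<Sum>b<n. \<Sum>a<b. if \<pi> b < \<pi> a then d * d else 0"
    let ?P = "\<Sum>i<n. winv (\<rho> i) (\<lambda>j. q (?c (i, j))) [0..<val i]"
    let ?W = "winv (flag_pos G) (q \<circ> ?c) (edge_word G ?es @ legs G)"
    \<comment> \<open>\<open>edge_list G'\<close> need not be the image of
      \<open>edge_list G\<close>; this is where the freedom in the choice of half-edges is
      used.\<close>
    have "amp G' bs (edge_list G') c = amp G' bs (map \<phi> ?es) c"
      by (rule amp_edge_reps[OF G'.wf G'.conn assms(1) G'.edge_reps_edge_list edge_reps_map[OF es(1)] c])
    also have "\<dots> = koszul n \<pi> (\<lambda>_. d) * det_factor d G (map pull bs) ?es * sg (?W + ?P + ?I) * wprod G ?es ?c"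
      by (simp only: amp_def det_factor_iso[OF assms(1) es(1)] winv_iso[OF es(1) c] wprod_iso[OF es(2)])
    also have "\<dots> = koszul n \<pi> (\<lambda>_. d) * sg (?P + ?I) * amp G (map pull bs) ?es ?c"
      by (simp only: amp_def sg_add ac_simps)
    finally have amp': "amp G' bs (edge_list G') c = \<dots>" .
    have "koszul n \<pi> (\<lambda>i. ps ! i) = (koszul n \<pi> (\<lambda>i. d + ?Q i) :: 'k)"
      by (rule koszul_cong) (use vcoeff_par[OF supp False] in auto)
    also have "\<dots> = sg (?K + ?I + ?D)"
      unfolding koszul_double_sum sum.distrib[symmetric]
      by (intro arg_cong[where f = sg] sum.cong refl) (simp add: distrib_left distrib_right ac_simps)
    also have "\<dots> = koszul n \<pi> (\<lambda>_. d) * sg (?I + ?D)"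
      unfolding koszul_double_sum by (simp only: sg_add mult.assoc)
    finally have kos: "koszul n \<pi> (\<lambda>i. ps ! i) = (koszul n \<pi> (\<lambda>_. d) * sg (?I + ?D) :: 'k)" .
    have sgP: "sg ?P * sg ?P = (1 :: 'k)" by simp
    have "amp G' bs (edge_list G') c * sg (vsign G' c) * vcoeff G' xs' c
      = koszul n \<pi> (\<lambda>_. d) * (sg ?P * sg ?P) * sg ?I * sg ?D *
        (amp G (map pull bs) ?es ?c * sg (vsign G ?c) * vcoeff G xs ?c)"
    proof -
      have v: "vcoeff G' xs' c = sg ?P * vcoeff G xs ?c" by (rule vcoeff_iso) (rule xs')
      show ?thesis unfolding amp' v vsign_iso by (simp only: sg_add ac_simps)
    qed
    then show ?thesis unfolding kos sgP by (simp only: sg_add ac_simps mult_1_left)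
  qed
  have "{c \<in> assigns G'. map c (legs G') = js} = {c \<in> assigns G'. map (pull_assign c) (legs G) = js}"
  proof -
    have "map c (legs G') = map (pull_assign c) (legs G)" for c
      using G.set_legs by (auto simp: legs pull_assign_apply)
    then show ?thesis by simp
  qed
  moreover have "contract G' bs xs' js = (\<Sum>c\<in>{c \<in> assigns G'. map c (legs G') = js}.
     amp G' bs (edge_list G') c * sg (vsign G' c) * vcoeff G' xs' c)"
    using True by (simp only: contract_def legs length_map simp_thms if_True)
  ultimately have "contract G' bs xs' js = (\<Sum>c\<in>{c \<in> assigns G'. map (pull_assign c) (legs G) = js}.
     koszul n \<pi> (\<lambda>i. ps ! i) * (amp G (map pull bs) ?es (pull_assign c) * sg (vsign G (pull_assign c)) *
        vcoeff G xs (pull_assign c)))"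
    by (simp only:) (rule sum.cong[OF refl], rule summand, simp)
  also have "\<dots> = (\<Sum>c\<in>{c \<in> assigns G. map c (legs G) = js}.
     koszul n \<pi> (\<lambda>i. ps ! i) * (amp G (map pull bs) ?es c * sg (vsign G c) * vcoeff G xs c))"
  proof (rule sum.reindex_bij_betw)
    show "bij_betw pull_assign {c \<in> assigns G'. map (pull_assign c) (legs G) = js} {c \<in> assigns G. map c (legs G) = js}"
    proof (rule bij_betw_subset[OF bij_pull_assign])
      have "pull_assign ` {c \<in> assigns G'. map (pull_assign c) (legs G) = js}
        = {c \<in> pull_assign ` assigns G'. map c (legs G) = js}" by (rule image_filter)
      then show "pull_assign ` {c \<in> assigns G'. map (pull_assign c) (legs G) = js}
        = {c \<in> assigns G. map c (legs G) = js}"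
        by (simp only: bij_betw_imp_surj_on[OF bij_pull_assign])
    qed blast
  qed
  finally show ?thesis using True by (simp add: contract_def sum_distrib_left)
qed

end

section \<open>Graftings\<close>

lemma length_concat_upt: "length (concat (map F [0..<m])) = (\<Sum>i<m. length (F i))"
  by (induction m) simp_all

lemma nth_concat_upt:
  assumes "i < m" "v < length (F i)"
  shows "concat (map F [0..<m]) ! ((\<Sum>j<i. length (F j)) + v) = F i ! v"
  using assms(1)
proof (induction m)
  case (Suc m)
  show ?case
  proof (cases "i = m")
    case True
    then show ?thesis using assms(2) by (simp add: nth_append length_concat_upt)
  next
    case False
    then have "i < m" using Suc.prems by simp
    moreover have "(\<Sum>j<i. length (F j)) + v < (\<Sum>j<m. length (F j))"
    proof -
      have "(\<Sum>j<Suc i. length (F j)) \<le> (\<Sum>j<m. length (F j))" by (rule sum_mono2) (use \<open>i < m\<close> in auto)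
      then show ?thesis using assms(2) by simp
    qed
    ultimately show ?thesis using Suc.IH by (simp add: nth_append length_concat_upt)
  qed
qed simp

text \<open>The sign of splitting off the diagonal blocks one after the other, starting with the last one.\<close>

primrec peel_sign :: "(nat \<Rightarrow> nat) \<Rightarrow> (nat \<Rightarrow> nat) \<Rightarrow> (nat \<Rightarrow> nat) \<Rightarrow> nat \<Rightarrow> nat \<Rightarrow> bit" where
  "peel_sign b p u 0 k = 0"
| "peel_sign b p u (Suc h) k = of_nat (b h) * of_nat ((\<Sum>i<h. p i + u i) + p h) + of_nat (b h + u h) * of_nat k
     + peel_sign b p u h (p h + k)"

text \<open>The rows \<open>b i\<close> and \<open>u i\<close> vanish on the columns
  \<open>cs0\<close> and on those of earlier blocks, so the last block splits off once its rows are
  moved to the end: \<open>b h\<close> past everything in between to join \<open>u h\<close>, then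
  both past \<open>zs\<close>. The row list \<open>p h\<close> stays behind and joins
  \<open>zs\<close>.\<close>

lemma ldet_peel:
  fixes b :: "nat \<Rightarrow> ('c \<Rightarrow> 'k::field) list"
  assumes "\<And>i. i < h \<Longrightarrow> length (b i) + length (u i) = length (cs i)"
    and "length rs + (\<Sum>i<h. length (p i)) + length zs = length cs0"
    and "\<And>i r c. i < h \<Longrightarrow> r \<in> set (b i) \<union> set (u i) \<Longrightarrow> c \<in> set cs0 \<Longrightarrow> r c = 0"
    and "\<And>i j r c. i < h \<Longrightarrow> j < i \<Longrightarrow> r \<in> set (b i) \<union> set (u i) \<Longrightarrow> c \<in> set (cs j) \<Longrightarrow> r c = 0"
  shows "ldet (rs @ concat (map b [0..<h]) @ concat (map (\<lambda>i. p i @ u i) [0..<h]) @ zs) (cs0 @ concat (map cs [0..<h]))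
    = sg (peel_sign (\<lambda>i. length (b i)) (\<lambda>i. length (p i)) (\<lambda>i. length (u i)) h (length zs)) *
      ldet (rs @ concat (map p [0..<h]) @ zs) cs0 * (\<Prod>i<h. ldet (b i @ u i) (cs i))"
  using assms
proof (induction h arbitrary: zs)
  case (Suc h)
  let ?B = "concat (map b [0..<h])" and ?Z = "concat (map (\<lambda>i. p i @ u i) [0..<h])"
    and ?C = "concat (map cs [0..<h])"
  have lB: "length ?B + length ?Z = (\<Sum>i<h. length (p i)) + length ?C"
  proof -
    have "(\<Sum>i<h. length (b i) + length (u i)) = (\<Sum>i<h. length (cs i))"
      by (rule sum.cong) (use Suc.prems(1) in auto)
    then show ?thesis by (simp add: length_concat_upt sum.distrib)
  qed
  have lh: "length (b h) + length (u h) = length (cs h)" using Suc.prems(1) by simp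
  have len: "length rs + length ?B + length ?Z + length (p h) + length zs = length cs0 + length ?C"
    using lB Suc.prems(2) by simp
  have lZ: "length ?Z = (\<Sum>i<h. length (p i) + length (u i))"
    by (simp add: length_concat_upt)
  have "ldet (rs @ concat (map b [0..<Suc h]) @ concat (map (\<lambda>i. p i @ u i) [0..<Suc h]) @ zs) (cs0 @ concat (map cs [0..<Suc h]))
      = ldet ((rs @ ?B) @ b h @ (?Z @ p h) @ (u h @ zs)) (cs0 @ ?C @ cs h)" by simp
  also have "\<dots> = sg (of_nat (length (?Z @ p h)) * of_nat (length (b h))) *
      ldet ((rs @ ?B) @ (?Z @ p h) @ b h @ (u h @ zs)) (cs0 @ ?C @ cs h)"
    by (rule ldet_swap_row_blocks) (use len lh in simp)
  also have "ldet ((rs @ ?B) @ (?Z @ p h) @ b h @ (u h @ zs)) (cs0 @ ?C @ cs h)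
      = ldet ((rs @ ?B @ ?Z @ p h) @ (b h @ u h) @ zs @ []) (cs0 @ ?C @ cs h)" by simp
  also have "\<dots> = sg (of_nat (length zs) * of_nat (length (b h @ u h))) *
      ldet ((rs @ ?B @ ?Z @ p h) @ zs @ (b h @ u h) @ []) (cs0 @ ?C @ cs h)"
    by (rule ldet_swap_row_blocks) (use len lh in simp)
  also have "ldet ((rs @ ?B @ ?Z @ p h) @ zs @ (b h @ u h) @ []) (cs0 @ ?C @ cs h)
      = ldet ((rs @ ?B @ ?Z @ p h @ zs) @ (b h @ u h)) ((cs0 @ ?C) @ cs h)" by simp
  also have "\<dots> = ldet (rs @ ?B @ ?Z @ p h @ zs) (cs0 @ ?C) * ldet (b h @ u h) (cs h)"
  proof (rule ldet_block)
    fix r c assume r: "r \<in> set (b h @ u h)" and c: "c \<in> set (cs0 @ ?C)"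
    then consider "c \<in> set cs0" | j where "j < h" "c \<in> set (cs j)" by auto
    then show "r c = 0" by cases (use Suc.prems(3)[of h r c] Suc.prems(4)[of h _ r c] r in auto)
  qed (use len lh in simp_all)
  also have "ldet (rs @ ?B @ ?Z @ p h @ zs) (cs0 @ ?C)
    = sg (peel_sign (\<lambda>i. length (b i)) (\<lambda>i. length (p i)) (\<lambda>i. length (u i)) h (length (p h @ zs))) *
      ldet (rs @ concat (map p [0..<h]) @ p h @ zs) cs0 * (\<Prod>i<h. ldet (b i @ u i) (cs i))"
  proof (rule Suc.IH)
    show "length rs + (\<Sum>i<h. length (p i)) + length (p h @ zs) = length cs0" using Suc.prems(2) by simp
  next
    fix i j r c assume "i < h" "j < i" "r \<in> set (b i) \<union> set (u i)" "c \<in> set (cs j)"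
    then show "r c = 0" using Suc.prems(4)[of i j r c] by simp
  next
    fix i r c assume "i < h" "r \<in> set (b i) \<union> set (u i)" "c \<in> set cs0"
    then show "r c = 0" using Suc.prems(3)[of i r c] by simp
  qed (use Suc.prems(1) in simp)
  finally show ?case
    by (simp add: sg_add lZ ac_simps)
qed simp

text \<open>Here \<open>k i\<close> is the number of vertices of block \<open>i\<close>,
  \<open>p i\<close> counts its first vertex and \<open>u i\<close> the others, except that the
  first vertex of block 0 is the base and has no row. So the rows passed by \<open>b h\<close> are
  as many as the vertices of the preceding blocks.\<close>

lemma peel_sign_eq:
  assumes "\<And>i. i < h \<Longrightarrow> p i = (if i = 0 then 0 else 1)" "\<And>i. i < h \<Longrightarrow> u i + 1 = k i"
  shows "peel_sign b p u h n = (\<Sum>i<h. \<Sum>j<i. of_nat (b i) * of_nat (k j) + of_nat (b j + u j)) + of_nat n * (\<Sum>i<h. of_nat (b i + u i))"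
  using assms
proof (induction h arbitrary: n)
  case (Suc h)
  have k: "(\<Sum>i<m. p i + u i) + (if m = 0 then 0 else 1) = (\<Sum>i<m. k i)" if "m \<le> h" for m
    using that
  proof (induction m)
    case (Suc m)
    have "u m + 1 = k m" "p m = (if m = 0 then 0 else 1)" using Suc Suc.prems Suc_le_lessD Suc.prems \<open>\<And>i. i < Suc h \<Longrightarrow> u i + 1 = k i\<close>
      \<open>\<And>i. i < Suc h \<Longrightarrow> p i = (if i = 0 then 0 else 1)\<close> by auto
    then show ?case using Suc by auto
  qed simp
  have ph: "p h = (if h = 0 then 0 else 1)" using Suc.prems(1) by simp
  have K: "(\<Sum>i<h. p i + u i) + p h = (\<Sum>i<h. k i)" using k[of h] ph by simp
  let ?E = "\<Sum>i<h. of_nat (b i + u i) :: bit"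
  have "peel_sign b p u h (p h + n) = (\<Sum>i<h. \<Sum>j<i. of_nat (b i) * of_nat (k j) + of_nat (b j + u j))
      + of_nat (p h + n) * ?E"
    by (rule Suc.IH) (use Suc.prems in simp_all)
  moreover have "of_nat (p h + n) * ?E = ?E + of_nat n * ?E"
    using ph by (cases "h = 0") (simp_all add: distrib_right)
  moreover have "(\<Sum>j<h. of_nat (b h) * of_nat (k j) + of_nat (b j + u j)) = of_nat (b h) * of_nat (\<Sum>j<h. k j) + ?E"
    by (simp add: sum.distrib sum_distrib_left)
  ultimately show ?case
    unfolding peel_sign.simps sum.lessThan_Suc K by (simp only: distrib_left ac_simps)
qed simp

section \<open>Vertices, flags and edges of a grafted graph\<close>

locale grafted = H: graph_conn H + G: graph_conn G for H G +
  fixes Gs :: "nat \<Rightarrow> graph"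
  assumes graft: "grafting H Gs G"
    and conn_i: "i < length (verts H) \<Longrightarrow> graph_conn (Gs i)"
    and val: "i < length (verts H) \<Longrightarrow> snd (verts H ! i) = length (legs (Gs i))"
begin

abbreviation "h \<equiv> length (verts H)"
abbreviation "k i \<equiv> length (verts (Gs i))"
abbreviation "off \<equiv> offset Gs"
abbreviation "out \<equiv> outer_flag Gs"

lemma wf_i: "i < h \<Longrightarrow> graph_wf (Gs i)"
  using conn_i graph_conn.axioms(1) by blast

lemma k_pos: "i < h \<Longrightarrow> 0 < k i"
  by (rule graph_conn.nv_pos[OF conn_i])

lemma off_Suc [simp]: "off (Suc i) = off i + k i" and off_0 [simp]: "off 0 = 0"
  by (simp_all add: offset_def)

lemma off_mono: "i \<le> j \<Longrightarrow> off i \<le> off j"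
  unfolding offset_def by (rule sum_mono2) auto

lemma off_less: "i < j \<Longrightarrow> v < k i \<Longrightarrow> off i + v < off j"
  using off_mono[of "Suc i" j] by simp

lemma verts_G: "verts G = concat (map (\<lambda>i. verts (Gs i)) [0..<h])"
  using graft unfolding grafting_def by blast

lemma length_G: "length (verts G) = off h"
  by (simp add: verts_G length_concat_upt offset_def)

lemma vert_G: "i < h \<Longrightarrow> v < k i \<Longrightarrow> verts G ! (off i + v) = verts (Gs i) ! v"
  unfolding verts_G offset_def by (rule nth_concat_upt)

lemma block_exists: "u < off m \<Longrightarrow> \<exists>i<m. \<exists>v<k i. u = off i + v"
proof (induction m)
  case (Suc m)
  show ?case
  proof (cases "u < off m")
    case True
    then show ?thesis using Suc.IH less_Suc_eq by blast
  next
    case False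
    then show ?thesis using Suc.prems by (intro exI[of _ m]) (auto intro!: exI[of _ "u - off m"])
  qed
qed simp

lemma block_inj: "off i + v = off i' + v' \<Longrightarrow> v < k i \<Longrightarrow> v' < k i' \<Longrightarrow> i = i' \<and> v = v'"
  using off_less[of i i' v] off_less[of i' i v'] by (cases i i' rule: linorder_cases) auto

lemma sum_blocks: "(\<Sum>u<off m. g u) = (\<Sum>i<m. \<Sum>v<k i. g (off i + v))" for g :: "nat \<Rightarrow> 'b::comm_monoid_add"
proof (induction m)
  case (Suc m)
  have "(\<Sum>u<off m + n. g u) = (\<Sum>u<off m. g u) + (\<Sum>v<n. g (off m + v))" for n
    by (induction n) (simp_all add: ac_simps)
  then show ?case using Suc by simp
qed simp

lemma prod_blocks: "(\<Prod>u<off m. g u) = (\<Prod>i<m. \<Prod>v<k i. g (off i + v))" for g :: "nat \<Rightarrow> 'b::comm_monoid_mult"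
proof (induction m)
  case (Suc m)
  have "(\<Prod>u<off m + n. g u) = (\<Prod>u<off m. g u) * (\<Prod>v<n. g (off m + v))" for n
    by (induction n) (simp_all add: ac_simps)
  then show ?case using Suc by simp
qed simp

lemma emb_Pair [simp]: "emb Gs i (v, j) = (off i + v, j)"
  by (simp add: emb_def)

lemma out_Pair [simp]: "out (i, l) = emb Gs i (legs (Gs i) ! l)"
  by (simp add: outer_flag_def)

lemma emb_flags: "i < h \<Longrightarrow> f \<in> flags (Gs i) \<Longrightarrow> emb Gs i f \<in> flags G"
  by (cases f) (simp add: flags_def length_G vert_G off_less)

lemma emb_inj:
  assumes "f \<in> flags (Gs i)" "f' \<in> flags (Gs i')" "emb Gs i f = emb Gs i' f'"
  shows "i = i'" "f = f'"
proof -
  obtain v j v' j' where f: "f = (v, j)" "f' = (v', j')" by fastforce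
  then have "v < k i" "v' < k i'" using assms(1,2) by (auto simp: flags_def)
  then show "i = i'" "f = f'" using block_inj[of i v i' v'] assms(3) f by auto
qed

lemma flag_exists:
  assumes "f \<in> flags G"
  obtains i g where "i < h" "g \<in> flags (Gs i)" "f = emb Gs i g"
proof -
  obtain u j where f: "f = (u, j)" "u < off h" "j < snd (verts G ! u)"
    using assms by (auto simp: flags_def length_G)
  then obtain i v where "i < h" "v < k i" "u = off i + v" using block_exists by blast
  then show thesis using that[of i "(v, j)"] f by (simp add: flags_def vert_G)
qed

lemma legs_i: "i < h \<Longrightarrow> l < snd (verts H ! i) \<Longrightarrow> legs (Gs i) ! l \<in> set (legs (Gs i))"
  by (simp add: val)

lemma leg_flag:
  assumes "i < h" "f \<in> set (legs (Gs i))"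
  shows "f \<in> flags (Gs i)" "ginv (Gs i) f = f"
  using graph_wf.set_legs[OF wf_i[OF assms(1)]] assms(2) by auto

lemma flag_H: "(i, l) \<in> flags H \<longleftrightarrow> i < h \<and> l < snd (verts H ! i)"
  by (auto simp: flags_def)

lemma out_flags: "f \<in> flags H \<Longrightarrow> out f \<in> flags G"
  by (cases f) (auto simp: flag_H intro: emb_flags leg_flag legs_i)

lemma out_inj: "inj_on out (flags H)"
proof (rule inj_onI)
  fix f f' assume f: "f \<in> flags H" "f' \<in> flags H" "out f = out f'"
  obtain i l i' l' where ff: "f = (i, l)" "f' = (i', l')" by fastforce
  then have il: "i < h" "l < snd (verts H ! i)" "i' < h" "l' < snd (verts H ! i')" using f by (auto simp: flag_H)
  have e: "i = i'" "legs (Gs i) ! l = legs (Gs i') ! l'"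
    using emb_inj[of "legs (Gs i) ! l" i "legs (Gs i') ! l'" i'] f(3) ff leg_flag(1)[OF il(1) legs_i[OF il(1,2)]]
      leg_flag(1)[OF il(3) legs_i[OF il(3,4)]] by auto
  then have "l = l'"
    using graph_wf.distinct_legs[OF wf_i[OF il(1)]] il val by (simp add: nth_eq_iff_index_eq)
  then show "f = f'" using e ff by simp
qed

lemma ginv_emb: "i < h \<Longrightarrow> f \<in> flags (Gs i) \<Longrightarrow> ginv (Gs i) f \<noteq> f \<Longrightarrow> ginv G (emb Gs i f) = emb Gs i (ginv (Gs i) f)"
  using graft leg_flag(2) unfolding grafting_def by blast

lemma ginv_out: "f \<in> flags H \<Longrightarrow> ginv G (out f) = out (ginv H f)"
  using graft unfolding grafting_def by blast

lemma legs_G: "legs G = map out (legs H)"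
  using graft unfolding grafting_def by blast

lemma leg_out:
  assumes "i < h" "f \<in> flags (Gs i)" "ginv (Gs i) f = f"
  obtains l where "(i, l) \<in> flags H" "f = legs (Gs i) ! l" "emb Gs i f = out (i, l)"
proof -
  have "f \<in> set (legs (Gs i))" using graph_wf.set_legs[OF wf_i[OF assms(1)]] assms by simp
  then obtain l where "l < length (legs (Gs i))" "f = legs (Gs i) ! l" by (metis in_set_conv_nth)
  then show thesis using that[of l] assms(1) by (simp add: flag_H val)
qed

text \<open>The blocks come in decreasing order, and before the outer edges in
  \<open>edges_G\<close>, because the determinant reads the edges backwards: its columns then start
  with the outer edges, followed by the blocks in increasing order.\<close>

primrec block_edges :: "nat \<Rightarrow> flag list" where
  "block_edges 0 = []"
| "block_edges (Suc m) = map (emb Gs m) (edge_list (Gs m)) @ block_edges m"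

definition edges_G :: "flag list" where
  "edges_G = block_edges h @ map out (edge_list H)"

lemma set_block_edges: "set (block_edges m) = (\<Union>i<m. emb Gs i ` set (edge_list (Gs i)))"
  by (induction m) (auto simp: lessThan_Suc)

lemma reps_i: "i < h \<Longrightarrow> edge_reps (Gs i) (edge_list (Gs i))"
  using graph_wf.edge_reps_edge_list wf_i by blast

lemma edge_i:
  assumes "i < h" "f \<in> set (edge_list (Gs i))"
  shows "f \<in> flags (Gs i)" "ginv (Gs i) f \<noteq> f"
  using edge_repsD[OF reps_i[OF assms(1)] assms(2)] .

lemma out_not_emb:
  assumes "f \<in> flags H" "i < h" "g \<in> flags (Gs i)" "ginv (Gs i) g \<noteq> g"
  shows "out f \<noteq> emb Gs i g"
proof
  obtain i' l where f: "f = (i', l)" by fastforce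
  assume "out f = emb Gs i g"
  then have "emb Gs i' (legs (Gs i') ! l) = emb Gs i g" by (simp add: f)
  moreover have il: "i' < h" "l < snd (verts H ! i')" using assms(1) f by (auto simp: flag_H)
  note leg = leg_flag[OF il(1) legs_i[OF il]]
  ultimately have "i' = i" "legs (Gs i') ! l = g" using emb_inj[OF leg(1) assms(3)] by auto
  then show False using leg(2) assms(4) by simp
qed

lemma distinct_block_edges: "m \<le> h \<Longrightarrow> distinct (block_edges m)"
proof (induction m)
  case (Suc m)
  then have m: "m < h" by simp
  have "inj_on (emb Gs m) (set (edge_list (Gs m)))"
    by (rule inj_onI) (use emb_inj(2) edge_i(1)[OF m] in blast)
  then have "distinct (map (emb Gs m) (edge_list (Gs m)))"
    using reps_i[OF m] by (simp add: distinct_map edge_reps_def)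
  moreover have "emb Gs m f \<noteq> emb Gs i g"
    if "f \<in> set (edge_list (Gs m))" "i < m" "g \<in> set (edge_list (Gs i))" for f g i
    using emb_inj(1)[of f m g i] edge_i(1)[of m f] edge_i(1)[of i g] that m by auto
  then have "set (map (emb Gs m) (edge_list (Gs m))) \<inter> set (block_edges m) = {}"
    unfolding set_block_edges set_map by blast
  ultimately show ?case using Suc by (simp only: block_edges.simps distinct_append)
qed simp

text \<open>Every flag of \<open>G\<close> lies in exactly one block. It belongs to an edge of the
  block unless it is a leg there, in which case it is the image of a flag of
  \<open>H\<close>.\<close>

lemma edge_reps_G: "edge_reps G edges_G"
  unfolding edge_reps_def
proof (intro conjI ballI impI)
  have H: "set (edge_list H) \<subseteq> flags H" by (rule edge_reps_subset[OF H.edge_reps_edge_list])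
  have mem_emb: "emb Gs i f \<in> set edges_G \<longleftrightarrow> f \<in> set (edge_list (Gs i))"
    if f: "i < h" "f \<in> flags (Gs i)" "ginv (Gs i) f \<noteq> f" for i f
  proof
    assume "emb Gs i f \<in> set edges_G"
    then consider i' f' where "i' < h" "f' \<in> set (edge_list (Gs i'))" "emb Gs i f = emb Gs i' f'"
      | f' where "f' \<in> flags H" "emb Gs i f = out f'"
      using H by (auto simp: edges_G_def set_block_edges simp del: split_paired_Ex)
    then show "f \<in> set (edge_list (Gs i))"
    proof cases
      case 1
      then show ?thesis using emb_inj[OF f(2) edge_i(1)[OF 1(1,2)] 1(3)] by simp
    next
      case 2
      then show ?thesis using out_not_emb[OF _ f] by metis
    qed
  qed (use f(1) in \<open>auto simp: edges_G_def set_block_edges\<close>)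
  have mem_out: "out f \<in> set edges_G \<longleftrightarrow> f \<in> set (edge_list H)" if f: "f \<in> flags H" for f
  proof
    assume "out f \<in> set edges_G"
    then consider i' f' where "i' < h" "f' \<in> set (edge_list (Gs i'))" "out f = emb Gs i' f'"
      | f' where "f' \<in> set (edge_list H)" "out f = out f'"
      by (auto simp: edges_G_def set_block_edges simp del: split_paired_Ex)
    then show "f \<in> set (edge_list H)"
    proof cases
      case 1
      then show ?thesis using out_not_emb[OF f 1(1) edge_i[OF 1(1,2)]] by simp
    next
      case 2
      then show ?thesis using inj_onD[OF out_inj, of f f'] f H by blast
    qed
  qed (auto simp: edges_G_def)
  show "distinct edges_G"
  proof -
    have "distinct (map out (edge_list H))"
      using H.edge_reps_edge_list inj_on_subset[OF out_inj H] by (simp add: distinct_map edge_reps_def)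
    moreover have "out f \<notin> set (block_edges h)" if "f \<in> set (edge_list H)" for f
    proof
      assume "out f \<in> set (block_edges h)"
      then obtain i g where "i < h" "g \<in> set (edge_list (Gs i))" "out f = emb Gs i g"
        by (auto simp: set_block_edges simp del: split_paired_Ex)
      then show False using out_not_emb edge_i that H by blast
    qed
    ultimately show ?thesis using distinct_block_edges[of h] by (auto simp: edges_G_def)
  qed
  show "set edges_G \<subseteq> {f \<in> flags G. ginv G f \<noteq> f}"
  proof
    fix f assume "f \<in> set edges_G"
    then consider i g where "i < h" "g \<in> set (edge_list (Gs i))" "f = emb Gs i g"
      | g where "g \<in> set (edge_list H)" "f = out g"
      by (auto simp: edges_G_def set_block_edges simp del: split_paired_Ex)
    then show "f \<in> {f \<in> flags G. ginv G f \<noteq> f}"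
    proof cases
      case 1
      have g: "g \<in> flags (Gs i)" "ginv (Gs i) g \<noteq> g" "ginv (Gs i) g \<in> flags (Gs i)"
        using edge_i[OF 1(1,2)] graph_wf.ginv_in[OF wf_i[OF 1(1)]] by auto
      have "ginv G f \<noteq> f" unfolding 1(3) ginv_emb[OF 1(1) g(1,2)] using emb_inj(2)[OF g(3,1)] g(2) by blast
      then show ?thesis using emb_flags[OF 1(1) g(1)] 1(3) by simp
    next
      case 2
      note g = edge_repsD[OF H.edge_reps_edge_list 2(1)]
      have "out (ginv H g) \<noteq> out g" using inj_onD[OF out_inj, of "ginv H g" g] g by auto
      then show ?thesis using 2(2) out_flags[OF g(1)] ginv_out[OF g(1)] by simp
    qed
  qed
  fix f assume f: "f \<in> flags G" "ginv G f \<noteq> f"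
  obtain i g where g: "i < h" "g \<in> flags (Gs i)" "f = emb Gs i g" using flag_exists[OF f(1)] .
  show "(f \<in> set edges_G) \<noteq> (ginv G f \<in> set edges_G)"
  proof (cases "ginv (Gs i) g = g")
    case False
    have g': "ginv (Gs i) g \<in> flags (Gs i)" "ginv (Gs i) (ginv (Gs i) g) \<noteq> ginv (Gs i) g"
      using g False graph_wf.ginv_in[OF wf_i[OF g(1)]] graph_wf.ginv_ginv[OF wf_i[OF g(1)]] by auto
    have "(g \<in> set (edge_list (Gs i))) \<noteq> (ginv (Gs i) g \<in> set (edge_list (Gs i)))"
      using reps_i[OF g(1)] g(2) False unfolding edge_reps_def by blast
    then show ?thesis
      unfolding g(3) ginv_emb[OF g(1,2) False] mem_emb[OF g(1,2) False] mem_emb[OF g(1) g'] .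
  next
    case True
    obtain l where l: "(i, l) \<in> flags H" "g = legs (Gs i) ! l" "emb Gs i g = out (i, l)"
      by (rule leg_out[OF g(1,2) True])
    have "ginv H (i, l) \<noteq> (i, l)" using f(2) ginv_out[OF l(1)] l(3) g(3) by metis
    then have "((i, l) \<in> set (edge_list H)) \<noteq> (ginv H (i, l) \<in> set (edge_list H))"
      using H.edge_reps_edge_list l(1) unfolding edge_reps_def by blast
    moreover have "ginv H (i, l) \<in> flags H" using l(1) by simp
    ultimately show ?thesis
      unfolding g(3) l(3) ginv_out[OF l(1)] mem_out[OF l(1)] using mem_out by blast
  qed
qed

section \<open>Pushing chains forward from the blocks and collapsing them onto the outer
  graph\<close>

lemma push_Pair:
  "v < k i \<Longrightarrow> push_chain Gs i c (off i + v, j) = c (v, j)"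
  by (simp add: push_chain_def)

lemma push_emb: "f \<in> flags (Gs i) \<Longrightarrow> push_chain Gs i c (emb Gs i f) = c f"
  by (cases f) (simp add: flags_def push_Pair)

lemma push_emb_other: "f \<in> flags (Gs i') \<Longrightarrow> i' \<noteq> i \<Longrightarrow> push_chain Gs i c (emb Gs i' f) = 0"
proof -
  assume f: "f \<in> flags (Gs i')" "i' \<noteq> i"
  obtain v j where vj: "f = (v, j)" by fastforce
  then have "v < k i'" using f by (simp add: flags_def)
  then have "\<not> (off i \<le> off i' + v \<and> off i' + v < off i + k i)"
    using off_less[of i' i v] off_mono[of "Suc i" i'] f(2) by (cases i i' rule: linorder_cases) auto
  then show ?thesis by (auto simp: vj push_chain_def)
qed

lemma push_outside: "i < h \<Longrightarrow> f \<notin> flags G \<Longrightarrow> c \<in> chains1 (Gs i) \<Longrightarrow> push_chain Gs i c f = 0"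
proof -
  assume i: "i < h" "f \<notin> flags G" "c \<in> chains1 (Gs i)"
  obtain u j where f: "f = (u, j)" by fastforce
  show ?thesis
  proof (cases "off i \<le> u \<and> u < off i + k i")
    case True
    then have "(u - off i, j) \<notin> flags (Gs i)" using i(2) emb_flags[OF i(1), of "(u - off i, j)"] f by auto
    then have "c (u - off i, j) = 0" using i(3) unfolding chains1_def by blast
    then show ?thesis by (simp add: f push_chain_def)
  qed (auto simp: f push_chain_def)
qed

text \<open>A leg is its own opposite, so a chain equals its negative there and vanishes in
  characteristic 0.\<close>

lemma push_leg: "i < h \<Longrightarrow> f \<in> set (legs (Gs i)) \<Longrightarrow> c \<in> chains1 (Gs i) \<Longrightarrow> push_chain Gs i c (emb Gs i f) = 0"
proof -
  assume i: "i < h" "f \<in> set (legs (Gs i))" "c \<in> chains1 (Gs i)"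
  note f = leg_flag[OF i(1,2)]
  have "c f = - c f" using graph_wf.chain_ginv[OF wf_i[OF i(1)] i(3), of f] f(2) by simp
  then show ?thesis by (simp add: push_emb[OF f(1)])
qed

lemma push_out: "i < h \<Longrightarrow> f \<in> flags H \<Longrightarrow> c \<in> chains1 (Gs i) \<Longrightarrow> push_chain Gs i c (out f) = 0"
proof -
  assume i: "i < h" "f \<in> flags H" "c \<in> chains1 (Gs i)"
  obtain i' l where f: "f = (i', l)" by fastforce
  then have il: "i' < h" "l < snd (verts H ! i')" using i(2) by (auto simp: flag_H)
  show ?thesis
    using push_leg[OF i(1) _ i(3), of "legs (Gs i) ! l"] push_emb_other[of "legs (Gs i') ! l" i' i]
      leg_flag(1)[OF il(1) legs_i[OF il]] legs_i[OF il] by (cases "i' = i") (auto simp: f)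
qed

lemma push_chains1:
  assumes "i < h" "c \<in> chains1 (Gs i)"
  shows "push_chain Gs i c \<in> chains1 G"
  unfolding chains1_def mem_Collect_eq
proof (intro conjI allI impI ballI)
  fix f assume "f \<in> flags G"
  then obtain i' g where g: "i' < h" "g \<in> flags (Gs i')" "f = emb Gs i' g" by (rule flag_exists)
  show "push_chain Gs i c (ginv G f) = - push_chain Gs i c f"
  proof (cases "ginv (Gs i') g = g")
    case False
    have g': "ginv (Gs i') g \<in> flags (Gs i')" using g graph_wf.ginv_in[OF wf_i[OF g(1)]] by simp
    note e = ginv_emb[OF g(1,2) False]
    show ?thesis
    proof (cases "i' = i")
      case True
      then show ?thesis
        unfolding g(3) e using push_emb[of g i c] push_emb[of "ginv (Gs i) g" i c] g(2) g'
          graph_wf.chain_ginv[OF wf_i[OF assms(1)] assms(2), of g] by simp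
    next
      case False
      then show ?thesis unfolding g(3) e by (simp add: push_emb_other[OF g(2)] push_emb_other[OF g'])
    qed
  next
    case True
    obtain l where l: "(i', l) \<in> flags H" "emb Gs i' g = out (i', l)" by (rule leg_out[OF g(1,2) True])
    have "ginv H (i', l) \<in> flags H" using l(1) by simp
    then show ?thesis
      unfolding g(3) l(2) ginv_out[OF l(1)] using push_out[OF assms(1) _ assms(2)] l(1) by (simp del: out_Pair)
  qed
qed (use push_outside assms in blast)

lemma bdry_push:
  assumes "i < h" "i' < h" "v < k i'"
  shows "bdry G (push_chain Gs i c) (off i' + v) = (if i' = i then bdry (Gs i) c v else 0)"
proof -
  have fl: "(v, j) \<in> flags (Gs i')" if "j < snd (verts (Gs i') ! v)" for j
    using that assms by (simp add: flags_def)
  have "bdry G (push_chain Gs i c) (off i' + v) = (\<Sum>j<snd (verts (Gs i') ! v). push_chain Gs i c (emb Gs i' (v, j)))"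
    by (simp add: bdry_def vert_G assms)
  also have "\<dots> = (\<Sum>j<snd (verts (Gs i') ! v). if i' = i then c (v, j) else 0)"
  proof (rule sum.cong[OF refl])
    fix j assume "j \<in> {..<snd (verts (Gs i') ! v)}"
    then have "(v, j) \<in> flags (Gs i')" using fl by simp
    then show "push_chain Gs i c (emb Gs i' (v, j)) = (if i' = i then c (v, j) else 0)"
      using push_emb[of "(v, j)" i c] push_emb_other[of "(v, j)" i' i c] by (cases "i' = i") (simp_all del: emb_Pair)
  qed
  finally show ?thesis by (simp add: bdry_def)
qed

lemma push_H1:
  assumes "i < h" "c \<in> H1 (Gs i)"
  shows "push_chain Gs i c \<in> H1 G"
proof -
  have c: "c \<in> chains1 (Gs i)" "\<And>v. v < k i \<Longrightarrow> bdry (Gs i) c v = 0" using assms(2) by (auto simp: H1_def)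
  have "bdry G (push_chain Gs i c) u = 0" if u: "u < off h" for u
  proof -
    obtain i' v where "i' < h" "v < k i'" "u = off i' + v" using block_exists[OF u] by blast
    then show ?thesis by (cases "i' = i") (simp_all add: bdry_push[OF assms(1)] c(2))
  qed
  then show ?thesis using push_chains1[OF assms(1) c(1)] by (simp add: H1_def length_G)
qed

lemma collapse_apply: "f \<in> flags H \<Longrightarrow> collapse_chain H Gs c f = c (out f)"
  by (simp add: collapse_chain_def pull_chain_def)

lemma collapse_chains1:
  assumes "c \<in> chains1 G"
  shows "collapse_chain H Gs c \<in> chains1 H"
  unfolding chains1_def mem_Collect_eq
proof (intro conjI allI impI ballI)
  fix f assume f: "f \<in> flags H"
  then have "ginv H f \<in> flags H" by simp
  then show "collapse_chain H Gs c (ginv H f) = - collapse_chain H Gs c f"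
    using G.chain_ginv[OF assms, of "out f"] f by (simp only: collapse_apply ginv_out)
qed (simp add: collapse_chain_def pull_chain_def)

text \<open>In the sum over all flags of a block the inner edges cancel, and the legs that remain
  are the flags of the \<open>i\<close>-th vertex of \<open>H\<close>.\<close>

lemma bdry_collapse:
  assumes "c \<in> chains1 G" "i < h"
  shows "bdry H (collapse_chain H Gs c) i = (\<Sum>v<k i. bdry G c (off i + v))"
proof -
  let ?L = "set (legs (Gs i))"
  interpret Gi: graph_wf "Gs i" by (rule wf_i[OF assms(2)])
  have sub: "?L \<subseteq> flags (Gs i)" using Gi.set_legs by blast
  have "(\<Sum>v<k i. bdry G c (off i + v)) = (\<Sum>f\<in>flags (Gs i). c (emb Gs i f))"
    unfolding sum_flags by (simp add: bdry_def vert_G assms(2))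
  also have "\<dots> = (\<Sum>f\<in>flags (Gs i) - ?L. c (emb Gs i f)) + (\<Sum>f\<in>?L. c (emb Gs i f))"
    by (rule sum.subset_diff[OF sub finite_flags])
  also have "(\<Sum>f\<in>flags (Gs i) - ?L. c (emb Gs i f)) = 0"
  proof -
    have set: "flags (Gs i) - ?L = {f \<in> flags (Gs i). ginv (Gs i) f \<noteq> f}" using Gi.set_legs by blast
    have "(\<Sum>f\<in>flags (Gs i) - ?L. c (emb Gs i f)) = (\<Sum>f\<in>flags (Gs i) - ?L. c (emb Gs i (ginv (Gs i) f)))"
      unfolding set
      by (rule sum.reindex_bij_witness[of _ "ginv (Gs i)" "ginv (Gs i)"]) (auto simp del: split_paired_All)
    also have "\<dots> = (\<Sum>f\<in>flags (Gs i) - ?L. - c (emb Gs i f))"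
      unfolding set
    proof (rule sum.cong[OF refl])
      fix f assume "f \<in> {f \<in> flags (Gs i). ginv (Gs i) f \<noteq> f}"
      then have "emb Gs i (ginv (Gs i) f) = ginv G (emb Gs i f)" using ginv_emb[OF assms(2)] by simp
      then show "c (emb Gs i (ginv (Gs i) f)) = - c (emb Gs i f)" using G.chain_ginv[OF assms(1)] by simp
    qed
    also have "\<dots> = - (\<Sum>f\<in>flags (Gs i) - ?L. c (emb Gs i f))" by (rule sum_negf)
    finally show ?thesis by (simp add: eq_neg_iff_add_eq_0 mult_2[symmetric])
  qed
  also have "(\<Sum>f\<in>?L. c (emb Gs i f)) = (\<Sum>f\<leftarrow>legs (Gs i). c (emb Gs i f))"
    by (rule sum_list_distinct_conv_sum_set[OF Gi.distinct_legs, symmetric])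
  also have "\<dots> = (\<Sum>l<snd (verts H ! i). collapse_chain H Gs c (i, l))"
    unfolding sum_list_nth_sum val[OF assms(2)]
    by (rule sum.cong[OF refl], subst collapse_apply) (use assms(2) in \<open>auto simp: flag_H val\<close>)
  finally show ?thesis by (simp add: bdry_def)
qed

lemma collapse_H1:
  assumes "c \<in> H1 G"
  shows "collapse_chain H Gs c \<in> H1 H"
proof -
  have c: "c \<in> chains1 G" "\<And>u. u < off h \<Longrightarrow> bdry G c u = 0" using assms by (auto simp: H1_def length_G)
  have "bdry H (collapse_chain H Gs c) i = 0" if "i < h" for i
    unfolding bdry_collapse[OF c(1) that] using c(2) off_less that by simp
  then show ?thesis using collapse_chains1[OF c(1)] by (simp add: H1_def)
qed

text \<open>Lifts of the first vertices of the blocks thus collapse to lifts of the vertices of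
  \<open>H\<close>, which can serve in the orientation of \<open>H\<close>.\<close>

lemma bdry_collapse_lift:
  assumes "i < h" "j < h" "1 \<le> j"
  shows "bdry H (collapse_chain H Gs (lift_vertex G (off j))) i = (if i = j then 1 else 0) - (if i = 0 then 1 else 0 :: 'k::field_char_0)"
proof -
  have pos: "off m < off h" if "m < h" for m using off_less[OF that, of 0] k_pos[OF that] by simp
  have l: "lift_vertex G (off j) \<in> chains1 G" using G.lift_vertex(1) pos[OF assms(2)] length_G by simp
  have "bdry H (collapse_chain H Gs (lift_vertex G (off j))) i
    = (\<Sum>v<k i. (if off i + v = off j then 1 else 0) - (if off i + v = 0 then 1 else 0 :: 'k))"
    unfolding bdry_collapse[OF l assms(1)]
    by (rule sum.cong[OF refl], subst G.lift_vertex(2)) (use pos[OF assms(2)] off_less[OF assms(1)] length_G in auto)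
  also have "\<dots> = (\<Sum>v<k i. (if v = 0 then (if i = j then 1 else 0) - (if i = 0 then 1 else 0) else 0))"
  proof (rule sum.cong[OF refl])
    fix v assume "v \<in> {..<k i}"
    then have "off i + v = off m \<longleftrightarrow> v = 0 \<and> i = m" if "m < h" for m
      using block_inj[of i v m 0] k_pos[OF that] by auto
    from this[OF assms(2)] this[of 0]
    show "(if off i + v = off j then 1 else 0) - (if off i + v = 0 then 1 else 0)
      = (if v = 0 then (if i = j then 1 else 0) - (if i = 0 then 1 else 0) else 0 :: 'k)"
      using H.nv_pos by auto
  qed
  also have "\<dots> = (if i = j then 1 else 0) - (if i = 0 then 1 else 0)"
    using k_pos[OF assms(1)] by simp
  finally show ?thesis .
qed

end

section \<open>The orientation determinant of a grafted graph\<close>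

locale grafted_det = grafted H G Gs for H G Gs +
  fixes d :: bit and bs :: "(flag \<Rightarrow> 'k::field_char_0) list" and bss :: "nat \<Rightarrow> (flag \<Rightarrow> 'k) list"
  assumes det_args_i: "i < h \<Longrightarrow> det_args d (Gs i) (bss i)"
    and bs_H1: "set bs \<subseteq> H1 G" and length_bs: "length bs = det_rank TYPE('k) d H"
begin

abbreviation "e i \<equiv> length (edge_list (Gs i))"

definition bs_G :: "(flag \<Rightarrow> 'k) list" where
  "bs_G = bs @ concat (map (\<lambda>i. map (push_chain Gs i) (bss i)) [0..<h])"

lemma length_edges_G: "length edges_G = (\<Sum>i<h. e i) + length (edge_list H)"
proof -
  have "length (block_edges m) = (\<Sum>i<m. e i)" for m by (induction m) simp_all
  then show ?thesis by (simp add: edges_G_def)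
qed

lemma euler_i: "i < h \<Longrightarrow> betti TYPE('k) (Gs i) + k i = e i + 1"
  using graph_conn.betti_euler[OF conn_i reps_i] by blast

lemma betti_G: "betti TYPE('k) G = betti TYPE('k) H + (\<Sum>i<h. betti TYPE('k) (Gs i))"
proof -
  have "(\<Sum>i<h. betti TYPE('k) (Gs i) + k i) = (\<Sum>i<h. e i + 1)"
    by (rule sum.cong) (use euler_i in auto)
  then have "(\<Sum>i<h. betti TYPE('k) (Gs i)) + off h = (\<Sum>i<h. e i) + h"
    by (simp only: sum.distrib offset_def) simp
  then show ?thesis
    using G.betti_euler[OF edge_reps_G, where ?'k = 'k] H.betti_euler[OF H.edge_reps_edge_list, where ?'k = 'k]
      length_edges_G length_G by linarith
qed

lemma det_args_G: "det_args d G bs_G"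
proof -
  have "set bs_G \<subseteq> H1 G"
  proof
    fix c assume "c \<in> set bs_G"
    then consider "c \<in> set bs" | i c' where "i < h" "c' \<in> set (bss i)" "c = push_chain Gs i c'"
      by (auto simp: bs_G_def)
    then show "c \<in> H1 G"
    proof cases
      case 2
      then show ?thesis using push_H1[OF 2(1), of c'] det_args_i[OF 2(1)] by (auto simp: det_args_def)
    qed (use bs_H1 in blast)
  qed
  moreover have "length bs_G = det_rank TYPE('k) d G"
  proof -
    have "(\<Sum>i<h. length (bss i)) = (\<Sum>i<h. det_rank TYPE('k) d (Gs i))"
      by (rule sum.cong) (use det_args_i in \<open>auto simp: det_args_def\<close>)
    then show ?thesis using length_bs by (simp add: bs_G_def length_concat_upt det_rank_def betti_G)
  qed
  ultimately show ?thesis by (simp add: det_args_def)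
qed

lemma det_args_H: "det_args d H (map (collapse_chain H Gs) bs)"
  using bs_H1 collapse_H1 length_bs by (auto simp: det_args_def)

lemma bss_length: "i < h \<Longrightarrow> of_nat (length (bss i)) = d * (of_nat (e i) + of_nat (k i) + 1)"
proof -
  assume i: "i < h"
  show ?thesis
  proof (cases "d = 0")
    case False
    have "of_nat (betti TYPE('k) (Gs i) + k i) = (of_nat (e i + 1) :: bit)" by (simp only: euler_i[OF i])
    then have "of_nat (betti TYPE('k) (Gs i)) + of_nat (k i) = (of_nat (e i) + 1 :: bit)" by simp
    then show ?thesis using det_args_i[OF i] False
      by (simp add: det_args_def det_rank_def bit_add_eq_move ac_simps)
  qed (use det_args_i[OF i] in \<open>simp add: det_args_def det_rank_def\<close>)
qed

abbreviation "lf i \<equiv> lift_vertex (Gs i) :: nat \<Rightarrow> flag \<Rightarrow> 'k"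
abbreviation "base i \<equiv> lift_vertex G (off i) :: flag \<Rightarrow> 'k"

text \<open>The row of the first vertex of a block. Block 0 has none, its first vertex being the
  base vertex of \<open>G\<close>.\<close>

definition heads :: "nat \<Rightarrow> (flag \<Rightarrow> 'k) list" where
  "heads i = (if i = 0 then [] else [base i])"

text \<open>Paths inside the block, which start at its first vertex; these rows live on the columns
  of the block alone.\<close>

definition tails :: "nat \<Rightarrow> (flag \<Rightarrow> 'k) list" where
  "tails i = map (\<lambda>v. push_chain Gs i (lf i v)) [1..<k i]"

text \<open>The same paths continued back to the base vertex of \<open>G\<close>, so that they have
  the boundary of the lifts of \<open>G\<close>.\<close>

definition shifted_tails :: "nat \<Rightarrow> (flag \<Rightarrow> 'k) list" where
  "shifted_tails i = (if i = 0 then tails i else map (\<lambda>x f. x f + base i f) (tails i))"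

lemma off_pos: "0 < m \<Longrightarrow> 0 < off m"
  using off_less[of 0 m 0] k_pos[OF H.nv_pos] by simp

lemma lifts_blocks:
  "m \<le> h \<Longrightarrow> map (lift_vertex G :: nat \<Rightarrow> flag \<Rightarrow> 'k) [1..<off m]
    = concat (map (\<lambda>i. heads i @ map (\<lambda>v. lift_vertex G (off i + v)) [1..<k i]) [0..<m])"
proof (induction m)
  case (Suc m)
  have k: "0 < k m" using k_pos Suc.prems by simp
  have shift: "map (\<lambda>v. off m + v) [1..<k m] = [off m + 1..<off m + k m]"
  proof -
    have "map (\<lambda>v. a + v) [1..<n] = [a + 1..<a + n]" if "0 < n" for a n :: nat
      using that by (induction n) auto
    then show ?thesis using k by blast
  qed
  have "map (lift_vertex G :: nat \<Rightarrow> flag \<Rightarrow> 'k) [off m + 1..<off m + k m] = map (\<lambda>v. lift_vertex G (off m + v)) [1..<k m]"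
    unfolding shift[symmetric] by simp
  moreover have "[1..<off m + k m] = [1..<off m] @ (if m = 0 then [] else [off m]) @ [off m + 1..<off m + k m]"
  proof (cases "m = 0")
    case False
    then have "0 < off m" using off_pos by simp
    then have "[1..<off m + k m] = [1..<off m] @ [off m..<off m + k m]" by (intro upt_add_eq_append) simp
    then show ?thesis using False k by (simp add: upt_conv_Cons)
  qed simp
  ultimately show ?case using Suc by (simp add: heads_def)
qed simp

lemma rev_block_edges: "rev (block_edges m) = concat (map (\<lambda>i. map (emb Gs i) (rev (edge_list (Gs i)))) [0..<m])"
  by (induction m) (simp_all add: rev_map)

lemma base_chain:
  assumes "i < h"
  shows "base i \<in> chains1 G"
    "u < off h \<Longrightarrow> bdry G (base i) u = (if u = off i then 1 else 0) - (if u = 0 then 1 else 0)"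
proof -
  have "off i < length (verts G)" using off_less[OF assms, of 0] k_pos[OF assms] length_G by simp
  then show "base i \<in> chains1 G" "u < off h \<Longrightarrow> bdry G (base i) u = (if u = off i then 1 else 0) - (if u = 0 then 1 else 0)"
    by (simp_all add: G.lift_vertex length_G)
qed

lemma lf_chain: "i < h \<Longrightarrow> v < k i \<Longrightarrow> lf i v \<in> chains1 (Gs i)"
  using graph_conn.lift_vertex(1)[OF conn_i] by blast

text \<open>A path to a vertex of block \<open>i\<close> can be chosen to go to the first vertex of
  the block and to stay inside the block from there on.\<close>

lemma lift_block_diff:
  assumes "i < h" "1 \<le> v" "v < k i"
  shows "(\<lambda>f. lift_vertex G (off i + v) f - (if i = 0 then push_chain Gs i (lf i v) f else push_chain Gs i (lf i v) f + base i f))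
    \<in> H1 G"
proof -
  let ?P = "push_chain Gs i (lf i v)"
  let ?T = "\<lambda>f. if i = 0 then ?P f else ?P f + base i f"
  have less: "off i + v < length (verts G)" using off_less assms length_G by simp
  have P: "?P \<in> chains1 G" by (rule push_chains1[OF assms(1) lf_chain]) (use assms in simp_all)
  show ?thesis
  proof (rule G.same_bdry_diff)
    show "lift_vertex G (off i + v) \<in> chains1 G" by (rule G.lift_vertex(1)[OF less])
    show "?T \<in> chains1 G"
      using P fs.subspace_add[OF G.chains1_subspace P base_chain(1)[OF assms(1)]]
      by (cases "i = 0") (simp_all add: plus_fun_def)
    fix u assume "u < length (verts G)"
    then have u: "u < off h" by (simp add: length_G)
    obtain i' v' where uv: "i' < h" "v' < k i'" "u = off i' + v'" using block_exists[OF u] by blast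
    have bP: "bdry G ?P u = (if i' = i then (if v' = v then 1 else 0) - (if v' = 0 then 1 else 0) else 0)"
      unfolding uv(3) bdry_push[OF assms(1) uv(1,2)]
      by (cases "i' = i") (use graph_conn.lift_vertex(2)[OF conn_i[OF assms(1)], of v v', where ?'k = 'k] assms uv(2) in simp_all)
    have e1: "u = off i + v \<longleftrightarrow> i' = i \<and> v' = v"
      using block_inj[of i' v' i v] uv assms by auto
    have e2: "u = off i \<longleftrightarrow> i' = i \<and> v' = 0"
      using block_inj[of i' v' i 0] uv k_pos[OF assms(1)] by auto
    have bT: "bdry G ?T u = bdry G ?P u + (if i = 0 then 0 else bdry G (base i) u)"
      by (cases "i = 0") (simp_all add: G.bdry_linear)
    show "bdry G (lift_vertex G (off i + v)) u = bdry G ?T u"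
    proof -
      have L: "bdry G (lift_vertex G (off i + v)) u
        = (if i' = i \<and> v' = v then 1 else 0) - (if u = 0 then 1 else 0 :: 'k)"
        using G.lift_vertex(2)[OF less, of u, where ?'k = 'k] u length_G e1 by simp
      have L0: "bdry G (base i) u = (if i' = i \<and> v' = 0 then 1 else 0) - (if u = 0 then 1 else 0 :: 'k)"
        using base_chain(2)[OF assms(1) u] e2 by simp
      show ?thesis
      proof (cases "i = 0")
        case True
        then have "u = 0 \<longleftrightarrow> i' = 0 \<and> v' = 0" using e2 by simp
        then show ?thesis unfolding bT bP L using True assms(2) by auto
      qed (unfold bT bP L L0, simp)
    qed
  qed
qed

lemma list_all2_concat_upt:
  "(\<And>i. i < m \<Longrightarrow> list_all2 R (F i) (F' i)) \<Longrightarrow> list_all2 R (concat (map F [0..<m])) (concat (map F' [0..<m]))"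
  by (induction m) (simp_all add: list_all2_appendI)

lemma length_heads_tails: "i < h \<Longrightarrow> length (tails i) + 1 = k i" "length (heads i) = (if i = 0 then 0 else 1)"
  using k_pos[of i] by (simp_all add: tails_def heads_def)

text \<open>With suitable lifts the matrix becomes block triangular: cycles and paths inside a block
  vanish on outer edges and on other blocks. The diagonal blocks are the orientations of
  \<open>H\<close> and of all \<open>Gs i\<close>; the sign is that of sorting the rows into
  blocks.\<close>

lemma det_factor_graft:
  "det_factor d G bs_G edges_G = sg (d * (\<Sum>i<h. \<Sum>j<i. of_nat (length (bss i)) * of_nat (k j) + of_nat (e j))) *
     det_factor d H (map (collapse_chain H Gs) bs) (edge_list H) *
     (\<Prod>i<h. det_factor d (Gs i) (bss i) (edge_list (Gs i)))"
proof (cases "d = 0")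
  case True
  then show ?thesis by (simp add: det_factor_def)
next
  case False
  then have d: "d = 1" by simp
  let ?b = "\<lambda>i. map (push_chain Gs i) (bss i)" and ?c = "\<lambda>i. map (emb Gs i) (rev (edge_list (Gs i)))"
    and ?outer = "map out (rev (edge_list H))"
  have cols: "rev edges_G = ?outer @ concat (map ?c [0..<h])"
    by (simp add: edges_G_def rev_block_edges rev_map)
  have lenG: "length (bs_G @ map (lift_vertex G :: nat \<Rightarrow> flag \<Rightarrow> 'k) [1..<length (verts G)]) = length edges_G"
    by (rule G.length_det_rows[OF det_args_G d edge_reps_G])
  have betti_i: "length (bss i) = betti TYPE('k) (Gs i)" "set (bss i) \<subseteq> H1 (Gs i)" if "i < h" for i
    using det_args_i[OF that] d by (auto simp: det_args_def det_rank_def)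
  have len_i: "length (bss i) + length (tails i) = e i" if "i < h" for i
    using euler_i[OF that] betti_i[OF that] length_heads_tails(1)[OF that] by linarith
  have lifts: "map (lift_vertex G :: nat \<Rightarrow> flag \<Rightarrow> 'k) [1..<length (verts G)]
      = concat (map (\<lambda>i. heads i @ map (\<lambda>v. lift_vertex G (off i + v)) [1..<k i]) [0..<h])"
    unfolding length_G by (rule lifts_blocks) simp
  have len_blocks: "length (concat (map (\<lambda>i. heads i @ tails i) [0..<h])) = length (map (lift_vertex G :: nat \<Rightarrow> flag \<Rightarrow> 'k) [1..<length (verts G)])"
    unfolding lifts by (simp add: length_concat_upt tails_def)
  have "det_factor d G bs_G edges_G = ldet (bs_G @ map (lift_vertex G) [1..<length (verts G)]) (rev edges_G)"
    using d by (simp add: det_factor_def)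
  \<comment> \<open>The lifts are replaced by paths through the first vertex of the block, which
    changes them by cycles only.\<close>
  also have "\<dots> = ldet (bs_G @ concat (map (\<lambda>i. heads i @ shifted_tails i) [0..<h])) (rev edges_G)"
  proof (rule G.ldet_lifts)
    show "list_all2 (\<lambda>u v. (\<lambda>f. u f - v f) \<in> H1 G) (map (lift_vertex G) [1..<length (verts G)])
      (concat (map (\<lambda>i. heads i @ shifted_tails i) [0..<h]))"
      unfolding lifts
    proof (rule list_all2_concat_upt, rule list_all2_appendI)
      fix i assume i: "i < h"
      have "(\<lambda>f. 0) \<in> (H1 G :: (flag \<Rightarrow> 'k) set)"
        using fs.subspace_0[OF G.H1_subspace] by (simp add: zero_fun_def)
      then show "list_all2 (\<lambda>u v. (\<lambda>f. u f - v f) \<in> H1 G) (heads i) (heads i)"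
        by (simp add: list_all2_conv_all_nth)
      show "list_all2 (\<lambda>u v. (\<lambda>f. u f - v f) \<in> H1 G) (map (\<lambda>v. lift_vertex G (off i + v)) [1..<k i]) (shifted_tails i)"
        using lift_block_diff[OF i]
        by (cases "i = 0") (auto simp: list_all2_conv_all_nth shifted_tails_def tails_def simp del: add_Suc_right)
    qed
  qed (use det_args_G lenG d in \<open>simp_all add: det_args_def det_rank_def\<close>)
  \<comment> \<open>The common part \<open>base i\<close> of the paths in a block is itself a row,
    so row operations remove it.\<close>
  also have "\<dots> = ldet (bs_G @ concat (map (\<lambda>i. heads i @ tails i) [0..<h])) (rev edges_G)"
  proof -
    have "ldet (bs_G @ concat (map (\<lambda>i. heads i @ shifted_tails i) [0..<m]) @ zs) (rev edges_G)
      = ldet (bs_G @ concat (map (\<lambda>i. heads i @ tails i) [0..<m]) @ zs) (rev edges_G)"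
      if "length (bs_G @ concat (map (\<lambda>i. heads i @ tails i) [0..<m]) @ zs) = length (rev edges_G)" for m zs
      using that
    proof (induction m arbitrary: zs)
      case (Suc m)
      have len_sh: "length (concat (map (\<lambda>i. heads i @ shifted_tails i) [0..<m])) = length (concat (map (\<lambda>i. heads i @ tails i) [0..<m]))"
        by (auto simp: length_concat_upt shifted_tails_def intro!: sum.cong)
      let ?A = "bs_G @ concat (map (\<lambda>i. heads i @ shifted_tails i) [0..<m])"
      have "ldet (?A @ heads m @ shifted_tails m @ zs) (rev edges_G) = ldet (?A @ heads m @ tails m @ zs) (rev edges_G)"
      proof (cases "m = 0")
        case False
        then have "ldet (?A @ heads m @ shifted_tails m @ zs) (rev edges_G)
          = ldet (?A @ base m # map (\<lambda>x f. x f + base m f) (tails m) @ zs) (rev edges_G)"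
          by (simp add: heads_def shifted_tails_def)
        also have "\<dots> = ldet (?A @ base m # tails m @ zs) (rev edges_G)"
          by (rule ldet_shift_rows) (use Suc.prems False len_sh in \<open>simp add: heads_def\<close>)
        finally show ?thesis using False by (simp add: heads_def)
      qed (simp add: shifted_tails_def)
      also have "\<dots> = ldet (bs_G @ concat (map (\<lambda>i. heads i @ tails i) [0..<m]) @ heads m @ tails m @ zs) (rev edges_G)"
        using Suc.IH[of "heads m @ tails m @ zs"] Suc.prems by simp
      finally show ?case by simp
    qed simp
    from this[of h "[]"] show ?thesis using lenG len_blocks by simp
  qed
  also have "\<dots> = ldet (bs @ concat (map ?b [0..<h]) @ concat (map (\<lambda>i. heads i @ tails i) [0..<h]) @ [])
      (?outer @ concat (map ?c [0..<h]))"
    by (simp add: bs_G_def cols)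
  \<comment> \<open>The outer columns keep the rows \<open>bs\<close> and the heads, as many as
    \<open>H\<close> has edges; each block keeps its cycles and tails.\<close>
  also have "\<dots> = sg (peel_sign (\<lambda>i. length (?b i)) (\<lambda>i. length (heads i)) (\<lambda>i. length (tails i)) h (length ([] :: (flag \<Rightarrow> 'k) list))) *
      ldet (bs @ concat (map heads [0..<h]) @ []) ?outer * (\<Prod>i<h. ldet (?b i @ tails i) (?c i))"
  proof (rule ldet_peel)
    fix i assume i: "i < h"
    show "length (?b i) + length (tails i) = length (?c i)" using len_i[OF i] by simp
    have rows: "\<exists>c\<in>chains1 (Gs i). r = push_chain Gs i c" if "r \<in> set (?b i) \<union> set (tails i)" for r
      using that betti_i(2)[OF i] lf_chain[OF i] by (auto simp: tails_def H1_def)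
    fix r f assume r: "r \<in> set (?b i) \<union> set (tails i)"
    then obtain c where c: "c \<in> chains1 (Gs i)" "r = push_chain Gs i c" using rows by blast
    {
      assume "f \<in> set ?outer"
      then obtain g where "g \<in> flags H" "f = out g"
        using edge_reps_subset[OF H.edge_reps_edge_list] by auto
      then show "r f = 0" using push_out[OF i _ c(1)] c(2) by simp
    next
      fix j assume "j < i" "f \<in> set (?c j)"
      then obtain g where "g \<in> flags (Gs j)" "f = emb Gs j g"
        using edge_i(1)[of j] i by auto
      then show "r f = 0" using push_emb_other[of g j i c] \<open>j < i\<close> c(2) by simp
    }
  next
    have "length bs + h = length (edge_list H) + 1"
      using H.betti_euler[OF H.edge_reps_edge_list, where ?'k = 'k] length_bs d by (simp add: det_rank_def)
    moreover have "(\<Sum>i<m. length (heads i)) + (if m = 0 then 0 else 1) = m" for m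
      by (induction m) (auto simp: heads_def)
    from this[of h] have "(\<Sum>i<h. length (heads i)) + 1 = h" using H.nv_pos by simp
    ultimately show "length bs + (\<Sum>i<h. length (heads i)) + length ([] :: (flag \<Rightarrow> 'k) list) = length ?outer" by simp
  qed
  also have "peel_sign (\<lambda>i. length (?b i)) (\<lambda>i. length (heads i)) (\<lambda>i. length (tails i)) h (length ([] :: (flag \<Rightarrow> 'k) list))
      = d * (\<Sum>i<h. \<Sum>j<i. of_nat (length (bss i)) * of_nat (k j) + of_nat (e j))"
  proof -
    have "peel_sign (\<lambda>i. length (?b i)) (\<lambda>i. length (heads i)) (\<lambda>i. length (tails i)) h 0
      = (\<Sum>i<h. \<Sum>j<i. of_nat (length (?b i)) * of_nat (k j) + of_nat (length (?b j) + length (tails j)))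
        + of_nat 0 * (\<Sum>i<h. of_nat (length (?b i) + length (tails i)))"
      by (rule peel_sign_eq) (use length_heads_tails in auto)
    also have "\<dots> = (\<Sum>i<h. \<Sum>j<i. of_nat (length (bss i)) * of_nat (k j) + of_nat (e j))"
      using len_i by (auto intro!: sum.cong simp flip: of_nat_add)
    finally show ?thesis using d by simp
  qed
  \<comment> \<open>Evaluating a chain at the image of an outer flag is evaluating its collapse, and
    the collapsed heads are lifts for \<open>H\<close>.\<close>
  also have "ldet (bs @ concat (map heads [0..<h]) @ []) ?outer = det_factor d H (map (collapse_chain H Gs) bs) (edge_list H)"
  proof -
    have heads: "concat (map heads [0..<h]) = map base [1..<h]"
    proof -
      have "concat (map heads [0..<m]) = map base [1..<m]" for m by (induction m) (auto simp: heads_def)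
      then show ?thesis .
    qed
    have len: "length (bs @ map base [1..<h]) = length (edge_list H)"
      using H.length_det_rows[OF det_args_H d H.edge_reps_edge_list] by simp
    have "ldet (bs @ concat (map heads [0..<h]) @ []) ?outer = ldet (map (\<lambda>r. r \<circ> out) (bs @ map base [1..<h])) (rev (edge_list H))"
      unfolding heads append_Nil2 by (rule ldet_map_cols) (use len in simp)
    also have "\<dots> = ldet (map (collapse_chain H Gs) bs @ map (\<lambda>j. collapse_chain H Gs (base j)) [1..<h]) (rev (edge_list H))"
    proof (rule ldet_cong)
      fix i f assume i: "i < length (rev (edge_list H))" and f: "f \<in> set (rev (edge_list H))"
      have "map (collapse_chain H Gs) bs @ map (\<lambda>j. collapse_chain H Gs (base j)) [1..<h] = map (collapse_chain H Gs) (bs @ map base [1..<h])"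
        by simp
      moreover have "i < length (bs @ map base [1..<h])" using i len by simp
      moreover have "f \<in> flags H" using f edge_reps_subset[OF H.edge_reps_edge_list] by auto
      ultimately show "(map (\<lambda>r. r \<circ> out) (bs @ map base [1..<h]) ! i) f
        = ((map (collapse_chain H Gs) bs @ map (\<lambda>j. collapse_chain H Gs (base j)) [1..<h]) ! i) f"
        by (simp only: nth_map collapse_apply comp_apply)
    qed
    also have "\<dots> = det_factor d H (map (collapse_chain H Gs) bs) (edge_list H)"
    proof -
      have "det_factor d H (map (collapse_chain H Gs) bs) (edge_list H)
        = (if d = 0 then 1 else ldet (map (collapse_chain H Gs) bs @ map (\<lambda>j. collapse_chain H Gs (base j)) [1..<h]) (rev (edge_list H)))"
        by (rule H.det_factor_lifts[OF det_args_H H.edge_reps_edge_list])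
          (simp_all add: collapse_chains1 base_chain(1) bdry_collapse_lift)
      then show ?thesis using d by simp
    qed
    finally show ?thesis .
  qed
  also have "(\<Prod>i<h. ldet (?b i @ tails i) (?c i)) = (\<Prod>i<h. det_factor d (Gs i) (bss i) (edge_list (Gs i)))"
  proof (rule prod.cong[OF refl])
    fix i assume "i \<in> {..<h}"
    then have i: "i < h" by simp
    let ?rows = "bss i @ map (lf i) [1..<k i]"
    have len: "length ?rows = e i"
      by (rule graph_conn.length_det_rows[OF conn_i[OF i] det_args_i[OF i] d reps_i[OF i]])
    have "ldet (?b i @ tails i) (?c i) = ldet (map (\<lambda>r. r \<circ> emb Gs i) (map (push_chain Gs i) ?rows)) (rev (edge_list (Gs i)))"
      using ldet_map_cols[of "map (push_chain Gs i) ?rows" "rev (edge_list (Gs i))" "emb Gs i"] len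
      by (simp add: tails_def comp_def)
    also have "\<dots> = ldet ?rows (rev (edge_list (Gs i)))"
    proof (rule ldet_cong)
      fix j f assume "j < length (rev (edge_list (Gs i)))" "f \<in> set (rev (edge_list (Gs i)))"
      then have "j < length ?rows" "f \<in> flags (Gs i)" using len edge_i(1)[OF i] by auto
      then show "(map (\<lambda>r. r \<circ> emb Gs i) (map (push_chain Gs i) ?rows) ! j) f = (?rows ! j) f"
        by (simp only: nth_map length_map comp_apply push_emb)
    qed
    finally show "ldet (?b i @ tails i) (?c i) = det_factor d (Gs i) (bss i) (edge_list (Gs i))"
      using d by (simp add: det_factor_def)
  qed
  finally show ?thesis .
qed

end

section \<open>Associativity of contractions\<close>

locale pairing_graft = pairing d N q w + grafted H G Gs
  for d N q and w :: "nat \<Rightarrow> nat \<Rightarrow> 'k::field_char_0" and H G Gs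
begin

definition outer_assign :: "(flag \<Rightarrow> nat) \<Rightarrow> flag \<Rightarrow> nat" where
  "outer_assign c = (\<lambda>f\<in>flags H. c (out f))"

definition inner_assign :: "(flag \<Rightarrow> nat) \<Rightarrow> nat \<Rightarrow> flag \<Rightarrow> nat" where
  "inner_assign c i = (\<lambda>f\<in>flags (Gs i). c (emb Gs i f))"

lemma outer_assigns: "c \<in> assigns G \<Longrightarrow> outer_assign c \<in> assigns H"
  unfolding assigns_def outer_assign_def using out_flags by (auto simp del: out_Pair)

lemma inner_assigns: "c \<in> assigns G \<Longrightarrow> i < h \<Longrightarrow> inner_assign c i \<in> assigns (Gs i)"
  unfolding assigns_def inner_assign_def using emb_flags by (auto simp del: emb_Pair)

lemma outer_apply: "f \<in> flags H \<Longrightarrow> outer_assign c f = c (out f)"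
  by (simp add: outer_assign_def)

lemma inner_apply: "f \<in> flags (Gs i) \<Longrightarrow> inner_assign c i f = c (emb Gs i f)"
  by (simp add: inner_assign_def)

lemma wf_graph_i: "i < h \<Longrightarrow> wf_graph (Gs i)"
  using wf_i graph_wf.wf by blast

abbreviation "ew i \<equiv> edge_word (Gs i) (edge_list (Gs i))"
abbreviation "word i \<equiv> ew i @ legs (Gs i)"

lemma set_word: "i < h \<Longrightarrow> set (word i) = flags (Gs i)"
  by (rule graph_wf.mset_edge_word(3)[OF wf_i reps_i])

lemma edge_word_emb:
  assumes "i < h" "set es \<subseteq> set (edge_list (Gs i))"
  shows "edge_word G (map (emb Gs i) es) = map (emb Gs i) (edge_word (Gs i) es)"
  using assms(2)
proof (induction es)
  case (Cons f es)
  then show ?case using ginv_emb[OF assms(1) edge_i[OF assms(1), of f]] by simp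
qed simp

lemma edge_word_out: "set es \<subseteq> flags H \<Longrightarrow> edge_word G (map out es) = map out (edge_word H es)"
proof (induction es)
  case (Cons f es)
  then show ?case using ginv_out[of f] by simp
qed simp

text \<open>An intermediate word with the inner edges as in \<open>edges_G\<close>, followed by all
  outer flags in the order of \<open>flag_list H\<close>. It separates the sign of the blocks from
  the sign of rearranging the outer flags inside \<open>H\<close>.\<close>

definition block_words :: "nat \<Rightarrow> flag list" where
  "block_words m = edge_word G (block_edges m) @ concat (map (\<lambda>i. map (emb Gs i) (legs (Gs i))) [0..<m])"

lemma set_block_words:
  assumes "m \<le> h" "f \<in> set (block_words m)"
  obtains i g where "i < m" "g \<in> flags (Gs i)" "f = emb Gs i g"
proof -
  have "set (block_words m) \<subseteq> (\<Union>i<m. emb Gs i ` flags (Gs i))"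
    using assms(1)
  proof (induction m)
    case (Suc m)
    then have m: "m < h" by simp
    have "set (map (emb Gs m) (word m)) \<subseteq> emb Gs m ` flags (Gs m)" using set_word[OF m] by auto
    moreover have "set (block_words m) \<subseteq> (\<Union>i<m. emb Gs i ` flags (Gs i))" using Suc by simp
    moreover have "set (block_words (Suc m)) = set (map (emb Gs m) (word m)) \<union> set (block_words m)"
      using edge_word_emb[OF m order_refl] by (auto simp: block_words_def)
    ultimately show ?case unfolding lessThan_Suc by blast
  qed (simp add: block_words_def)
  then show thesis using assms(2) that by blast
qed

lemma pos_emb_less:
  assumes "i < h" "i' < h" "f \<in> flags (Gs i)" "f' \<in> flags (Gs i')"
  shows "i < i' \<Longrightarrow> flag_pos G (emb Gs i f) < flag_pos G (emb Gs i' f')"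
    and "i = i' \<Longrightarrow> flag_pos G (emb Gs i f) < flag_pos G (emb Gs i' f') \<longleftrightarrow> flag_pos (Gs i) f < flag_pos (Gs i) f'"
proof -
  obtain v j v' j' where f: "f = (v, j)" "f' = (v', j')" by fastforce
  then have v: "v < k i" "v' < k i'" using assms(3,4) by (auto simp: flags_def)
  have iff: "flag_pos G (emb Gs i f) < flag_pos G (emb Gs i' f') \<longleftrightarrow>
      off i + v < off i' + v' \<or> off i + v = off i' + v' \<and> j < j'"
    using flag_pos_less_iff[OF emb_flags[OF assms(1,3)] emb_flags[OF assms(2,4)]] by (simp add: f)
  show "i < i' \<Longrightarrow> flag_pos G (emb Gs i f) < flag_pos G (emb Gs i' f')"
    unfolding iff using off_less[of i i' v] v by simp
  show "i = i' \<Longrightarrow> flag_pos G (emb Gs i f) < flag_pos G (emb Gs i' f') \<longleftrightarrow> flag_pos (Gs i) f < flag_pos (Gs i) f'"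
    unfolding iff using flag_pos_less_iff[OF assms(3), of f'] assms(4) f by auto
qed

definition block_par :: "(flag \<Rightarrow> nat) \<Rightarrow> nat \<Rightarrow> bit" where
  "block_par c i = (\<Sum>v<k i. vpar (Gs i) (inner_assign c i) v)"

lemma sum_list_cong: "(\<And>x. x \<in> set xs \<Longrightarrow> f x = g x) \<Longrightarrow> sum_list (map f xs) = sum_list (map g xs)"
  by (metis map_cong)

lemma word_par:
  assumes "i < h"
  shows "sum_list (map (q \<circ> c) (map (emb Gs i) (word i))) = block_par c i"
proof -
  have "sum_list (map (q \<circ> c) (map (emb Gs i) (word i))) = sum_list (map (q \<circ> inner_assign c i) (word i))"
    unfolding map_map by (rule sum_list_cong) (simp only: set_word[OF assms] comp_apply inner_apply)
  also have "\<dots> = sum_list (map (q \<circ> inner_assign c i) (flag_list (Gs i)))"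
    by (rule sum_list_map_mset[OF graph_wf.mset_edge_word(1)[OF wf_i[OF assms] reps_i[OF assms]]])
  finally show ?thesis by (simp add: block_par_def vpar_sum)
qed

lemma winv_emb:
  assumes "i < h"
  shows "winv (flag_pos G) (q \<circ> c) (map (emb Gs i) (word i))
    = winv (flag_pos (Gs i)) (q \<circ> inner_assign c i) (word i)"
  unfolding winv_map
  by (rule winv_cong) (simp_all only: set_word[OF assms] comp_apply inner_apply pos_emb_less(2)[OF assms assms])

text \<open>The block \<open>m\<close> wraps the earlier ones: its edges stand in front of them, its
  legs behind. As its flags have the larger positions, its edges, of parity \<open>d\<close> each,
  are inverted with all earlier letters, and its legs with none of them.\<close>

lemma winv_block_words:
  assumes "m \<le> h" "\<And>i. i < m \<Longrightarrow> sum_list (map (q \<circ> inner_assign c i) (ew i)) = d * of_nat (length (edge_list (Gs i)))"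
  shows "winv (flag_pos G) (q \<circ> c) (block_words m)
      = (\<Sum>i<m. winv (flag_pos (Gs i)) (q \<circ> inner_assign c i) (word i))
        + (\<Sum>i<m. \<Sum>j<i. d * of_nat (length (edge_list (Gs i))) * block_par c j)"
    "sum_list (map (q \<circ> c) (block_words m)) = (\<Sum>j<m. block_par c j)"
proof -
  let ?r = "flag_pos G" and ?p = "q \<circ> c"
  have "winv ?r ?p (block_words m)
      = (\<Sum>i<m. winv (flag_pos (Gs i)) (q \<circ> inner_assign c i) (word i))
        + (\<Sum>i<m. \<Sum>j<i. d * of_nat (length (edge_list (Gs i))) * block_par c j) \<and>
    sum_list (map ?p (block_words m)) = (\<Sum>j<m. block_par c j)"
    using assms
  proof (induction m)
    case (Suc m)
    then have m: "m < h" by simp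
    let ?P = "map (emb Gs m) (ew m)" and ?L = "map (emb Gs m) (legs (Gs m))"
    have bw: "block_words (Suc m) = ?P @ block_words m' @ ?L" if "m' = m" for m'
      using edge_word_emb[OF m order_refl] that by (simp add: block_words_def)
    have IH: "winv ?r ?p (block_words m) = (\<Sum>i<m. winv (flag_pos (Gs i)) (q \<circ> inner_assign c i) (word i))
        + (\<Sum>i<m. \<Sum>j<i. d * of_nat (length (edge_list (Gs i))) * block_par c j)"
      "sum_list (map ?p (block_words m)) = (\<Sum>j<m. block_par c j)"
      using Suc.IH[OF less_imp_le[OF m] Suc.prems(2)[OF less_SucI]] by blast+
    have word: "map (emb Gs m) (word m) = ?P @ ?L" by simp
    have sub: "set ?P \<union> set ?L \<subseteq> emb Gs m ` flags (Gs m)"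
      using set_word[OF m] by auto
    have less: "?r y < ?r x" if x: "x \<in> set ?P \<union> set ?L" and y: "y \<in> set (block_words m)" for x y
    proof -
      obtain g where g: "g \<in> flags (Gs m)" "x = emb Gs m g" using x sub by blast
      obtain i g' where g': "i < m" "g' \<in> flags (Gs i)" "y = emb Gs i g'"
        by (rule set_block_words[OF less_imp_le[OF m] y])
      show ?thesis unfolding g g' by (rule pos_emb_less(1)[OF _ m g'(2) g(1) g'(1)]) (use g' m in simp)
    qed
    have c1: "wcross ?r ?p ?P (block_words m) = sum_list (map ?p ?P) * sum_list (map ?p (block_words m))"
      by (rule wcross_all) (use less in blast)
    have c2: "wcross ?r ?p (block_words m) ?L = 0"
      by (rule wcross_none) (use less in \<open>blast intro: less_imp_le\<close>)
    have pP: "sum_list (map ?p ?P) = d * of_nat (length (edge_list (Gs m)))"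
    proof -
      have "sum_list (map ?p ?P) = sum_list (map (q \<circ> inner_assign c m) (ew m))"
        unfolding map_map
      proof (rule sum_list_cong)
        fix f assume "f \<in> set (ew m)"
        then have "f \<in> flags (Gs m)" using set_word[OF m] by auto
        then show "((q \<circ> c) \<circ> emb Gs m) f = (q \<circ> inner_assign c m) f" by (simp add: inner_apply)
      qed
      then show ?thesis using Suc.prems(2)[of m] by simp
    qed
    have own: "winv ?r ?p ?P + winv ?r ?p ?L + wcross ?r ?p ?P ?L
      = winv (flag_pos (Gs m)) (q \<circ> inner_assign c m) (word m)"
      using winv_emb[OF m, of c] unfolding word winv_append[of ?r ?p ?P ?L] .
    have "winv ?r ?p (block_words (Suc m)) = (winv ?r ?p ?P + winv ?r ?p ?L + wcross ?r ?p ?P ?L)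
      + winv ?r ?p (block_words m) + wcross ?r ?p ?P (block_words m) + wcross ?r ?p (block_words m) ?L"
      unfolding bw[OF refl] winv_append wcross_append_right wcross_append_left by (simp only: ac_simps)
    then have 1: "winv ?r ?p (block_words (Suc m)) = winv (flag_pos (Gs m)) (q \<circ> inner_assign c m) (word m)
      + winv ?r ?p (block_words m) + d * of_nat (length (edge_list (Gs m))) * (\<Sum>j<m. block_par c j)"
      unfolding own c1 c2 pP IH(2) by (simp only: add_0_right)
    have 2: "sum_list (map ?p (block_words (Suc m))) = sum_list (map ?p (block_words m)) + block_par c m"
      unfolding bw[OF refl] word_par[OF m, symmetric] word map_append sum_list.append by (simp only: ac_simps)
    show ?case unfolding 1 2 IH sum.lessThan_Suc sum_distrib_left by (simp only: ac_simps simp_thms)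
  qed (simp add: block_words_def)
  then show "winv (flag_pos G) (q \<circ> c) (block_words m)
      = (\<Sum>i<m. winv (flag_pos (Gs i)) (q \<circ> inner_assign c i) (word i))
        + (\<Sum>i<m. \<Sum>j<i. d * of_nat (length (edge_list (Gs i))) * block_par c j)"
    "sum_list (map (q \<circ> c) (block_words m)) = (\<Sum>j<m. block_par c j)" by blast+
qed

lemma map_out_flag_list:
  "map out (flag_list H) = concat (map (\<lambda>i. map (emb Gs i) (legs (Gs i))) [0..<h])"
proof -
  have "map out (map (Pair i) [0..<snd (verts H ! i)]) = map (emb Gs i) (legs (Gs i))" if "i < h" for i
    by (rule nth_equalityI) (simp_all add: val[OF that])
  then have "map (\<lambda>i. map out (map (Pair i) [0..<snd (verts H ! i)])) [0..<h] = map (\<lambda>i. map (emb Gs i) (legs (Gs i))) [0..<h]"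
    by simp
  then show ?thesis by (simp only: flag_list_def map_concat map_map comp_def)
qed

text \<open>Behind the inner edges the word of \<open>H\<close> is replaced by
  \<open>flag_list H\<close>. The resulting sign may be computed with the ranks of \<open>H\<close>,
  for which \<open>flag_list H\<close> is sorted; the rest is
  \<open>winv_block_words\<close>.\<close>

lemma winv_graft:
  assumes "\<And>i. i < h \<Longrightarrow> sum_list (map (q \<circ> inner_assign c i) (ew i)) = d * of_nat (length (edge_list (Gs i)))"
  shows "winv (flag_pos G) (q \<circ> c) (edge_word G edges_G @ legs G)
    = winv (flag_pos H) (q \<circ> outer_assign c) (edge_word H (edge_list H) @ legs H)
      + (\<Sum>i<h. winv (flag_pos (Gs i)) (q \<circ> inner_assign c i) (word i))
      + (\<Sum>i<h. \<Sum>j<i. d * of_nat (length (edge_list (Gs i))) * block_par c j)"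
proof -
  let ?r = "flag_pos G" and ?p = "q \<circ> c" and ?A = "edge_word G (block_edges h)"
    and ?X = "edge_word H (edge_list H) @ legs H" and ?Y = "flag_list H"
  note X = H.mset_edge_word[OF H.edge_reps_edge_list]
  have eH: "set (edge_list H) \<subseteq> flags H" by (rule edge_reps_subset[OF H.edge_reps_edge_list])
  have L: "edge_word G edges_G @ legs G = ?A @ map out ?X"
    by (simp add: edges_G_def edge_word_out[OF eH] legs_G)
  have "winv ?r ?p (?A @ map out ?X) + winv ?r ?p (?A @ map out ?Y) = winv ?r ?p (map out ?X) + winv ?r ?p (map out ?Y)"
    by (rule winv_append_mset) (use X(1) in \<open>simp only: mset_map\<close>)
  also have "\<dots> = winv (?r \<circ> out) (q \<circ> outer_assign c) ?X + winv (?r \<circ> out) (q \<circ> outer_assign c) ?Y"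
    unfolding winv_map
    by (intro arg_cong2[where f = "(+)"] winv_cong) (simp_all only: X(3) set_flag_list comp_apply outer_apply)
  also have "\<dots> = winv (flag_pos H) (q \<circ> outer_assign c) ?X + winv (flag_pos H) (q \<circ> outer_assign c) ?Y"
  proof (rule winv_change_rank)
    have "inj_on (flag_pos G) (out ` flags H)"
      by (rule inj_on_subset[OF inj_flag_pos]) (use out_flags in blast)
    then show "inj_on (?r \<circ> out) (set ?X)" unfolding X(3) by (rule comp_inj_on[OF out_inj])
    show "inj_on (flag_pos H) (set ?X)" unfolding X(3) by (rule inj_flag_pos)
  qed (rule X(1,2))+
  also have "winv (flag_pos H) (q \<circ> outer_assign c) ?Y = 0" by (rule winv_sorted[OF sorted_flag_list])
  finally have "winv ?r ?p (?A @ map out ?X) + winv ?r ?p (?A @ map out ?Y) = winv (flag_pos H) (q \<circ> outer_assign c) ?X"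
    by (simp only: add_0_right)
  then have "winv ?r ?p (?A @ map out ?X) = winv ?r ?p (?A @ map out ?Y) + winv (flag_pos H) (q \<circ> outer_assign c) ?X"
    by (rule iffD1[OF bit_add_eq_move])
  moreover have "?A @ map out ?Y = block_words h" by (simp add: block_words_def map_out_flag_list)
  ultimately show ?thesis
    unfolding L using winv_block_words(1)[OF order_refl, of c] assms by (simp only: ac_simps)
qed

lemma vpar_graft: "i < h \<Longrightarrow> v < k i \<Longrightarrow> vpar G c (off i + v) = vpar (Gs i) (inner_assign c i) v"
  unfolding vpar_def by (simp add: vert_G) (rule sum.cong, simp_all add: inner_assign_def flags_def)

lemma vpar_outer: "i < h \<Longrightarrow> vpar H (outer_assign c) i = sum_list (map (q \<circ> inner_assign c i) (legs (Gs i)))"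
proof -
  assume i: "i < h"
  have "sum_list (map (q \<circ> inner_assign c i) (legs (Gs i))) = (\<Sum>l<snd (verts H ! i). q (inner_assign c i (legs (Gs i) ! l)))"
    by (simp add: sum_list_nth_sum val[OF i])
  also have "\<dots> = vpar H (outer_assign c) i"
    unfolding vpar_def
  proof (rule sum.cong[OF refl])
    fix l assume "l \<in> {..<snd (verts H ! i)}"
    then have l: "(i, l) \<in> flags H" "legs (Gs i) ! l \<in> flags (Gs i)"
      using i leg_flag(1)[OF i legs_i[OF i]] by (auto simp: flag_H)
    then show "q (inner_assign c i (legs (Gs i) ! l)) = q (outer_assign c (i, l))"
      by (simp add: inner_apply outer_apply)
  qed
  finally show ?thesis by simp
qed

text \<open>Besides the moves inside the blocks, each symbol \<theta> of block \<open>i\<close>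
  passes all flags of the earlier blocks.\<close>

lemma vsign_graft:
  "vsign G c = (\<Sum>i<h. vsign (Gs i) (inner_assign c i)) + (\<Sum>i<h. \<Sum>j<i. d * of_nat (k i) * block_par c j)"
proof -
  have S: "(\<Sum>u<off m. vpar G c u) = (\<Sum>j<m. block_par c j)" if "m \<le> h" for m
    unfolding sum_blocks block_par_def by (intro sum.cong refl) (use that vpar_graft in auto)
  have split: "(\<Sum>u<off i + v. d * vpar G c u) = d * (\<Sum>j<i. block_par c j) + (\<Sum>v'<v. d * vpar (Gs i) (inner_assign c i) v')"
    if "i < h" "v \<le> k i" for i v
    using that(2)
  proof (induction v)
    case 0
    show ?case using S[of i] that(1) by (simp add: sum_distrib_left[symmetric])
  next
    case (Suc v)
    then show ?case using vpar_graft[OF that(1), of v c] by (simp add: ac_simps)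
  qed
  have "vsign G c = (\<Sum>i<h. \<Sum>v<k i. \<Sum>u<off i + v. d * vpar G c u)"
    by (simp add: vsign_def length_G sum_blocks)
  also have "\<dots> = (\<Sum>i<h. \<Sum>v<k i. d * (\<Sum>j<i. block_par c j) + (\<Sum>v'<v. d * vpar (Gs i) (inner_assign c i) v'))"
    by (intro sum.cong refl split) simp_all
  also have "\<dots> = (\<Sum>i<h. (\<Sum>j<i. d * of_nat (k i) * block_par c j) + vsign (Gs i) (inner_assign c i))"
    by (intro sum.cong refl) (simp add: sum.distrib vsign_def sum_distrib_left ac_simps)
  finally show ?thesis by (simp add: sum.distrib add.commute)
qed

lemma vcoeff_graft:
  assumes "\<And>i. i < h \<Longrightarrow> length (xss i) = k i"
  shows "vcoeff G (concat (map xss [0..<h])) c = (\<Prod>i<h. vcoeff (Gs i) (xss i) (inner_assign c i))"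
  unfolding vcoeff_def length_G prod_blocks
proof (intro prod.cong refl)
  fix i v assume "i \<in> {..<h}" "v \<in> {..<k i}"
  then have iv: "i < h" "v < k i" by auto
  have o: "off i = (\<Sum>j<i. length (xss j))" unfolding offset_def by (rule sum.cong) (use assms iv in auto)
  have "concat (map xss [0..<h]) ! (off i + v) = xss i ! v"
    unfolding o by (rule nth_concat_upt) (use iv assms in auto)
  moreover have "map (\<lambda>j. c (off i + v, j)) [0..<snd (verts G ! (off i + v))]
      = map (\<lambda>j. inner_assign c i (v, j)) [0..<snd (verts (Gs i) ! v)]"
    using iv by (simp add: vert_G inner_assign_def flags_def)
  ultimately show "(concat (map xss [0..<h]) ! (off i + v)) (map (\<lambda>j. c (off i + v, j)) [0..<snd (verts G ! (off i + v))])
      = (xss i ! v) (map (\<lambda>j. inner_assign c i (v, j)) [0..<snd (verts (Gs i) ! v)])" by simp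
qed

lemma wprod_graft:
  "wprod G edges_G c = wprod H (edge_list H) (outer_assign c) * (\<Prod>i<h. wprod (Gs i) (edge_list (Gs i)) (inner_assign c i))"
proof -
  have out: "wprod G (map out es) c = wprod H es (outer_assign c)" if "set es \<subseteq> flags H" for es
    using that
  proof (induction es)
    case (Cons f es)
    then show ?case using ginv_out[of f] by (simp add: outer_apply)
  qed simp
  have emb: "wprod G (map (emb Gs i) es) c = wprod (Gs i) es (inner_assign c i)"
    if "i < h" "set es \<subseteq> set (edge_list (Gs i))" for i es
    using that(2)
  proof (induction es)
    case (Cons f es)
    have f: "f \<in> flags (Gs i)" "ginv (Gs i) f \<noteq> f" "ginv (Gs i) f \<in> flags (Gs i)"
      using edge_i[OF that(1), of f] Cons.prems graph_wf.ginv_in[OF wf_i[OF that(1)]] by auto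
    then show ?case using Cons ginv_emb[OF that(1) f(1,2)] by (simp add: inner_apply)
  qed simp
  have "wprod G (block_edges m) c = (\<Prod>i<m. wprod (Gs i) (edge_list (Gs i)) (inner_assign c i))" if "m \<le> h" for m
    using that by (induction m) (simp_all add: emb mult.commute)
  then show ?thesis
    using out[OF edge_reps_subset[OF H.edge_reps_edge_list]] by (simp add: edges_G_def mult.commute)
qed

text \<open>The flags of \<open>G\<close> are those of the blocks, and the outer flags are the legs
  of the blocks. So an assignment for \<open>G\<close> amounts to assignments for the blocks whose
  values on the legs are prescribed by one for \<open>H\<close>.\<close>

lemma bij_assigns:
  "bij_betw (\<lambda>c. (outer_assign c, \<lambda>i\<in>{..<h}. inner_assign c i)) {c \<in> assigns G. map c (legs G) = js}
    (SIGMA cH : {c \<in> assigns H. map c (legs H) = js}.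
      PiE {..<h} (\<lambda>i. {c \<in> assigns (Gs i). map c (legs (Gs i)) = map (\<lambda>l. cH (i, l)) [0..<snd (verts H ! i)]}))"
  (is "bij_betw ?F ?A ?B")
  unfolding bij_betw_def
proof
  have legs_inner: "map (inner_assign c i) (legs (Gs i)) = map (\<lambda>l. outer_assign c (i, l)) [0..<snd (verts H ! i)]"
    if "i < h" for c i
  proof (rule nth_equalityI)
    fix l assume "l < length (map (inner_assign c i) (legs (Gs i)))"
    then have l: "l < snd (verts H ! i)" using val[OF that] by simp
    then have "legs (Gs i) ! l \<in> flags (Gs i)" using leg_flag(1)[OF that legs_i[OF that]] by blast
    then show "map (inner_assign c i) (legs (Gs i)) ! l = map (\<lambda>l. outer_assign c (i, l)) [0..<snd (verts H ! i)] ! l"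
      using l that val[OF that] by (simp add: inner_apply outer_apply flag_H)
  qed (simp add: val[OF that])
  have legs_outer: "map (outer_assign c) (legs H) = map c (legs G)" for c
    using H.set_legs by (simp add: legs_G outer_apply)
  have eqI: "c = c'" if c: "c \<in> assigns G" "c' \<in> assigns G"
    and e: "\<And>i f. i < h \<Longrightarrow> f \<in> flags (Gs i) \<Longrightarrow> c (emb Gs i f) = c' (emb Gs i f)" for c c'
  proof (rule PiE_ext)
    show "c \<in> flags G \<rightarrow>\<^sub>E {..<N}" "c' \<in> flags G \<rightarrow>\<^sub>E {..<N}" using c unfolding assigns_def by auto
    fix f assume "f \<in> flags G"
    then obtain i g where "i < h" "g \<in> flags (Gs i)" "f = emb Gs i g" by (rule flag_exists)
    then show "c f = c' f" using e by blast
  qed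
  show "inj_on ?F ?A"
  proof (rule inj_onI)
    fix c c' assume c: "c \<in> ?A" "c' \<in> ?A" and F: "?F c = ?F c'"
    show "c = c'"
    proof (rule eqI)
      fix i f assume i: "i < h" "f \<in> flags (Gs i)"
      have "inner_assign c i = inner_assign c' i"
        using F i(1) unfolding prod.inject by (metis lessThan_iff restrict_apply')
      then show "c (emb Gs i f) = c' (emb Gs i f)" using inner_apply[OF i(2)] by metis
    qed (use c in auto)
  qed
  show "?F ` ?A = ?B"
  proof (intro equalityI subsetI)
    fix x assume "x \<in> ?F ` ?A"
    then obtain c where c: "c \<in> assigns G" "map c (legs G) = js" "x = ?F c" by blast
    show "x \<in> ?B"
      unfolding c(3) using c(1,2) outer_assigns inner_assigns legs_outer legs_inner by simp
  next
    fix x assume x: "x \<in> ?B"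
    obtain cH cc where x_def: "x = (cH, cc)" by fastforce
    have cH: "cH \<in> assigns H" "map cH (legs H) = js"
      and cc: "cc \<in> extensional {..<h}" "\<And>i. i < h \<Longrightarrow> cc i \<in> assigns (Gs i)"
        "\<And>i. i < h \<Longrightarrow> map (cc i) (legs (Gs i)) = map (\<lambda>l. cH (i, l)) [0..<snd (verts H ! i)]"
      using x by (auto simp: x_def PiE_def Pi_def simp del: map_eq_conv)
    \<comment> \<open>Recovers block and flag from a flag of \<open>G\<close>; the choice is unique
      because the blocks are embedded disjointly.\<close>
    define loc where "loc f = (SOME ig. fst ig < h \<and> snd ig \<in> flags (Gs (fst ig)) \<and> f = emb Gs (fst ig) (snd ig))" for f
    have loc: "loc (emb Gs i g) = (i, g)" if "i < h" "g \<in> flags (Gs i)" for i g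
    proof -
      have "fst (loc (emb Gs i g)) < h \<and> snd (loc (emb Gs i g)) \<in> flags (Gs (fst (loc (emb Gs i g)))) \<and>
          emb Gs i g = emb Gs (fst (loc (emb Gs i g))) (snd (loc (emb Gs i g)))"
        unfolding loc_def by (rule someI[of _ "(i, g)"]) (use that in simp)
      then show ?thesis using emb_inj[OF that(2)] by (metis prod.collapse)
    qed
    define c where "c = (\<lambda>f\<in>flags G. cc (fst (loc f)) (snd (loc f)))"
    have ce: "c (emb Gs i g) = cc i g" if "i < h" "g \<in> flags (Gs i)" for i g
      using emb_flags[OF that] loc[OF that] by (simp add: c_def)
    have cA: "c \<in> assigns G"
      unfolding assigns_def
    proof (rule PiE_I)
      fix f assume "f \<in> flags G"
      then obtain i g where "i < h" "g \<in> flags (Gs i)" "f = emb Gs i g" by (rule flag_exists)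
      then show "c f \<in> {..<N}" using ce assigns_less[OF cc(2)] by simp
    qed (simp add: c_def)
    have inner: "inner_assign c i = cc i" if "i < h" for i
    proof (rule PiE_ext)
      show "inner_assign c i \<in> flags (Gs i) \<rightarrow>\<^sub>E {..<N}" "cc i \<in> flags (Gs i) \<rightarrow>\<^sub>E {..<N}"
        using inner_assigns[OF cA that] cc(2)[OF that] by (simp_all add: assigns_def)
    qed (use ce that in \<open>simp add: inner_apply\<close>)
    have outer: "outer_assign c = cH"
    proof (rule PiE_ext)
      show "outer_assign c \<in> flags H \<rightarrow>\<^sub>E {..<N}" "cH \<in> flags H \<rightarrow>\<^sub>E {..<N}"
        using outer_assigns[OF cA] cH(1) by (simp_all add: assigns_def)
      fix f assume f: "f \<in> flags H"
      obtain i l where il: "f = (i, l)" by fastforce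
      then have i: "i < h" "l < snd (verts H ! i)" using f by (auto simp: flag_H)
      have "outer_assign c f = map (cc i) (legs (Gs i)) ! l"
        using f ce[OF i(1) leg_flag(1)[OF i(1) legs_i[OF i]]] i val by (simp add: il outer_apply)
      also have "\<dots> = cH f" unfolding cc(3)[OF i(1)] using i by (simp add: il)
      finally show "outer_assign c f = cH f" .
    qed
    have "(\<lambda>i\<in>{..<h}. inner_assign c i) = cc"
      by (rule extensionalityI[OF restrict_extensional cc(1)]) (simp add: inner)
    then have "?F c = x" by (simp add: outer x_def)
    moreover have "map c (legs G) = js" using legs_outer[of c] outer cH(2) by simp
    ultimately show "x \<in> ?F ` ?A" using cA by blast
  qed
qed

end

section \<open>Comparison of the signs in iterated contractions\<close>

locale pairing_grafted_det = pairing_graft d N q w H G Gs + grafted_det H G Gs d bs bss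
  for d N q and w :: "nat \<Rightarrow> nat \<Rightarrow> 'k::field_char_0" and H G Gs
    and bs :: "(flag \<Rightarrow> 'k) list" and bss :: "nat \<Rightarrow> (flag \<Rightarrow> 'k) list"
begin

text \<open>The summands of both sides agree up to the Koszul sign of moving determinants past
  decorations. The signs are quadratic in the parities of pairs of blocks, and the Euler relation
  for the blocks, in the form of \<open>bss_length\<close>, makes them match.\<close>

lemma summand_graft:
  assumes c: "c \<in> assigns G"
    and supp: "\<And>i v. i < h \<Longrightarrow> v < k i \<Longrightarrow> supported (snd (verts (Gs i) ! v)) (pss i ! v) (xss i ! v)"
    and len: "\<And>i. i < h \<Longrightarrow> length (pss i) = k i" "\<And>i. i < h \<Longrightarrow> length (xss i) = k i"
  shows "amp H (map (collapse_chain H Gs) bs) (edge_list H) (outer_assign c) * sg (vsign H (outer_assign c)) *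
      (\<Prod>i<h. amp (Gs i) (bss i) (edge_list (Gs i)) (inner_assign c i) * sg (vsign (Gs i) (inner_assign c i)) *
        vcoeff (Gs i) (xss i) (inner_assign c i))
    = sg (\<Sum>i<h. \<Sum>j<i. of_nat (length (bss i)) * sum_list (pss j)) *
      (amp G bs_G (edge_list G) c * sg (vsign G c) * vcoeff G (concat (map xss [0..<h])) c)"
proof -
  let ?ci = "\<lambda>i. inner_assign c i" and ?cH = "outer_assign c"
  have ampG: "amp G bs_G (edge_list G) c = amp G bs_G edges_G c"
    by (rule amp_edge_reps[OF G.wf G.conn det_args_G G.edge_reps_edge_list edge_reps_G c])
  have prod_sg: "(\<Prod>i<m. sg (g i)) = (sg (\<Sum>i<m. g i) :: 'k)" for m :: nat and g
    by (induction m) (simp_all add: sg_add)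
  have vcoeffG: "vcoeff G (concat (map xss [0..<h])) c = (\<Prod>i<h. vcoeff (Gs i) (xss i) (?ci i))"
    by (rule vcoeff_graft) (rule len(2))
  show ?thesis
  proof (cases "\<forall>i<h. wprod (Gs i) (edge_list (Gs i)) (?ci i) \<noteq> 0 \<and> vcoeff (Gs i) (xss i) (?ci i) \<noteq> 0")
    \<comment> \<open>A vanishing inner pairing or coefficient makes both sides 0. Otherwise all
      parities are determined by the assignment.\<close>
    case False
    then obtain i where i: "i < h" "wprod (Gs i) (edge_list (Gs i)) (?ci i) * vcoeff (Gs i) (xss i) (?ci i) = 0" by auto
    have "(\<Prod>i<h. amp (Gs i) (bss i) (edge_list (Gs i)) (?ci i) * sg (vsign (Gs i) (?ci i)) * vcoeff (Gs i) (xss i) (?ci i)) = 0"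
      by (rule prod_zero) (use i in \<open>auto simp: amp_def intro!: bexI[of _ i]\<close>)
    moreover have "wprod G edges_G c = 0 \<or> vcoeff G (concat (map xss [0..<h])) c = 0"
      unfolding wprod_graft vcoeffG using i by auto
    then have "amp G bs_G edges_G c * sg (vsign G c) * vcoeff G (concat (map xss [0..<h])) c = 0"
      by (auto simp: amp_def)
    ultimately show ?thesis unfolding ampG by (simp only: mult_zero_right)
  next
    case True
    let ?e = "\<lambda>i. of_nat (length (edge_list (Gs i))) :: bit" and ?m = "\<lambda>i. of_nat (length (bss i)) :: bit"
      and ?k = "\<lambda>i. of_nat (k i) :: bit" and ?Q = "block_par c" and ?L = "\<lambda>i. vpar H ?cH i"
    have ew: "sum_list (map (q \<circ> ?ci i) (ew i)) = d * ?e i" if "i < h" for i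
      by (rule edge_word_par[OF wf_graph_i[OF that] inner_assigns[OF c that] edge_reps_subset[OF reps_i[OF that]]])
        (use True that in blast)
    have Q: "?Q i = d * ?e i + ?L i" if "i < h" for i
      using total_par[OF wf_graph_i[OF that] inner_assigns[OF c that] reps_i[OF that]] True that
      by (simp add: block_par_def vpar_outer)
    have ps: "sum_list (pss i) = d * ?k i + ?Q i" if "i < h" for i
    proof -
      have "pss i ! v = d + vpar (Gs i) (?ci i) v" if "v < k i" for v
        using vcoeff_par[of "Gs i" "pss i" "xss i" "?ci i" v] supp True \<open>i < h\<close> that by blast
      then have "sum_list (pss i) = (\<Sum>v<k i. d + vpar (Gs i) (?ci i) v)"
        using sum_list_map_sum[of id "pss i"] len(1)[OF that] by simp
      then show ?thesis by (simp add: sum.distrib block_par_def mult.commute)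
    qed
    let ?WH = "winv (flag_pos H) (q \<circ> ?cH) (edge_word H (edge_list H) @ legs H)"
    let ?Wi = "\<Sum>i<h. winv (flag_pos (Gs i)) (q \<circ> ?ci i) (word i)"
    let ?Vi = "\<Sum>i<h. vsign (Gs i) (?ci i)"
    let ?D = "\<Sum>i<h. \<Sum>j<i. ?m i * ?k j + ?e j" and ?E = "\<Sum>i<h. \<Sum>j<i. d * ?e i * ?Q j"
      and ?K = "\<Sum>i<h. \<Sum>j<i. d * ?k i * ?Q j" and ?A = "\<Sum>i<h. \<Sum>j<i. ?m i * sum_list (pss j)"
    let ?dH = "det_factor d H (map (collapse_chain H Gs) bs) (edge_list H)"
      and ?di = "\<Prod>i<h. det_factor d (Gs i) (bss i) (edge_list (Gs i))"
      and ?wH = "wprod H (edge_list H) ?cH" and ?wi = "\<Prod>i<h. wprod (Gs i) (edge_list (Gs i)) (?ci i)"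
      and ?xi = "\<Prod>i<h. vcoeff (Gs i) (xss i) (?ci i)"
    \<comment> \<open>For each pair \<open>j < i\<close>, the signs of moving determinants, sorting
      rows, crossing words and moving symbols \<theta> leave \<open>d\<close> times the parity of
      the legs of block \<open>j\<close>, which is the contribution of vertex \<open>j\<close> to
      \<open>vsign H\<close>.\<close>
    have signs: "?A + (d * ?D + (?E + ?K)) = vsign H ?cH"
    proof -
      have "?A + (d * ?D + (?E + ?K)) = (\<Sum>i<h. \<Sum>j<i. ?m i * sum_list (pss j) + (d * (?m i * ?k j + ?e j) + (d * ?e i * ?Q j + d * ?k i * ?Q j)))"
        by (simp only: sum_distrib_left sum.distrib[symmetric])
      also have "\<dots> = (\<Sum>i<h. \<Sum>j<i. d * ?L j)"
      proof (intro sum.cong refl)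
        fix i j assume "i \<in> {..<h}" "j \<in> {..<i}"
        then have ij: "i < h" "j < h" by auto
        show "?m i * sum_list (pss j) + (d * (?m i * ?k j + ?e j) + (d * ?e i * ?Q j + d * ?k i * ?Q j)) = d * ?L j"
          unfolding ps[OF ij(2)] Q[OF ij(2)] bss_length[OF ij(1)]
          by (cases d) (simp_all add: distrib_left distrib_right ac_simps)
      qed
      finally show ?thesis by (simp add: vsign_def)
    qed
    have lhs: "amp H (map (collapse_chain H Gs) bs) (edge_list H) ?cH * sg (vsign H ?cH) *
        (\<Prod>i<h. amp (Gs i) (bss i) (edge_list (Gs i)) (?ci i) * sg (vsign (Gs i) (?ci i)) * vcoeff (Gs i) (xss i) (?ci i))
      = ?dH * sg ?WH * ?wH * sg (vsign H ?cH) * (?di * sg ?Wi * ?wi * sg ?Vi * ?xi)"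
      by (simp only: amp_def prod.distrib prod_sg)
    have winvG: "winv (flag_pos G) (q \<circ> c) (edge_word G edges_G @ legs G) = ?WH + ?Wi + ?E"
      by (rule winv_graft) (rule ew)
    have rhs: "sg ?A * (amp G bs_G (edge_list G) c * sg (vsign G c) * vcoeff G (concat (map xss [0..<h])) c)
      = sg ?A * ((sg (d * ?D) * ?dH * ?di) * sg (?WH + ?Wi + ?E) * (?wH * ?wi) * sg (?Vi + ?K) * ?xi)"
      unfolding ampG unfolding amp_def winvG det_factor_graft wprod_graft vsign_graft vcoeffG ..
    show ?thesis
      unfolding lhs rhs unfolding signs[symmetric] by (simp only: sg_add ac_simps)
  qed
qed

text \<open>The product over the blocks of sums over inner assignments is expanded into a sum over
  families, which \<open>bij_assigns\<close> turns into a sum over assignments of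
  \<open>G\<close>.\<close>

lemma contract_graft:
  assumes supp: "\<And>i v. i < h \<Longrightarrow> v < k i \<Longrightarrow> supported (snd (verts (Gs i) ! v)) (pss i ! v) (xss i ! v)"
    and len: "\<And>i. i < h \<Longrightarrow> length (pss i) = k i" "\<And>i. i < h \<Longrightarrow> length (xss i) = k i"
  shows "contract H (map (collapse_chain H Gs) bs) (map (\<lambda>i. contract (Gs i) (bss i) (xss i)) [0..<h]) js
    = sg (\<Sum>i<h. \<Sum>j<i. of_nat (length (bss i)) * sum_list (pss j)) *
      contract G bs_G (concat (map xss [0..<h])) js"
proof (cases "length js = length (legs H) \<and> set js \<subseteq> {..<N}")
  case False
  then show ?thesis by (auto simp: contract_def legs_G)
next
  case True
  let ?B = "\<lambda>cH i. {c \<in> assigns (Gs i). map c (legs (Gs i)) = map (\<lambda>l. cH (i, l)) [0..<snd (verts H ! i)]}"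
  let ?A = "{c \<in> assigns H. map c (legs H) = js}"
  let ?f = "\<lambda>i c. amp (Gs i) (bss i) (edge_list (Gs i)) c * sg (vsign (Gs i) c) * vcoeff (Gs i) (xss i) c"
  let ?g = "\<lambda>cH. amp H (map (collapse_chain H Gs) bs) (edge_list H) cH * sg (vsign H cH)"
  let ?s = "sg (\<Sum>i<h. \<Sum>j<i. of_nat (length (bss i)) * sum_list (pss j)) :: 'k"
  have inner: "vcoeff H (map (\<lambda>i. contract (Gs i) (bss i) (xss i)) [0..<h]) cH
      = (\<Sum>cc\<in>PiE {..<h} (?B cH). \<Prod>i<h. ?f i (cc i))" if cH: "cH \<in> assigns H" for cH
  proof -
    have "vcoeff H (map (\<lambda>i. contract (Gs i) (bss i) (xss i)) [0..<h]) cH = (\<Prod>i<h. \<Sum>c\<in>?B cH i. ?f i c)"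
      unfolding vcoeff_def[of H]
    proof (rule prod.cong[OF refl])
      fix i assume "i \<in> {..<h}"
      then have i: "i < h" by simp
      have "set (map (\<lambda>l. cH (i, l)) [0..<snd (verts H ! i)]) \<subseteq> {..<N}"
        using assigns_less[OF cH] i by (auto simp: flag_H)
      then show "(map (\<lambda>i. contract (Gs i) (bss i) (xss i)) [0..<h] ! i) (map (\<lambda>j. cH (i, j)) [0..<snd (verts H ! i)])
        = (\<Sum>c\<in>?B cH i. ?f i c)"
        using i val[OF i] by (simp add: contract_def del: map_eq_conv)
    qed
    also have "\<dots> = (\<Sum>cc\<in>PiE {..<h} (?B cH). \<Prod>i<h. ?f i (cc i))"
      by (rule prod_sum_PiE) auto
    finally show ?thesis .
  qed
  have "contract H (map (collapse_chain H Gs) bs) (map (\<lambda>i. contract (Gs i) (bss i) (xss i)) [0..<h]) js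
    = (\<Sum>cH\<in>?A. ?g cH * vcoeff H (map (\<lambda>i. contract (Gs i) (bss i) (xss i)) [0..<h]) cH)"
    using True by (simp add: contract_def)
  also have "\<dots> = (\<Sum>cH\<in>?A. \<Sum>cc\<in>PiE {..<h} (?B cH). ?g cH * (\<Prod>i<h. ?f i (cc i)))"
    by (rule sum.cong[OF refl]) (simp add: inner sum_distrib_left)
  also have "\<dots> = (\<Sum>(cH, cc)\<in>Sigma ?A (\<lambda>cH. PiE {..<h} (?B cH)). ?g cH * (\<Prod>i<h. ?f i (cc i)))"
    by (rule sum.Sigma) (auto intro!: finite_PiE)
  also have "\<dots> = (\<Sum>c\<in>{c \<in> assigns G. map c (legs G) = js}.
      ?g (outer_assign c) * (\<Prod>i<h. ?f i (restrict (inner_assign c) {..<h} i)))"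
    using sum.reindex_bij_betw[OF bij_assigns[of js], of "\<lambda>(cH, cc). ?g cH * (\<Prod>i<h. ?f i (cc i))"]
    by (simp only: case_prod_conv)
  also have "\<dots> = (\<Sum>c\<in>{c \<in> assigns G. map c (legs G) = js}.
      ?s * (amp G bs_G (edge_list G) c * sg (vsign G c) * vcoeff G (concat (map xss [0..<h])) c))"
  proof (rule sum.cong[OF refl])
    fix c assume "c \<in> {c \<in> assigns G. map c (legs G) = js}"
    then have c: "c \<in> assigns G" by simp
    have "(\<Prod>i<h. ?f i (restrict (inner_assign c) {..<h} i)) = (\<Prod>i<h. ?f i (inner_assign c i))"
      by (rule prod.cong) auto
    then show "?g (outer_assign c) * (\<Prod>i<h. ?f i (restrict (inner_assign c) {..<h} i))
      = ?s * (amp G bs_G (edge_list G) c * sg (vsign G c) * vcoeff G (concat (map xss [0..<h])) c)"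
      using summand_graft[OF c supp len] by (simp only:)
  qed
  also have "\<dots> = ?s * contract G bs_G (concat (map xss [0..<h])) js"
    using True by (simp add: contract_def legs_G sum_distrib_left)
  finally show ?thesis .
qed

end

section \<open>The endomorphism operad\<close>

context dg_pairing
begin

lemma deriv_linear:
  "deriv (\<lambda>is. x is + y is) = (\<lambda>is. deriv x is + deriv y is)"
  "deriv (\<lambda>is. a * x is) = (\<lambda>is. a * deriv x is)"
  by (simp_all add: fun_eq_iff deriv_def distrib_left sum.distrib sum_distrib_left ac_simps)

text \<open>Acting twice in one position gives the square of \<open>M\<close>; actions in two
  positions anticommute, since the first one changes a parity that the second one passes.\<close>

lemma deriv_deriv:
  assumes MM: "\<And>a b. a < N \<Longrightarrow> b < N \<Longrightarrow> (\<Sum>k<N. M a k * M k b) = 0"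
  shows "deriv (deriv x) = (\<lambda>_. 0)"
proof
  fix js
  show "deriv (deriv x) js = 0"
  proof (cases "set js \<subseteq> {..<N}")
    case True
    let ?n = "length js" and ?P = "\<lambda>j js. sum_list (map q (take j js))"
    define t where "t j k j' k' = sg (?P j js) * M (js ! j) k * (sg (?P j' (js[j := k])) * M (js[j := k] ! j') k' * x (js[j := k, j' := k']))"
      for j k j' k'
    have upd: "set (js[j := k]) \<subseteq> {..<N}" if "k < N" for j k
      using True that set_update_subset_insert[of js j k] by auto
    have "deriv (deriv x) js = (\<Sum>j<?n. \<Sum>k<N. \<Sum>j'<?n. \<Sum>k'<N. t j k j' k')"
      using True upd by (simp add: deriv_def[of "deriv x"]) (simp add: deriv_def t_def sum_distrib_left)
    also have "\<dots> = (\<Sum>j<?n. \<Sum>j'<?n. \<Sum>k<N. \<Sum>k'<N. t j k j' k')"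
      by (rule sum.cong[OF refl], rule sum.swap)
    also have "\<dots> = (\<Sum>j'<?n. \<Sum>j<?n. \<Sum>k<N. \<Sum>k'<N. t j k j' k')" by (rule sum.swap)
    also have "\<dots> = (\<Sum>b<?n. \<Sum>a<b. (\<Sum>k<N. \<Sum>k'<N. t a k b k') + (\<Sum>k<N. \<Sum>k'<N. t b k a k')) + (\<Sum>a<?n. \<Sum>k<N. \<Sum>k'<N. t a k a k')"
      by (rule sum_pairs)
    also have "(\<Sum>a<?n. \<Sum>k<N. \<Sum>k'<N. t a k a k') = 0"
    proof (rule sum.neutral, rule ballI)
      fix a assume "a \<in> {..<?n}"
      then have a: "a < ?n" by simp
      have "(\<Sum>k<N. \<Sum>k'<N. t a k a k') = (\<Sum>k'<N. \<Sum>k<N. t a k a k')" by (rule sum.swap)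
      also have "\<dots> = (\<Sum>k'<N. (\<Sum>k<N. M (js ! a) k * M k k') * x (js[a := k']))"
        using a by (simp add: t_def sum_distrib_left sum_distrib_right ac_simps)
      also have "\<dots> = 0" using MM nth_less[OF True a] by simp
      finally show "(\<Sum>k<N. \<Sum>k'<N. t a k a k') = 0" .
    qed
    also have "(\<Sum>b<?n. \<Sum>a<b. (\<Sum>k<N. \<Sum>k'<N. t a k b k') + (\<Sum>k<N. \<Sum>k'<N. t b k a k')) = 0"
    proof (intro sum.neutral ballI)
      fix a b assume "b \<in> {..<?n}" "a \<in> {..<b}"
      then have ab: "a < b" "b < ?n" by auto
      \<comment> \<open>Only the later position \<open>b\<close> notices the order: when
        \<open>a\<close> is changed first, the sign in front of \<open>b\<close> is
        reversed.\<close>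
      have "t a k b k' + t b k' a k = 0" if k: "k < N" "k' < N" for k k'
      proof (cases "M (js ! a) k = 0")
        case False
        have qa: "q (js ! a) = q k + 1" using M_par[OF _ k(1) False] nth_less[OF True] ab by simp
        have "take b js = take a js @ js ! a # drop (Suc a) (take b js)"
          using ab id_take_nth_drop[of a "take b js"] by (simp add: min_def)
        then have "?P b js = ?P a js + (q (js ! a) + sum_list (map q (drop (Suc a) (take b js))))"
          by (metis list.simps(9) map_append sum_list.Cons sum_list.append)
        moreover have "?P b (js[a := k]) = ?P a js + (q k + sum_list (map q (drop (Suc a) (take b js))))"
        proof -
          have "take b (js[a := k]) = take a js @ k # drop (Suc a) (take b js)"
            unfolding take_update_swap using ab by (subst upd_conv_take_nth_drop) (simp_all add: min_def)
          then show ?thesis by simp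
        qed
        ultimately have "?P b (js[a := k]) = ?P b js + 1" using qa by (simp add: ac_simps)
        then have "sg (?P b (js[a := k])) = - (sg (?P b js) :: 'k)" by (simp add: sg_add) (simp add: sg_def)
        moreover have "?P a (js[b := k']) = ?P a js" using ab by simp
        moreover have "js[b := k', a := k] = js[a := k, b := k']" using ab by (simp add: list_update_swap)
        ultimately show ?thesis using ab by (simp add: t_def)
      qed (use ab in \<open>simp add: t_def\<close>)
      then have "(\<Sum>k<N. \<Sum>k'<N. t a k b k' + t b k' a k) = 0" by simp
      moreover have "(\<Sum>k<N. \<Sum>k'<N. t b k a k') = (\<Sum>k<N. \<Sum>k'<N. t b k' a k)" by (rule sum.swap)
      ultimately show "(\<Sum>k<N. \<Sum>k'<N. t a k b k') + (\<Sum>k<N. \<Sum>k'<N. t b k a k') = 0"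
        by (simp add: sum.distrib)
    qed
    finally show ?thesis by simp
  qed (simp add: deriv_def)
qed

end

context pairing
begin

lemma vcoeff_update:
  assumes "i < length (verts G)" "length xs = length (verts G)"
  shows "vcoeff G (xs[i := z]) c = z (map (\<lambda>j. c (i, j)) [0..<snd (verts G ! i)]) *
    (\<Prod>i'\<in>{..<length (verts G)} - {i}. (xs ! i') (map (\<lambda>j. c (i', j)) [0..<snd (verts G ! i')]))"
proof -
  have "(\<Prod>i'\<in>{..<length (verts G)} - {i}. (xs[i := z] ! i') (map (\<lambda>j. c (i', j)) [0..<snd (verts G ! i')]))
    = (\<Prod>i'\<in>{..<length (verts G)} - {i}. (xs ! i') (map (\<lambda>j. c (i', j)) [0..<snd (verts G ! i')]))"
    by (rule prod.cong) auto
  then show ?thesis unfolding vcoeff_def by (subst prod.remove[of _ i]) (use assms in simp_all)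
qed

lemma contract_add:
  assumes "i < length (verts G)" "length xs = length (verts G)"
  shows "contract G bs (xs[i := \<lambda>is. (xs ! i) is + y is]) = (\<lambda>js. contract G bs xs js + contract G bs (xs[i := y]) js)"
proof
  fix js
  have "vcoeff G (xs[i := \<lambda>is. (xs ! i) is + y is]) c = vcoeff G xs c + vcoeff G (xs[i := y]) c" for c
    using vcoeff_update[OF assms, of "xs ! i" c] by (simp add: vcoeff_update[OF assms] distrib_right)
  then show "contract G bs (xs[i := \<lambda>is. (xs ! i) is + y is]) js = contract G bs xs js + contract G bs (xs[i := y]) js"
    by (simp add: contract_def distrib_left sum.distrib)
qed

lemma contract_smul:
  assumes "i < length (verts G)" "length xs = length (verts G)"
  shows "contract G bs (xs[i := \<lambda>is. a * (xs ! i) is]) = (\<lambda>js. a * contract G bs xs js)"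
proof
  fix js
  have "vcoeff G (xs[i := \<lambda>is. a * (xs ! i) is]) c = a * vcoeff G xs c" for c
    using vcoeff_update[OF assms, of "xs ! i" c] by (simp add: vcoeff_update[OF assms])
  then show "contract G bs (xs[i := \<lambda>is. a * (xs ! i) is]) js = a * contract G bs xs js"
    by (simp add: contract_def sum_distrib_left ac_simps)
qed

lemma contract_det:
  assumes "\<And>es. edge_reps G es \<Longrightarrow> det_factor d G bs es = a * det_factor d G bs' es + det_factor d G bs'' es" "wf_graph G"
  shows "contract G bs xs js = a * contract G bs' xs js + contract G bs'' xs js"
proof -
  interpret graph_wf G by unfold_locales (rule assms)
  show ?thesis
    using assms(1)[OF edge_reps_edge_list]
    by (simp add: contract_def amp_def distrib_left distrib_right sum.distrib sum_distrib_left ac_simps)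
qed

lemma contract_det_linear:
  assumes "wf_graph G" "connected_graph G" "det_args d G bs" "i < length bs"
  shows "contract G (bs[i := \<lambda>f. a * u f + (bs ! i) f]) xs js = a * contract G (bs[i := u]) xs js + contract G bs xs js"
proof (rule contract_det)
  fix es assume es: "edge_reps G es"
  interpret graph_conn G by unfold_locales (use assms in auto)
  have d: "d = 1" using assms(3,4) by (auto simp: det_args_def det_rank_def split: if_splits)
  let ?us = "map (lift_vertex G) [1..<length (verts G)] :: (flag \<Rightarrow> 'k) list"
  have bs: "bs = take i bs @ bs ! i # drop (Suc i) bs" using assms(4) by (simp add: id_take_nth_drop)
  have len: "length (take i bs @ u # drop (Suc i) bs @ ?us) = length (rev es)"
    using length_det_rows[OF assms(3) d es] assms(4) by simp
  have upd: "bs[i := v] @ ?us = take i bs @ v # drop (Suc i) bs @ ?us" for v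
    using assms(4) by (simp add: upd_conv_take_nth_drop)
  have "ldet (bs @ ?us) (rev es) = ldet (take i bs @ bs ! i # drop (Suc i) bs @ ?us) (rev es)"
    by (metis bs append.assoc append_Cons)
  then show "det_factor d G (bs[i := \<lambda>f. a * u f + (bs ! i) f]) es = a * det_factor d G (bs[i := u]) es + det_factor d G bs es"
    unfolding det_factor_def upd using ldet_row_linear[OF len, of a "bs ! i"] d by simp
qed (rule assms(1))

lemma contract_det_alternating:
  assumes "wf_graph G" "connected_graph G" "det_args d G bs" "i < j" "j < length bs" "bs ! i = bs ! j"
  shows "contract G bs xs js = 0"
proof -
  interpret graph_conn G by unfold_locales (use assms in auto)
  have d: "d = 1" using assms(3,5) by (auto simp: det_args_def det_rank_def split: if_splits)
  have "det_factor d G bs (edge_list G) = 0"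
    unfolding det_factor_def
    using d ldet_equal_rows[of i j "rev (edge_list G)" "bs @ map (lift_vertex G) [1..<length (verts G)]"]
      length_det_rows[OF assms(3) d edge_reps_edge_list] assms(4-6) by (simp add: nth_append)
  then show ?thesis by (simp add: contract_def amp_def)
qed

end

lemma relabelled_wf:
  assumes "wf_graph G" "relabelled G \<tau> G'" "\<tau> permutes {..<length (legs G)}"
  shows "wf_graph G'"
proof -
  let ?n = "length (legs G)"
  have len: "length (legs G') = ?n" and lg: "\<And>l. l < ?n \<Longrightarrow> legs G' ! \<tau> l = legs G ! l"
    and same: "verts G' = verts G" "ginv G' = ginv G"
    using assms(2) unfolding relabelled_def by auto
  have "map ((!) (legs G')) (map \<tau> [0..<?n]) = legs G"
    by (rule nth_equalityI) (use lg in auto)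
  then have "mset (legs G) = image_mset ((!) (legs G')) (mset (map \<tau> [0..<?n]))" by (metis mset_map)
  also have "\<dots> = mset (map ((!) (legs G')) [0..<length (legs G')])"
    unfolding perm_upt(3)[OF assms(3)] len by (rule mset_map[symmetric])
  finally have "mset (legs G) = mset (legs G')" unfolding map_nth .
  then have "set (legs G') = set (legs G)" "distinct (legs G') = distinct (legs G)"
    using mset_eq_setD[of "legs G" "legs G'"] mset_eq_imp_distinct_iff[of "legs G" "legs G'"] by simp_all
  then show ?thesis using assms(1) by (simp add: wf_graph_def same flags_def)
qed

section \<open>Coordinates with respect to the homogeneous basis\<close>

context dg_inner_product_space
begin

interpretation vs: vector_space sc by (rule vs)

abbreviation "es \<equiv> hbasis sc V"
abbreviation "dimV \<equiv> length es"
abbreviation "qpar \<equiv> shifted_par d V es"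
abbreviation "wpair \<equiv> edge_pairing d V B es"

definition dmat :: "nat \<Rightarrow> nat \<Rightarrow> 'k" where
  "dmat a k = vs.representation (set es) (D (es ! k)) (es ! a)"

definition bpar :: "nat \<Rightarrow> bit" where
  "bpar a = (if es ! a \<in> V 0 then 0 else 1)"

lemma basis:
  shows "distinct es" "set es \<subseteq> V 0 \<union> V 1" "vs.independent (set es)" "vs.span (set es) = UNIV"
  using homogeneous_basis_hbasis unfolding homogeneous_basis_def by auto

lemma qpar: "qpar a = bpar a + d"
  by (simp add: shifted_par_def bpar_def)

lemma wpair: "wpair a b = sg (d * bpar a) * B (es ! a) (es ! b)"
  by (simp add: edge_pairing_def bpar_def)

lemma bpar_in: "a < dimV \<Longrightarrow> es ! a \<in> V (bpar a)"
proof -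
  assume "a < dimV"
  then have "es ! a \<in> V 0 \<union> V 1" using basis(2) nth_mem by blast
  then show ?thesis by (auto simp: bpar_def)
qed

lemma sum_basis: "(\<Sum>e\<in>set es. g e) = (\<Sum>a<dimV. g (es ! a))" for g :: "'v \<Rightarrow> 'b::comm_monoid_add"
  using sum.reindex_bij_betw[OF bij_betw_nth[OF basis(1) refl refl], of g] by simp

lemma expand: "v = (\<Sum>a<dimV. sc (vs.representation (set es) v (es ! a)) (es ! a))"
  using vs.sum_representation_eq[OF basis(3), of v "set es"] basis(4) by (simp add: sum_basis)

lemma expand_unique:
  assumes "(\<Sum>a<dimV. sc (g a) (es ! a)) = (\<Sum>a<dimV. sc (g' a) (es ! a))" "a < dimV"
  shows "g a = g' a"
proof -
  have bij: "bij_betw ((!) es) {..<dimV} (set es)" by (rule bij_betw_nth[OF basis(1) refl refl])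
  define u where "u e = g (inv_into {..<dimV} ((!) es) e) - g' (inv_into {..<dimV} ((!) es) e)" for e
  have u: "u (es ! a) = g a - g' a" if "a < dimV" for a
    using bij that by (simp add: u_def bij_betw_def inv_into_f_f)
  have "(\<Sum>e\<in>set es. sc (u e) e) = (\<Sum>a<dimV. sc (g a) (es ! a)) - (\<Sum>a<dimV. sc (g' a) (es ! a))"
    unfolding sum_basis sum_subtractf[symmetric]
    by (rule sum.cong) (simp_all add: u vs.scale_left_diff_distrib)
  then have "(\<Sum>e\<in>set es. sc (u e) e) = 0" using assms(1) by simp
  then have "u (es ! a) = 0"
    using vs.dependent_finite[of "set es"] basis(3) nth_mem[OF assms(2)] by blast
  then show ?thesis using u[OF assms(2)] by simp
qed

lemma parity_cases: "p = r \<or> p = r + (1 :: bit)"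
  by (cases p; cases r) auto

lemma parity_Int: "v \<in> V p \<Longrightarrow> v \<in> V (p + 1) \<Longrightarrow> v = 0"
  using parity_disjoint by (cases p) auto

text \<open>The part of the expansion with the wrong parity is a difference of two vectors of parity
  \<open>p\<close>, hence lies in both parity components and is 0.\<close>

lemma representation_parity:
  assumes "v \<in> V p" "a < dimV" "bpar a \<noteq> p"
  shows "vs.representation (set es) v (es ! a) = 0"
proof -
  let ?r = "\<lambda>a. vs.representation (set es) v (es ! a)"
  have inV: "(\<Sum>a<dimV. sc (if bpar a = r then ?r a else 0) (es ! a)) \<in> V r" for r
    using bpar_in by (intro vs.subspace_sum[OF parity_subspace])
      (auto intro!: vs.subspace_scale[OF parity_subspace] simp: vs.subspace_0[OF parity_subspace])
  let ?x = "\<Sum>a<dimV. sc (if bpar a = p then ?r a else 0) (es ! a)"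
    and ?y = "\<Sum>a<dimV. sc (if bpar a = p + 1 then ?r a else 0) (es ! a)"
  have "?x + ?y = (\<Sum>a<dimV. sc (?r a) (es ! a))"
    unfolding sum.distrib[symmetric]
  proof (rule sum.cong[OF refl])
    fix a
    show "sc (if bpar a = p then ?r a else 0) (es ! a) + sc (if bpar a = p + 1 then ?r a else 0) (es ! a) = sc (?r a) (es ! a)"
      using parity_cases[of "bpar a" p] by (cases p) auto
  qed
  then have v: "?y = v - ?x" using expand[of v] by (simp add: eq_diff_eq add.commute)
  have "?y \<in> V p" unfolding v by (rule vs.subspace_diff[OF parity_subspace assms(1) inV])
  then have "?y = 0" using inV[of "p + 1"] parity_Int by blast
  then have "(\<Sum>a<dimV. sc (if bpar a = p + 1 then ?r a else 0) (es ! a)) = (\<Sum>a<dimV. sc 0 (es ! a))" by simp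
  from expand_unique[OF this assms(2)] show ?thesis
    using parity_cases[of "bpar a" p] assms(3) by auto
qed

lemma D_expand: "D (es ! k) = (\<Sum>a<dimV. sc (dmat a k) (es ! a))"
  unfolding dmat_def by (rule expand)

lemma dmat_par: "a < dimV \<Longrightarrow> k < dimV \<Longrightarrow> dmat a k \<noteq> 0 \<Longrightarrow> bpar a = bpar k + 1"
  using representation_parity[OF D_odd[OF bpar_in]] unfolding dmat_def by blast

lemma B_sum_left: "B (\<Sum>a\<in>A. sc (g a) (f a)) v = (\<Sum>a\<in>A. g a * B (f a) v)"
proof -
  interpret l: Vector_Spaces.linear sc "(*)" "\<lambda>v'. B v' v" by (rule B_linear_left)
  show ?thesis by (simp add: l.sum l.scale)
qed

lemma B_sum_right: "B v (\<Sum>a\<in>A. sc (g a) (f a)) = (\<Sum>a\<in>A. g a * B v (f a))"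
proof -
  interpret l: Vector_Spaces.linear sc "(*)" "B v" by (rule B_linear_right)
  show ?thesis by (simp add: l.sum l.scale)
qed

lemma D_sum: "D (\<Sum>a\<in>A. sc (g a) (f a)) = (\<Sum>a\<in>A. sc (g a) (D (f a)))"
proof -
  interpret l: Vector_Spaces.linear sc sc D by (rule D_linear)
  show ?thesis by (simp add: l.sum l.scale)
qed

lemma B_par: "a < dimV \<Longrightarrow> b < dimV \<Longrightarrow> B (es ! a) (es ! b) \<noteq> 0 \<Longrightarrow> bpar b = bpar a + d"
  using B_even[OF bpar_in bpar_in, of a b] by (cases "bpar a"; cases "bpar b"; cases d) auto

lemma dmat_dmat:
  assumes "b < dimV" "a < dimV"
  shows "(\<Sum>k<dimV. dmat a k * dmat k b) = 0"
proof -
  have "(\<Sum>a<dimV. sc (\<Sum>k<dimV. dmat a k * dmat k b) (es ! a)) = (\<Sum>k<dimV. sc (dmat k b) (\<Sum>a<dimV. sc (dmat a k) (es ! a)))"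
    by (simp only: vs.scale_sum_left vs.scale_sum_right vs.scale_scale, subst sum.swap) (simp only: mult.commute)
  also have "\<dots> = (\<Sum>k<dimV. sc (dmat k b) (D (es ! k)))" by (simp only: D_expand)
  also have "\<dots> = D (D (es ! b))" by (simp only: D_expand[of b] D_sum)
  also have "\<dots> = (\<Sum>a<dimV. sc 0 (es ! a))" by (simp add: D_D)
  finally show ?thesis by (rule expand_unique[OF _ assms(2)])
qed

text \<open>The sign in \<open>edge_pairing\<close> turns the symmetry of \<open>B\<close> for the
  original parities into \<open>w_sym\<close> for the shifted ones, and the compatibility of
  \<open>B\<close> with \<open>D\<close> into \<open>w_M\<close>.\<close>

sublocale dgp: dg_pairing d dimV qpar wpair dmat
proof
  fix a b assume ab: "a < dimV" "b < dimV"
  show "wpair a b \<noteq> 0 \<Longrightarrow> qpar a + qpar b = d"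
    using B_par[OF ab] by (simp add: wpair qpar ac_simps)
  show "wpair b a = sg (d + qpar a * qpar b) * wpair a b"
  proof (cases "B (es ! a) (es ! b) = 0")
    case True
    then show ?thesis using B_sym[OF bpar_in[OF ab(2)] bpar_in[OF ab(1)]] by (simp add: wpair)
  next
    case False
    note b = B_par[OF ab False]
    have "wpair b a = sg (d * bpar b) * (sg (bpar b * bpar a) * B (es ! a) (es ! b))"
      using B_sym[OF bpar_in[OF ab(2)] bpar_in[OF ab(1)]] by (simp add: wpair)
    also have "\<dots> = sg (d * bpar b + bpar b * bpar a) * B (es ! a) (es ! b)"
      by (simp only: sg_add mult.assoc)
    also have "d * bpar b + bpar b * bpar a = (d + qpar a * qpar b) + d * bpar a"
      unfolding b qpar by (cases d; cases "bpar a") simp_all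
    finally show ?thesis by (simp only: wpair sg_add mult.assoc)
  qed
next
  fix a k assume "a < dimV" "k < dimV" "dmat a k \<noteq> 0"
  then show "qpar a = qpar k + 1" using dmat_par by (simp add: qpar ac_simps)
next
  fix x y assume x: "x < dimV" and y: "y < dimV"
  \<comment> \<open>The differential changes the parity, so the sign of the pairing is the same for
    all contributing indices \<open>a\<close>, namely that of \<open>bpar x + 1\<close>.\<close>
  have 1: "(\<Sum>a<dimV. wpair a y * dmat a x) = sg (d * (bpar x + 1)) * B (D (es ! x)) (es ! y)"
    unfolding D_expand B_sum_left sum_distrib_left
  proof (rule sum.cong[OF refl])
    fix a assume "a \<in> {..<dimV}"
    then show "wpair a y * dmat a x = sg (d * (bpar x + 1)) * (dmat a x * B (es ! a) (es ! y))"
      using dmat_par[of a x] x by (cases "dmat a x = 0") (auto simp: wpair)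
  qed
  have 2: "(\<Sum>a<dimV. wpair x a * dmat a y) = sg (d * bpar x) * B (es ! x) (D (es ! y))"
    unfolding D_expand B_sum_right by (simp add: wpair sum_distrib_left ac_simps)
  have "B (D (es ! x)) (es ! y) = - (sg (bpar x) * B (es ! x) (D (es ! y)))"
    using B_dg[OF bpar_in[OF x], of "es ! y"] by (simp add: eq_neg_iff_add_eq_0)
  moreover have "sg (qpar x) * sg (d * bpar x) = (sg (d * (bpar x + 1)) * sg (bpar x) :: 'k)"
    unfolding sg_add[symmetric] qpar by (cases d; cases "bpar x") simp_all
  ultimately show "(\<Sum>a<dimV. wpair a y * dmat a x) + sg (qpar x) * (\<Sum>a<dimV. wpair x a * dmat a y) = 0"
    unfolding 1 2 by (simp flip: mult.assoc)
qed

abbreviation "EndV \<equiv> End_opd d sc V D B"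

lemma end_mu_contract: "end_mu d V B es G bs xs = dgp.contract G bs xs"
proof
  fix js
  show "end_mu d V B es G bs xs js = dgp.contract G bs xs js"
    unfolding end_mu_def dgp.contract_def
  proof (intro if_cong refl sum.cong)
    show "{c \<in> flags G \<rightarrow>\<^sub>E {..<dimV}. map c (legs G) = js} = {c \<in> dgp.assigns G. map c (legs G) = js}"
      by (simp add: dgp.assigns_def)
    fix c
    have "concat (map (\<lambda>f. [f, ginv G f]) (edge_list G)) @ legs G = edge_word G (edge_list G) @ legs G"
      by (simp add: edge_word_def)
    then show "(let q = qpar \<circ> c; target = concat (map (\<lambda>f. [f, ginv G f]) (edge_list G)) @ legs G
        in (if d = 0 then 1 else orient G bs) *
          sg (\<Sum>i<length (verts G). \<Sum>i'<i. d * (\<Sum>j<snd (verts G ! i'). q (i', j))) *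
          koszul (length target) (\<lambda>r. flag_pos G (target ! r)) (\<lambda>r. q (target ! r)) *
          prod_list (map (\<lambda>f. wpair (c f) (c (ginv G f))) (edge_list G)) *
          (\<Prod>i<length (verts G). (xs ! i) (map (\<lambda>j. c (i, j)) [0..<snd (verts G ! i)])))
      = dgp.amp G bs (edge_list G) c * sg (dgp.vsign G c) * dgp.vcoeff G xs c"
      unfolding Let_def koszul_winv orient_ldet
      by (simp add: dgp.amp_def dgp.wprod_def dgp.vsign_def dgp.vpar_def dgp.vcoeff_def ac_simps)
  qed
qed

lemma EndV_simps:
  "elems EndV = end_elems d V es" "zer EndV = (\<lambda>g n p is. 0)" "add EndV = (\<lambda>g n p x y is. x is + y is)"
  "smul EndV = (\<lambda>g n p a x is. a * x is)" "dif EndV = (\<lambda>g n p. dgp.deriv)" "act EndV = (\<lambda>g n p. dgp.perm_act)"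
  "mu EndV = (\<lambda>G bs ps. dgp.contract G bs)"
proof -
  show "dif EndV = (\<lambda>g n p. dgp.deriv)"
    by (simp add: End_opd_def Let_def fun_eq_iff end_dif_def dgp.deriv_def dmat_def)
  show "act EndV = (\<lambda>g n p. dgp.perm_act)"
    by (simp add: End_opd_def Let_def fun_eq_iff end_act_def dgp.perm_act_def)
  show "mu EndV = (\<lambda>G bs ps. dgp.contract G bs)"
    by (simp add: End_opd_def Let_def end_mu_contract fun_eq_iff)
qed (simp_all add: End_opd_def Let_def)

definition unstable :: "nat \<Rightarrow> nat \<Rightarrow> bool" where
  "unstable g n \<longleftrightarrow> (g, n) \<in> {(0, 0), (0, 1), (1, 0)}"

lemma end_elems_iff:
  "x \<in> end_elems d V es g n p \<longleftrightarrow> (if unstable g n then x = (\<lambda>_. 0) else dgp.supported n p x)"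
  by (simp add: end_elems_def unstable_def dgp.supported_def)

lemma end_elems_supported: "x \<in> end_elems d V es g n p \<Longrightarrow> dgp.supported n p x"
  by (auto simp: end_elems_iff dgp.supported_def split: if_splits)

lemma inputs_supported:
  assumes "inputs EndV G ps xs"
  shows "\<And>i. i < length (verts G) \<Longrightarrow> dgp.supported (snd (verts G ! i)) (ps ! i) (xs ! i)"
    "length ps = length (verts G)" "length xs = length (verts G)"
  using assms end_elems_supported unfolding inputs_def EndV_simps by blast+

lemma opsum_End: "opsum EndV g n p fs = (\<lambda>is. \<Sum>f\<leftarrow>fs. f is)"
  by (induction fs) (simp_all add: opsum_def EndV_simps)

text \<open>The axioms are the results on \<open>contract\<close>, \<open>deriv\<close> and
  \<open>perm_act\<close>. The components that are set to 0 need separate care, for closedness under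
  the operations.\<close>

theorem End_operad: "extended_modular_operad d EndV"
  unfolding extended_modular_operad_def
proof
  fix g n :: nat and p :: bit and x y z :: "nat list \<Rightarrow> 'k" and a b :: 'k and \<sigma> \<tau> :: "nat \<Rightarrow> nat"
  have zero: "dgp.deriv (\<lambda>_. 0) = (\<lambda>_. 0)" "dgp.perm_act \<sigma> (\<lambda>_. 0) = (\<lambda>_. 0)" for \<sigma>
    by (simp_all add: fun_eq_iff dgp.deriv_def dgp.perm_act_def)
  show "zer EndV g n p \<in> elems EndV g n p"
    by (simp add: EndV_simps end_elems_iff dgp.supported_def)
  {
    assume x: "x \<in> elems EndV g n p"
    note xs = end_elems_supported[OF x[unfolded EndV_simps]]
    show "smul EndV g n p a x \<in> elems EndV g n p"
      using x by (auto simp: EndV_simps end_elems_iff dgp.supported_def split: if_splits)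
    show "dif EndV g n p x \<in> elems EndV g n (p + 1)"
      using x zero by (auto simp: EndV_simps end_elems_iff dgp.supported_deriv split: if_splits)
    show "act EndV g n p \<sigma> x \<in> elems EndV g n p" if "\<sigma> permutes {..<n}"
      using x zero that by (auto simp: EndV_simps end_elems_iff dgp.supported_perm_act split: if_splits)
    show "add EndV g n p x (zer EndV g n p) = x" "add EndV g n p x (smul EndV g n p (- 1) x) = zer EndV g n p"
      "smul EndV g n p 1 x = x" "smul EndV g n p a (smul EndV g n p b x) = smul EndV g n p (a * b) x"
      "smul EndV g n p (a + b) x = add EndV g n p (smul EndV g n p a x) (smul EndV g n p b x)"
      by (simp_all add: EndV_simps fun_eq_iff distrib_right)
    show "(g, n) \<in> {(0, 0), (0, 1), (1, 0)} \<Longrightarrow> x = zer EndV g n p"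
      using x by (simp add: EndV_simps end_elems_iff unstable_def)
    show "dif EndV g n p (smul EndV g n p a x) = smul EndV g n (p + 1) a (dif EndV g n p x)"
      by (simp add: EndV_simps dgp.deriv_linear)
    show "dif EndV g n (p + 1) (dif EndV g n p x) = zer EndV g n p"
      using dgp.deriv_deriv dmat_dmat by (simp add: EndV_simps)
    show "act EndV g n p \<sigma> (smul EndV g n p a x) = smul EndV g n p a (act EndV g n p \<sigma> x)"
      by (simp add: EndV_simps dgp.perm_act_linear)
    show "act EndV g n (p + 1) \<sigma> (dif EndV g n p x) = dif EndV g n p (act EndV g n p \<sigma> x)" if "\<sigma> permutes {..<n}"
      using dgp.deriv_perm_act[OF xs that] by (simp add: EndV_simps)
    show "act EndV g n p id x = x" using dgp.perm_act_id[OF xs] by (simp add: EndV_simps)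
    show "act EndV g n p \<tau> (act EndV g n p \<sigma> x) = act EndV g n p (\<tau> \<circ> \<sigma>) x"
      if "\<sigma> permutes {..<n}" "\<tau> permutes {..<n}"
      using dgp.perm_act_compose[OF xs that] by (simp add: EndV_simps)
    show "mu EndV (corolla g n) [] [p] [x] = x" using dgp.contract_corolla[OF xs] by (simp add: EndV_simps)
    assume "y \<in> elems EndV g n p"
    then show "add EndV g n p x y \<in> elems EndV g n p"
      using x by (force simp: EndV_simps end_elems_iff dgp.supported_def split: if_splits)
    show "add EndV g n p (add EndV g n p x y) z = add EndV g n p x (add EndV g n p y z)"
      "add EndV g n p x y = add EndV g n p y x"
      "smul EndV g n p a (add EndV g n p x y) = add EndV g n p (smul EndV g n p a x) (smul EndV g n p a y)"
      by (simp_all add: EndV_simps fun_eq_iff distrib_left ac_simps)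
    show "dif EndV g n p (add EndV g n p x y) = add EndV g n (p + 1) (dif EndV g n p x) (dif EndV g n p y)"
      "act EndV g n p \<sigma> (add EndV g n p x y) = add EndV g n p (act EndV g n p \<sigma> x) (act EndV g n p \<sigma> y)"
      by (simp_all add: EndV_simps dgp.deriv_linear dgp.perm_act_linear)
  }
next
  fix G bs ps xs
  assume comp: "composable d EndV G bs ps xs"
  then have G: "ext_stable G" and bs: "det_args d G bs" and inp: "inputs EndV G ps xs"
    unfolding composable_def by auto
  note wc = ext_stable_wf[OF G] and supp = inputs_supported[OF inp]
  let ?g = "genus TYPE('k) G" and ?n = "length (legs G)" and ?p = "out_par bs ps"
  have len: "length bs = det_rank TYPE('k) d G" using bs by (simp add: det_args_def)
  \<comment> \<open>Otherwise the component would be 0 and the contraction would have to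
    vanish.\<close>
  have "\<not> unstable ?g ?n" unfolding unstable_def by (rule ext_stable_genus[OF G])
  then show "mu EndV G bs ps xs \<in> elems EndV ?g ?n ?p"
    using dgp.supported_contract[OF wc len supp(1,2)] by (simp add: EndV_simps end_elems_iff)
  show "mu EndV G bs ps xs = mu EndV G bs ps xs'"
    if "composable d EndV G bs ps xs'" "\<And>i. i < length (verts G) \<Longrightarrow> xs ! i = xs' ! i" for xs'
  proof -
    have "xs = xs'"
      by (rule nth_equalityI) (use that supp(3) in \<open>auto simp: composable_def inputs_def\<close>)
    then show ?thesis by simp
  qed
  show "mu EndV G bs ps (xs[i := add EndV (fst (verts G ! i)) (snd (verts G ! i)) (ps ! i) (xs ! i) y])
      = add EndV ?g ?n ?p (mu EndV G bs ps xs) (mu EndV G bs ps (xs[i := y]))" if "i < length (verts G)" for i y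
    using dgp.contract_add[OF that supp(3)] by (simp add: EndV_simps)
  show "mu EndV G bs ps (xs[i := smul EndV (fst (verts G ! i)) (snd (verts G ! i)) (ps ! i) a (xs ! i)])
      = smul EndV ?g ?n ?p a (mu EndV G bs ps xs)" if "i < length (verts G)" for i a
    using dgp.contract_smul[OF that supp(3)] by (simp add: EndV_simps)
  show "mu EndV G (bs[i := \<lambda>f. a * u f + (bs ! i) f]) ps xs
      = add EndV ?g ?n ?p (smul EndV ?g ?n ?p a (mu EndV G (bs[i := u]) ps xs)) (mu EndV G bs ps xs)"
    if "i < length bs" for i u a
    using dgp.contract_det_linear[OF wc bs that] by (simp add: EndV_simps fun_eq_iff)
  show "mu EndV G bs ps xs = zer EndV ?g ?n ?p" if "i < j" "j < length bs" "bs ! i = bs ! j" for i j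
    using dgp.contract_det_alternating[OF wc bs that] by (simp add: EndV_simps fun_eq_iff)
  show "dif EndV ?g ?n ?p (mu EndV G bs ps xs) = opsum EndV ?g ?n (?p + 1)
      (map (\<lambda>i. smul EndV ?g ?n (?p + 1) (sg (of_nat (length bs) + sum_list (take i ps)))
         (mu EndV G bs (ps[i := ps ! i + 1])
           (xs[i := dif EndV (fst (verts G ! i)) (snd (verts G ! i)) (ps ! i) (xs ! i)])))
        [0..<length (verts G)])"
    unfolding opsum_End
    using dgp.deriv_contract[OF wc len supp(1,3,2)]
    by (simp add: EndV_simps fun_eq_iff sum_list_sum_nth lessThan_atLeast0)
  show "mu EndV G' bs ps xs = act EndV ?g ?n ?p \<tau> (mu EndV G bs ps xs)"
    if "\<tau> permutes {..<length (legs G)}" "relabelled G \<tau> G'" for \<tau> G'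
    using dgp.contract_relabel[OF wc(1) relabelled_wf[OF wc(1) that(2,1)] that(2,1)] by (simp add: EndV_simps)
next
  fix G G' \<pi> \<rho> ps xs ps' xs' and bs :: "(flag \<Rightarrow> 'k) list"
  assume G: "ext_stable G" "ext_stable G'" and iso: "graph_iso G G' \<pi> \<rho>" and bs: "det_args d G' bs"
    and inp: "inputs EndV G ps xs"
    and xs': "\<And>i. i < length (verts G) \<Longrightarrow> ps' ! \<pi> i = ps ! i \<and>
        xs' ! \<pi> i = act EndV (fst (verts G ! i)) (snd (verts G ! i)) (ps ! i) (\<rho> i) (xs ! i)"
  interpret i: pairing_iso d dimV qpar wpair G G' \<pi> \<rho>
    by unfold_locales (use ext_stable_wf G iso in auto)
  have xs'': "\<And>i. i < length (verts G) \<Longrightarrow> xs' ! \<pi> i = dgp.perm_act (\<rho> i) (xs ! i)"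
    using xs' by (simp add: EndV_simps)
  show "mu EndV G' bs ps' xs' = smul EndV (genus TYPE('k) G) (length (legs G)) (out_par bs ps)
      (koszul (length (verts G)) \<pi> (\<lambda>i. ps ! i)) (mu EndV G (map (pull_chain G (flag_map \<pi> \<rho>)) bs) ps xs)"
    using i.contract_iso[OF bs inputs_supported(1)[OF inp] xs''] by (simp add: EndV_simps fun_eq_iff)
next
  fix H G Gs pss xss and bs :: "(flag \<Rightarrow> 'k) list" and bss :: "nat \<Rightarrow> (flag \<Rightarrow> 'k) list"
  assume H: "ext_stable H" and G: "ext_stable G" and graft: "grafting H Gs G"
    and comp: "\<And>i. i < length (verts H) \<Longrightarrow>
        verts H ! i = (genus TYPE('k) (Gs i), length (legs (Gs i))) \<and>
        composable d EndV (Gs i) (bss i) (pss i) (xss i)"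
    and bs: "set bs \<subseteq> H1 G" "length bs = det_rank TYPE('k) d H"
  have i: "ext_stable (Gs i)" "det_args d (Gs i) (bss i)" "inputs EndV (Gs i) (pss i) (xss i)" if "i < length (verts H)" for i
    using comp[OF that] unfolding composable_def by auto
  interpret g: pairing_grafted_det d dimV qpar wpair H G Gs bs bss
  proof unfold_locales
    fix i assume "i < length (verts H)"
    then show "wf_graph (Gs i)" "connected_graph (Gs i)" "snd (verts H ! i) = length (legs (Gs i))"
        "det_args d (Gs i) (bss i)"
      using i(1,2) comp ext_stable_wf by auto
  qed (use H G graft bs ext_stable_wf in auto)
  note inp = inputs_supported[OF i(3)]
  show "mu EndV H (map (collapse_chain H Gs) bs) (map (\<lambda>i. out_par (bss i) (pss i)) [0..<length (verts H)])
      (map (\<lambda>i. mu EndV (Gs i) (bss i) (pss i) (xss i)) [0..<length (verts H)])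
    = smul EndV (genus TYPE('k) G) (length (legs G)) (out_par bs (map (\<lambda>i. out_par (bss i) (pss i)) [0..<length (verts H)]))
        (sg (\<Sum>i<length (verts H). \<Sum>j<i. of_nat (length (bss i)) * sum_list (pss j)))
        (mu EndV G (bs @ concat (map (\<lambda>i. map (push_chain Gs i) (bss i)) [0..<length (verts H)]))
          (concat (map pss [0..<length (verts H)])) (concat (map xss [0..<length (verts H)])))"
    using g.contract_graft[of pss xss] inp by (simp add: EndV_simps fun_eq_iff g.bs_G_def)
qed auto

end

section \<open>Operators as elements of arity (0, 2)\<close>

lemma attach_simps [simp]:
  "verts (attach_graph g n j) = [(g, n), (0, 2)]"
  "ginv (attach_graph g n j) = Transposition.transpose (0, j) (1, 0)"
  "legs (attach_graph g n j) = map (\<lambda>l. if l = j then (1, 1) else (0, l)) [0..<n]"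
  by (simp_all add: attach_graph_def)

lemma attach_flags: "flags (attach_graph g n j) = {0} \<times> {..<n} \<union> {(1, 0), (1, 1)}"
  by (auto simp: flags_def less_Suc_eq nth_Cons' numeral_2_eq_2)

lemma attach_flag_list: "flag_list (attach_graph g n j) = map (Pair 0) [0..<n] @ [(1, 0), (1, 1)]"
  by (simp add: flag_list_def numeral_2_eq_2)

lemma attach_wf:
  assumes "j < n"
  shows "wf_graph (attach_graph g n j)" "connected_graph (attach_graph g n j)"
proof -
  let ?G = "attach_graph g n j"
  have "ginv ?G permutes flags ?G"
    unfolding attach_simps by (rule permutes_swap_id) (use assms in \<open>auto simp: attach_flags\<close>)
  moreover have "distinct (legs ?G)" by (auto simp: distinct_map inj_on_def split: if_splits)
  moreover have "set (legs ?G) = {f \<in> flags ?G. ginv ?G f = f}"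
  proof (intro equalityI subsetI)
    fix f assume "f \<in> {f \<in> flags ?G. ginv ?G f = f}"
    then have f: "f \<in> flags ?G" "ginv ?G f = f" by auto
    then have "f = (1, 1) \<or> (\<exists>l<n. l \<noteq> j \<and> f = (0, l))"
      by (auto simp: attach_flags Transposition.transpose_def split: if_splits)
    then show "f \<in> set (legs ?G)" using assms by (auto simp: image_iff)
  qed (use assms in \<open>auto simp: attach_flags Transposition.transpose_def split: if_splits\<close>)
  ultimately show "wf_graph ?G" by (simp add: wf_graph_def del: attach_simps(3))
  let ?E = "{(fst f, fst (ginv ?G f)) | f. f \<in> flags ?G}"
  have "(0, 1) = (fst (0 :: nat, j), fst (ginv ?G (0, j)))" "(1, 0) = (fst (1 :: nat, 0 :: nat), fst (ginv ?G (1, 0)))"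
    "(0, j) \<in> flags ?G" "(1, 0) \<in> flags ?G"
    using assms by (simp_all add: attach_flags)
  then have E: "(0, 1) \<in> ?E\<^sup>*" "(1, 0) \<in> ?E\<^sup>*" by blast+
  have "(a, b) \<in> ?E\<^sup>*" if "a < 2" "b < 2" for a b
  proof -
    have "a = 0 \<or> a = 1" "b = 0 \<or> b = 1" using that by auto
    then show ?thesis by (elim disjE) (simp_all only: E rtrancl.rtrancl_refl)
  qed
  then show "connected_graph ?G" by (simp add: connected_graph_def numeral_2_eq_2)
qed

lemma attach_pos: "l < n \<Longrightarrow> flag_pos (attach_graph g n j) (0, l) = l"
  "flag_pos (attach_graph g n j) (1, 0) = n" "flag_pos (attach_graph g n j) (1, 1) = Suc n"
  "flag_pos (attach_graph g n j) (Suc 0, 0) = n" "flag_pos (attach_graph g n j) (Suc 0, Suc 0) = Suc n"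
  by (simp_all add: flag_pos_def)

lemma attach_edge_list:
  assumes "j < n"
  shows "edge_list (attach_graph g n j) = [(0, j)]"
proof -
  have "filter (\<lambda>f. flag_pos (attach_graph g n j) f < flag_pos (attach_graph g n j) (ginv (attach_graph g n j) f)) (map (Pair 0) [0..<n])
      = filter (\<lambda>f. f = (0, j)) (map (Pair 0) [0..<n])"
    by (rule filter_cong) (use assms in \<open>auto simp: Transposition.transpose_def attach_pos\<close>)
  also have "\<dots> = map (Pair 0) (filter (\<lambda>l. l = j) [0..<n])"
    by (simp add: filter_map comp_def)
  also have "filter (\<lambda>l. l = j) [0..<n] = [j]"
    using assms by (induction n) (auto simp: filter_empty_conv)
  finally show ?thesis
    using assms by (simp add: edge_list_def attach_flag_list Transposition.transpose_def attach_pos)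
qed

lemma attach_betti:
  assumes "j < n"
  shows "betti TYPE('k::field_char_0) (attach_graph g n j) = 0" "genus TYPE('k) (attach_graph g n j) = g"
proof -
  interpret graph_conn "attach_graph g n j"
    using attach_wf[OF assms] by unfold_locales
  show "betti TYPE('k) (attach_graph g n j) = 0"
    using betti_euler[OF edge_reps_edge_list, where ?'k = 'k] by (simp add: attach_edge_list[OF assms])
  then show "genus TYPE('k) (attach_graph g n j) = g" by (simp add: genus_def)
qed

lemma attach_ext_stable: "ext_stable (attach_graph 0 2 1)"
  using attach_wf[of 1 2 0] by (simp add: ext_stable_def)

lemma attach_det_args: "j < n \<Longrightarrow> det_args d (attach_graph g n j) ([] :: (flag \<Rightarrow> 'k::field_char_0) list)"
  by (simp add: det_args_def det_rank_def attach_betti)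

text \<open>A determinant of size 1: the lift of vertex 1 has coefficient 0 on the leg, hence 1 on
  the flag \<open>(1, 0)\<close> and -1 on its opposite.\<close>

lemma attach_det_factor:
  assumes "j < n"
  shows "det_factor d (attach_graph g n j) [] [(0, j)] = (sg d :: 'k::field_char_0)"
proof (cases "d = 0")
  case False
  let ?G = "attach_graph g n j" and ?u = "lift_vertex (attach_graph g n j) 1 :: flag \<Rightarrow> 'k"
  interpret graph_conn ?G using attach_wf[OF assms] by unfold_locales
  have u: "?u \<in> chains1 ?G" by (rule lift_vertex(1)) simp
  have "?u (1, 0) + ?u (1, 1) = 1"
    using lift_vertex(2)[of 1 1, where ?'k = 'k] by (simp add: bdry_def numeral_2_eq_2)
  moreover have "?u (1, 1) = - ?u (1, 1)" using chain_ginv[OF u, of "(1, 1)"] assms by (simp add: Transposition.transpose_def)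
  moreover have "?u (0, j) = - ?u (1, 0)" using chain_ginv[OF u, of "(1, 0)"] by simp
  ultimately have "?u (0, j) = - 1" by simp
  then show ?thesis
    using False by (simp add: det_factor_def ldet_def det_single sg_def)
qed (simp add: det_factor_def)

section \<open>Contraction with an attached bivalent vertex\<close>

context pairing
begin

text \<open>The leg of the attached vertex takes the place of the \<open>j\<close>-th flag, so
  \<open>y\<close> is moved past the flags behind \<open>j\<close>. This gives no further sign if
  \<open>y\<close> is even or if there are no such flags; the two cases serve the unit axiom and the
  product.\<close>

lemma contract_attach:
  assumes x: "supported n p x" and y: "supported 2 p' y" and j: "j < n" and p': "p' = 0 \<or> Suc j = n"
    and js: "length js = n" "set js \<subseteq> {..<N}"
  shows "contract (attach_graph g n j) [] [x, y] js
    = (\<Sum>a<N. \<Sum>b<N. sg (d + d * q a) * x (js[j := a]) * w a b * y [b, js ! j])"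
proof -
  let ?G = "attach_graph g n j" and ?z = "js ! j"
  \<comment> \<open>The assignments with prescribed values on the legs: only the two ends of the
    edge are free.\<close>
  define c where "c a b = (\<lambda>f\<in>flags ?G. if f = (0, j) then a else if f = (1, 0) then b else if f = (1, 1) then ?z else js ! snd f)" for a b
  have z: "?z < N" by (rule nth_less[OF js(2)]) (use j js in simp)
  have c0: "c a b (0, l) = js[j := a] ! l" if "l < n" for a b l
    using that js by (simp add: c_def attach_flags nth_list_update)
  have c1: "c a b (1, 0) = b" "c a b (1, 1) = ?z" "c a b (Suc 0, 0) = b" "c a b (Suc 0, Suc 0) = ?z" for a b
    by (simp_all add: c_def attach_flags)
  have legs_c: "map (c a b) (legs ?G) = js" for a b
    by (rule nth_equalityI) (use js c0 c1 in \<open>auto simp: nth_list_update\<close>)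
  have c_in: "c a b \<in> assigns ?G" if "a < N" "b < N" for a b
    unfolding assigns_def c_def
  proof (rule restrict_PiE_iff[THEN iffD2], rule ballI)
    fix f assume "f \<in> flags ?G"
    then show "(if f = (0, j) then a else if f = (1, 0) then b else if f = (1, 1) then ?z else js ! snd f) \<in> {..<N}"
      using that z nth_less[OF js(2)] js(1) by (auto simp: attach_flags)
  qed
  have "(\<Sum>c'\<in>legs_assigns ?G js. amp ?G [] (edge_list ?G) c' * sg (vsign ?G c') * vcoeff ?G [x, y] c')
    = (\<Sum>(a, b)\<in>{..<N} \<times> {..<N}. amp ?G [] (edge_list ?G) (c a b) * sg (vsign ?G (c a b)) * vcoeff ?G [x, y] (c a b))"
  proof (rule sum.reindex_bij_witness[of _ "\<lambda>(a, b). c a b" "\<lambda>c'. (c' (0, j), c' (1, 0))"])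
    fix c' assume c': "c' \<in> legs_assigns ?G js"
    have v: "c' (if l = j then (1, 1) else (0, l)) = js ! l" if "l < n" for l
    proof -
      have "map c' (legs ?G) ! l = c' (if l = j then (1, 1) else (0, l))" using that by simp
      then show ?thesis using c' by simp
    qed
    have v0: "c' (0, l) = js ! l" if "l < n" "l \<noteq> j" for l using v[OF that(1)] that by simp
    have v1: "c' (1, 1) = ?z" using v[OF j] by simp
    have "c (c' (0, j)) (c' (1, 0)) = c'"
    proof (rule extensionalityI[of _ "flags ?G"])
      show "c' \<in> extensional (flags ?G)" using c' by (auto simp: assigns_def PiE_def)
      fix f assume f: "f \<in> flags ?G"
      then have "f = (1, 0) \<or> f = (1, 1) \<or> (\<exists>l<n. f = (0, l))" by (auto simp: attach_flags)
      then show "c (c' (0, j)) (c' (1, 0)) f = c' f"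
        using f v0 v1 by (cases "f = (0, j)") (auto simp: c_def attach_flags)
    qed (simp add: c_def)
    then show "(case (c' (0, j), c' (1, 0)) of (a, b) \<Rightarrow> c a b) = c'" by simp
    then show "(case (c' (0, j), c' (1, 0)) of (a, b) \<Rightarrow> amp ?G [] (edge_list ?G) (c a b) * sg (vsign ?G (c a b)) * vcoeff ?G [x, y] (c a b))
      = amp ?G [] (edge_list ?G) c' * sg (vsign ?G c') * vcoeff ?G [x, y] c'" by simp
    have "(0, j) \<in> flags ?G" "(1, 0) \<in> flags ?G" using j by (auto simp: attach_flags)
    then show "(c' (0, j), c' (1, 0)) \<in> {..<N} \<times> {..<N}" using c' assigns_less by blast
  next
    fix ab assume ab: "ab \<in> {..<N} \<times> {..<N}"
    obtain a b where "ab = (a, b)" by fastforce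
    then show "(\<lambda>c'. (c' (0, j), c' (1, 0))) (case ab of (a, b) \<Rightarrow> c a b) = ab"
      "(case ab of (a, b) \<Rightarrow> c a b) \<in> legs_assigns ?G js"
      using ab c_in[of a b] legs_c[of a b] c0[OF j, of a b] c1(1)[of a b] j js by (simp_all del: map_map attach_simps(3))
  qed
  also have "\<dots> = (\<Sum>(a, b)\<in>{..<N} \<times> {..<N}. sg (d + d * q a) * x (js[j := a]) * w a b * y [b, ?z])"
  proof (rule sum.cong[OF refl], safe)
    fix a b assume ab: "a < N" "b < N"
    let ?A = "sum_list (map q (take j js))" and ?C = "sum_list (map q (drop (Suc j) js))"
    let ?p = "q \<circ> c a b" and ?r = "flag_pos ?G"
    have vc: "vcoeff ?G [x, y] (c a b) = x (js[j := a]) * y [b, ?z]"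
    proof -
      have "map (\<lambda>l. c a b (0, l)) [0..<n] = js[j := a]"
        by (rule nth_equalityI) (use c0 js in simp_all)
      then show ?thesis
        by (simp add: vcoeff_def numeral_2_eq_2 lessThan_Suc c1 mult.commute del: restrict_apply)
    qed
    have wp: "wprod ?G [(0, j)] (c a b) = w a b"
      using c0[OF j, of a b] c1(1)[of a b] j js by (simp del: restrict_apply)
    show "amp ?G [] (edge_list ?G) (c a b) * sg (vsign ?G (c a b)) * vcoeff ?G [x, y] (c a b)
      = sg (d + d * q a) * x (js[j := a]) * w a b * y [b, ?z]"
    proof (cases "w a b = 0 \<or> y [b, ?z] = 0")
      case True
      then show ?thesis unfolding vc attach_edge_list[OF j] amp_def wp by auto
    next
      case False
      have qab: "q b = q a + d"
      proof -
        have "q a + q b = d" using False w_par ab by blast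
        then show ?thesis by (metis bit_add_self_left)
      qed
      have qz: "d + (q b + q ?z) = p'" using supportedD(3)[OF y, of "[b, ?z]"] False by simp
      have js_split: "js = take j js @ ?z # drop (Suc j) js" using j js by (simp add: id_take_nth_drop)
      have vpar0: "vpar ?G (c a b) 0 = ?A + (q a + ?C)"
      proof -
        have "vpar ?G (c a b) 0 = (\<Sum>l<length (js[j := a]). q (js[j := a] ! l))"
          unfolding vpar_def using js c0[of _ a b] by (intro sum.cong) (simp_all del: restrict_apply)
        also have "\<dots> = sum_list (map q (js[j := a]))" by (rule sum_list_nth_sum[symmetric])
        also have "\<dots> = ?A + (q a + ?C)" using j js by (simp add: upd_conv_take_nth_drop)
        finally show ?thesis .
      qed
      have vs: "vsign ?G (c a b) = d * (?A + (q a + ?C))"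
        by (simp add: vsign_def lessThan_Suc vpar0 del: restrict_apply)
      let ?L1 = "map (Pair 0) [0..<j] :: flag list" and ?L2 = "map (Pair 0) [Suc j..<n] :: flag list"
      have legs: "legs ?G = ?L1 @ (1, 1) # ?L2"
      proof -
        have "[0..<n] = [0..<j] @ j # [Suc j..<n]"
          using j by (metis less_imp_le_nat upt_add_eq_append upt_conv_Cons le_add_diff_inverse zero_le)
        then show ?thesis by (auto simp: attach_graph_def)
      qed
      have pL1: "sum_list (map ?p ?L1) = ?A"
      proof -
        have "map ?p ?L1 = map q (take j js)"
          by (rule nth_equalityI) (use j js c0[of _ a b] in \<open>simp_all del: restrict_apply\<close>)
        then show ?thesis by simp
      qed
      have pL2: "sum_list (map ?p ?L2) = ?C"
      proof -
        have "map ?p ?L2 = map q (drop (Suc j) js)"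
          by (rule nth_equalityI) (use j js c0[of _ a b] in \<open>simp_all del: restrict_apply\<close>)
        then show ?thesis by simp
      qed
      have posl: "?r f < n" if "f \<in> set ?L1 \<union> set ?L2" for f
        using that j attach_pos(1) by auto
      have s1: "wcross ?r ?p [(0, j)] ?L1 = q a * ?A"
      proof -
        have "wcross ?r ?p [(0, j)] ?L1 = sum_list (map ?p [(0, j)]) * sum_list (map ?p ?L1)"
          by (rule wcross_all) (use j attach_pos(1)[of _ n g j] in auto)
        then show ?thesis unfolding pL1 using c0[OF j, of a b] j js by simp
      qed
      have s2: "wcross ?r ?p [(0, j)] ((1, 0) # [(1, 1)]) = 0" "wcross ?r ?p [(0, j)] ?L2 = 0"
        using j by (auto intro!: wcross_none simp: attach_pos)
      have s3: "wcross ?r ?p [(1, 0)] ?L1 = q b * ?A" "wcross ?r ?p [(1, 0)] ?L2 = q b * ?C"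
        "wcross ?r ?p [(1, 1)] ?L2 = q ?z * ?C"
      proof -
        have "wcross ?r ?p [(1, 0)] ?L1 = sum_list (map ?p [(1, 0)]) * sum_list (map ?p ?L1)"
          "wcross ?r ?p [(1, 0)] ?L2 = sum_list (map ?p [(1, 0)]) * sum_list (map ?p ?L2)"
          "wcross ?r ?p [(1, 1)] ?L2 = sum_list (map ?p [(1, 1)]) * sum_list (map ?p ?L2)"
          by (rule wcross_all; use posl in \<open>auto simp: attach_pos less_SucI\<close>)+
        then show "wcross ?r ?p [(1, 0)] ?L1 = q b * ?A" "wcross ?r ?p [(1, 0)] ?L2 = q b * ?C"
          "wcross ?r ?p [(1, 1)] ?L2 = q ?z * ?C"
          unfolding pL1 pL2 using c1[of a b] by simp_all
      qed
      have s4: "wcross ?r ?p ?L1 [(1, 1)] = 0" "wcross ?r ?p [(1, 0)] [(1, 1)] = 0" "wcross ?r ?p ?L1 ?L2 = 0"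
        using j by (auto intro!: wcross_none simp: attach_pos)
      have s5: "winv ?r ?p ?L1 = 0" "winv ?r ?p ?L2 = 0"
      proof -
        have "map ?r ?L1 = [0..<j]" "map ?r ?L2 = [Suc j..<n]" using j by (auto simp: attach_pos intro!: map_idI)
        then show "winv ?r ?p ?L1 = 0" "winv ?r ?p ?L2 = 0" by (simp_all add: winv_sorted)
      qed
      have e1: "wcross ?r ?p [(0, j)] [(1, 0)] = 0" "wcross ?r ?p [(0, j)] [(1, 1)] = 0"
        using j by (auto intro!: wcross_none simp: attach_pos)
      have "winv ?r ?p ([(0, j)] @ [(1, 0)] @ ?L1 @ [(1, 1)] @ ?L2) = q a * ?A + (q b * ?A + q b * ?C) + q ?z * ?C"
        by (simp only: winv_append wcross_append_left wcross_append_right s1 s2 s3 s4 s5 e1)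
          (simp add: ac_simps)
      then have W: "winv ?r ?p (edge_word ?G [(0, j)] @ legs ?G) = q a * ?A + (q b * ?A + q b * ?C) + q ?z * ?C"
        unfolding legs by simp
      \<comment> \<open>The only place where the alternative on \<open>p'\<close> and
        \<open>j\<close> enters: either there is nothing behind \<open>j\<close>, or the new leg has
        the parity of the flag that it replaces.\<close>
      have zC: "q ?z * ?C = q a * ?C"
      proof (cases "Suc j = n")
        case True
        then show ?thesis using js by simp
      next
        case False
        then have "d + (q b + q ?z) = 0" using p' qz by simp
        then show ?thesis unfolding qab by (cases "q ?z"; cases "q a"; cases d) simp_all
      qed
      have sgn: "d + (q a * ?A + (q b * ?A + q b * ?C) + q ?z * ?C) + d * (?A + (q a + ?C)) = d + d * q a"
        unfolding zC qab by (simp add: distrib_left distrib_right ac_simps)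
      have "amp ?G [] (edge_list ?G) (c a b) * sg (vsign ?G (c a b))
        = sg (d + (q a * ?A + (q b * ?A + q b * ?C) + q ?z * ?C) + d * (?A + (q a + ?C))) * w a b"
        unfolding amp_def attach_edge_list[OF j] attach_det_factor[OF j] W vs wp by (simp only: sg_add ac_simps)
      then show ?thesis unfolding vc sgn by (simp only: ac_simps)
    qed
  qed
  finally show ?thesis
    using js by (simp add: contract_def sum.cartesian_product del: attach_simps(3))
      (simp add: attach_graph_def)
qed

end

section \<open>Elements of arity (0, 2) as operators\<close>

context dg_inner_product_space
begin

interpretation vs: vector_space sc by (rule vs)

abbreviation "opr \<equiv> as_operator sc V B"

lemma opr_def: "opr x v = (\<Sum>a<dimV. \<Sum>b<dimV. sc (x [a, b] * B (es ! b) v) (es ! a))"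
  by (simp add: as_operator_def Let_def)

lemma opr_coeff: "opr x v = (\<Sum>a<dimV. sc (\<Sum>b<dimV. x [a, b] * B (es ! b) v) (es ! a))"
  by (simp add: opr_def vs.scale_sum_left)

lemma B_add_right: "B v (u + u') = B v u + B v u'" and B_scale_right: "B v (sc a u) = a * B v u"
  and B_minus_right: "B v (u - u') = B v u - B v u'"
proof -
  interpret l: Vector_Spaces.linear sc "(*)" "B v" by (rule B_linear_right)
  show "B v (u + u') = B v u + B v u'" "B v (sc a u) = a * B v u" "B v (u - u') = B v u - B v u'"
    by (simp_all add: l.add l.scale l.diff)
qed

lemma B_add_left: "B (u + u') v = B u v + B u' v" and B_scale_left: "B (sc a u) v = a * B u v"
proof -
  interpret l: Vector_Spaces.linear sc "(*)" "\<lambda>u. B u v" by (rule B_linear_left)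
  show "B (u + u') v = B u v + B u' v" "B (sc a u) v = a * B u v"
    by (simp_all add: l.add l.scale)
qed

lemma linear_sc_iff:
  "Vector_Spaces.linear sc sc f \<longleftrightarrow> (\<forall>u v. f (u + v) = f u + f v) \<and> (\<forall>a v. f (sc a v) = sc a (f v))"
  by (auto simp: Vector_Spaces.linear_def module_hom_def module_hom_axioms_def vs vs.module_axioms)

lemma linear_opr: "Vector_Spaces.linear sc sc (opr x)"
  unfolding linear_sc_iff
  
proof (intro conjI allI)
  show "opr x (u + v) = opr x u + opr x v" for u v
    by (simp only: opr_def B_add_right distrib_left vs.scale_left_distrib sum.distrib)
  show "opr x (sc a v) = sc a (opr x v)" for a v
    by (simp only: opr_def B_scale_right vs.scale_sum_right vs.scale_scale mult.left_commute)
qed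

lemma linear_expand:
  assumes "Vector_Spaces.linear sc sc f"
  shows "f v = (\<Sum>a<dimV. sc (vs.representation (set es) v (es ! a)) (f (es ! a)))"
proof -
  interpret l: Vector_Spaces.linear sc sc f by (rule assms)
  show ?thesis by (subst expand[of v]) (simp add: l.sum l.scale)
qed

lemma linear_eqI:
  assumes "Vector_Spaces.linear sc sc f" "Vector_Spaces.linear sc sc f'" "\<And>a. a < dimV \<Longrightarrow> f (es ! a) = f' (es ! a)"
  shows "f = f'"
proof
  fix v
  show "f v = f' v"
    by (subst linear_expand[OF assms(1)], subst linear_expand[OF assms(2)]) (simp add: assms(3))
qed

lemma opr_plus: "opr (\<lambda>is. x is + y is) v = opr x v + opr y v"
  and opr_smul: "opr (\<lambda>is. a * x is) v = sc a (opr x v)"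
  by (simp_all only: opr_def distrib_right vs.scale_left_distrib sum.distrib vs.scale_sum_right vs.scale_scale mult.assoc)

lemma opr_zero: "opr (\<lambda>_. 0) v = 0"
  by (simp add: opr_def)

text \<open>For fixed \<open>a\<close> the coefficients describe the functional that gives the
  \<open>a\<close>-th coordinate of the operator, and nondegeneracy recovers them from it.\<close>

lemma opr_inj:
  assumes "dgp.supported 2 p x" "dgp.supported 2 p' x'" "opr x = opr x'"
  shows "x = x'"
proof
  fix js
  have coeff: "x [a, b] = x' [a, b]" if ab: "a < dimV" "b < dimV" for a b
  proof -
    let ?v = "\<Sum>b<dimV. sc (x [a, b] - x' [a, b]) (es ! b)"
    have "B ?v w = 0" for w
    proof -
      have "opr x w = opr x' w" using assms(3) by simp
      then have "(\<Sum>b<dimV. x [a, b] * B (es ! b) w) = (\<Sum>b<dimV. x' [a, b] * B (es ! b) w)"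
        unfolding opr_coeff by (rule expand_unique[OF _ ab(1)])
      then show ?thesis by (simp add: B_sum_left left_diff_distrib sum_subtractf)
    qed
    then have "?v = 0" by (rule B_nondegenerate)
    then have "(\<Sum>b<dimV. sc (x [a, b] - x' [a, b]) (es ! b)) = (\<Sum>b<dimV. sc 0 (es ! b))" by simp
    from expand_unique[OF this ab(2)] show ?thesis by simp
  qed
  show "x js = x' js"
  proof (cases "length js = 2 \<and> set js \<subseteq> {..<dimV}")
    case True
    then obtain a b where "js = [a, b]" by (auto simp: length_Suc_conv numeral_2_eq_2)
    then show ?thesis using True coeff by simp
  next
    case False
    then show ?thesis using assms(1,2) unfolding dgp.supported_def by metis
  qed
qed

lemma opr_parity:
  assumes "dgp.supported 2 p x" "v \<in> V r"
  shows "opr x v \<in> V (r + p)"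
  unfolding opr_def
proof (intro vs.subspace_sum[OF parity_subspace])
  fix a b assume ab: "a \<in> {..<dimV}" "b \<in> {..<dimV}"
  show "sc (x [a, b] * B (es ! b) v) (es ! a) \<in> V (r + p)"
  proof (cases "x [a, b] = 0 \<or> B (es ! b) v = 0")
    case True
    then show ?thesis using vs.subspace_0[OF parity_subspace] by auto
  next
    case False
    then have "d + (qpar a + qpar b) = p" using dgp.supportedD(3)[OF assms(1), of "[a, b]"] by simp
    moreover have "bpar b + r = d" using B_even[OF bpar_in assms(2), of b] ab False by auto
    ultimately have "bpar a = r + p" unfolding qpar by (cases "bpar a"; cases "bpar b"; cases d; cases r) auto
    then show ?thesis using vs.subspace_scale[OF parity_subspace bpar_in[of a]] ab by simp
  qed
qed

text \<open>Each coordinate of \<open>f\<close> is a functional, represented by a vector through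
  \<open>B\<close>; the coordinates of these vectors are the coefficients. Their homogeneity is not
  visible from the construction and is obtained at the end, by removing the part of the wrong
  parity.\<close>

lemma opr_surj:
  assumes lin: "Vector_Spaces.linear sc sc f" and par: "\<And>r v. v \<in> V r \<Longrightarrow> f v \<in> V (r + p)"
  obtains x where "dgp.supported 2 p x" "opr x = f"
proof -
  let ?rep = "vs.representation (set es)"
  interpret fd: finite_dimensional_vector_space sc "set es"
    by unfold_locales (use basis in auto)
  \<comment> \<open>Its injectivity is nondegeneracy. In finite dimension it is then surjective,
    which provides the dual basis \<open>u\<close>.\<close>
  define \<psi> where "\<psi> v = (\<Sum>c<dimV. sc (B v (es ! c)) (es ! c))" for v
  have lin\<psi>: "Vector_Spaces.linear sc sc \<psi>"
    unfolding linear_sc_iff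
    by (auto simp: \<psi>_def B_add_left B_scale_left vs.scale_left_distrib sum.distrib vs.scale_sum_right)
  have "inj \<psi>"
  proof -
    interpret l: Vector_Spaces.linear sc sc \<psi> by (rule lin\<psi>)
    have "v = 0" if "\<psi> v = 0" for v
    proof (rule B_nondegenerate)
      fix w
      have "(\<Sum>c<dimV. sc (B v (es ! c)) (es ! c)) = (\<Sum>c<dimV. sc 0 (es ! c))" using that by (simp add: \<psi>_def)
      then have "B v (es ! c) = 0" if "c < dimV" for c using expand_unique[OF _ that, of "\<lambda>c. B v (es ! c)" "\<lambda>_. 0"] by blast
      then show "B v w = 0" by (subst expand[of w]) (simp add: B_sum_right)
    qed
    then show ?thesis by (simp add: l.inj_iff_eq_0)
  qed
  then have "surj \<psi>" using fd.linear_inj_imp_surj[OF lin\<psi>] by blast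
  then have "\<forall>c. \<exists>u. \<psi> u = es ! c" by (metis surjD)
  then obtain u where u: "\<psi> (u c) = es ! c" for c by metis
  have dual: "B (u c) (es ! c') = (if c' = c then 1 else 0)" if "c < dimV" "c' < dimV" for c c'
  proof -
    have "(\<Sum>c'<dimV. sc (B (u c) (es ! c')) (es ! c')) = (\<Sum>c'<dimV. sc (if c' = c then 1 else 0) (es ! c'))"
      using u[of c] that(1) by (simp add: \<psi>_def if_distrib[of "\<lambda>a. sc a _"] cong: if_cong)
    from expand_unique[OF this that(2)] show ?thesis .
  qed
  \<comment> \<open>The vector with \<open>B (y a) v\<close> equal to the \<open>a\<close>-th
    coordinate of \<open>f v\<close>, assembled from the dual basis.\<close>
  define y where "y a = (\<Sum>c<dimV. sc (?rep (f (es ! c)) (es ! a)) (u c))" for a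
  define x where "x r js = (if length js = 2 \<and> set js \<subseteq> {..<dimV} \<and> d + sum_list (map qpar js) = r
      then ?rep (y (js ! 0)) (es ! (js ! 1)) else 0)" for r js
  have supp: "dgp.supported 2 r (x r)" for r
    by (auto simp: dgp.supported_def x_def)
  have sum: "opr (\<lambda>is. x p is + x (p + 1) is) = f"
  proof (rule linear_eqI[OF linear_opr lin])
    fix c assume c: "c < dimV"
    have xsum: "x p [a, b] + x (p + 1) [a, b] = ?rep (y a) (es ! b)" if "a < dimV" "b < dimV" for a b
      using that parity_cases[of "d + (qpar a + qpar b)" p] by (cases p) (auto simp: x_def)
    have "opr (\<lambda>is. x p is + x (p + 1) is) (es ! c) = (\<Sum>a<dimV. sc (\<Sum>b<dimV. ?rep (y a) (es ! b) * B (es ! b) (es ! c)) (es ! a))"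
      unfolding opr_coeff by (intro sum.cong refl arg_cong2[where f = sc] arg_cong2[where f = "(*)"]) (simp add: xsum)
    also have "\<dots> = (\<Sum>a<dimV. sc (B (y a) (es ! c)) (es ! a))"
      by (subst (2) expand) (simp add: B_sum_left)
    also have "\<dots> = (\<Sum>a<dimV. sc (?rep (f (es ! c)) (es ! a)) (es ! a))"
      using c by (simp add: y_def B_sum_left dual if_distrib[of "\<lambda>z. _ * z"] cong: if_cong)
    finally show "opr (\<lambda>is. x p is + x (p + 1) is) (es ! c) = f (es ! c)" by (simp flip: expand)
  qed
  \<comment> \<open>This operator changes the parity by \<open>p + 1\<close>; being the difference
    of two operators that change it by \<open>p\<close>, it also changes it by \<open>p\<close>, so
    it vanishes.\<close>
  have "opr (x (p + 1)) = opr (\<lambda>_. 0)"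
  proof (rule linear_eqI[OF linear_opr linear_opr])
    fix c assume c: "c < dimV"
    have "opr (x (p + 1)) (es ! c) = f (es ! c) - opr (x p) (es ! c)"
      using fun_cong[OF sum, of "es ! c"] by (simp add: opr_plus eq_diff_eq add.commute)
    then have "opr (x (p + 1)) (es ! c) \<in> V (bpar c + p)"
      using vs.subspace_diff[OF parity_subspace par[OF bpar_in[OF c]] opr_parity[OF supp bpar_in[OF c]]] by simp
    moreover have "opr (x (p + 1)) (es ! c) \<in> V (bpar c + p + 1)"
      using opr_parity[OF supp bpar_in[OF c], of "p + 1"] by (simp add: add.assoc)
    ultimately show "opr (x (p + 1)) (es ! c) = opr (\<lambda>_. 0) (es ! c)"
      using parity_Int by (simp add: opr_zero)
  qed
  moreover have "dgp.supported 2 (p + 1) (\<lambda>_. 0)" by (simp add: dgp.supported_def)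
  ultimately have "x (p + 1) = (\<lambda>_. 0)" using opr_inj[OF supp] by blast
  then have "opr (x p) = f" using sum by simp
  then show thesis using that supp by blast
qed

text \<open>The orientation and Koszul signs of the graph are exactly the sign put into
  \<open>edge_pairing\<close>, so the unsigned form \<open>B\<close> remains.\<close>

lemma opr_attach:
  assumes "dgp.supported n p x" "dgp.supported 2 p' y" "j < n" "p' = 0 \<or> Suc j = n" "length js = n" "set js \<subseteq> {..<dimV}"
  shows "dgp.contract (attach_graph g n j) [] [x, y] js
    = (\<Sum>a<dimV. \<Sum>b<dimV. x (js[j := a]) * B (es ! a) (es ! b) * y [b, js ! j])"
  unfolding dgp.contract_attach[OF assms]
proof (intro sum.cong refl)
  fix a b
  have "sg (d + d * qpar a) * sg (d * bpar a) = (1 :: 'k)"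
    unfolding sg_add[symmetric] qpar by (cases d; cases "bpar a") simp_all
  moreover have "sg (d + d * qpar a) * x (js[j := a]) * wpair a b * y [b, js ! j]
     = (sg (d + d * qpar a) * sg (d * bpar a)) * (x (js[j := a]) * B (es ! a) (es ! b) * y [b, js ! j])"
    unfolding wpair by (simp only: ac_simps)
  ultimately show "sg (d + d * qpar a) * x (js[j := a]) * wpair a b * y [b, js ! j] = x (js[j := a]) * B (es ! a) (es ! b) * y [b, js ! j]"
    by (simp only: mult_1_left)
qed

lemma opr_compose:
  assumes "dgp.supported 2 p x" "dgp.supported 2 p' y"
  shows "opr (dgp.contract (attach_graph 0 2 1) [] [x, y]) v = opr x (opr y v)"
proof -
  have entry: "dgp.contract (attach_graph 0 2 1) [] [x, y] [i, z] = (\<Sum>a<dimV. \<Sum>b<dimV. x [i, a] * B (es ! a) (es ! b) * y [b, z])"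
    if "i < dimV" "z < dimV" for i z
    using opr_attach[OF assms, of 1 "[i, z]"] that by simp
  have "opr (dgp.contract (attach_graph 0 2 1) [] [x, y]) v
    = (\<Sum>i<dimV. sc (\<Sum>z<dimV. (\<Sum>a<dimV. \<Sum>b<dimV. x [i, a] * B (es ! a) (es ! b) * y [b, z]) * B (es ! z) v) (es ! i))"
    unfolding opr_coeff by (intro sum.cong refl arg_cong2[where f = sc] arg_cong2[where f = "(*)"]) (simp only: entry lessThan_iff)
  also have "\<dots> = (\<Sum>i<dimV. sc (\<Sum>a<dimV. x [i, a] * B (es ! a) (opr y v)) (es ! i))"
  proof (rule sum.cong[OF refl], rule arg_cong2[where f = sc, OF _ refl])
    fix i
    have "(\<Sum>z<dimV. (\<Sum>a<dimV. \<Sum>b<dimV. x [i, a] * B (es ! a) (es ! b) * y [b, z]) * B (es ! z) v)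
      = (\<Sum>a<dimV. \<Sum>z<dimV. \<Sum>b<dimV. x [i, a] * B (es ! a) (es ! b) * y [b, z] * B (es ! z) v)"
      by (simp only: sum_distrib_right) (rule sum.swap)
    also have "\<dots> = (\<Sum>a<dimV. \<Sum>b<dimV. \<Sum>z<dimV. x [i, a] * B (es ! a) (es ! b) * y [b, z] * B (es ! z) v)"
      by (rule sum.cong[OF refl], rule sum.swap)
    also have "\<dots> = (\<Sum>a<dimV. x [i, a] * B (es ! a) (opr y v))"
      unfolding opr_coeff B_sum_right by (simp add: sum_distrib_left sum_distrib_right ac_simps)
    finally show "(\<Sum>z<dimV. (\<Sum>a<dimV. \<Sum>b<dimV. x [i, a] * B (es ! a) (es ! b) * y [b, z]) * B (es ! z) v)
      = (\<Sum>a<dimV. x [i, a] * B (es ! a) (opr y v))" .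
  qed
  also have "\<dots> = opr x (opr y v)" by (simp only: opr_coeff[of x])
  finally show ?thesis .
qed

lemma supported_attach:
  assumes "dgp.supported 2 p x" "dgp.supported 2 p' y"
  shows "dgp.supported 2 (p + p') (dgp.contract (attach_graph 0 2 1) [] [x, y])"
proof -
  have "dgp.supported (length (legs (attach_graph 0 2 1))) (out_par ([] :: (flag \<Rightarrow> 'k) list) [p, p'])
      (dgp.contract (attach_graph 0 2 1) [] [x, y])"
    by (rule dgp.supported_contract)
      (use attach_wf[of 1 2 0] assms in \<open>auto simp: det_rank_def attach_betti less_Suc_eq numeral_2_eq_2\<close>)
  then show ?thesis by (simp add: out_par_def)
qed

text \<open>The first tensor factor contributes \<open>D\<close> applied to the value. The second
  one contributes \<open>D\<close> inside \<open>B\<close>, which \<open>B_dg\<close> moves to the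
  argument; the sign collected there is the parity of the operator.\<close>

lemma opr_deriv:
  assumes "dgp.supported 2 p x"
  shows "opr (dgp.deriv x) v = D (opr x v) - sc (sg p) (opr x (D v))"
proof -
  have entry: "dgp.deriv x [i, j] = (\<Sum>k<dimV. dmat i k * x [k, j]) + (\<Sum>k<dimV. sg (qpar i) * dmat j k * x [i, k])"
    if "i < dimV" "j < dimV" for i j
    using that by (simp add: dgp.deriv_def lessThan_Suc numeral_2_eq_2)
  have "opr (dgp.deriv x) v = (\<Sum>i<dimV. \<Sum>j<dimV. sc ((\<Sum>k<dimV. dmat i k * x [k, j]) * B (es ! j) v) (es ! i))
    + (\<Sum>i<dimV. \<Sum>j<dimV. sc ((\<Sum>k<dimV. sg (qpar i) * dmat j k * x [i, k]) * B (es ! j) v) (es ! i))"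
    unfolding opr_def sum.distrib[symmetric]
    by (intro sum.cong refl) (simp add: entry distrib_right vs.scale_left_distrib)
  also have "(\<Sum>i<dimV. \<Sum>j<dimV. sc ((\<Sum>k<dimV. dmat i k * x [k, j]) * B (es ! j) v) (es ! i)) = D (opr x v)"
  proof -
    have "D (opr x v) = (\<Sum>k<dimV. sc (\<Sum>j<dimV. x [k, j] * B (es ! j) v) (\<Sum>i<dimV. sc (dmat i k) (es ! i)))"
      by (simp add: opr_coeff D_sum flip: D_expand)
    also have "\<dots> = (\<Sum>k<dimV. \<Sum>i<dimV. \<Sum>j<dimV. sc (dmat i k * x [k, j] * B (es ! j) v) (es ! i))"
      by (simp add: vs.scale_sum_right vs.scale_sum_left[symmetric] sum_distrib_left ac_simps)
    also have "\<dots> = (\<Sum>i<dimV. \<Sum>k<dimV. \<Sum>j<dimV. sc (dmat i k * x [k, j] * B (es ! j) v) (es ! i))" by (rule sum.swap)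
    also have "\<dots> = (\<Sum>i<dimV. \<Sum>j<dimV. \<Sum>k<dimV. sc (dmat i k * x [k, j] * B (es ! j) v) (es ! i))"
      by (rule sum.cong[OF refl], rule sum.swap)
    finally show ?thesis by (simp only: sum_distrib_right vs.scale_sum_left)
  qed
  also have "(\<Sum>i<dimV. \<Sum>j<dimV. sc ((\<Sum>k<dimV. sg (qpar i) * dmat j k * x [i, k]) * B (es ! j) v) (es ! i))
    = - sc (sg p) (opr x (D v))"
  proof -
    have "(\<Sum>i<dimV. \<Sum>j<dimV. sc ((\<Sum>k<dimV. sg (qpar i) * dmat j k * x [i, k]) * B (es ! j) v) (es ! i))
      = (\<Sum>i<dimV. \<Sum>k<dimV. \<Sum>j<dimV. sc (sg (qpar i) * dmat j k * x [i, k] * B (es ! j) v) (es ! i))"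
      by (simp only: sum_distrib_right vs.scale_sum_left) (rule sum.cong[OF refl], rule sum.swap)
    also have "\<dots> = (\<Sum>i<dimV. \<Sum>k<dimV. sc (sg (qpar i) * x [i, k] * B (D (es ! k)) v) (es ! i))"
      by (simp only: D_expand B_sum_left sum_distrib_left vs.scale_sum_left) (simp add: ac_simps)
    also have "\<dots> = (\<Sum>i<dimV. \<Sum>k<dimV. - sc (sg p) (sc (x [i, k] * B (es ! k) (D v)) (es ! i)))"
    proof (intro sum.cong refl)
      fix i k assume "i \<in> {..<dimV}" "k \<in> {..<dimV}"
      then have k: "k < dimV" by simp
      show "sc (sg (qpar i) * x [i, k] * B (D (es ! k)) v) (es ! i) = - sc (sg p) (sc (x [i, k] * B (es ! k) (D v)) (es ! i))"
      proof (cases "x [i, k] = 0")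
        case False
        have "d + (qpar i + qpar k) = p" using dgp.supportedD(3)[OF assms False] by simp
        then have p: "p = qpar i + bpar k" unfolding qpar by (cases d) (auto simp: ac_simps)
        have "B (D (es ! k)) v = - (sg (bpar k) * B (es ! k) (D v))"
          using B_dg[OF bpar_in[OF k], of v] by (simp add: eq_neg_iff_add_eq_0)
        then show ?thesis unfolding p sg_add by (simp add: ac_simps)
      qed simp
    qed
    also have "\<dots> = - sc (sg p) (opr x (D v))"
      by (simp only: opr_def sum_negf vs.scale_sum_right)
    finally show ?thesis .
  qed
  finally show ?thesis by simp
qed

lemma perm_act_transpose: "dgp.perm_act (Transposition.transpose 0 1) x [i, j] = sg (qpar i * qpar j) * x [j, i]"
  by (simp add: dgp.perm_act_def Let_def koszul_upt numeral_2_eq_2 mult.commute)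

text \<open>Where coefficient and pairing do not vanish, \<open>r\<close> and \<open>p\<close> are
  determined by the parities of the two indices. The sign of the transposition, the sign of
  \<open>B_sym\<close> and \<open>p * r\<close> then cancel.\<close>

lemma opr_adjoint:
  assumes "dgp.supported 2 p x" "v \<in> V r"
  shows "B (opr x v) u = sg (p * r) * B v (opr (dgp.perm_act (Transposition.transpose 0 1) x) u)"
proof -
  have "B (opr x v) u = (\<Sum>a<dimV. \<Sum>b<dimV. x [a, b] * B (es ! b) v * B (es ! a) u)"
    by (simp add: opr_coeff B_sum_left sum_distrib_right)
  also have "\<dots> = (\<Sum>a<dimV. \<Sum>b<dimV. sg (p * r) * (sg (qpar b * qpar a) * x [a, b] * B (es ! a) u * B v (es ! b)))"
  proof (intro sum.cong refl)
    fix a b assume "a \<in> {..<dimV}" "b \<in> {..<dimV}"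
    then have b: "b < dimV" by simp
    show "x [a, b] * B (es ! b) v * B (es ! a) u = sg (p * r) * (sg (qpar b * qpar a) * x [a, b] * B (es ! a) u * B v (es ! b))"
    proof (cases "x [a, b] = 0 \<or> B (es ! b) v = 0")
      case True
      then show ?thesis using B_sym[OF assms(2) bpar_in[OF b]] by auto
    next
      case False
      have "d + (qpar a + qpar b) = p" using dgp.supportedD(3)[OF assms(1), of "[a, b]"] False by simp
      moreover have "bpar b + r = d" using B_even[OF bpar_in[OF b] assms(2)] False by auto
      then have "r = bpar b + d" by (cases "bpar b"; cases r; cases d) auto
      ultimately have "p * r + (qpar b * qpar a + r * bpar b) = 0"
        unfolding qpar by (cases "bpar b"; cases "bpar a"; cases d) auto
      then have "sg (p * r + (qpar b * qpar a + r * bpar b)) = (1 :: 'k)" by simp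
      then have s: "sg (p * r) * (sg (qpar b * qpar a) * sg (r * bpar b)) = (1 :: 'k)" by (simp only: sg_add)
      have "sg (p * r) * (sg (qpar b * qpar a) * x [a, b] * B (es ! a) u * B v (es ! b))
        = (sg (p * r) * (sg (qpar b * qpar a) * sg (r * bpar b))) * (x [a, b] * B (es ! b) v * B (es ! a) u)"
        unfolding B_sym[OF assms(2) bpar_in[OF b]] by (simp only: ac_simps)
      then show ?thesis unfolding s mult_1_left by (rule sym)
    qed
  qed
  also have "\<dots> = sg (p * r) * (\<Sum>b<dimV. \<Sum>a<dimV. sg (qpar b * qpar a) * x [a, b] * B (es ! a) u * B v (es ! b))"
    by (subst sum.swap) (simp only: sum_distrib_left)
  also have "(\<Sum>b<dimV. \<Sum>a<dimV. sg (qpar b * qpar a) * x [a, b] * B (es ! a) u * B v (es ! b))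
     = B v (opr (dgp.perm_act (Transposition.transpose 0 1) x) u)"
    by (simp add: opr_coeff B_sum_right perm_act_transpose sum_distrib_right del: One_nat_def)
  finally show ?thesis .
qed

text \<open>Nondegeneracy is given for the first argument. \<open>B_sym\<close> transfers it, but
  only for homogeneous vectors; a basis vector pairs with at most one of the two components of
  \<open>u\<close>, so both pairings vanish.\<close>

lemma B_nondegenerate_right:
  assumes "\<And>r v. v \<in> V r \<Longrightarrow> B v u = 0"
  shows "u = 0"
proof (rule B_nondegenerate)
  fix w
  obtain u0 u1 where u: "u0 \<in> V 0" "u1 \<in> V 1" "u = u0 + u1" using parity_span by blast
  have "B u (es ! c) = 0" if c: "c < dimV" for c
  proof -
    have "B (es ! c) u0 = 0 \<and> B (es ! c) u1 = 0"
    proof (cases "bpar c + 0 = d")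
      case True
      then have "B (es ! c) u1 = 0" using B_even[OF bpar_in[OF c] u(2)] by (cases "bpar c"; cases d) auto
      then show ?thesis using assms[OF bpar_in[OF c]] u(3) by (simp add: B_add_right)
    next
      case False
      then have "B (es ! c) u0 = 0" using B_even[OF bpar_in[OF c] u(1)] by blast
      then show ?thesis using assms[OF bpar_in[OF c]] u(3) by (simp add: B_add_right)
    qed
    then show ?thesis
      using B_sym[OF u(1) bpar_in[OF c]] B_sym[OF u(2) bpar_in[OF c]] u(3) by (simp add: B_add_left)
  qed
  then show "B u w = 0" by (subst expand[of w]) (simp add: B_sum_right)
qed

lemma transpose_permutes: "Transposition.transpose 0 (1::nat) permutes {..<2}"
  by (rule permutes_swap_id) auto

lemma opr_self_adjoint_iff:
  assumes "dgp.supported 2 p x"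
  shows "dgp.perm_act (Transposition.transpose 0 1) x = x \<longleftrightarrow>
    (\<forall>r. \<forall>v\<in>V r. \<forall>u. B (opr x v) u = sg (p * r) * B v (opr x u))" (is "?L \<longleftrightarrow> ?R")
proof
  assume ?L
  then show ?R using opr_adjoint[OF assms] by metis
next
  assume R: ?R
  let ?y = "dgp.perm_act (Transposition.transpose 0 1) x"
  have "opr ?y u - opr x u = 0" for u
  proof (rule B_nondegenerate_right)
    fix r v assume v: "v \<in> V r"
    have "sg (p * r) * B v (opr ?y u) = sg (p * r) * B v (opr x u)"
      using opr_adjoint[OF assms v, of u] R v by simp
    then show "B v (opr ?y u - opr x u) = 0" by (simp add: B_minus_right)
  qed
  then have "opr ?y = opr x" by (simp add: fun_eq_iff)
  then show ?L by (rule opr_inj[OF dgp.supported_perm_act[OF assms transpose_permutes] assms])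
qed

end

section \<open>Well-typed expressions and their classes\<close>

lemma expr_simps:
  "elems (expr_opd d \<O>) g n p = {e. wt d \<O> e g n p}" "zer (expr_opd d \<O>) = Zero"
  "add (expr_opd d \<O>) g n p = Add" "smul (expr_opd d \<O>) g n p = Smul"
  "dif (expr_opd d \<O>) g n p = expr_dif \<O>" "act (expr_opd d \<O>) g n p = Act"
  "mu (expr_opd d \<O>) G bs ps = Mu G bs"
  by (simp_all add: expr_opd_def)

text \<open>\<open>expr_dif\<close> reads its signs from \<open>par\<close>; this makes them the
  signs required by \<open>mu_dif\<close>, where the parities are given separately.\<close>

lemma wt_par: "wt d \<O> e g n p \<Longrightarrow> par e = p"
proof (induction rule: wt.induct)
  case (wt_Mu G bs ps es)
  then have "map par es = ps" by (intro nth_equalityI) auto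
  then show ?case by simp
qed auto

lemma out_par_flip: "i < length ps \<Longrightarrow> out_par bs (ps[i := ps ! i + 1]) = out_par bs ps + 1"
proof -
  have "sum_list (ps[i := ps ! i + 1]) = sum_list ps + 1" if "i < length ps"
    using that by (induction ps arbitrary: i) (auto simp: nth_Cons' ac_simps split: nat.splits)
  then show "i < length ps \<Longrightarrow> ?thesis" by (simp add: out_par_def ac_simps)
qed

lemma wt_MuI:
  assumes "composable d (expr_opd d \<O>) G bs ps es"
  shows "wt d \<O> (Mu G bs es) (genus TYPE('k::field_char_0) G) (length (legs G)) (out_par (bs :: (flag \<Rightarrow> 'k) list) ps)"
  using assms by (intro wt_Mu) (auto simp: composable_def inputs_def expr_simps)

lemma wt_foldr_Add: "\<forall>e \<in> set es. wt d \<O> e g n p \<Longrightarrow> wt d \<O> (foldr Add es (Zero g n p)) g n p"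
  by (induction es) (auto intro: wt_Zero wt_Add)

lemma wt_expr_dif:
  fixes \<O> :: "('k::field_char_0, 'a) opd"
  assumes "modular_operad_upto d \<O> R" "wt d \<O> e g n p"
  shows "wt d \<O> (expr_dif \<O> e) g n (p + 1)"
  using assms(2)
proof (induction rule: wt.induct)
  case (wt_Gen x g n p)
  then show ?case using modular_operad_upto.dif_closed[OF assms(1)] by (simp add: wt.wt_Gen)
next
  case (wt_Mu G bs ps es)
  have ps: "map par es = ps"
  proof (rule nth_equalityI)
    fix i assume i: "i < length (map par es)"
    then have "wt d \<O> (es ! i) (fst (verts G ! i)) (snd (verts G ! i)) (ps ! i)" using wt_Mu by simp
    then show "map par es ! i = ps ! i" using i by (simp add: wt_par)
  qed (use wt_Mu in simp)
  have "wt d \<O> (Mu G bs (es[i := expr_dif \<O> (es ! i)])) (genus TYPE('k) G) (length (legs G)) (out_par bs ps + 1)"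
    if i: "i < length (verts G)" for i
  proof -
    have "wt d \<O> (Mu G bs (es[i := expr_dif \<O> (es ! i)])) (genus TYPE('k) G) (length (legs G)) (out_par bs (ps[i := ps ! i + 1]))"
      by (rule wt.wt_Mu) (use wt_Mu i in \<open>auto simp: nth_list_update\<close>)
    then show ?thesis using i wt_Mu by (simp add: out_par_flip)
  qed
  then show ?case
    unfolding expr_dif.simps Let_def ps by (intro wt_foldr_Add) (use wt_Mu in \<open>auto intro!: wt_Smul\<close>)
qed (auto intro: wt.intros)

text \<open>\<open>BV_eq\<close> is an intersection of congruences, so it inherits every closure
  property that all of them have. The following lemmas are obtained in this way.\<close>

lemma BV_eqI:
  "(\<And>R. modular_operad_upto d (expr_opd d \<O>) R \<Longrightarrow> BV_relations d \<O> R \<Longrightarrow> R g n p e e') \<Longrightarrow> BV_eq d \<O> g n p e e'"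
  unfolding BV_eq_def by blast

lemma BV_eqD:
  "BV_eq d \<O> g n p e e' \<Longrightarrow> modular_operad_upto d (expr_opd d \<O>) R \<Longrightarrow> BV_relations d \<O> R \<Longrightarrow> R g n p e e'"
  unfolding BV_eq_def by blast

lemma BV_eq_refl: "wt d \<O> e g n p \<Longrightarrow> BV_eq d \<O> g n p e e"
  by (rule BV_eqI, erule modular_operad_upto.R_refl) (simp add: expr_simps)

lemma BV_eq_sym: "wt d \<O> e g n p \<Longrightarrow> wt d \<O> e' g n p \<Longrightarrow> BV_eq d \<O> g n p e e' \<Longrightarrow> BV_eq d \<O> g n p e' e"
  by (rule BV_eqI, rule modular_operad_upto.R_sym[of d "expr_opd d \<O>" _ e g n p e']) (simp_all add: expr_simps BV_eqD)

lemma BV_eq_trans: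
  "wt d \<O> e g n p \<Longrightarrow> wt d \<O> e' g n p \<Longrightarrow> wt d \<O> e'' g n p \<Longrightarrow>
    BV_eq d \<O> g n p e e' \<Longrightarrow> BV_eq d \<O> g n p e' e'' \<Longrightarrow> BV_eq d \<O> g n p e e''"
  by (rule BV_eqI, rule modular_operad_upto.R_trans[of d "expr_opd d \<O>" _ e g n p e']) (simp_all add: expr_simps BV_eqD)

lemma BV_eq_Add:
  assumes "wt d \<O> e g n p" "wt d \<O> e' g n p" "wt d \<O> f g n p" "wt d \<O> f' g n p"
    "BV_eq d \<O> g n p e e'" "BV_eq d \<O> g n p f f'"
  shows "BV_eq d \<O> g n p (Add e f) (Add e' f')"
proof (rule BV_eqI)
  fix R assume R: "modular_operad_upto d (expr_opd d \<O>) R" "BV_relations d \<O> R"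
  show "R g n p (Add e f) (Add e' f')"
    using modular_operad_upto.add_cong[OF R(1), of e g n p e' f f'] assms BV_eqD[OF _ R] by (simp add: expr_simps)
qed

lemma BV_eq_unary:
  assumes "wt d \<O> e g n p" "wt d \<O> e' g n p" "BV_eq d \<O> g n p e e'"
  shows "BV_eq d \<O> g n p (Smul a e) (Smul a e')"
    and "BV_eq d \<O> g n (p + 1) (expr_dif \<O> e) (expr_dif \<O> e')"
    and "\<sigma> permutes {..<n} \<Longrightarrow> BV_eq d \<O> g n p (Act \<sigma> e) (Act \<sigma> e')"
proof -
  show "BV_eq d \<O> g n p (Smul a e) (Smul a e')"
  proof (rule BV_eqI)
    fix R assume R: "modular_operad_upto d (expr_opd d \<O>) R" "BV_relations d \<O> R"
    show "R g n p (Smul a e) (Smul a e')"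
      using modular_operad_upto.smul_cong[OF R(1), of e g n p e' a] assms BV_eqD[OF _ R] by (simp add: expr_simps)
  qed
  show "BV_eq d \<O> g n (p + 1) (expr_dif \<O> e) (expr_dif \<O> e')"
  proof (rule BV_eqI)
    fix R assume R: "modular_operad_upto d (expr_opd d \<O>) R" "BV_relations d \<O> R"
    show "R g n (p + 1) (expr_dif \<O> e) (expr_dif \<O> e')"
      using modular_operad_upto.dif_cong[OF R(1), of e g n p e'] assms BV_eqD[OF _ R] by (simp add: expr_simps)
  qed
  show "BV_eq d \<O> g n p (Act \<sigma> e) (Act \<sigma> e')" if "\<sigma> permutes {..<n}"
  proof (rule BV_eqI)
    fix R assume R: "modular_operad_upto d (expr_opd d \<O>) R" "BV_relations d \<O> R"
    show "R g n p (Act \<sigma> e) (Act \<sigma> e')"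
      using modular_operad_upto.act_cong[OF R(1), of e g n p e' \<sigma>] assms that BV_eqD[OF _ R] by (simp add: expr_simps)
  qed
qed

lemma BV_eq_Mu:
  fixes \<O> :: "('k::field_char_0, 'a) opd"
  assumes "composable d (expr_opd d \<O>) G bs ps es" "composable d (expr_opd d \<O>) G bs ps es'"
    "\<And>i. i < length (verts G) \<Longrightarrow> BV_eq d \<O> (fst (verts G ! i)) (snd (verts G ! i)) (ps ! i) (es ! i) (es' ! i)"
  shows "BV_eq d \<O> (genus TYPE('k) G) (length (legs G)) (out_par bs ps) (Mu G bs es) (Mu G bs es')"
proof (rule BV_eqI)
  fix R assume R: "modular_operad_upto d (expr_opd d \<O>) R" "BV_relations d \<O> R"
  show "R (genus TYPE('k) G) (length (legs G)) (out_par bs ps) (Mu G bs es) (Mu G bs es')"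
    using modular_operad_upto.mu_cong[OF R(1) assms(1,2)] assms(3) BV_eqD[OF _ R] by (simp add: expr_simps)
qed

section \<open>Operations on classes of expressions\<close>

lemma BV_simps:
  fixes \<O> :: "('k::field_char_0, 'a) opd"
  shows "elems (BV d \<O>) g n p = BV_class d \<O> g n p ` {e. wt d \<O> e g n p}"
  "add (BV d \<O>) g n p X Y = BV_class d \<O> g n p (Add (rep X) (rep Y))"
  "smul (BV d \<O>) g n p a X = BV_class d \<O> g n p (Smul a (rep X))"
  "dif (BV d \<O>) g n p X = BV_class d \<O> g n (p + 1) (expr_dif \<O> (rep X))"
  "act (BV d \<O>) g n p \<sigma> X = BV_class d \<O> g n p (Act \<sigma> (rep X))"
  "mu (BV d \<O>) G bs ps Xs = BV_class d \<O> (genus TYPE('k) G) (length (legs G)) (out_par bs ps) (Mu G bs (map rep Xs))"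
  by (simp_all add: BV_def quotient_opd_def BV_class_def expr_simps)

text \<open>The quotient computes with chosen representatives; this lemma allows replacing them by
  the expression at hand.\<close>

lemma rep_class:
  assumes "wt d \<O> e g n p"
  shows "wt d \<O> (rep (BV_class d \<O> g n p e)) g n p" "BV_eq d \<O> g n p e (rep (BV_class d \<O> g n p e))"
proof -
  have "e \<in> BV_class d \<O> g n p e" using assms by (simp add: BV_class_def cls_def expr_simps BV_eq_refl)
  then have "rep (BV_class d \<O> g n p e) \<in> BV_class d \<O> g n p e" unfolding rep_def by (rule someI)
  then show "wt d \<O> (rep (BV_class d \<O> g n p e)) g n p" "BV_eq d \<O> g n p e (rep (BV_class d \<O> g n p e))"
    by (simp_all add: BV_class_def cls_def expr_simps)
qed

lemma wt_rep: "X \<in> elems (BV d \<O>) g n p \<Longrightarrow> wt d \<O> (rep X) g n p"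
  by (auto simp: BV_simps rep_class)

lemma class_eqI:
  assumes "wt d \<O> e g n p" "wt d \<O> e' g n p" "BV_eq d \<O> g n p e e'"
  shows "BV_class d \<O> g n p e = BV_class d \<O> g n p e'"
proof -
  have "BV_eq d \<O> g n p e f \<longleftrightarrow> BV_eq d \<O> g n p e' f" if "wt d \<O> f g n p" for f
    using assms that BV_eq_sym[of d \<O> e g n p e'] BV_eq_trans[of d \<O> e g n p e' f] BV_eq_trans[of d \<O> e' g n p e f] by blast
  then show ?thesis by (auto simp: BV_class_def cls_def expr_simps)
qed

lemma class_ops:
  assumes e: "wt d \<O> e g n p"
  shows "wt d \<O> f g n p \<Longrightarrow> add (BV d \<O>) g n p (BV_class d \<O> g n p e) (BV_class d \<O> g n p f) = BV_class d \<O> g n p (Add e f)"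
    and "smul (BV d \<O>) g n p a (BV_class d \<O> g n p e) = BV_class d \<O> g n p (Smul a e)"
    and "modular_operad_upto d \<O> R \<Longrightarrow> dif (BV d \<O>) g n p (BV_class d \<O> g n p e) = BV_class d \<O> g n (p + 1) (expr_dif \<O> e)"
    and "\<sigma> permutes {..<n} \<Longrightarrow> act (BV d \<O>) g n p \<sigma> (BV_class d \<O> g n p e) = BV_class d \<O> g n p (Act \<sigma> e)"
proof -
  note r = rep_class[OF e] and sym = BV_eq_sym[OF e rep_class(1)[OF e] rep_class(2)[OF e]]
  show "add (BV d \<O>) g n p (BV_class d \<O> g n p e) (BV_class d \<O> g n p f) = BV_class d \<O> g n p (Add e f)" if f: "wt d \<O> f g n p"
    unfolding BV_simps
    by (intro class_eqI wt_Add BV_eq_Add r sym rep_class f e BV_eq_sym[OF f rep_class(1)[OF f] rep_class(2)[OF f]])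
  show "smul (BV d \<O>) g n p a (BV_class d \<O> g n p e) = BV_class d \<O> g n p (Smul a e)"
    unfolding BV_simps by (intro class_eqI wt_Smul BV_eq_unary r sym e)
  show "dif (BV d \<O>) g n p (BV_class d \<O> g n p e) = BV_class d \<O> g n (p + 1) (expr_dif \<O> e)" if "modular_operad_upto d \<O> R"
    unfolding BV_simps by (intro class_eqI wt_expr_dif[OF that] BV_eq_unary r sym e)
  show "act (BV d \<O>) g n p \<sigma> (BV_class d \<O> g n p e) = BV_class d \<O> g n p (Act \<sigma> e)" if "\<sigma> permutes {..<n}"
    unfolding BV_simps by (intro class_eqI wt_Act BV_eq_unary r sym e that)
qed

lemma composable_BV:
  assumes "composable d (BV d \<O>) G bs ps Xs"
  shows "composable d (expr_opd d \<O>) G bs ps (map rep Xs)"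
  using assms by (auto simp: composable_def inputs_def expr_simps intro!: wt_rep)

lemma class_mu:
  fixes \<O> :: "('k::field_char_0, 'a) opd"
  assumes c: "composable d (expr_opd d \<O>) G bs ps es"
  defines "Xs \<equiv> map (\<lambda>i. BV_class d \<O> (fst (verts G ! i)) (snd (verts G ! i)) (ps ! i) (es ! i)) [0..<length (verts G)]"
  shows "composable d (BV d \<O>) G bs ps Xs"
    "mu (BV d \<O>) G bs ps Xs = BV_class d \<O> (genus TYPE('k) G) (length (legs G)) (out_par bs ps) (Mu G bs es)"
proof -
  have w: "wt d \<O> (es ! i) (fst (verts G ! i)) (snd (verts G ! i)) (ps ! i)" if "i < length (verts G)" for i
    using c that by (simp add: composable_def inputs_def expr_simps)
  show X: "composable d (BV d \<O>) G bs ps Xs"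
    using c w by (auto simp: composable_def inputs_def Xs_def BV_simps)
  note c' = composable_BV[OF X]
  show "mu (BV d \<O>) G bs ps Xs = BV_class d \<O> (genus TYPE('k) G) (length (legs G)) (out_par bs ps) (Mu G bs es)"
    unfolding BV_simps
  proof (intro class_eqI wt_MuI c c' BV_eq_Mu)
    fix i assume i: "i < length (verts G)"
    show "BV_eq d \<O> (fst (verts G ! i)) (snd (verts G ! i)) (ps ! i) (map rep Xs ! i) (es ! i)"
      using BV_eq_sym[OF w[OF i] rep_class[OF w[OF i]]] i by (simp add: Xs_def)
  qed
qed

lemma wt_circ1:
  fixes \<O> :: "('k::field_char_0, 'a) opd"
  assumes "wt d \<O> e 0 2 p" "wt d \<O> e' 0 2 p'"
  shows "composable d (expr_opd d \<O>) (attach_graph 0 2 1) [] [p, p'] [e, e']" "wt d \<O> (circ1 e e') 0 2 (p + p')"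
proof -
  show c: "composable d (expr_opd d \<O>) (attach_graph 0 2 1) [] [p, p'] [e, e']"
    using assms attach_det_args[of 1 2 d 0]
    by (auto simp: composable_def attach_ext_stable inputs_def expr_simps less_Suc_eq simp del: One_nat_def)
  show "wt d \<O> (circ1 e e') 0 2 (p + p')"
    using wt_MuI[OF c] attach_betti(2)[of 1 2 0, where ?'k = 'k] by (simp add: out_par_def)
qed

lemma BV_eq_axioms:
  shows "wt d \<O> e g n p \<Longrightarrow> BV_eq d \<O> g n p (Add e (Zero g n p)) e"
    and "x \<in> elems \<O> g n p \<Longrightarrow> y \<in> elems \<O> g n p \<Longrightarrow> BV_eq d \<O> g n p (Gen g n p (add \<O> g n p x y)) (Add (Gen g n p x) (Gen g n p y))"
    and "x \<in> elems \<O> g n p \<Longrightarrow> BV_eq d \<O> g n p (Gen g n p (smul \<O> g n p a x)) (Smul a (Gen g n p x))"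
    and "x \<in> elems \<O> g n p \<Longrightarrow> \<sigma> permutes {..<n} \<Longrightarrow> BV_eq d \<O> g n p (Gen g n p (act \<O> g n p \<sigma> x)) (Act \<sigma> (Gen g n p x))"
    and "BV_eq d \<O> 0 2 1 (Act (Transposition.transpose 0 1) S) S"
    and "BV_eq d \<O> 0 2 0 (Act (Transposition.transpose 0 1) T) T"
    and "BV_eq d \<O> 0 2 0 (circ1 S S) (Zero 0 2 0)"
    and "BV_eq d \<O> 0 2 0 (circ1 T T) T"
    and "BV_eq d \<O> 0 2 1 (circ1 S T) (Zero 0 2 1)"
    and "BV_eq d \<O> 0 2 1 (circ1 T S) (Zero 0 2 1)"
proof -
  show "BV_eq d \<O> g n p (Add e (Zero g n p)) e" if "wt d \<O> e g n p"
    by (rule BV_eqI, rule modular_operad_upto.add_zer[of d "expr_opd d \<O>" _ e g n p, unfolded expr_simps]) (use that in auto)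
qed ((rule BV_eqI, erule BV_relations.Gen_add BV_relations.Gen_smul BV_relations.Gen_act BV_relations.S_sym BV_relations.T_sym
    BV_relations.S_S BV_relations.T_T BV_relations.S_T BV_relations.T_S; assumption)+)

lemma BV_eq_Gen_mu:
  fixes \<O> :: "('k::field_char_0, 'a) opd"
  assumes "composable d \<O> G bs ps xs"
  shows "BV_eq d \<O> (genus TYPE('k) G) (length (legs G)) (out_par bs ps)
        (Gen (genus TYPE('k) G) (length (legs G)) (out_par bs ps) (mu \<O> G bs ps xs))
        (Mu G bs (map (\<lambda>i. Gen (fst (verts G ! i)) (snd (verts G ! i)) (ps ! i) (xs ! i)) [0..<length (verts G)]))"
  using assms BV_relations.Gen_mu by (blast intro: BV_eqI)

lemma composable_Gen:
  assumes "composable d \<O> G bs ps xs"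
  shows "composable d (expr_opd d \<O>) G bs ps (map (\<lambda>i. Gen (fst (verts G ! i)) (snd (verts G ! i)) (ps ! i) (xs ! i)) [0..<length (verts G)])"
  using assms by (auto simp: composable_def inputs_def expr_simps intro: wt_Gen)

section \<open>Algebras over the BV-resolution\<close>

text \<open>The kernel of a map into an operad is an admissible relation: each axiom up to the
  kernel is the axiom of \<open>Q\<close> at the images. The map need only commute with the
  differential on elements, since \<open>expr_dif\<close> is compatible with evaluation for
  well-typed expressions, whereas the other equations hold by recursion.\<close>

lemma modular_operad_upto_pullback:
  fixes P :: "('k::field_char_0, 'a) opd" and Q :: "('k, 'b) opd" and f :: "'a \<Rightarrow> 'b"
  assumes Q: "extended_modular_operad d Q"
    and closed: "\<And>g n p. zer P g n p \<in> elems P g n p"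
      "\<And>g n p x y. x \<in> elems P g n p \<Longrightarrow> y \<in> elems P g n p \<Longrightarrow> add P g n p x y \<in> elems P g n p"
      "\<And>g n p a x. x \<in> elems P g n p \<Longrightarrow> smul P g n p a x \<in> elems P g n p"
      "\<And>g n p x. x \<in> elems P g n p \<Longrightarrow> dif P g n p x \<in> elems P g n (p + 1)"
      "\<And>g n p \<sigma> x. x \<in> elems P g n p \<Longrightarrow> \<sigma> permutes {..<n} \<Longrightarrow> act P g n p \<sigma> x \<in> elems P g n p"
      "\<And>G bs ps xs. composable d P G bs ps xs \<Longrightarrow>
        mu P G bs ps xs \<in> elems P (genus TYPE('k) G) (length (legs G)) (out_par bs ps)"
    and f_elems: "\<And>g n p x. x \<in> elems P g n p \<Longrightarrow> f x \<in> elems Q g n p"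
    and hom: "\<And>g n p. f (zer P g n p) = zer Q g n p"
      "\<And>g n p x y. f (add P g n p x y) = add Q g n p (f x) (f y)"
      "\<And>g n p a x. f (smul P g n p a x) = smul Q g n p a (f x)"
      "\<And>g n p \<sigma> x. f (act P g n p \<sigma> x) = act Q g n p \<sigma> (f x)"
      "\<And>G bs ps xs. f (mu P G bs ps xs) = mu Q G bs ps (map f xs)"
    and hom_dif: "\<And>g n p x. x \<in> elems P g n p \<Longrightarrow> f (dif P g n p x) = dif Q g n p (f x)"
  shows "modular_operad_upto d P (\<lambda>g n p x y. f x = f y)"
proof -
  interpret q: modular_operad_upto d Q "\<lambda>_ _ _. (=)"
    using Q by (simp add: extended_modular_operad_def)
  have comp: "composable d Q G bs ps (map f xs)" if "composable d P G bs ps xs" for G bs ps xs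
    using that by (auto simp: composable_def inputs_def f_elems)
  have opsum: "f (opsum P g n p xs) = opsum Q g n p (map f xs)" for g n p xs
    by (induction xs) (simp_all add: opsum_def hom)
  show ?thesis
  proof
    fix g n :: nat and p :: bit and x y z :: 'a and a b :: 'k and \<sigma> \<tau> :: "nat \<Rightarrow> nat"
    show "zer P g n p \<in> elems P g n p" by (rule closed)
    {
      assume x: "x \<in> elems P g n p"
      note fx = f_elems[OF x]
      show "smul P g n p a x \<in> elems P g n p" "dif P g n p x \<in> elems P g n (p + 1)"
        "\<sigma> permutes {..<n} \<Longrightarrow> act P g n p \<sigma> x \<in> elems P g n p"
        by (simp_all add: closed x)
      show "f (add P g n p x (zer P g n p)) = f x" "f (add P g n p x (smul P g n p (- 1) x)) = f (zer P g n p)"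
        "f (smul P g n p 1 x) = f x" "f (smul P g n p a (smul P g n p b x)) = f (smul P g n p (a * b) x)"
        "f (smul P g n p (a + b) x) = f (add P g n p (smul P g n p a x) (smul P g n p b x))"
        by (simp_all add: hom fx q.add_zer q.add_neg q.smul_one q.smul_smul q.smul_add_left)
      show "(g, n) \<in> {(0, 0), (0, 1), (1, 0)} \<Longrightarrow> f x = f (zer P g n p)"
        using q.unstable_zero[OF _ fx] by (simp only: hom)
      show "f (dif P g n p (smul P g n p a x)) = f (smul P g n (p + 1) a (dif P g n p x))"
        using x by (simp add: hom hom_dif closed fx q.dif_smul)
      show "f (dif P g n (p + 1) (dif P g n p x)) = f (zer P g n p)"
        using x closed(4)[OF x] by (simp add: hom hom_dif fx q.dif_dif)
      show "f (act P g n p \<sigma> (smul P g n p a x)) = f (smul P g n p a (act P g n p \<sigma> x))"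
        "f (act P g n (p + 1) \<sigma> (dif P g n p x)) = f (dif P g n p (act P g n p \<sigma> x))" if "\<sigma> permutes {..<n}"
        using x that by (simp_all add: hom hom_dif closed fx q.act_smul q.act_dif)
      show "f (act P g n p id x) = f x" by (simp add: hom fx q.act_id)
      show "f (act P g n p \<tau> (act P g n p \<sigma> x)) = f (act P g n p (\<tau> \<circ> \<sigma>) x)"
        if "\<sigma> permutes {..<n}" "\<tau> permutes {..<n}"
        using q.act_act[OF fx that] by (simp only: hom)
      show "f (mu P (corolla g n) [] [p] [x]) = f x" if "ext_stable (corolla g n)"
        using q.mu_corolla[OF that fx] by (simp add: hom)
      show "f x = f y \<Longrightarrow> f (smul P g n p a x) = f (smul P g n p a y)"
        "f x = f y \<Longrightarrow> f (act P g n p \<sigma> x) = f (act P g n p \<sigma> y)" for y by (simp_all add: hom)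
      assume y: "y \<in> elems P g n p"
      note fy = f_elems[OF y]
      show "add P g n p x y \<in> elems P g n p" by (rule closed; fact)
      show "f x = f y \<Longrightarrow> f (dif P g n p x) = f (dif P g n p y)" using x y by (simp add: hom_dif)
      show "f (add P g n p x y) = f (add P g n p y x)"
        using q.add_comm[OF fx fy] by (simp only: hom)
      show "f (smul P g n p a (add P g n p x y)) = f (add P g n p (smul P g n p a x) (smul P g n p a y))"
        using q.smul_add_right[OF fx fy] by (simp only: hom)
      show "f (dif P g n p (add P g n p x y)) = f (add P g n (p + 1) (dif P g n p x) (dif P g n p y))"
        using x y by (simp add: hom hom_dif closed fx fy q.dif_add)
      show "f (act P g n p \<sigma> (add P g n p x y)) = f (add P g n p (act P g n p \<sigma> x) (act P g n p \<sigma> y))"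
        if "\<sigma> permutes {..<n}"
        using q.act_add[OF fx fy that] by (simp only: hom)
      show "f x = f x' \<Longrightarrow> f y = f y' \<Longrightarrow> f (add P g n p x y) = f (add P g n p x' y')" for x' y' by (simp add: hom)
      assume z: "z \<in> elems P g n p"
      show "f (add P g n p (add P g n p x y) z) = f (add P g n p x (add P g n p y z))"
        using q.add_assoc[OF fx fy f_elems[OF z]] by (simp only: hom)
    }
  next
    fix G bs ps xs
    assume c: "composable d P G bs ps xs"
    note c' = comp[OF c]
    let ?g = "genus TYPE('k) G" and ?n = "length (legs G)" and ?p = "out_par bs ps"
    have len: "length xs = length (verts G)" using c by (simp add: composable_def inputs_def)
    have el: "xs ! i \<in> elems P (fst (verts G ! i)) (snd (verts G ! i)) (ps ! i)" if "i < length (verts G)" for i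
      using c that by (simp add: composable_def inputs_def)
    show "mu P G bs ps xs \<in> elems P ?g ?n ?p" by (rule closed(6)[OF c])
    show "f (mu P G bs ps xs) = f (mu P G bs ps xs')"
      if "composable d P G bs ps xs'" "\<And>i. i < length (verts G) \<Longrightarrow> f (xs ! i) = f (xs' ! i)" for xs'
    proof -
      have "map f xs = map f xs'"
        by (rule nth_equalityI) (use that len in \<open>auto simp: composable_def inputs_def\<close>)
      then show ?thesis by (simp add: hom)
    qed
    show "f (mu P G bs ps (xs[i := add P (fst (verts G ! i)) (snd (verts G ! i)) (ps ! i) (xs ! i) y]))
        = f (add P ?g ?n ?p (mu P G bs ps xs) (mu P G bs ps (xs[i := y])))"
      if "i < length (verts G)" "y \<in> elems P (fst (verts G ! i)) (snd (verts G ! i)) (ps ! i)" for i y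
      using q.mu_add[OF c' that(1) f_elems[OF that(2)]] that(1) len by (simp add: hom map_update)
    show "f (mu P G bs ps (xs[i := smul P (fst (verts G ! i)) (snd (verts G ! i)) (ps ! i) a (xs ! i)]))
        = f (smul P ?g ?n ?p a (mu P G bs ps xs))" if "i < length (verts G)" for i a
      using q.mu_smul[OF c' that] that len by (simp add: hom map_update)
    show "f (mu P G (bs[i := \<lambda>f. a * u f + (bs ! i) f]) ps xs)
        = f (add P ?g ?n ?p (smul P ?g ?n ?p a (mu P G (bs[i := u]) ps xs)) (mu P G bs ps xs))"
      if "i < length bs" "u \<in> H1 G" for i u a
      using q.mu_det_linear[OF c' that] by (simp add: hom)
    show "f (mu P G bs ps xs) = f (zer P ?g ?n ?p)" if "i < j" "j < length bs" "bs ! i = bs ! j" for i j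
      using q.mu_det_alternating[OF c' that] by (simp add: hom)
    have dif: "f (mu P G bs ps' (xs[i := dif P (fst (verts G ! i)) (snd (verts G ! i)) (ps ! i) (xs ! i)]))
        = mu Q G bs ps' ((map f xs)[i := dif Q (fst (verts G ! i)) (snd (verts G ! i)) (ps ! i) (map f xs ! i)])"
      if "i < length (verts G)" for i ps'
      using that len by (simp add: hom map_update hom_dif[OF el])
    show "f (dif P ?g ?n ?p (mu P G bs ps xs)) = f (opsum P ?g ?n (?p + 1)
        (map (\<lambda>i. smul P ?g ?n (?p + 1) (sg (of_nat (length bs) + sum_list (take i ps)))
           (mu P G bs (ps[i := ps ! i + 1])
             (xs[i := dif P (fst (verts G ! i)) (snd (verts G ! i)) (ps ! i) (xs ! i)])))
          [0..<length (verts G)]))"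
      unfolding opsum hom_dif[OF closed(6)[OF c]] hom(5) q.mu_dif[OF c'] map_map
      by (rule arg_cong[where f = "opsum Q ?g ?n (?p + 1)"], rule map_cong) (simp_all add: hom(3) dif)
    show "f (mu P G' bs ps xs) = f (act P ?g ?n ?p \<tau> (mu P G bs ps xs))"
      if "\<tau> permutes {..<length (legs G)}" "relabelled G \<tau> G'" for \<tau> G'
      using q.mu_relabel[OF c' that] by (simp add: hom)
  next
    fix G G' \<pi> \<rho> ps xs ps' xs' and bs :: "(flag \<Rightarrow> 'k) list"
    assume G: "ext_stable G" "ext_stable G'" and iso: "graph_iso G G' \<pi> \<rho>" and bs: "det_args d G' bs"
      and inp: "inputs P G ps xs" and len: "length ps' = length ps" "length xs' = length xs"
      and xs': "\<And>i. i < length (verts G) \<Longrightarrow> ps' ! \<pi> i = ps ! i \<and>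
          xs' ! \<pi> i = act P (fst (verts G ! i)) (snd (verts G ! i)) (ps ! i) (\<rho> i) (xs ! i)"
    have inp': "inputs Q G ps (map f xs)" using inp by (auto simp: inputs_def f_elems)
    have "ps' ! \<pi> i = ps ! i \<and> map f xs' ! \<pi> i
        = act Q (fst (verts G ! i)) (snd (verts G ! i)) (ps ! i) (\<rho> i) (map f xs ! i)" if i: "i < length (verts G)" for i
    proof -
      have "\<pi> permutes {..<length (verts G)}" using iso by (simp add: graph_iso_def)
      then have "\<pi> i < length xs'" using i inp len permutes_in_image[of \<pi> "{..<length (verts G)}" i] by (simp add: inputs_def)
      then show ?thesis using xs'[OF i] i inp by (simp add: hom inputs_def)
    qed
    from q.mu_iso[OF G iso bs inp' len(1) _ this]
    show "f (mu P G' bs ps' xs') = f (smul P (genus TYPE('k) G) (length (legs G)) (out_par bs ps)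
        (koszul (length (verts G)) \<pi> (\<lambda>i. ps ! i)) (mu P G (map (pull_chain G (flag_map \<pi> \<rho>)) bs) ps xs))"
      using len by (simp add: hom)
  next
    fix H G Gs pss xss and bs :: "(flag \<Rightarrow> 'k) list" and bss :: "nat \<Rightarrow> (flag \<Rightarrow> 'k) list"
    assume H: "ext_stable H" and G: "ext_stable G" and graft: "grafting H Gs G"
      and c: "\<And>i. i < length (verts H) \<Longrightarrow>
          verts H ! i = (genus TYPE('k) (Gs i), length (legs (Gs i))) \<and>
          composable d P (Gs i) (bss i) (pss i) (xss i)"
      and bs: "set bs \<subseteq> H1 G" "length bs = det_rank TYPE('k) d H"
    have c': "\<And>i. i < length (verts H) \<Longrightarrow>
          verts H ! i = (genus TYPE('k) (Gs i), length (legs (Gs i))) \<and>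
          composable d Q (Gs i) (bss i) (pss i) (map f (xss i))"
      using c comp by blast
    show "f (mu P H (map (collapse_chain H Gs) bs) (map (\<lambda>i. out_par (bss i) (pss i)) [0..<length (verts H)])
        (map (\<lambda>i. mu P (Gs i) (bss i) (pss i) (xss i)) [0..<length (verts H)]))
      = f (smul P (genus TYPE('k) G) (length (legs G)) (out_par bs (map (\<lambda>i. out_par (bss i) (pss i)) [0..<length (verts H)]))
          (sg (\<Sum>i<length (verts H). \<Sum>j<i. of_nat (length (bss i)) * sum_list (pss j)))
          (mu P G (bs @ concat (map (\<lambda>i. map (push_chain Gs i) (bss i)) [0..<length (verts H)]))
            (concat (map pss [0..<length (verts H)])) (concat (map xss [0..<length (verts H)]))))"
      using q.mu_assoc[OF H G graft c' bs] by (simp add: hom map_concat comp_def)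
  qed (auto simp: f_elems)
qed

context dg_inner_product_space
begin

interpretation vs: vector_space sc by (rule vs)

text \<open>The coefficients of the identity form the inverse of the matrix of \<open>B\<close>, and
  contracting with \<open>u\<close> multiplies by both.\<close>

lemma contract_attach_unit:
  assumes u: "dgp.supported 2 0 u" "opr u = id" and x: "dgp.supported n p x" and j: "j < n"
  shows "dgp.contract (attach_graph g n j) [] [x, u] = x"
proof -
  have left: "(\<Sum>b<dimV. u [a, b] * B (es ! b) (es ! c)) = (if a = c then 1 else 0)" if "a < dimV" "c < dimV" for a c
  proof -
    have "(\<Sum>a<dimV. sc (\<Sum>b<dimV. u [a, b] * B (es ! b) (es ! c)) (es ! a)) = opr u (es ! c)"
      by (simp only: opr_coeff)
    also have "\<dots> = (\<Sum>a<dimV. sc (if a = c then 1 else 0) (es ! a))"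
      using u(2) that(2) by (simp add: if_distrib[of "\<lambda>a. sc a _"] cong: if_cong)
    finally show ?thesis by (rule expand_unique[OF _ that(1)])
  qed
  \<comment> \<open>From \<open>opr u = id\<close> the matrix is a left inverse. That it is also a
    right inverse is tested by pairing with all basis vectors and uses nondegeneracy.\<close>
  have right: "(\<Sum>b<dimV. B (es ! a) (es ! b) * u [b, z]) = (if z = a then 1 else 0)" if a: "a < dimV" and z: "z < dimV" for a z
  proof -
    let ?m = "\<lambda>z. \<Sum>b<dimV. B (es ! a) (es ! b) * u [b, z]"
    have "(\<Sum>z<dimV. sc (?m z) (es ! z)) - es ! a = 0"
    proof (rule B_nondegenerate)
      fix w
      have "B (\<Sum>z<dimV. sc (?m z) (es ! z)) (es ! c) = B (es ! a) (es ! c)" if c: "c < dimV" for c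
      proof -
        have "B (\<Sum>z<dimV. sc (?m z) (es ! z)) (es ! c)
          = (\<Sum>z<dimV. \<Sum>b<dimV. B (es ! a) (es ! b) * (u [b, z] * B (es ! z) (es ! c)))"
          by (simp only: B_sum_left sum_distrib_right mult.assoc)
        also have "\<dots> = (\<Sum>b<dimV. B (es ! a) (es ! b) * (\<Sum>z<dimV. u [b, z] * B (es ! z) (es ! c)))"
          by (subst sum.swap) (simp only: sum_distrib_left)
        also have "\<dots> = B (es ! a) (es ! c)"
          using c by (simp add: left if_distrib[of "\<lambda>z. _ * z"] cong: if_cong)
        finally show ?thesis .
      qed
      then have "B (\<Sum>z<dimV. sc (?m z) (es ! z)) w = B (es ! a) w"
        by (subst (1 2) expand[of w]) (simp add: B_sum_right)
      then show "B ((\<Sum>z<dimV. sc (?m z) (es ! z)) - es ! a) w = 0"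
        using B_add_left[of "(\<Sum>z<dimV. sc (?m z) (es ! z)) - es ! a" "es ! a" w] by simp
    qed
    then have "(\<Sum>z<dimV. sc (?m z) (es ! z)) = (\<Sum>z<dimV. sc (if z = a then 1 else 0) (es ! z))"
      using a by (simp add: if_distrib[of "\<lambda>a. sc a _"] cong: if_cong)
    then show ?thesis by (rule expand_unique[OF _ z])
  qed
  show ?thesis
  proof
    fix js
    show "dgp.contract (attach_graph g n j) [] [x, u] js = x js"
    proof (cases "length js = n \<and> set js \<subseteq> {..<dimV}")
      case True
      then have js: "length js = n" "set js \<subseteq> {..<dimV}" by auto
      have z: "js ! j < dimV" by (rule nth_less[OF js(2)]) (use j js in simp)
      have "dgp.contract (attach_graph g n j) [] [x, u] js
        = (\<Sum>a<dimV. x (js[j := a]) * (\<Sum>b<dimV. B (es ! a) (es ! b) * u [b, js ! j]))"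
        using opr_attach[OF x u(1) j _ js] by (simp add: sum_distrib_left mult.assoc)
      also have "\<dots> = (\<Sum>a<dimV. if a = js ! j then x (js[j := a]) else 0)"
        using z by (intro sum.cong) (auto simp: right)
      also have "\<dots> = x js" using z by simp
      finally show ?thesis .
    next
      case False
      then have "x js = 0" using x unfolding dgp.supported_def by blast
      then show ?thesis using False by (auto simp: dgp.contract_def)
    qed
  qed
qed

lemma supported_zero: "dgp.supported n p (\<lambda>_. 0)"
  by (simp add: dgp.supported_def)

lemma end_elems_02: "x \<in> elems EndV 0 2 p \<longleftrightarrow> dgp.supported 2 p x"
  by (simp add: EndV_simps end_elems_iff unstable_def)

lemma stable_part_simps:
  "elems (stable_part EndV) g n p = (if (g, n) = (0, 2) then {\<lambda>_. 0} else elems EndV g n p)"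
  "add (stable_part EndV) = add EndV" "smul (stable_part EndV) = smul EndV" "dif (stable_part EndV) = dif EndV"
  "act (stable_part EndV) = act EndV" "mu (stable_part EndV) = mu EndV"
  by (simp_all add: stable_part_def EndV_simps fun_eq_iff)

end

context dg_inner_product_space
begin

lemma contract_circ1_eqI:
  assumes "dgp.supported 2 p x" "dgp.supported 2 p' x'" "dgp.supported 2 r y" "\<And>a. opr x (opr x' a) = opr y a"
  shows "dgp.contract (attach_graph 0 2 1) [] [x, x'] = y"
  by (rule opr_inj[OF supported_attach[OF assms(1,2)] assms(3)]) (simp add: fun_eq_iff opr_compose[OF assms(1,2)] assms(4) del: One_nat_def)

end

section \<open>The operators of a given BV-algebra\<close>

locale BV_algebra = dg_inner_product_space d sc V D B
  for d and sc :: "'k::field_char_0 \<Rightarrow> 'v::ab_group_add \<Rightarrow> 'v" and V D B +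
  fixes \<O> :: "('k, 'a) opd" and \<beta> :: "nat \<Rightarrow> nat \<Rightarrow> bit \<Rightarrow> ('k, 'a) expr set \<Rightarrow> nat list \<Rightarrow> 'k"
  assumes operad: "modular_operad d \<O>"
    and hom: "operad_hom d (BV d \<O>) EndV \<beta>"
    and unit: "opr (\<beta> 0 2 0 (BV_class d \<O> 0 2 0 One)) = id"
begin

interpretation vs: vector_space sc by (rule vs)

sublocale o: modular_operad_upto d \<O> "\<lambda>_ _ _. (=)"
  using operad by (simp add: modular_operad_def extended_modular_operad_def)

definition val :: "nat \<Rightarrow> nat \<Rightarrow> bit \<Rightarrow> ('k, 'a) expr \<Rightarrow> nat list \<Rightarrow> 'k" where
  "val g n p e = \<beta> g n p (BV_class d \<O> g n p e)"

lemma val_eqI: "wt d \<O> e g n p \<Longrightarrow> wt d \<O> e' g n p \<Longrightarrow> BV_eq d \<O> g n p e e' \<Longrightarrow> val g n p e = val g n p e'"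
  by (simp add: val_def class_eqI)

lemma val_hom:
  assumes "wt d \<O> e g n p"
  shows "val g n p e \<in> elems EndV g n p"
    and "wt d \<O> f g n p \<Longrightarrow> val g n p (Add e f) = (\<lambda>js. val g n p e js + val g n p f js)"
    and "val g n p (Smul a e) = (\<lambda>js. a * val g n p e js)"
    and "val g n (p + 1) (expr_dif \<O> e) = dgp.deriv (val g n p e)"
    and "\<sigma> permutes {..<n} \<Longrightarrow> val g n p (Act \<sigma> e) = dgp.perm_act \<sigma> (val g n p e)"
proof -
  have el: "BV_class d \<O> g n p e \<in> elems (BV d \<O>) g n p" if "wt d \<O> e g n p" for e
    using that by (simp add: BV_simps)
  note h = hom[unfolded operad_hom_def, THEN conjunct1, rule_format, OF el[OF assms]]
  show "val g n p e \<in> elems EndV g n p" using h by (simp add: val_def)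
  show "val g n p (Add e f) = (\<lambda>js. val g n p e js + val g n p f js)" if f: "wt d \<O> f g n p"
    using h[THEN conjunct2, THEN conjunct1, rule_format, OF el[OF f]]
    by (simp add: val_def class_ops(1)[OF assms f] EndV_simps)
  show "val g n p (Smul a e) = (\<lambda>js. a * val g n p e js)"
    using h by (simp add: val_def class_ops(2)[OF assms] EndV_simps)
  show "val g n (p + 1) (expr_dif \<O> e) = dgp.deriv (val g n p e)"
    using h by (simp add: val_def class_ops(3)[OF assms o.modular_operad_upto_axioms] EndV_simps)
  show "val g n p (Act \<sigma> e) = dgp.perm_act \<sigma> (val g n p e)" if "\<sigma> permutes {..<n}"
    using h that by (simp add: val_def class_ops(4)[OF assms] EndV_simps)
qed

lemma val_Mu:
  assumes "composable d (expr_opd d \<O>) G bs ps fs"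
  shows "val (genus TYPE('k) G) (length (legs G)) (out_par bs ps) (Mu G bs fs)
    = dgp.contract G bs (map (\<lambda>i. val (fst (verts G ! i)) (snd (verts G ! i)) (ps ! i) (fs ! i)) [0..<length (verts G)])"
proof -
  note h = hom[unfolded operad_hom_def, THEN conjunct2, THEN conjunct1, rule_format, OF class_mu(1)[OF assms]]
  have "map (\<lambda>i. \<beta> (fst (verts G ! i)) (snd (verts G ! i)) (ps ! i)
        (map (\<lambda>i. BV_class d \<O> (fst (verts G ! i)) (snd (verts G ! i)) (ps ! i) (fs ! i)) [0..<length (verts G)] ! i)) [0..<length (verts G)]
    = map (\<lambda>i. val (fst (verts G ! i)) (snd (verts G ! i)) (ps ! i) (fs ! i)) [0..<length (verts G)]"
    by (simp add: val_def)
  moreover have "val (genus TYPE('k) G) (length (legs G)) (out_par bs ps) (Mu G bs fs)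
    = mu EndV G bs ps (map (\<lambda>i. \<beta> (fst (verts G ! i)) (snd (verts G ! i)) (ps ! i)
        (map (\<lambda>i. BV_class d \<O> (fst (verts G ! i)) (snd (verts G ! i)) (ps ! i) (fs ! i)) [0..<length (verts G)] ! i)) [0..<length (verts G)])"
    using h unfolding class_mu(2)[OF assms] by (simp only: val_def)
  ultimately show ?thesis by (simp only: EndV_simps)
qed

lemma val_circ1:
  assumes "wt d \<O> e 0 2 p" "wt d \<O> e' 0 2 p'"
  shows "val 0 2 (p + p') (circ1 e e') = dgp.contract (attach_graph 0 2 1) [] [val 0 2 p e, val 0 2 p' e']"
  using val_Mu[OF wt_circ1(1)[OF assms]] attach_betti(2)[of 1 2 0, where ?'k = 'k]
  by (simp add: out_par_def upt_rec numeral_2_eq_2)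

lemma opr_circ1:
  assumes "wt d \<O> e 0 2 p" "wt d \<O> e' 0 2 p'"
  shows "opr (val 0 2 (p + p') (circ1 e e')) v = opr (val 0 2 p e) (opr (val 0 2 p' e') v)"
proof -
  have "dgp.supported 2 p (val 0 2 p e)" "dgp.supported 2 p' (val 0 2 p' e')"
    using assms val_hom(1) end_elems_02 by blast+
  then show ?thesis unfolding val_circ1[OF assms] by (rule opr_compose)
qed

text \<open>\<open>operad_hom\<close> has no clause for zero; additivity at \<open>0 + 0\<close>
  supplies it.\<close>

lemma val_Zero: "val g n p (Zero g n p) = (\<lambda>_. 0)"
proof -
  have "val g n p (Add (Zero g n p) (Zero g n p)) = val g n p (Zero g n p)"
    by (rule val_eqI) (simp_all add: wt_Add wt_Zero BV_eq_axioms)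
  then show ?thesis by (simp add: val_hom(2)[OF wt_Zero wt_Zero] fun_eq_iff)
qed

text \<open>A stable operad vanishes in arity (0, 2), so \<open>x\<close> equals
  \<open>0 * x\<close> there. This is why the restriction of a BV-algebra takes values in
  \<open>stable_part\<close>.\<close>

lemma val_Gen_zero:
  assumes "x \<in> elems \<O> 0 2 p"
  shows "val 0 2 p (Gen 0 2 p x) = (\<lambda>_. 0)"
proof -
  have "smul \<O> 0 2 p 0 x = x"
    using o.smul_closed[OF assms, of 0] assms operad by (simp add: modular_operad_def)
  moreover have "val 0 2 p (Gen 0 2 p (smul \<O> 0 2 p 0 x)) = val 0 2 p (Smul 0 (Gen 0 2 p x))"
    by (rule val_eqI) (intro wt_Gen wt_Smul o.smul_closed assms BV_eq_axioms)+
  ultimately show ?thesis using val_hom(3)[OF wt_Gen[OF assms], of 0] by simp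
qed

lemma restrict_structure_val:
  "x \<in> elems \<O> g n p \<Longrightarrow> restrict_structure d \<O> \<beta> g n p x = val g n p (Gen g n p x)"
  "x \<notin> elems \<O> g n p \<Longrightarrow> restrict_structure d \<O> \<beta> g n p x = undefined"
  by (simp_all add: restrict_structure_def val_def)

lemma restrict_structure_hom: "operad_hom d \<O> (stable_part EndV) (restrict_structure d \<O> \<beta>)"
  unfolding operad_hom_def stable_part_simps
proof (intro conjI allI ballI impI)
  fix g n p x assume x: "x \<in> elems \<O> g n p"
  note w = wt_Gen[OF x]
  show "restrict_structure d \<O> \<beta> g n p x \<in> (if (g, n) = (0, 2) then {\<lambda>_. 0} else elems EndV g n p)"
    using val_hom(1)[OF w] x val_Gen_zero by (auto simp: restrict_structure_val)
  show "restrict_structure d \<O> \<beta> g n p (add \<O> g n p x y)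
      = add EndV g n p (restrict_structure d \<O> \<beta> g n p x) (restrict_structure d \<O> \<beta> g n p y)" if y: "y \<in> elems \<O> g n p" for y
  proof -
    have "val g n p (Gen g n p (add \<O> g n p x y)) = val g n p (Add (Gen g n p x) (Gen g n p y))"
      by (rule val_eqI) (intro wt_Gen wt_Add o.add_closed x y BV_eq_axioms)+
    then show ?thesis
      using x y by (simp add: restrict_structure_val o.add_closed val_hom(2)[OF w wt_Gen[OF y]] EndV_simps)
  qed
  show "restrict_structure d \<O> \<beta> g n p (smul \<O> g n p a x) = smul EndV g n p a (restrict_structure d \<O> \<beta> g n p x)" for a
  proof -
    have "val g n p (Gen g n p (smul \<O> g n p a x)) = val g n p (Smul a (Gen g n p x))"
      by (rule val_eqI) (intro wt_Gen wt_Smul o.smul_closed x BV_eq_axioms)+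
    then show ?thesis
      using x by (simp add: restrict_structure_val o.smul_closed val_hom(3)[OF w] EndV_simps)
  qed
  show "restrict_structure d \<O> \<beta> g n (p + 1) (dif \<O> g n p x) = dif EndV g n p (restrict_structure d \<O> \<beta> g n p x)"
    using val_hom(4)[OF w] x by (simp add: restrict_structure_val o.dif_closed EndV_simps)
  show "restrict_structure d \<O> \<beta> g n p (act \<O> g n p \<sigma> x) = act EndV g n p \<sigma> (restrict_structure d \<O> \<beta> g n p x)"
    if \<sigma>: "\<sigma> permutes {..<n}" for \<sigma>
  proof -
    have "val g n p (Gen g n p (act \<O> g n p \<sigma> x)) = val g n p (Act \<sigma> (Gen g n p x))"
      by (rule val_eqI) (intro wt_Gen wt_Act o.act_closed x \<sigma> BV_eq_axioms)+
    then show ?thesis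
      using x \<sigma> by (simp add: restrict_structure_val o.act_closed val_hom(5)[OF w] EndV_simps)
  qed
next
  fix G bs ps xs assume c: "composable d \<O> G bs ps xs"
  let ?g = "genus TYPE('k) G" and ?n = "length (legs G)" and ?p = "out_par bs ps"
  have x: "xs ! i \<in> elems \<O> (fst (verts G ! i)) (snd (verts G ! i)) (ps ! i)" if "i < length (verts G)" for i
    using c that by (simp add: composable_def inputs_def)
  have "val ?g ?n ?p (Gen ?g ?n ?p (mu \<O> G bs ps xs)) = val ?g ?n ?p
      (Mu G bs (map (\<lambda>i. Gen (fst (verts G ! i)) (snd (verts G ! i)) (ps ! i) (xs ! i)) [0..<length (verts G)]))"
    by (intro val_eqI wt_Gen o.mu_closed c wt_MuI composable_Gen BV_eq_Gen_mu)
  also have "\<dots> = dgp.contract G bs (map (\<lambda>i. restrict_structure d \<O> \<beta> (fst (verts G ! i)) (snd (verts G ! i)) (ps ! i) (xs ! i))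
      [0..<length (verts G)])"
    unfolding val_Mu[OF composable_Gen[OF c]]
    by (rule arg_cong[where f = "dgp.contract G bs"], rule map_cong) (simp_all add: restrict_structure_val x)
  finally show "restrict_structure d \<O> \<beta> ?g ?n ?p (mu \<O> G bs ps xs) = mu EndV G bs ps
      (map (\<lambda>i. restrict_structure d \<O> \<beta> (fst (verts G ! i)) (snd (verts G ! i)) (ps ! i) (xs ! i)) [0..<length (verts G)])"
    using o.mu_closed[OF c] by (simp add: restrict_structure_val EndV_simps)
qed (simp add: restrict_structure_val)

abbreviation "s \<equiv> opr (val 0 2 1 S)"
abbreviation "t \<equiv> opr (val 0 2 0 T)"

lemma supported_ST: "dgp.supported 2 1 (val 0 2 1 S)" "dgp.supported 2 0 (val 0 2 0 T)"
  using val_hom(1)[OF wt_S] val_hom(1)[OF wt_T] end_elems_02 by blast+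

lemma operator_relations: "s (s a) = 0" "t (t a) = t a" "s (t a) = 0" "t (s a) = 0"
proof -
  \<comment> \<open>The parities are kept as sums, the form in which \<open>wt_circ1\<close> and
    \<open>opr_circ1\<close> deliver them.\<close>
  have "val 0 2 (1 + 1) (circ1 S S) = val 0 2 (1 + 1) (Zero 0 2 (1 + 1))" "val 0 2 (0 + 0) (circ1 T T) = val 0 2 (0 + 0) T"
    "val 0 2 (1 + 0) (circ1 S T) = val 0 2 (1 + 0) (Zero 0 2 (1 + 0))" "val 0 2 (0 + 1) (circ1 T S) = val 0 2 (0 + 1) (Zero 0 2 (0 + 1))"
    by (rule val_eqI, rule wt_circ1(2), (rule wt_S wt_T)+, simp add: wt_T wt_Zero, simp add: BV_eq_axioms del: One_nat_def)+
  then show "s (s a) = 0" "t (t a) = t a" "s (t a) = 0" "t (s a) = 0"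
    using opr_circ1[OF wt_S wt_S, of a] opr_circ1[OF wt_T wt_T, of a] opr_circ1[OF wt_S wt_T, of a] opr_circ1[OF wt_T wt_S, of a]
    by (simp_all only: val_Zero opr_zero add_0_left)
qed

lemma operator_adjoint: "v \<in> V p \<Longrightarrow> B (s v) u = sg p * B v (s u)" "v \<in> V p \<Longrightarrow> B (t v) u = B v (t u)"
proof -
  have "val 0 2 1 (Act (Transposition.transpose 0 1) S) = val 0 2 1 S"
    "val 0 2 0 (Act (Transposition.transpose 0 1) T) = val 0 2 0 T"
    by (rule val_eqI; intro wt_S wt_T wt_Act BV_eq_axioms transpose_permutes)+
  then have "dgp.perm_act (Transposition.transpose 0 1) (val 0 2 1 S) = val 0 2 1 S"
    "dgp.perm_act (Transposition.transpose 0 1) (val 0 2 0 T) = val 0 2 0 T"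
    by (simp_all only: val_hom(5)[OF wt_S transpose_permutes] val_hom(5)[OF wt_T transpose_permutes])
  then show "v \<in> V p \<Longrightarrow> B (s v) u = sg p * B v (s u)" "v \<in> V p \<Longrightarrow> B (t v) u = B v (t u)"
    using opr_self_adjoint_iff[OF supported_ST(1)] opr_self_adjoint_iff[OF supported_ST(2)] by (auto simp: sg_def)
qed

lemma operator_differential: "D (t a) = t (D a)" "D (s a) + s (D a) = a - t a"
proof -
  have "dgp.deriv (val 0 2 0 T) = (\<lambda>_. 0)" using val_hom(4)[OF wt_T] by (simp add: val_Zero)
  then show "D (t a) = t (D a)" using opr_deriv[OF supported_ST(2), of a] by (simp add: opr_zero sg_def)
  have "dgp.deriv (val 0 2 1 S) = (\<lambda>js. val 0 2 0 One js + - 1 * val 0 2 0 T js)"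
    using val_hom(4)[OF wt_S] by (simp add: val_hom(2)[OF wt_One wt_Smul[OF wt_T]] val_hom(3)[OF wt_T])
  then have "opr (dgp.deriv (val 0 2 1 S)) a = a + sc (- 1) (t a)"
    using unit by (simp only: opr_plus opr_smul) (simp add: val_def)
  then show "D (s a) + s (D a) = a - t a" using opr_deriv[OF supported_ST(1), of a] by (simp add: sg_def)
qed

end

text \<open>Every class has a well-typed expression in the generators, so induction over expressions
  applies. Values of \<open>S\<close> and \<open>T\<close> are recovered from their operators by
  \<open>opr_inj\<close>, and that of \<open>One\<close> from the condition that it acts as the
  identity.\<close>

lemma BV_algebra_unique:
  assumes "BV_algebra d sc V D B \<O> \<beta>" "BV_algebra d sc V D B \<O> \<beta>'"
    and "restrict_structure d \<O> \<beta> = restrict_structure d \<O> \<beta>'"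
    and "as_operator sc V B (\<beta> 0 2 1 (BV_class d \<O> 0 2 1 S)) = as_operator sc V B (\<beta>' 0 2 1 (BV_class d \<O> 0 2 1 S))"
    and "as_operator sc V B (\<beta> 0 2 0 (BV_class d \<O> 0 2 0 T)) = as_operator sc V B (\<beta>' 0 2 0 (BV_class d \<O> 0 2 0 T))"
  shows "\<beta> = \<beta>'"
proof -
  interpret b: BV_algebra d sc V D B \<O> \<beta> by fact
  interpret b': BV_algebra d sc V D B \<O> \<beta>' by fact
  have "b.val g n p e = b'.val g n p e" if "wt d \<O> e g n p" for g n p e
    using that
  proof (induction rule: wt.induct)
    case (wt_Gen x g n p)
    then show ?case using assms(3) b.restrict_structure_val(1) b'.restrict_structure_val(1) by metis
  next
    case wt_One
    have "b.dgp.supported 2 0 (b.val 0 2 0 One)" "b.dgp.supported 2 0 (b'.val 0 2 0 One)"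
      using b.val_hom(1)[OF wt.wt_One] b'.val_hom(1)[OF wt.wt_One] b.end_elems_02 by blast+
    then show ?case by (rule b.opr_inj) (simp add: b.val_def b'.val_def b.unit b'.unit)
  next
    case wt_S
    show ?case by (rule b.opr_inj[OF b.supported_ST(1) b'.supported_ST(1)]) (simp add: b.val_def b'.val_def assms)
  next
    case wt_T
    show ?case by (rule b.opr_inj[OF b.supported_ST(2) b'.supported_ST(2)]) (simp add: b.val_def b'.val_def assms)
  next
    case (wt_Mu G bs ps es)
    then have c: "composable d (expr_opd d \<O>) G bs ps es" by (simp add: composable_def inputs_def expr_simps)
    have "map (\<lambda>i. b.val (fst (verts G ! i)) (snd (verts G ! i)) (ps ! i) (es ! i)) [0..<length (verts G)]
      = map (\<lambda>i. b'.val (fst (verts G ! i)) (snd (verts G ! i)) (ps ! i) (es ! i)) [0..<length (verts G)]"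
      using wt_Mu by simp
    then show ?case by (simp only: b.val_Mu[OF c] b'.val_Mu[OF c])
  qed (simp_all add: b.val_Zero b'.val_Zero b.val_hom b'.val_hom)
  then have eq: "\<beta> g n p X = \<beta>' g n p X" if "X \<in> elems (BV d \<O>) g n p" for g n p X
    using that by (auto simp: BV_simps b.val_def b'.val_def)
  show ?thesis
  proof (intro ext)
    fix g n p X js
    show "\<beta> g n p X js = \<beta>' g n p X js"
      using eq[of X g n p] b.hom b'.hom unfolding operad_hom_def by (cases "X \<in> elems (BV d \<O>) g n p") auto
  qed
qed

section \<open>The BV-algebra of given operators\<close>

locale BV_extension = dg_inner_product_space d sc V D B
  for d and sc :: "'k::field_char_0 \<Rightarrow> 'v::ab_group_add \<Rightarrow> 'v" and V D B +
  fixes \<O> :: "('k, 'a) opd" and \<alpha> :: "nat \<Rightarrow> nat \<Rightarrow> bit \<Rightarrow> 'a \<Rightarrow> nat list \<Rightarrow> 'k" and u s t :: "nat list \<Rightarrow> 'k"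
  assumes operad: "modular_operad d \<O>"
    and hom: "operad_hom d \<O> (stable_part EndV) \<alpha>"
    and u: "dgp.supported 2 0 u" "opr u = id"
    and s: "dgp.supported 2 1 s" "\<And>a. opr s (opr s a) = 0"
      "\<And>p a b. a \<in> V p \<Longrightarrow> B (opr s a) b = sg p * B a (opr s b)"
    and t: "dgp.supported 2 0 t" "\<And>a. opr t (opr t a) = opr t a" "\<And>a. D (opr t a) = opr t (D a)"
      "\<And>a b. B (opr t a) b = B a (opr t b)"
    and s_t: "\<And>a. opr s (opr t a) = 0" "\<And>a. opr t (opr s a) = 0"
      "\<And>a. D (opr s a) + opr s (D a) = a - opr t a"
begin

interpretation vs: vector_space sc by (rule vs)

sublocale o: modular_operad_upto d \<O> "\<lambda>_ _ _. (=)"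
  using operad by (simp add: modular_operad_def extended_modular_operad_def)

sublocale q: modular_operad_upto d EndV "\<lambda>_ _ _. (=)"
  using End_operad by (simp add: extended_modular_operad_def)

primrec ev :: "('k, 'a) expr \<Rightarrow> nat list \<Rightarrow> 'k" where
  "ev (Gen g n p x) = \<alpha> g n p x"
| "ev One = u"
| "ev S = s"
| "ev T = t"
| "ev (Zero g n p) = (\<lambda>_. 0)"
| "ev (Add e e') = (\<lambda>js. ev e js + ev e' js)"
| "ev (Smul a e) = (\<lambda>js. a * ev e js)"
| "ev (Act \<sigma> e) = dgp.perm_act \<sigma> (ev e)"
| "ev (Mu G bs fs) = dgp.contract G bs (map ev fs)"

lemma hom_simps:
  assumes x: "x \<in> elems \<O> g n p"
  shows "\<alpha> g n p x \<in> elems EndV g n p"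
    and "y \<in> elems \<O> g n p \<Longrightarrow> \<alpha> g n p (add \<O> g n p x y) = (\<lambda>js. \<alpha> g n p x js + \<alpha> g n p y js)"
    and "\<alpha> g n p (smul \<O> g n p a x) = (\<lambda>js. a * \<alpha> g n p x js)"
    and "\<alpha> g n (p + 1) (dif \<O> g n p x) = dgp.deriv (\<alpha> g n p x)"
    and "\<sigma> permutes {..<n} \<Longrightarrow> \<alpha> g n p (act \<O> g n p \<sigma> x) = dgp.perm_act \<sigma> (\<alpha> g n p x)"
proof -
  note h = hom[unfolded operad_hom_def stable_part_simps EndV_simps(2-), THEN conjunct1, rule_format, OF x]
  have "\<alpha> g n p x \<in> (if (g, n) = (0, 2) then {\<lambda>_. 0} else elems EndV g n p)" using h by (rule conjunct1)
  then show "\<alpha> g n p x \<in> elems EndV g n p" using supported_zero by (auto simp: end_elems_02 split: if_splits)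
qed (use hom[unfolded operad_hom_def stable_part_simps EndV_simps(2-), THEN conjunct1, rule_format, OF x] in auto)

lemma hom_mu:
  assumes "composable d \<O> G bs ps xs"
  shows "\<alpha> (genus TYPE('k) G) (length (legs G)) (out_par bs ps) (mu \<O> G bs ps xs)
    = dgp.contract G bs (map (\<lambda>i. \<alpha> (fst (verts G ! i)) (snd (verts G ! i)) (ps ! i) (xs ! i)) [0..<length (verts G)])"
  using hom[unfolded operad_hom_def stable_part_simps EndV_simps(2-), THEN conjunct2, THEN conjunct1, rule_format, OF assms] .

text \<open>The differential on operators is the supercommutator with \<open>D\<close>, so these
  equations are the identities \<open>dt = td\<close> and \<open>ds + sd = 1 - t\<close>,
  transported by \<open>opr_inj\<close>.\<close>

lemma deriv_generators: "dgp.deriv u = (\<lambda>_. 0)" "dgp.deriv t = (\<lambda>_. 0)" "dgp.deriv s = (\<lambda>js. u js + - 1 * t js)"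
proof -
  have "opr (dgp.deriv u) = opr (\<lambda>_. 0)" "opr (dgp.deriv t) = opr (\<lambda>_. 0)" "opr (dgp.deriv s) = opr (\<lambda>js. u js + - 1 * t js)"
  proof (rule_tac [!] ext)
    fix v
    show "opr (dgp.deriv u) v = opr (\<lambda>_. 0) v" by (simp add: opr_deriv[OF u(1)] u(2) opr_zero sg_def)
    show "opr (dgp.deriv t) v = opr (\<lambda>_. 0) v" by (simp add: opr_deriv[OF t(1)] t(3) opr_zero sg_def)
    have "opr (dgp.deriv s) v = D (opr s v) + opr s (D v)" by (simp add: opr_deriv[OF s(1)] sg_def)
    also have "\<dots> = opr (\<lambda>js. u js + - 1 * t js) v"
      unfolding s_t(3) opr_plus opr_smul u(2) by simp
    finally show "opr (dgp.deriv s) v = opr (\<lambda>js. u js + - 1 * t js) v" .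
  qed
  moreover have "dgp.supported 2 0 (\<lambda>js. u js + - 1 * t js)"
    using u(1) t(1) unfolding dgp.supported_def by (metis add.right_neutral mult_zero_right)
  ultimately show "dgp.deriv u = (\<lambda>_. 0)" "dgp.deriv t = (\<lambda>_. 0)" "dgp.deriv s = (\<lambda>js. u js + - 1 * t js)"
    using opr_inj dgp.supported_deriv u(1) t(1) s(1) supported_zero by blast+
qed

lemma composable_ev:
  assumes "\<And>i. i < length (verts G) \<Longrightarrow> ev (fs ! i) \<in> elems EndV (fst (verts G ! i)) (snd (verts G ! i)) (ps ! i)"
    "ext_stable G" "det_args d G bs" "length ps = length (verts G)" "length fs = length (verts G)"
  shows "composable d EndV G bs ps (map ev fs)"
  using assms by (simp add: composable_def inputs_def)

lemma ev_elems: "wt d \<O> e g n p \<Longrightarrow> ev e \<in> elems EndV g n p"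
proof (induction rule: wt.induct)
  case (wt_Add e g n p e')
  then show ?case using q.add_closed[of "ev e" g n p "ev e'"] by (simp add: EndV_simps(3))
next
  case (wt_Smul e g n p a)
  then show ?case using q.smul_closed[of "ev e" g n p a] by (simp add: EndV_simps(4))
next
  case (wt_Act e g n p \<sigma>)
  then show ?case using q.act_closed[of "ev e" g n p \<sigma>] by (simp add: EndV_simps(6))
next
  case (wt_Mu G bs ps fs)
  have "composable d EndV G bs ps (map ev fs)" by (rule composable_ev) (use wt_Mu in auto)
  then show ?case using q.mu_closed by (simp add: EndV_simps(7))
next
  case (wt_Zero g n p)
  then show ?case using q.zer_closed[of g n p] by (simp add: EndV_simps(2))
qed (use u(1) s(1) t(1) in \<open>simp_all add: hom_simps end_elems_02\<close>)

text \<open>The recursion for \<open>expr_dif\<close> at \<open>Mu\<close> is the Leibniz rule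
  \<open>mu_dif\<close> of the endomorphism operad, term by term.\<close>

lemma ev_expr_dif: "wt d \<O> e g n p \<Longrightarrow> ev (expr_dif \<O> e) = dgp.deriv (ev e)"
proof (induction rule: wt.induct)
  case (wt_Mu G bs ps fs)
  have el: "ev (fs ! i) \<in> elems EndV (fst (verts G ! i)) (snd (verts G ! i)) (ps ! i)" if "i < length (verts G)" for i
    using wt_Mu that by (simp add: ev_elems)
  have c: "composable d EndV G bs ps (map ev fs)" by (rule composable_ev) (use wt_Mu el in auto)
  have ps: "map par fs = ps"
  proof (rule nth_equalityI)
    fix i assume i: "i < length (map par fs)"
    then have "wt d \<O> (fs ! i) (fst (verts G ! i)) (snd (verts G ! i)) (ps ! i)" using wt_Mu by simp
    then show "map par fs ! i = ps ! i" using i by (simp add: wt_par)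
  qed (use wt_Mu in simp)
  have foldr: "ev (foldr Add es' (Zero g n p)) = opsum EndV g n p (map ev es')" for es' g n p
    by (induction es') (simp_all add: opsum_def EndV_simps(2,3))
  have "dgp.deriv (ev (Mu G bs fs)) = opsum EndV (genus TYPE('k) G) (length (legs G)) (out_par bs ps + 1)
      (map (\<lambda>i js. sg (of_nat (length bs) + sum_list (take i ps)) *
        dgp.contract G bs ((map ev fs)[i := dgp.deriv (map ev fs ! i)]) js) [0..<length (verts G)])"
    using q.mu_dif[OF c] by (simp add: EndV_simps(4,5,7))
  also have "\<dots> = ev (expr_dif \<O> (Mu G bs fs))"
    unfolding expr_dif.simps Let_def ps foldr
    by (rule arg_cong[where f = "opsum EndV _ _ _"], rule nth_equalityI) (use wt_Mu in \<open>simp_all add: map_update\<close>)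
  finally show ?case by (rule sym)
next
  case (wt_Zero g n p)
  show ?case by (simp add: fun_eq_iff dgp.deriv_def)
qed (simp_all add: hom_simps deriv_generators dgp.deriv_linear dgp.deriv_perm_act[OF end_elems_supported[OF ev_elems[unfolded EndV_simps]]])

lemma generators_symmetric:
  "dgp.perm_act (Transposition.transpose 0 1) u = u" "dgp.perm_act (Transposition.transpose 0 1) s = s"
  "dgp.perm_act (Transposition.transpose 0 1) t = t"
proof -
  show "dgp.perm_act (Transposition.transpose 0 1) u = u"
    by (rule opr_self_adjoint_iff[OF u(1), THEN iffD2]) (simp add: u sg_def)
  show "dgp.perm_act (Transposition.transpose 0 1) s = s"
    by (rule opr_self_adjoint_iff[OF s(1), THEN iffD2]) (use s(3) in simp)
  show "dgp.perm_act (Transposition.transpose 0 1) t = t"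
    by (rule opr_self_adjoint_iff[OF t(1), THEN iffD2]) (use t(4) in \<open>simp add: sg_def\<close>)
qed

lemma ev_relations: "BV_relations d \<O> (\<lambda>_ _ _ e e'. ev e = ev e')"
proof
  show "ev (Gen g n p (add \<O> g n p x y)) = ev (Add (Gen g n p x) (Gen g n p y))"
    if "x \<in> elems \<O> g n p" "y \<in> elems \<O> g n p" for g n p x y
    using that by (simp add: hom_simps)
  show "ev (Gen g n p (smul \<O> g n p a x)) = ev (Smul a (Gen g n p x))" if "x \<in> elems \<O> g n p" for g n p a x
    using that by (simp add: hom_simps)
  show "ev (Gen g n p (act \<O> g n p \<sigma> x)) = ev (Act \<sigma> (Gen g n p x))"
    if "x \<in> elems \<O> g n p" "\<sigma> permutes {..<n}" for g n p \<sigma> x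
    using that by (simp add: hom_simps)
  show "ev (Gen (genus TYPE('k) G) (length (legs G)) (out_par bs ps) (mu \<O> G bs ps xs))
      = ev (Mu G bs (map (\<lambda>i. Gen (fst (verts G ! i)) (snd (verts G ! i)) (ps ! i) (xs ! i)) [0..<length (verts G)]))"
    if "composable d \<O> G bs ps xs" for G bs ps xs
    using hom_mu[OF that] by (simp add: comp_def)
  show "ev (Act (Transposition.transpose 0 1) One) = ev One" "ev (Act (Transposition.transpose 0 1) S) = ev S"
    "ev (Act (Transposition.transpose 0 1) T) = ev T"
    by (simp_all only: ev.simps generators_symmetric)
  show "ev (circ1 S S) = ev (Zero 0 2 0)" "ev (circ1 T T) = ev T" "ev (circ1 S T) = ev (Zero 0 2 1)" "ev (circ1 T S) = ev (Zero 0 2 1)"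
    unfolding ev.simps list.map
    by (rule contract_circ1_eqI[OF s(1) s(1) supported_zero[of 2 0]] contract_circ1_eqI[OF t(1) t(1) t(1)]
        contract_circ1_eqI[OF s(1) t(1) supported_zero[of 2 0]] contract_circ1_eqI[OF t(1) s(1) supported_zero[of 2 0]];
        simp add: s t s_t opr_zero)+
  show "ev (Mu (attach_graph g n j) [] [e, One]) = ev e" if "wt d \<O> e g n p" "j < n" for e g n p j
    using contract_attach_unit[OF u end_elems_supported that(2)] ev_elems[OF that(1)] by (simp add: EndV_simps)
qed

text \<open>The kernel of \<open>ev\<close> satisfies the operad axioms by pullback and the
  relations of \<open>BV\<close> by \<open>ev_relations\<close>, so it is among the congruences
  whose intersection is \<open>BV_eq\<close>.\<close>

lemma ev_BV_eq: "BV_eq d \<O> g n p e e' \<Longrightarrow> ev e = ev e'"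
proof (erule BV_eqD)
  show "modular_operad_upto d (expr_opd d \<O>) (\<lambda>_ _ _ e e'. ev e = ev e')"
  proof (rule modular_operad_upto_pullback[OF End_operad])
    show "mu (expr_opd d \<O>) G bs ps fs \<in> elems (expr_opd d \<O>) (genus TYPE('k) G) (length (legs G)) (out_par bs ps)"
      if "composable d (expr_opd d \<O>) G bs ps fs" for G bs ps fs
      using wt_MuI[OF that] by (simp add: expr_simps)
  qed (auto simp: expr_simps EndV_simps(2-) wt_expr_dif[OF o.modular_operad_upto_axioms] ev_expr_dif ev_elems intro: wt.intros)
qed (rule ev_relations)

definition extension :: "nat \<Rightarrow> nat \<Rightarrow> bit \<Rightarrow> ('k, 'a) expr set \<Rightarrow> nat list \<Rightarrow> 'k" where
  "extension g n p X = (if X \<in> elems (BV d \<O>) g n p then ev (rep X) else undefined)"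

lemma extension_class: "wt d \<O> e g n p \<Longrightarrow> extension g n p (BV_class d \<O> g n p e) = ev e"
  using ev_BV_eq[OF rep_class(2)] by (simp add: extension_def BV_simps)

lemma extension_hom: "operad_hom d (BV d \<O>) EndV extension"
  unfolding operad_hom_def
proof (intro conjI allI ballI impI)
  fix g n p X assume X: "X \<in> elems (BV d \<O>) g n p"
  note w = wt_rep[OF X]
  have ext: "extension g n p X = ev (rep X)" if "X \<in> elems (BV d \<O>) g n p" for X using that by (simp add: extension_def)
  show "extension g n p X \<in> elems EndV g n p" using ev_elems[OF w] by (simp add: ext[OF X])
  show "extension g n p (add (BV d \<O>) g n p X Y) = add EndV g n p (extension g n p X) (extension g n p Y)"
    if "Y \<in> elems (BV d \<O>) g n p" for Y
    unfolding BV_simps(2) extension_class[OF wt_Add[OF w wt_rep[OF that]]] ext[OF X] ext[OF that] by (simp add: EndV_simps)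
  show "extension g n p (smul (BV d \<O>) g n p a X) = smul EndV g n p a (extension g n p X)" for a
    unfolding BV_simps(3) extension_class[OF wt_Smul[OF w]] ext[OF X] by (simp add: EndV_simps)
  show "extension g n (p + 1) (dif (BV d \<O>) g n p X) = dif EndV g n p (extension g n p X)"
    unfolding BV_simps(4) extension_class[OF wt_expr_dif[OF o.modular_operad_upto_axioms w]] ext[OF X]
    by (simp add: EndV_simps ev_expr_dif[OF w])
  show "extension g n p (act (BV d \<O>) g n p \<sigma> X) = act EndV g n p \<sigma> (extension g n p X)" if "\<sigma> permutes {..<n}" for \<sigma>
    unfolding BV_simps(5) extension_class[OF wt_Act[OF w that]] ext[OF X] by (simp add: EndV_simps)
next
  fix G bs ps Xs assume c: "composable d (BV d \<O>) G bs ps Xs"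
  then have len: "length Xs = length (verts G)"
    and el: "\<And>i. i < length (verts G) \<Longrightarrow> Xs ! i \<in> elems (BV d \<O>) (fst (verts G ! i)) (snd (verts G ! i)) (ps ! i)"
    by (auto simp: composable_def inputs_def)
  have "map (\<lambda>i. extension (fst (verts G ! i)) (snd (verts G ! i)) (ps ! i) (Xs ! i)) [0..<length (verts G)] = map ev (map rep Xs)"
    by (rule nth_equalityI) (use len el in \<open>simp_all add: extension_def\<close>)
  then show "extension (genus TYPE('k) G) (length (legs G)) (out_par bs ps) (mu (BV d \<O>) G bs ps Xs)
      = mu EndV G bs ps (map (\<lambda>i. extension (fst (verts G ! i)) (snd (verts G ! i)) (ps ! i) (Xs ! i)) [0..<length (verts G)])"
    unfolding BV_simps(6) extension_class[OF wt_MuI[OF composable_BV[OF c]]] by (simp add: EndV_simps)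
qed (simp add: extension_def)

lemma extension_restrict: "restrict_structure d \<O> extension = \<alpha>"
proof (intro ext)
  fix g n p x js
  show "restrict_structure d \<O> extension g n p x js = \<alpha> g n p x js"
    using hom unfolding operad_hom_def
    by (cases "x \<in> elems \<O> g n p") (auto simp: restrict_structure_def extension_class wt_Gen)
qed

end

text \<open>The inverse map takes the coefficient functions of \<open>s\<close>, \<open>t\<close>
  and the identity, which exist by \<open>opr_surj\<close>, and evaluates expressions with
  them.\<close>

theorem theorem7p3:
  fixes d :: bit
    and \<O> :: "('k::field_char_0, 'a) opd"
    and sc :: "'k \<Rightarrow> 'v::ab_group_add \<Rightarrow> 'v"
    and V :: "bit \<Rightarrow> 'v set"
    and D :: "'v \<Rightarrow> 'v"
    and B :: "'v \<Rightarrow> 'v \<Rightarrow> 'k"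
  assumes "modular_operad d \<O>"
    and "dg_inner_product_space d sc V D B"
  shows "bij_betw
    (\<lambda>\<beta>. (restrict_structure d \<O> \<beta>,
          as_operator sc V B (\<beta> 0 2 1 (BV_class d \<O> 0 2 1 S)),
          as_operator sc V B (\<beta> 0 2 0 (BV_class d \<O> 0 2 0 T))))
    (BV_algebra_structures d \<O> sc V D B)
    {(\<alpha>, s, t).
       \<alpha> \<in> algebra_structures d \<O> sc V D B \<and>
       (Vector_Spaces.linear sc sc s \<and> (\<forall>p. s ` V p \<subseteq> V (p + 1)) \<and> (\<forall>a. s (s a) = 0) \<and>
        (\<forall>p. \<forall>a \<in> V p. \<forall>q. \<forall>b \<in> V q. B (s a) b = sg p * B a (s b))) \<and>
       (Vector_Spaces.linear sc sc t \<and> (\<forall>p. t ` V p \<subseteq> V p) \<and> (\<forall>a. t (t a) = t a) \<and>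
        (\<forall>a. D (t a) = t (D a)) \<and> (\<forall>a b. B (t a) b = B a (t b))) \<and>
       (\<forall>a. s (t a) = 0 \<and> t (s a) = 0) \<and>
       (\<forall>a. D (s a) + s (D a) = a - t a)}"
  (is "bij_betw ?\<Phi> ?A ?data")
proof -
  interpret dg_inner_product_space d sc V D B by fact
  interpret vs: vector_space sc by (rule vs)
  have BV: "BV_algebra d sc V D B \<O> \<beta>" if "\<beta> \<in> ?A" for \<beta>
    by unfold_locales (use that assms(1) in \<open>auto simp: BV_algebra_structures_def\<close>)
  show ?thesis
    unfolding bij_betw_def
  proof (intro conjI inj_onI equalityI subsetI)
    fix \<beta> \<beta>' assume "\<beta> \<in> ?A" "\<beta>' \<in> ?A" "?\<Phi> \<beta> = ?\<Phi> \<beta>'"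
    then show "\<beta> = \<beta>'" using BV_algebra_unique[OF BV BV] by simp
  next
    fix x assume "x \<in> ?\<Phi> ` ?A"
    then obtain \<beta> where \<beta>: "\<beta> \<in> ?A" "x = ?\<Phi> \<beta>" by blast
    interpret b: BV_algebra d sc V D B \<O> \<beta> by (rule BV[OF \<beta>(1)])
    have "b.t ` V p \<subseteq> V p" "b.s ` V p \<subseteq> V (p + 1)" for p
      using opr_parity[OF b.supported_ST(1)] opr_parity[OF b.supported_ST(2)] by auto
    \<comment> \<open>Adjointness was obtained for homogeneous \<open>a\<close>. Since no sign
      depends on the parity, the two components can be added.\<close>
    moreover have "B (b.t a) c = B a (b.t c)" for a c
    proof -
      obtain a0 a1 where a: "a0 \<in> V 0" "a1 \<in> V 1" "a = a0 + a1" using parity_span by blast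
      interpret l: Vector_Spaces.linear sc sc b.t by (rule linear_opr)
      show ?thesis using b.operator_adjoint(2)[OF a(1)] b.operator_adjoint(2)[OF a(2)]
        by (simp add: a(3) l.add B_add_left)
    qed
    ultimately have "(restrict_structure d \<O> \<beta>, b.s, b.t) \<in> ?data"
      using b.restrict_structure_hom b.operator_relations b.operator_differential b.operator_adjoint(1) linear_opr
      by (simp add: algebra_structures_def)
    then show "x \<in> ?data" by (simp add: \<beta>(2) b.val_def)
  next
    fix x assume "x \<in> ?data"
    then obtain \<alpha> s t where x: "x = (\<alpha>, s, t)" and \<alpha>: "operad_hom d \<O> (stable_part EndV) \<alpha>"
      and s: "Vector_Spaces.linear sc sc s" "\<And>p. s ` V p \<subseteq> V (p + 1)" "\<And>a. s (s a) = 0"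
        "\<And>p q a b. a \<in> V p \<Longrightarrow> b \<in> V q \<Longrightarrow> B (s a) b = sg p * B a (s b)"
      and t: "Vector_Spaces.linear sc sc t" "\<And>p. t ` V p \<subseteq> V p" "\<And>a. t (t a) = t a" "\<And>a. D (t a) = t (D a)"
        "\<And>a b. B (t a) b = B a (t b)"
      and st: "\<And>a. s (t a) = 0" "\<And>a. t (s a) = 0" "\<And>a. D (s a) + s (D a) = a - t a"
      by (force simp: algebra_structures_def)
    \<comment> \<open>The summand 0 puts the even case into the form expected by
      \<open>opr_surj\<close>.\<close>
    have par: "s v \<in> V (r + 1)" "t v \<in> V (r + 0)" "id v \<in> V (r + 0)" if "v \<in> V r" for v r
      using s(2)[of r] t(2)[of r] that by auto
    obtain xs where xs: "dgp.supported 2 1 xs" "opr xs = s" by (rule opr_surj[OF s(1) par(1)])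
    obtain xt where xt: "dgp.supported 2 0 xt" "opr xt = t" by (rule opr_surj[OF t(1) par(2)])
    obtain u where u: "dgp.supported 2 0 u" "opr u = id" by (rule opr_surj[OF vs.linear_id par(3)])
    \<comment> \<open>The data speaks of homogeneous \<open>b\<close>; the sign involves only the
      parity of \<open>a\<close>, so linearity in \<open>b\<close> gives all vectors.\<close>
    have adj: "B (s a) b = sg p * B a (s b)" if "a \<in> V p" for p a b
    proof -
      obtain b0 b1 where b: "b0 \<in> V 0" "b1 \<in> V 1" "b = b0 + b1" using parity_span by blast
      interpret l: Vector_Spaces.linear sc sc s by (rule s(1))
      show ?thesis using s(4)[OF that b(1)] s(4)[OF that b(2)] by (simp add: b(3) l.add B_add_right distrib_left)
    qed
    interpret e: BV_extension d sc V D B \<O> \<alpha> u xs xt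
      by unfold_locales (use assms(1) \<alpha> u xs xt s(3) t st adj in simp_all)
    have "e.extension \<in> ?A"
      using e.extension_hom u(2) by (simp add: BV_algebra_structures_def e.extension_class wt_One)
    moreover have "?\<Phi> e.extension = x"
      by (simp add: x e.extension_restrict e.extension_class wt_S wt_T xs xt)
    ultimately show "x \<in> ?\<Phi> ` ?A" by force
  qed
qed

end
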